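(* The intersection in $\mathbb{P}^{19}$ of the $A$-discriminant of the hypersimplex $\Delta_{3,6}$ with the Grassmannian $\mathrm{Gr}(3,6)$ contains, as irreducible components, the two varieties $$V\big(I_{\mathrm{Gr}(3,6)}+\langle x_{123}x_{456}-x_{124}x_{356}\rangle\big)\qquad\text{and}\qquad V\big(I_{\mathrm{Gr}(3,6)}+\langle x_{126}x_{345}-x_{136}x_{245}\rangle\big),$$ each of which has dimension $8$ and degree $84$.
   Context: $\mathbb{P}^{19}$ is complex projective space with homogeneous coordinates $x_{ijk}$, $1\le i<j<k\le 6$. $\mathrm{Gr}(3,6)\subseteq\mathbb{P}^{19}$ is the Grassmannian in its Plücker embedding ($x_{ijk}$ is the $3\times3$ minor with columns $i<j<k$ of a $3\times 6$ matrix of rank $3$). $I_{\mathrm{Gr}(3,6)}\subseteq R=\mathbb{R}[x_{ijk}:1\le i<j<k\le 6]$ is its prime ideal, minimally generated by $35$ Plücker quadrics. For a homogeneous ideal $J$, $V(J)\subseteq\mathbb{P}^{19}$ denotes its zero set; dimension and degree are those of a projective variety in $\mathbb{P}^{19}$. The hypersimplex $\Delta_{3,6}=\mathrm{conv}(e_i+e_j+e_k:1\le i<j<k\le 6)$ is the Newton polytope of $f_x(\lambda)=\sum_{1\le i<j<k\le 6}x_{ijk}\lambda_i\lambda_j\lambda_k$. The $A$-discriminant of $\Delta_{3,6}$ is the hypersurface in $\mathbb{P}^{19}$ that is the Zariski closure of the set of all $x$ such that there exists $\lambda\in(\mathbb{C}^* )^6$ with $\frac{\partial f_x}{\partial\lambda_i}(\lambda)=0$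 for all $i=1,\dots,6$. *)

theory Defs
  imports "HOL-Analysis.Analysis" "HOL-Library.Poly_Mapping"
    "HOL-Computational_Algebra.Polynomial"
begin

section \<open>Polynomials in finitely many variables\<close>

text \<open>
  A polynomial over \<open>'a\<close> in the variables \<open>x\<^sub>i\<close>, with \<open>i\<close> ranging over a finite type \<open>'n\<close>, maps
  exponent vectors to coefficients; ring structure and multiplication (convolution) are those of
  \<^theory>\<open>HOL-Library.Poly_Mapping\<close>.
\<close>

type_synonym ('n, 'a) mpoly = "('n \<Rightarrow>\<^sub>0 nat) \<Rightarrow>\<^sub>0 'a"

definition Var :: "'n \<Rightarrow> ('n, 'a::zero_neq_one) mpoly" where
  "Var i = Poly_Mapping.single (Poly_Mapping.single i 1) 1"

definition eval :: "('n::finite, complex) mpoly \<Rightarrow> complex^'n \<Rightarrow> complex" where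
  "eval p v = (\<Sum>m\<in>Poly_Mapping.keys p.
     Poly_Mapping.lookup p m * (\<Prod>i\<in>UNIV. (v $ i) ^ Poly_Mapping.lookup m i))"

definition complexify :: "('n, real) mpoly \<Rightarrow> ('n, complex) mpoly" where
  "complexify p = Poly_Mapping.map complex_of_real p"

text \<open>The forms of degree \<open>d\<close>, including \<open>0\<close>.\<close>

definition forms :: "nat \<Rightarrow> ('n::finite, complex) mpoly set" where
  "forms d = {p. \<forall>m\<in>Poly_Mapping.keys p. (\<Sum>i\<in>UNIV. Poly_Mapping.lookup m i) = d}"

lemma eval_superset:
  assumes "finite A" "Poly_Mapping.keys p \<subseteq> A"
  shows "eval p v = (\<Sum>m\<in>A.
    Poly_Mapping.lookup p m * (\<Prod>i\<in>UNIV. (v $ i) ^ Poly_Mapping.lookup m i))"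
  unfolding eval_def
  by (rule sum.mono_neutral_left) (use assms in \<open>auto simp: in_keys_iff\<close>)

lemma eval_zero [simp]: "eval 0 v = 0"
  by (simp add: eval_def)

lemma eval_add: "eval (p + q) v = eval p v + eval q v"
proof -
  let ?A = "Poly_Mapping.keys p \<union> Poly_Mapping.keys q"
  have "Poly_Mapping.keys (p + q) \<subseteq> ?A" by (rule Poly_Mapping.keys_add)
  then show ?thesis
    using eval_superset[of ?A "p + q" v] eval_superset[of ?A p v] eval_superset[of ?A q v]
    by (simp add: lookup_add algebra_simps sum.distrib)
qed

lemma eval_single:
  "eval (Poly_Mapping.single m c) v = c * (\<Prod>i\<in>UNIV. (v $ i) ^ Poly_Mapping.lookup m i)"
  by (simp add: eval_def)

lemma mpoly_induct [case_names zero add_single]: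
  fixes p :: "('n, 'a::comm_monoid_add) mpoly"
  assumes "P 0" and "\<And>m c q. P q \<Longrightarrow> P (Poly_Mapping.single m c + q)"
  shows "P p"
proof (induction p rule: update_induct)
  case const
  then show ?case by (rule assms(1))
next
  case (update q m c)
  have "Poly_Mapping.update m c q = Poly_Mapping.single m c + q"
    by (rule poly_mapping_eqI)
      (use update(1) in \<open>auto simp: lookup_update lookup_add lookup_single when_def in_keys_iff\<close>)
  then show ?case using assms(2)[OF update(3)] by simp
qed

lemma eval_mult: "eval (p * q) v = eval p v * eval q v"
proof (induction p rule: mpoly_induct)
  case zero
  then show ?case by simp
next
  case (add_single m c p)
  have "eval (Poly_Mapping.single m c * q) v = eval (Poly_Mapping.single m c) v * eval q v"
  proof (induction q rule: mpoly_induct)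
    case zero
    then show ?case by simp
  next
    case (add_single m' c' q)
    then show ?case
      by (simp add: distrib_left eval_add mult_single eval_single lookup_add power_add
          prod.distrib mult_ac)
  qed
  then show ?case using add_single by (simp add: distrib_right eval_add)
qed

lemma forms_mult:
  assumes "p \<in> forms a" "q \<in> forms b"
  shows "p * q \<in> forms (a + b)"
  using assms Poly_Mapping.keys_mult[of p q]
  by (fastforce simp: forms_def lookup_add sum.distrib)

interpretation mpoly: vector_space
  "\<lambda>(c :: complex) (p :: ('n, complex) mpoly). Poly_Mapping.single 0 c * p"
  by unfold_locales
    (simp_all add: distrib_left distrib_right single_add mult_single flip: mult.assoc)

text \<open>Regarding a commutative ring as a module over itself, spans are generated ideals.\<close>

interpretation ideal: module "(*) :: 'a::comm_ring_1 \<Rightarrow> 'a \<Rightarrow> 'a"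
  by unfold_locales (simp_all add: algebra_simps)


section \<open>Complex projective space and its Zariski topology\<close>

text \<open>
  A point of the projective space of dimension \<open>CARD('n) - 1\<close> is a class of nonzero vectors
  modulo scaling; \<open>hcoords P\<close> is the set of all vectors of homogeneous coordinates of \<open>P\<close>.
\<close>

typedef 'n proj = "{{c *s v | c. c \<noteq> 0} | v :: complex^'n. v \<noteq> 0}"
  morphisms hcoords Abs_proj
  by (auto intro!: exI[of _ "1 :: complex^'n"] simp: vec_eq_iff)

definition vanishes_at :: "('n::finite, complex) mpoly \<Rightarrow> 'n proj \<Rightarrow> bool" where
  "vanishes_at p P \<longleftrightarrow> (\<forall>v\<in>hcoords P. eval p v = 0)"

definition zeros :: "('n::finite, complex) mpoly set \<Rightarrow> 'n proj set" where
  "zeros S = {P. \<forall>p\<in>S. vanishes_at p P}"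

definition vanishing_ideal :: "'n::finite proj set \<Rightarrow> ('n, complex) mpoly set" where
  "vanishing_ideal Y = {p. \<forall>P\<in>Y. vanishes_at p P}"

definition zariski :: "'n::finite proj topology" where
  "zariski = topology (\<lambda>U. \<exists>S. S \<subseteq> (\<Union>d. forms d) \<and> U = - zeros S)"

lemma vanishes_at_mult_forms:
  assumes p: "p \<in> forms a" and "vanishes_at (p * q) P"
  shows "vanishes_at p P \<or> vanishes_at q P"
proof (rule disjCI)
  assume "\<not> vanishes_at q P"
  then obtain w where w: "w \<in> hcoords P" "eval q w \<noteq> 0" by (auto simp: vanishes_at_def)
  then have pw: "eval p w = 0" using assms(2) by (auto simp: vanishes_at_def eval_mult)
  obtain v where v: "hcoords P = {c *s v | c. c \<noteq> 0}" using hcoords[of P] by auto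
  have eval_scale: "eval p (c *s u) = c ^ a * eval p u" for c u
  proof -
    have "(\<Prod>i\<in>UNIV. ((c *s u) $ i) ^ Poly_Mapping.lookup m i)
        = c ^ a * (\<Prod>i\<in>UNIV. (u $ i) ^ Poly_Mapping.lookup m i)"
      if "m \<in> Poly_Mapping.keys p" for m
    proof -
      have "(\<Prod>i\<in>UNIV. c ^ Poly_Mapping.lookup m i) = c ^ a"
        using p that by (simp add: forms_def flip: power_sum)
      then show ?thesis by (simp only: vector_smult_component power_mult_distrib prod.distrib)
    qed
    then show ?thesis
      unfolding eval_def sum_distrib_left
      by (intro sum.cong refl) (simp only: mult.left_commute)
  qed
  from w(1) v obtain c where "w = c *s v" "c \<noteq> 0" by blast
  then have "eval p v = 0" using pw by (simp add: eval_scale)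
  then show "vanishes_at p P"
    unfolding vanishes_at_def v by (auto simp: eval_scale)
qed

lemma istopology_zariski:
  "istopology (\<lambda>U :: 'n::finite proj set. \<exists>S. S \<subseteq> (\<Union>d. forms d) \<and> U = - zeros S)"
  unfolding istopology_def
proof (intro conjI allI impI)
  fix U V :: "'n proj set"
  assume U: "\<exists>S. S \<subseteq> (\<Union>d. forms d) \<and> U = - zeros S"
    and V: "\<exists>S. S \<subseteq> (\<Union>d. forms d) \<and> V = - zeros S"
  from U obtain S where S: "S \<subseteq> (\<Union>d. forms d)" "U = - zeros S" by (elim exE conjE)
  from V obtain T where T: "T \<subseteq> (\<Union>d. forms d)" "V = - zeros T" by (elim exE conjE)
  let ?R = "{p * q | p q. p \<in> S \<and> q \<in> T}"
  have "?R \<subseteq> (\<Union>d. forms d)"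
  proof
    fix r assume "r \<in> ?R"
    then obtain p q where pq: "r = p * q" "p \<in> S" "q \<in> T" by blast
    then obtain a b where "p \<in> forms a" "q \<in> forms b" using S(1) T(1) by blast
    then show "r \<in> (\<Union>d. forms d)" using pq(1) forms_mult by blast
  qed
  moreover have "U \<inter> V = - zeros ?R"
  proof -
    have "P \<in> zeros ?R \<longleftrightarrow> P \<in> zeros S \<or> P \<in> zeros T" for P
    proof
      assume *: "P \<in> zeros ?R"
      show "P \<in> zeros S \<or> P \<in> zeros T"
      proof (rule ccontr)
        assume "\<not> ?thesis"
        then obtain p q where pq: "p \<in> S" "q \<in> T" "\<not> vanishes_at p P" "\<not> vanishes_at q P"
          by (auto simp: zeros_def)
        moreover from pq(1) S(1) obtain a where "p \<in> forms a" by blast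
        moreover have "vanishes_at (p * q) P" using * pq(1,2) by (auto simp: zeros_def)
        ultimately show False using vanishes_at_mult_forms by blast
      qed
    next
      assume "P \<in> zeros S \<or> P \<in> zeros T"
      then show "P \<in> zeros ?R" by (auto simp: zeros_def vanishes_at_def eval_mult)
    qed
    then show ?thesis unfolding S(2) T(2) by blast
  qed
  ultimately show "\<exists>S. S \<subseteq> (\<Union>d. forms d) \<and> U \<inter> V = - zeros S"
    by (intro exI[of _ ?R] conjI)
next
  fix K :: "'n proj set set"
  assume "\<forall>U\<in>K. \<exists>S. S \<subseteq> (\<Union>d. forms d) \<and> U = - zeros S"
  then obtain f where f: "\<forall>U\<in>K. f U \<subseteq> (\<Union>d. forms d) \<and> U = - zeros (f U)"
    unfolding bchoice_iff by (elim exE)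
  have "\<Union>K = (\<Union>U\<in>K. - zeros (f U))"
  proof -
    have "(\<Union>U\<in>K. - zeros (f U)) = (\<Union>U\<in>K. U)"
    proof (rule SUP_cong[OF refl])
      fix U assume "U \<in> K"
      with f have "U = - zeros (f U)" by blast
      then show "- zeros (f U) = U" by (rule sym)
    qed
    then show ?thesis by simp
  qed
  also have "\<dots> = - zeros (\<Union>U\<in>K. f U)"
    by (auto simp: zeros_def)
  finally have "\<Union>K = - zeros (\<Union>U\<in>K. f U)" .
  moreover have "(\<Union>U\<in>K. f U) \<subseteq> (\<Union>d. forms d)"
    by (rule UN_least) (use f in simp)
  ultimately show "\<exists>S. S \<subseteq> (\<Union>d. forms d) \<and> \<Union>K = - zeros S"
    by (intro exI[of _ "\<Union>U\<in>K. f U"] conjI)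
qed

lemma openin_zariski:
  "openin zariski U \<longleftrightarrow> (\<exists>S. S \<subseteq> (\<Union>d. forms d) \<and> U = - zeros S)"
  unfolding zariski_def by (simp add: topology_inverse'[OF istopology_zariski])

lemma topspace_zariski [simp]: "topspace (zariski :: 'n::finite proj topology) = UNIV"
proof -
  have one: "(1 :: ('n, complex) mpoly) \<in> forms 0"
    by (simp add: forms_def)
  have "\<not> vanishes_at 1 P" for P :: "'n proj"
  proof -
    obtain v where "hcoords P = {c *s v | c. c \<noteq> 0}" using hcoords[of P] by auto
    then have "1 *s v \<in> hcoords P"
      by (simp only: mem_Collect_eq) (intro exI conjI, rule refl, simp)
    moreover have "eval 1 (1 *s v) = 1" using eval_single[of 0 1 "1 *s v"] by simp
    ultimately show ?thesis unfolding vanishes_at_def by (metis one_neq_zero)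
  qed
  then have "(UNIV :: 'n proj set) = - zeros {1}" by (auto simp: zeros_def)
  then have "openin zariski (UNIV :: 'n proj set)"
    unfolding openin_zariski using one by (intro exI[of _ "{1}"] conjI) blast+
  then show ?thesis using openin_subset by fastforce
qed

lemma closedin_zariski:
  "closedin zariski Z \<longleftrightarrow> (\<exists>S. S \<subseteq> (\<Union>d. forms d) \<and> Z = zeros S)"
  by (simp add: closedin_def openin_zariski flip: Compl_eq_Diff_UNIV)


section \<open>Irreducible components, dimension, degree\<close>

definition irreducible_space :: "'a topology \<Rightarrow> bool" where
  "irreducible_space X \<longleftrightarrow> topspace X \<noteq> {} \<and>
     (\<forall>C D. closedin X C \<and> closedin X D \<and> C \<union> D = topspace X \<longrightarrow>
        C = topspace X \<or> D = topspace X)"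

definition irreducible_components :: "'a topology \<Rightarrow> 'a set set" where
  "irreducible_components X =
     {Z. Z \<subseteq> topspace X \<and> irreducible_space (subtopology X Z) \<and>
         (\<forall>T. Z \<subseteq> T \<and> T \<subseteq> topspace X \<and> irreducible_space (subtopology X T) \<longrightarrow> T = Z)}"

text \<open>
  The supremum of the lengths \<open>n\<close> of chains \<open>Z\<^sub>0 \<subset> \<dots> \<subset> Z\<^sub>n\<close> of irreducible closed subsets
  (\<open>-\<infinity>\<close> for the empty space).
\<close>

definition krull_dim :: "'a topology \<Rightarrow> ereal" where
  "krull_dim X = Sup {ereal (real n) | n. \<exists>Z :: nat \<Rightarrow> 'a set.
     (\<forall>i\<le>n. closedin X (Z i) \<and> irreducible_space (subtopology X (Z i))) \<and>
     (\<forall>i<n. Z i \<subset> Z (Suc i))}"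

definition proj_dim :: "'n::finite proj set \<Rightarrow> ereal" where
  "proj_dim Y = krull_dim (subtopology zariski Y)"

text \<open>
  The dimension of the degree \<open>d\<close> part of the homogeneous coordinate ring
  \<open>\<complex>[x] / I(Y)\<close>; the space of all forms of degree \<open>d\<close> is finite-dimensional.
\<close>

definition hilbert_function :: "'n::finite proj set \<Rightarrow> nat \<Rightarrow> nat" where
  "hilbert_function Y d =
     mpoly.dim (forms d :: ('n, complex) mpoly set) - mpoly.dim (forms d \<inter> vanishing_ideal Y)"

definition hilbert_polynomial :: "'n::finite proj set \<Rightarrow> real poly" where
  "hilbert_polynomial Y =
     (THE p. \<forall>\<^sub>F d in sequentially. poly p (real d) = real (hilbert_function Y d))"

definition proj_degree :: "'n::finite proj set \<Rightarrow> real" where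
  "proj_degree Y = fact (degree (hilbert_polynomial Y)) * lead_coeff (hilbert_polynomial Y)"


section \<open>The Grassmannian and the discriminant of the hypersimplex\<close>

typedef triple = "{(i, j, k). 1 \<le> i \<and> i < j \<and> j < k \<and> k \<le> (6::nat)}"
  morphisms indices triple
  by (rule exI[of _ "(1, 2, 3)"]) simp

instance triple :: finite
proof
  have "{(i, j, k). 1 \<le> i \<and> i < j \<and> j < k \<and> k \<le> (6::nat)} \<subseteq> {..6} \<times> {..6} \<times> {..6}"
    by auto
  then have "finite {(i, j, k). 1 \<le> i \<and> i < j \<and> j < k \<and> k \<le> (6::nat)}"
    by (rule finite_subset) simp
  then show "finite (UNIV :: triple set)"
    unfolding type_definition.univ[OF type_definition_triple] by (rule finite_imageI)
qed

definition xvar :: "nat \<Rightarrow> nat \<Rightarrow> nat \<Rightarrow> (triple, real) mpoly" where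
  "xvar i j k = Var (triple (i, j, k))"

text \<open>
  Columns of a \<open>3 \<times> 6\<close> matrix and entries of a vector in \<open>\<complex>\<^sup>6\<close> are indexed by the numeral type \<open>6\<close>,
  whose elements are the residues of \<open>1, \<dots>, 6\<close> modulo \<open>6\<close>. The order \<open>i < j < k\<close>, on which the
  sign of a minor depends, is that of the natural numbers \<open>1, \<dots>, 6\<close>.
\<close>

definition minors :: "complex^6^3 \<Rightarrow> complex^triple" where
  "minors M = (\<chi> t. case indices t of (i, j, k) \<Rightarrow>
     det (transpose (vector [column (of_nat i) M, column (of_nat j) M, column (of_nat k) M]
       :: complex^3^3)))"

definition Gr36 :: "triple proj set" where
  "Gr36 = {P. \<exists>M. rank M = 3 \<and> minors M \<in> hcoords P}"

definition I_Gr36 :: "(triple, real) mpoly set" where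
  "I_Gr36 = {p. complexify p \<in> vanishing_ideal Gr36}"

definition variety :: "(triple, real) mpoly set \<Rightarrow> triple proj set" where
  "variety J = zeros (complexify ` J)"

definition hyp_poly :: "complex^triple \<Rightarrow> complex^6 \<Rightarrow> complex" where
  "hyp_poly a l = (\<Sum>t\<in>UNIV. case indices t of (i, j, k) \<Rightarrow>
     a $ t * l $ of_nat i * l $ of_nat j * l $ of_nat k)"

definition partial_deriv :: "6 \<Rightarrow> (complex^6 \<Rightarrow> complex) \<Rightarrow> complex^6 \<Rightarrow> complex" where
  "partial_deriv i f l = deriv (\<lambda>s. f (\<chi> j. if j = i then s else l $ j)) (l $ i)"

definition hypersimplex_discriminant :: "triple proj set" where
  "hypersimplex_discriminant = zariski closure_of
     {P. \<exists>a\<in>hcoords P. \<exists>l. (\<forall>i. l $ i \<noteq> 0) \<and> (\<forall>i. partial_deriv i (hyp_poly a) l = 0)}"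

end

theory Submission
  imports Defs "HOL-Library.Function_Algebras" "HOL-Computational_Algebra.Fundamental_Theorem_Algebra"
begin

text \<open>
  A point of the Grassmannian is a configuration of six vectors \<open>v\<^sub>1, \<dots>, v\<^sub>6\<close> in three-space, and
  \<open>x\<^sub>1\<^sub>2\<^sub>3 x\<^sub>4\<^sub>5\<^sub>6 = x\<^sub>1\<^sub>2\<^sub>4 x\<^sub>3\<^sub>5\<^sub>6\<close> says that the planes \<open>12\<close>, \<open>34\<close> and \<open>56\<close>, that is three lines in the
  projective plane, have a common vector. The second quadric says the same about \<open>23\<close>, \<open>45\<close>, \<open>61\<close>:
  it arises from the first by a cyclic shift of the columns. Everything is therefore proved for the
  configurations with concurrent lines, and both varieties are treated as one family with a shift
  \<open>r = 0, 1\<close>.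

  \<^bold>\<open>Hilbert function.\<close> The three concurrent lines split the twenty brackets into eight mixed ones, with
  one vector of each line, and twelve with both vectors of a line. Modulo the ideal, monomials in the
  brackets can be rewritten until only one representative per \<open>key\<close>, a short list of numbers of
  brackets of the various kinds, is left (\<open>straightening\<close>). On a curve of configurations on which the
  parameters grow at very different rates, the representatives have different orders of growth, so that
  they are independent (\<open>KW_indep\<close>). Hence the Hilbert function is the number of keys, which is a
  polynomial of degree 8 with leading coefficient \<open>84 / 8!\<close> (\<open>card_keys_poly\<close>). The same argument shows
  that the configurations with parameters, on which the vanishing of a product of forms is decided along
  polynomial curves, detect all forms, so that the varieties are irreducible (\<open>prime_cone_KV\<close>).

  \<^bold>\<open>Dimension.\<close> An irreducible closed proper subset has a Hilbert function of smaller growth, since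
  multiplication by a form that vanishes on it is injective on the larger set (\<open>hilb_ge_step\<close>). So the
  growth \<open>d\<^sup>8\<close> bounds the length of all chains by 8, and a chain of Schubert varieties attains the bound
  (\<open>proj_dim_Vty\<close>).

  \<^bold>\<open>Containment.\<close> If the three lines are concurrent, the columns can be rescaled such that all partial
  derivatives of the cubic vanish at \<open>(1, \<dots>, 1)\<close> (\<open>star_sum_pencil\<close>).

  \<^bold>\<open>Components.\<close> The Grassmannian has growth at most \<open>d\<^sup>9\<close>. An irreducible set strictly between one of the
  varieties and the intersection would have growth \<open>d\<^sup>9\<close>; if moreover some form vanishes on the
  discriminant but not on the Grassmannian, the latter would have growth \<open>d\<^sup>1\<^sup>0\<close> (\<open>component_Vty\<close>). The
  form is found by elimination. For one explicit configuration the critical equations have no solution,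
  not even at the boundary of the torus, that is, on the toric variety of the hypersimplex
  (\<open>nondegenerate_sample\<close>). There a Nullstellensatz certificate in each of the twenty charts yields a
  square matrix of linear forms which is the identity at this configuration and singular at all
  critical ones; its determinant is the form (\<open>eliminant\<close>). That the configuration is nondegenerate is
  seen by reading the critical equations as conditions on the closed polygon with edges \<open>l\<^sub>i v\<^sub>i\<close>: they
  force every other vertex onto a common axis, which for six edges makes opposite edges concurrent, and
  is impossible for fewer edges (\<open>not_critical_6\<close>, \<open>not_critical_5\<close>).
\<close>

declare ideal.scale_scale [simp del] \<comment> \<open>it reverses associativity of multiplication\<close>

section \<open>Points, cones and forms\<close>

definition cone :: "'n proj set \<Rightarrow> (complex^'n) set" where
  "cone Y = (\<Union>P\<in>Y. hcoords P)"

lemma cone_mono: "Y \<subseteq> Z \<Longrightarrow> cone Y \<subseteq> cone Z"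
  by (auto simp: cone_def)

lemma hcoords_ray: "v \<in> hcoords P \<Longrightarrow> hcoords P = {c *s v | c. c \<noteq> 0}"
proof -
  assume v: "v \<in> hcoords P"
  obtain w where w: "hcoords P = {c *s w | c. c \<noteq> 0}" using hcoords[of P] by auto
  with v obtain c where c: "v = c *s w" "c \<noteq> 0" by auto
  have "d *s w = (d / c) *s v" for d using c by (simp add: vector_smult_assoc)
  then have "{d *s w | d. d \<noteq> 0} \<subseteq> {d *s v | d. d \<noteq> 0}"
    using c(2) by (smt (verit) Collect_mono_iff divide_eq_0_iff)
  moreover have "{d *s v | d. d \<noteq> 0} \<subseteq> {d *s w | d. d \<noteq> 0}"
    using c by (auto simp: vector_smult_assoc)
  ultimately show ?thesis unfolding w by blast
qed

lemma hcoords_nonzero: "v \<in> hcoords P \<Longrightarrow> v \<noteq> 0"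
proof -
  assume v: "v \<in> hcoords P"
  obtain w where w: "hcoords P = {c *s w | c. c \<noteq> 0}" "w \<noteq> 0" using hcoords[of P] by auto
  with v show "v \<noteq> 0" by (auto simp: vec_eq_iff)
qed

lemma hcoords_nonempty: "\<exists>v. v \<in> hcoords P"
proof -
  obtain w where w: "hcoords P = {c *s w | c. c \<noteq> 0}" "w \<noteq> 0" using hcoords[of P] by auto
  then have "1 *s w \<in> hcoords P" unfolding w by (intro CollectI exI conjI) (rule refl, simp)
  then show ?thesis by blast
qed

lemma hcoords_ex:
  fixes v :: "complex^'n"
  assumes v: "v \<noteq> 0" shows "\<exists>P. v \<in> hcoords P"
proof -
  have "hcoords (Abs_proj {c *s v | c. c \<noteq> 0}) = {c *s v | c. c \<noteq> 0}"
    by (rule Abs_proj_inverse) (use v in blast)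
  moreover have "1 *s v \<in> {c *s v | c. c \<noteq> 0}" by (intro CollectI exI conjI) (rule refl, simp)
  ultimately have "v \<in> hcoords (Abs_proj {c *s v | c. c \<noteq> 0})" by simp
  then show ?thesis by blast
qed

lemma hcoords_unique: "v \<in> hcoords P \<Longrightarrow> v \<in> hcoords Q \<Longrightarrow> P = Q"
  using hcoords_ray[of v P] hcoords_ray[of v Q] by (simp add: hcoords_inject)

lemma scale_in_hcoords: "v \<in> hcoords P \<Longrightarrow> c \<noteq> 0 \<Longrightarrow> c *s v \<in> hcoords P"
  using hcoords_ray[of v P] by blast

lemma eval_scale_form:
  assumes "p \<in> forms a" shows "eval p (c *s v) = c ^ a * eval p v"
proof -
  have "(\<Prod>i\<in>UNIV. ((c *s v) $ i) ^ Poly_Mapping.lookup m i)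
      = c ^ a * (\<Prod>i\<in>UNIV. (v $ i) ^ Poly_Mapping.lookup m i)"
    if "m \<in> Poly_Mapping.keys p" for m
  proof -
    have "(\<Prod>i\<in>UNIV. c ^ Poly_Mapping.lookup m i) = c ^ a"
      using assms that by (simp add: forms_def flip: power_sum)
    then show ?thesis by (simp only: vector_smult_component power_mult_distrib prod.distrib)
  qed
  then show ?thesis
    unfolding eval_def sum_distrib_left
    by (intro sum.cong refl) (simp only: mult.left_commute)
qed

lemma eval_const_mult [simp]: "eval (Poly_Mapping.single 0 c * p) v = c * eval p v"
  by (simp add: eval_mult eval_single)

lemma eval_one [simp]: "eval 1 v = 1"
  using eval_single[of 0 1 v] by simp

lemma eval_Var [simp]: "eval (Var i) v = v $ i"
proof -
  have "(\<Prod>j\<in>UNIV. (v $ j) ^ (Poly_Mapping.lookup (Poly_Mapping.single i (1::nat)) j))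
      = (\<Prod>j\<in>UNIV. if j = i then v $ j else 1)"
    by (intro prod.cong refl) (auto simp: lookup_single when_def)
  then show ?thesis unfolding Var_def by (simp add: eval_single)
qed

lemma eval_sum: "eval (sum f A) v = (\<Sum>a\<in>A. eval (f a) v)"
  by (induction A rule: infinite_finite_induct) (auto simp: eval_add)

lemma eval_prod: "eval (prod f A) v = (\<Prod>a\<in>A. eval (f a) v)"
  by (induction A rule: infinite_finite_induct) (auto simp: eval_mult)

lemma eval_power [simp]: "eval (p ^ n) v = eval p v ^ n"
  by (induction n) (auto simp: eval_mult)

lemma eval_uminus [simp]: "eval (- p) v = - eval p v"
  using eval_add[of p "- p" v] by (simp add: add_eq_0_iff)

lemma eval_diff: "eval (p - q) v = eval p v - eval q v"
  using eval_add[of p "- q" v] by simp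

lemma forms_zero [simp]: "0 \<in> forms d" by (simp add: forms_def)

lemma forms_add: "p \<in> forms d \<Longrightarrow> q \<in> forms d \<Longrightarrow> p + q \<in> forms d"
  using Poly_Mapping.keys_add[of p q] by (auto simp: forms_def)

lemma forms_single: "(\<Sum>i\<in>UNIV. Poly_Mapping.lookup m i) = d \<Longrightarrow> Poly_Mapping.single m c \<in> forms d"
  by (auto simp: forms_def)

lemma forms_const: "Poly_Mapping.single 0 c \<in> forms 0"
  by (rule forms_single) simp

lemma forms_one: "1 \<in> forms 0"
  using forms_const[of 1] by simp

lemma forms_scale: "p \<in> forms d \<Longrightarrow> Poly_Mapping.single 0 c * p \<in> forms d"
  using forms_mult[OF forms_const, of p d c] by simp

lemma forms_uminus: "p \<in> forms d \<Longrightarrow> - p \<in> forms d"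
  by (simp add: forms_def)

lemma forms_diff: "p \<in> forms d \<Longrightarrow> q \<in> forms d \<Longrightarrow> p - q \<in> forms d"
  using forms_add[OF _ forms_uminus] by fastforce

lemma forms_sum: "(\<And>i. i \<in> A \<Longrightarrow> f i \<in> forms d) \<Longrightarrow> sum f A \<in> forms d"
  by (induction A rule: infinite_finite_induct) (auto intro: forms_add)

lemma forms_Var: "Var i \<in> forms 1"
  unfolding Var_def by (rule forms_single) (simp add: lookup_single when_def)

lemma forms_prod: "(\<And>i. i \<in> A \<Longrightarrow> f i \<in> forms (g i)) \<Longrightarrow> prod f A \<in> forms (sum g A)"
proof (induction A rule: infinite_finite_induct)
  case (insert x F)
  then show ?case by (simp add: forms_mult)
qed (auto simp: forms_one)

lemma forms_power: "p \<in> forms a \<Longrightarrow> p ^ n \<in> forms (n * a)"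
  by (induction n) (auto simp: forms_one intro: forms_mult)

lemma vanishes_at_form:
  assumes "p \<in> forms a" "v \<in> hcoords P"
  shows "vanishes_at p P \<longleftrightarrow> eval p v = 0"
  using hcoords_ray[OF assms(2)] assms eval_scale_form[OF assms(1)]
  by (auto simp: vanishes_at_def)

lemma vanishing_ideal_cone: "p \<in> vanishing_ideal Y \<longleftrightarrow> (\<forall>v\<in>cone Y. eval p v = 0)"
  by (auto simp: vanishing_ideal_def vanishes_at_def cone_def)

text \<open>Forms are sums of scalar multiples of monomials, which allows an induction over these operations.\<close>

lemma forms_induct [consumes 1, case_names zero add scale]:
  assumes "p \<in> forms d"
    and zero: "P 0" and add: "\<And>p q. P p \<Longrightarrow> P q \<Longrightarrow> P (p + q)"
    and mono: "\<And>m c. (\<Sum>i\<in>UNIV. Poly_Mapping.lookup m i) = d \<Longrightarrow> P (Poly_Mapping.single m c)"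
  shows "P p"
proof -
  have "p = (\<Sum>m\<in>Poly_Mapping.keys p. Poly_Mapping.single m (Poly_Mapping.lookup p m))"
  proof (rule poly_mapping_eqI)
    fix k
    have "Poly_Mapping.lookup (\<Sum>m\<in>Poly_Mapping.keys p. Poly_Mapping.single m (Poly_Mapping.lookup p m)) k
        = (\<Sum>m\<in>Poly_Mapping.keys p. if m = k then Poly_Mapping.lookup p m else 0)"
      by (simp add: lookup_sum lookup_single when_def)
    then show "Poly_Mapping.lookup p k = Poly_Mapping.lookup
        (\<Sum>m\<in>Poly_Mapping.keys p. Poly_Mapping.single m (Poly_Mapping.lookup p m)) k"
      by (simp add: in_keys_iff)
  qed
  moreover have "P (\<Sum>m\<in>S. Poly_Mapping.single m (Poly_Mapping.lookup p m))"
    if "finite S" "S \<subseteq> Poly_Mapping.keys p" for S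
    using that by (induction S rule: finite_induct)
      (use assms(1) in \<open>auto intro!: add mono zero simp: forms_def\<close>)
  ultimately show ?thesis by (metis finite_keys order_refl)
qed

section \<open>Irreducible sets\<close>

text \<open>The zero sets of homogeneous polynomials only depend on one vector on each ray, so that
  irreducibility becomes a primality condition on forms, tested on the affine cone.\<close>

definition prime_cone :: "(complex^'n::finite) set \<Rightarrow> bool" where
  "prime_cone K \<longleftrightarrow> (\<forall>a b. \<forall>p\<in>forms a. \<forall>q\<in>forms b. (\<forall>v\<in>K. eval p v * eval q v = 0) \<longrightarrow>
      (\<forall>v\<in>K. eval p v = 0) \<or> (\<forall>v\<in>K. eval q v = 0))"

lemma zeros_cone:
  assumes "S \<subseteq> (\<Union>d. forms d)" "v \<in> hcoords P"
  shows "P \<in> zeros S \<longleftrightarrow> (\<forall>p\<in>S. eval p v = 0)"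
  unfolding zeros_def using assms vanishes_at_form by blast

lemma irreducible_space_iff:
  fixes Z :: "'n::finite proj set"
  shows "irreducible_space (subtopology zariski Z) \<longleftrightarrow> Z \<noteq> {} \<and> prime_cone (cone Z)"
proof
  assume irr: "irreducible_space (subtopology zariski Z)"
  then have ne: "Z \<noteq> {}" by (simp add: irreducible_space_def)
  have "prime_cone (cone Z)" unfolding prime_cone_def
  proof (intro allI ballI impI)
    fix a b :: nat and p q :: "('n, complex) mpoly"
    assume p: "p \<in> forms a" and q: "q \<in> forms b" and pq: "\<forall>v\<in>cone Z. eval p v * eval q v = 0"
    have c: "closedin (subtopology zariski Z) (Z \<inter> zeros {r})" if r: "r \<in> forms e" for r e
    proof -
      have "closedin zariski (zeros {r})"
        unfolding closedin_zariski by (intro exI[of _ "{r}"]) (use r in auto)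
      then show ?thesis unfolding closedin_subtopology by blast
    qed
    have "Z \<subseteq> zeros {p} \<union> zeros {q}"
    proof
      fix P assume "P \<in> Z"
      obtain v where v: "v \<in> hcoords P" using hcoords_nonempty by blast
      then have "v \<in> cone Z" using \<open>P \<in> Z\<close> by (auto simp: cone_def)
      then show "P \<in> zeros {p} \<union> zeros {q}"
        using pq v vanishes_at_form[OF p v] vanishes_at_form[OF q v] by (auto simp: zeros_def)
    qed
    then have "Z \<inter> zeros {p} = Z \<or> Z \<inter> zeros {q} = Z"
      using irr c[OF p] c[OF q] unfolding irreducible_space_def
      by (elim conjE allE[of _ "Z \<inter> zeros {p}"] allE[of _ "Z \<inter> zeros {q}"]) auto
    then show "(\<forall>v\<in>cone Z. eval p v = 0) \<or> (\<forall>v\<in>cone Z. eval q v = 0)"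
      by (auto simp: cone_def zeros_def vanishes_at_def)
  qed
  with ne show "Z \<noteq> {} \<and> prime_cone (cone Z)" by blast
next
  assume *: "Z \<noteq> {} \<and> prime_cone (cone Z)"
  show "irreducible_space (subtopology zariski Z)" unfolding irreducible_space_def
  proof (intro conjI allI impI)
    show "topspace (subtopology zariski Z) \<noteq> {}" using * by simp
    fix C D :: "'n proj set"
    assume h: "closedin (subtopology zariski Z) C \<and> closedin (subtopology zariski Z) D \<and>
      C \<union> D = topspace (subtopology zariski Z)"
    then have "closedin (subtopology zariski Z) C" "closedin (subtopology zariski Z) D" by auto
    then obtain S T where S: "S \<subseteq> (\<Union>d. forms d)" "C = zeros S \<inter> Z"
      and T: "T \<subseteq> (\<Union>d. forms d)" "D = zeros T \<inter> Z"
      unfolding closedin_subtopology closedin_zariski by blast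
    have CD: "C \<union> D = Z" using h by simp
    show "C = topspace (subtopology zariski Z) \<or> D = topspace (subtopology zariski Z)"
    proof (rule ccontr)
      assume "\<not> ?thesis"
      then have "C \<noteq> Z" "D \<noteq> Z" by auto
      then obtain P Q where P: "P \<in> Z" "P \<notin> zeros S" and Q: "Q \<in> Z" "Q \<notin> zeros T"
        using S T by blast
      obtain v w where v: "v \<in> hcoords P" and w: "w \<in> hcoords Q" using hcoords_nonempty by blast
      obtain p q where p: "p \<in> S" "eval p v \<noteq> 0" and q: "q \<in> T" "eval q w \<noteq> 0"
        using P Q zeros_cone[OF S(1) v] zeros_cone[OF T(1) w] by blast
      obtain a b where ab: "p \<in> forms a" "q \<in> forms b" using S(1) T(1) p q by blast
      have "\<forall>u\<in>cone Z. eval p u * eval q u = 0"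
      proof
        fix u assume "u \<in> cone Z"
        then obtain R where R: "R \<in> Z" "u \<in> hcoords R" by (auto simp: cone_def)
        then have "R \<in> zeros S \<or> R \<in> zeros T" using CD S T by blast
        then show "eval p u * eval q u = 0"
          using zeros_cone[OF S(1) R(2)] zeros_cone[OF T(1) R(2)] p q by auto
      qed
      then have "(\<forall>v\<in>cone Z. eval p v = 0) \<or> (\<forall>v\<in>cone Z. eval q v = 0)"
        using * ab unfolding prime_cone_def by blast
      then show False using p q v w P Q by (auto simp: cone_def)
    qed
  qed
qed

text \<open>Two points on a rational curve inside \<open>K\<close> cannot be separated by a reducible equation:
  along the curve, a product of two nonzero polynomials in one variable is nonzero.\<close>

definition polynomial_fun :: "(complex \<Rightarrow> complex) \<Rightarrow> bool" where
  "polynomial_fun f \<longleftrightarrow> (\<exists>p. \<forall>t. f t = poly p t)"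

lemma polynomial_fun_const [simp, intro]: "polynomial_fun (\<lambda>t. c)"
  unfolding polynomial_fun_def by (rule exI[of _ "[:c:]"]) simp
lemma polynomial_fun_id [simp, intro]: "polynomial_fun (\<lambda>t. t)"
  unfolding polynomial_fun_def by (rule exI[of _ "[:0, 1:]"]) simp
lemma polynomial_fun_add [intro]:
  "polynomial_fun f \<Longrightarrow> polynomial_fun g \<Longrightarrow> polynomial_fun (\<lambda>t. f t + g t)"
  unfolding polynomial_fun_def by (metis poly_add)
lemma polynomial_fun_mult [intro]:
  "polynomial_fun f \<Longrightarrow> polynomial_fun g \<Longrightarrow> polynomial_fun (\<lambda>t. f t * g t)"
  unfolding polynomial_fun_def by (metis poly_mult)
lemma polynomial_fun_diff [intro]:
  "polynomial_fun f \<Longrightarrow> polynomial_fun g \<Longrightarrow> polynomial_fun (\<lambda>t. f t - g t)"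
  unfolding polynomial_fun_def by (metis poly_diff)
lemma polynomial_fun_power [intro]: "polynomial_fun f \<Longrightarrow> polynomial_fun (\<lambda>t. f t ^ n)"
  unfolding polynomial_fun_def by (metis poly_power)
lemma polynomial_fun_sum [intro]:
  "(\<And>i. i \<in> A \<Longrightarrow> polynomial_fun (f i)) \<Longrightarrow> polynomial_fun (\<lambda>t. \<Sum>i\<in>A. f i t)"
  by (induction A rule: infinite_finite_induct) auto
lemma polynomial_fun_prod [intro]:
  "(\<And>i. i \<in> A \<Longrightarrow> polynomial_fun (f i)) \<Longrightarrow> polynomial_fun (\<lambda>t. \<Prod>i\<in>A. f i t)"
  by (induction A rule: infinite_finite_induct) auto

lemma polynomial_fun_eval:
  assumes "\<And>i. polynomial_fun (\<lambda>t. g t $ i)" shows "polynomial_fun (\<lambda>t. eval p (g t))"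
  unfolding eval_def using assms by (intro polynomial_fun_sum polynomial_fun_mult
      polynomial_fun_prod polynomial_fun_power polynomial_fun_const)

lemma polynomial_fun_finite_zeros:
  assumes "polynomial_fun f" "f a \<noteq> 0" shows "finite {t. f t = 0}"
proof -
  obtain p where p: "\<forall>t. f t = poly p t" using assms(1) by (auto simp: polynomial_fun_def)
  then have "p \<noteq> 0" using assms(2) by auto
  then show ?thesis using poly_roots_finite p by simp
qed

lemma prime_cone_curves:
  fixes K :: "(complex^'n::finite) set"
  assumes "\<And>x y. x \<in> K \<Longrightarrow> y \<in> K \<Longrightarrow> \<exists>g. (\<forall>i. polynomial_fun (\<lambda>t. g t $ i)) \<and> g 0 = x \<and> g 1 = y \<and>
      finite {t. g t \<notin> K}"
  shows "prime_cone K"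
  unfolding prime_cone_def
proof (intro allI ballI impI, rule ccontr)
  fix a b :: nat and p q :: "('n, complex) mpoly"
  assume pq: "\<forall>v\<in>K. eval p v * eval q v = 0"
    and "\<not> ((\<forall>v\<in>K. eval p v = 0) \<or> (\<forall>v\<in>K. eval q v = 0))"
  then obtain x y where x: "x \<in> K" "eval p x \<noteq> 0" and y: "y \<in> K" "eval q y \<noteq> 0" by blast
  obtain g where g: "\<And>i. polynomial_fun (\<lambda>t. g t $ i)" "g 0 = x" "g 1 = y" "finite {t. g t \<notin> K}"
    using assms[OF x(1) y(1)] by blast
  have "finite {t. eval p (g t) = 0}"
    by (rule polynomial_fun_finite_zeros[of _ 0]) (use g x in \<open>auto intro: polynomial_fun_eval\<close>)
  moreover have "finite {t. eval q (g t) = 0}"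
    by (rule polynomial_fun_finite_zeros[of _ 1]) (use g y in \<open>auto intro: polynomial_fun_eval\<close>)
  ultimately have "finite ({t. g t \<notin> K} \<union> {t. eval p (g t) = 0} \<union> {t. eval q (g t) = 0})"
    using g(4) by simp
  from ex_new_if_finite[OF infinite_UNIV_char_0 this]
  obtain t where "t \<notin> {t. g t \<notin> K} \<union> {t. eval p (g t) = 0} \<union> {t. eval q (g t) = 0}"
    by (elim exE)
  then show False using pq by auto
qed

section \<open>Lower and upper bounds for Hilbert functions\<close>

definition indep_on :: "'v set \<Rightarrow> 'i set \<Rightarrow> ('i \<Rightarrow> 'v \<Rightarrow> complex) \<Rightarrow> bool" where
  "indep_on K J f \<longleftrightarrow> finite J \<and>
    (\<forall>c. (\<forall>v\<in>K. (\<Sum>j\<in>J. c j * f j v) = 0) \<longrightarrow> (\<forall>j\<in>J. c j = 0))"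

definition combination_on :: "'v set \<Rightarrow> 'i set \<Rightarrow> ('i \<Rightarrow> 'v \<Rightarrow> complex) \<Rightarrow> ('v \<Rightarrow> complex) \<Rightarrow> bool" where
  "combination_on K J f h \<longleftrightarrow> (\<exists>c. \<forall>v\<in>K. h v = (\<Sum>j\<in>J. c j * f j v))"

text \<open>Bounds for the dimension of the space of degree \<open>d\<close> functions on \<open>K\<close> are used
  in place of its value: they can be compared without knowing that the dimension is attained, and lower
  bounds for one set combine with upper bounds for another one.\<close>

definition hilb_ge :: "(complex^'n::finite) set \<Rightarrow> nat \<Rightarrow> nat \<Rightarrow> bool" where
  "hilb_ge K d n \<longleftrightarrow> (\<exists>f. (\<forall>i<n. f i \<in> forms d) \<and> indep_on K {..<n} (\<lambda>i. eval (f i)))"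

definition hilb_le :: "(complex^'n::finite) set \<Rightarrow> nat \<Rightarrow> nat \<Rightarrow> bool" where
  "hilb_le K d n \<longleftrightarrow> (\<exists>f. \<forall>p\<in>forms d. combination_on K {..<n} f (eval p))"

interpretation fn: vector_space "\<lambda>(c::complex) (f :: 'v \<Rightarrow> complex) v. c * f v"
  by unfold_locales (simp_all add: fun_eq_iff distrib_left distrib_right)

declare fn.scale_scale [simp del]

lemma sum_fun_apply: "(\<Sum>j\<in>J. f j) v = (\<Sum>j\<in>J. f j v)"
  by (induction J rule: infinite_finite_induct) auto

text \<open>Steinitz exchange in the space of functions on \<open>K\<close>.\<close>

lemma indep_on_card_le:
  assumes I: "indep_on K I f" and J: "finite J" and c: "\<And>i. i \<in> I \<Longrightarrow> combination_on K J g (f i)"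
  shows "card I \<le> card J"
proof -
  define R where "R h = (\<lambda>v. if v \<in> K then h v else 0)" for h :: "'a \<Rightarrow> complex"
  have fin: "finite I" using I by (simp add: indep_on_def)
  have inj: "inj_on (\<lambda>i. R (f i)) I"
  proof (rule inj_onI, rule ccontr)
    fix i j assume ij: "i \<in> I" "j \<in> I" "R (f i) = R (f j)" "i \<noteq> j"
    define c where "c k = (if k = i then 1 else if k = j then -1 else 0 :: complex)" for k
    have "(\<Sum>k\<in>I. c k * f k v) = 0" if "v \<in> K" for v
    proof -
      have "f i v = f j v" using ij(3) that by (auto simp: R_def fun_eq_iff split: if_splits)
      have "(\<Sum>k\<in>I. c k * f k v) = (\<Sum>k\<in>{i,j}. c k * f k v)"
        by (rule sum.mono_neutral_right) (use ij fin in \<open>auto simp: c_def\<close>)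
      also have "\<dots> = 0" using ij(4) \<open>f i v = f j v\<close> by (simp add: c_def)
      finally show ?thesis .
    qed
    then have "c i = 0" using I ij(1) unfolding indep_on_def by blast
    then show False by (simp add: c_def)
  qed
  have ind: "\<not> fn.dependent ((\<lambda>i. R (f i)) ` I)"
  proof
    assume "fn.dependent ((\<lambda>i. R (f i)) ` I)"
    then obtain u where u: "\<exists>h\<in>(\<lambda>i. R (f i)) ` I. u h \<noteq> 0"
      "(\<Sum>h\<in>(\<lambda>i. R (f i)) ` I. (\<lambda>v. u h * h v)) = 0"
      using fn.dependent_finite[of "(\<lambda>i. R (f i)) ` I"] fin by auto
    have "(\<Sum>i\<in>I. (u (R (f i))) * f i v) = 0" if "v \<in> K" for v
    proof -
      have "(\<Sum>h\<in>(\<lambda>i. R (f i)) ` I. (\<lambda>v. u h * h v)) v = 0" using u(2) by simp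
      then have "(\<Sum>i\<in>I. u (R (f i)) * R (f i) v) = 0"
        by (simp add: sum_fun_apply sum.reindex[OF inj])
      then show ?thesis using that by (simp add: R_def)
    qed
    then have "\<forall>i\<in>I. u (R (f i)) = 0" using I unfolding indep_on_def by (elim conjE allE[of _ "\<lambda>i. u (R (f i))"]) blast
    then show False using u(1) by auto
  qed
  have "(\<lambda>i. R (f i)) ` I \<subseteq> fn.span ((\<lambda>j. R (g j)) ` J)"
  proof clarify
    fix i assume "i \<in> I"
    then obtain c where c: "\<forall>v\<in>K. f i v = (\<Sum>j\<in>J. c j * g j v)"
      using c unfolding combination_on_def by blast
    have "R (f i) = (\<Sum>j\<in>J. (\<lambda>v. c j * R (g j) v))"
      by (rule ext) (auto simp: R_def sum_fun_apply c)
    moreover have "(\<lambda>v. c j * R (g j) v) \<in> fn.span ((\<lambda>j. R (g j)) ` J)" if "j \<in> J" for j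
      using that by (intro fn.span_scale[of "R (g j)" _ "c j"] fn.span_base) simp
    ultimately show "R (f i) \<in> fn.span ((\<lambda>j. R (g j)) ` J)"
      by (simp add: fn.span_sum)
  qed
  then have "card ((\<lambda>i. R (f i)) ` I) \<le> card ((\<lambda>j. R (g j)) ` J)"
    using fn.independent_span_bound[OF _ ind, of "(\<lambda>j. R (g j)) ` J"] J by auto
  then show ?thesis using card_image[OF inj] card_image_le[OF J, of "\<lambda>j. R (g j)"] by simp
qed

lemma hilb_ge_le: "hilb_ge K d n \<Longrightarrow> hilb_le K d m \<Longrightarrow> n \<le> m"
  unfolding hilb_ge_def hilb_le_def using indep_on_card_le[of K "{..<n}" _ "{..<m}"]
  by (metis card_lessThan finite_lessThan lessThan_iff)

lemma indep_on_reindex: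
  assumes "bij_betw h I J" "indep_on K J f" shows "indep_on K I (\<lambda>i. f (h i))"
  unfolding indep_on_def
proof (intro conjI allI impI)
  show "finite I" using assms bij_betw_finite unfolding indep_on_def by blast
  fix c :: "'a \<Rightarrow> complex" assume c: "\<forall>v\<in>K. (\<Sum>i\<in>I. c i * f (h i) v) = 0"
  have inv: "inv_into I h (h i) = i" if "i \<in> I" for i
    using assms(1) that by (auto simp: bij_betw_def)
  have "(\<Sum>j\<in>J. c (inv_into I h j) * f j v) = (\<Sum>i\<in>I. c i * f (h i) v)" for v
    by (subst sum.reindex_bij_betw[OF assms(1), symmetric]) (simp add: inv)
  then have "\<forall>v\<in>K. (\<Sum>j\<in>J. c (inv_into I h j) * f j v) = 0" using c by simp
  then have "\<forall>j\<in>J. c (inv_into I h j) = 0" using assms(2) unfolding indep_on_def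
    by (elim conjE allE[of _ "\<lambda>j. c (inv_into I h j)"]) blast
  then show "\<forall>i\<in>I. c i = 0" using assms(1) inv by (metis bij_betwE)
qed

lemma hilb_geI:
  assumes "indep_on K J (\<lambda>j. eval (f j))" "\<And>j. j \<in> J \<Longrightarrow> f j \<in> forms d"
  shows "hilb_ge K d (card J)"
proof -
  have "finite J" using assms(1) by (simp add: indep_on_def)
  then obtain h where h: "bij_betw h {..<card J} J"
    using ex_bij_betw_nat_finite[of J] by (auto simp: atLeast0LessThan)
  have "indep_on K {..<card J} (\<lambda>i. eval (f (h i)))"
    using indep_on_reindex[OF h assms(1)] .
  moreover have "\<forall>i<card J. f (h i) \<in> forms d" using h assms(2) by (auto simp: bij_betw_def)
  ultimately show ?thesis unfolding hilb_ge_def by (intro exI[of _ "\<lambda>i. f (h i)"]) auto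
qed

lemma hilb_leI:
  assumes "finite J" "\<And>p. p \<in> forms d \<Longrightarrow> combination_on K J f (eval p)"
  shows "hilb_le K d (card J)"
proof -
  obtain h where h: "bij_betw h {..<card J} J"
    using ex_bij_betw_nat_finite[OF assms(1)] by (auto simp: atLeast0LessThan)
  have "combination_on K {..<card J} (\<lambda>i. f (h i)) (eval p)" if p: "p \<in> forms d" for p
  proof -
    obtain c where c: "\<forall>v\<in>K. eval p v = (\<Sum>j\<in>J. c j * f j v)"
      using assms(2)[OF p] unfolding combination_on_def by blast
    have "(\<Sum>j\<in>J. c j * f j v) = (\<Sum>i<card J. c (h i) * f (h i) v)" for v
      by (rule sum.reindex_bij_betw[OF h, symmetric])
    then show ?thesis using c unfolding combination_on_def by (intro exI[of _ "\<lambda>i. c (h i)"]) simp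
  qed
  then show ?thesis unfolding hilb_le_def by blast
qed

lemma hilbert_function_eq_card:
  fixes Y :: "'n::finite proj set"
  assumes f: "\<And>j. j \<in> J \<Longrightarrow> f j \<in> forms d"
    and ind: "indep_on (cone Y) J (\<lambda>j. eval (f j))"
    and span: "\<And>p. p \<in> forms d \<Longrightarrow> combination_on (cone Y) J (\<lambda>j. eval (f j)) (eval p)"
  shows "hilbert_function Y d = card J"
proof -
  let ?I = "forms d \<inter> vanishing_ideal Y"
  let ?sc = "\<lambda>(c :: complex) (p :: ('n, complex) mpoly). Poly_Mapping.single 0 c * p"
  have fin: "finite J" using ind by (simp add: indep_on_def)
  define F where "F = (forms d :: ('n, complex) mpoly set)"
  obtain B where B: "B \<subseteq> ?I" "mpoly.independent B" "?I \<subseteq> mpoly.span B" "card B = mpoly.dim ?I"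
    using mpoly.basis_exists[of ?I] by blast
  have subI: "mpoly.subspace ?I"
    unfolding mpoly.subspace_def by (auto simp: vanishing_ideal_cone eval_add intro: forms_add forms_scale)
  have spB: "mpoly.span B = ?I"
    using B subI by (metis mpoly.span_mono mpoly.span_eq_iff subset_antisym)
  have finmono: "finite {m :: 'n \<Rightarrow>\<^sub>0 nat. (\<Sum>i\<in>UNIV. Poly_Mapping.lookup m i) = d}"
  proof (rule finite_imageD)
    show "finite (Poly_Mapping.lookup ` {m :: 'n \<Rightarrow>\<^sub>0 nat. (\<Sum>i\<in>UNIV. Poly_Mapping.lookup m i) = d})"
    proof (rule finite_subset)
      show "Poly_Mapping.lookup ` {m :: 'n \<Rightarrow>\<^sub>0 nat. (\<Sum>i\<in>UNIV. Poly_Mapping.lookup m i) = d}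
          \<subseteq> (UNIV :: 'n set) \<rightarrow>\<^sub>E {..d}"
        by (auto intro!: member_le_sum)
      show "finite ((UNIV :: 'n set) \<rightarrow>\<^sub>E {..d})" by (intro finite_PiE) auto
    qed
    show "inj_on Poly_Mapping.lookup {m :: 'n \<Rightarrow>\<^sub>0 nat. (\<Sum>i\<in>UNIV. Poly_Mapping.lookup m i) = d}"
      by (rule inj_onI) (simp add: poly_mapping_eqI)
  qed
  have spmono: "F \<subseteq> mpoly.span ((\<lambda>m. Poly_Mapping.single m 1) `
      {m :: 'n \<Rightarrow>\<^sub>0 nat. (\<Sum>i\<in>UNIV. Poly_Mapping.lookup m i) = d})"
  proof
    fix p :: "('n, complex) mpoly" assume "p \<in> F"
    then have "p \<in> forms d" by (simp add: F_def)
    then show "p \<in> mpoly.span ((\<lambda>m. Poly_Mapping.single m 1) `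
      {m :: 'n \<Rightarrow>\<^sub>0 nat. (\<Sum>i\<in>UNIV. Poly_Mapping.lookup m i) = d})"
    proof (induction rule: forms_induct)
      case (scale m c)
      then have "?sc c (Poly_Mapping.single m 1) \<in> mpoly.span ((\<lambda>m. Poly_Mapping.single m 1) `
        {m :: 'n \<Rightarrow>\<^sub>0 nat. (\<Sum>i\<in>UNIV. Poly_Mapping.lookup m i) = d})"
        by (intro mpoly.span_scale mpoly.span_base) auto
      then show ?case by (simp add: mult_single)
    qed (auto intro: mpoly.span_zero mpoly.span_add)
  qed
  have finB: "finite B"
  proof (rule conjunct1[OF mpoly.independent_span_bound[OF finite_imageI[OF finmono] B(2)]])
    show "B \<subseteq> mpoly.span ((\<lambda>m. Poly_Mapping.single m 1) `
        {m :: 'n \<Rightarrow>\<^sub>0 nat. (\<Sum>i\<in>UNIV. Poly_Mapping.lookup m i) = d})"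
      using B(1) spmono unfolding F_def by blast
  qed
  have injf: "inj_on f J"
  proof (rule inj_onI, rule ccontr)
    fix i j assume ij: "i \<in> J" "j \<in> J" "f i = f j" "i \<noteq> j"
    define c where "c k = (if k = i then 1 else if k = j then -1 else 0 :: complex)" for k
    have "(\<Sum>k\<in>J. c k * eval (f k) v) = 0" for v
    proof -
      have "(\<Sum>k\<in>J. c k * eval (f k) v) = (\<Sum>k\<in>{i,j}. c k * eval (f k) v)"
        by (rule sum.mono_neutral_right) (use ij fin in \<open>auto simp: c_def\<close>)
      then show ?thesis using ij(3,4) by (simp add: c_def)
    qed
    then have "c i = 0" using ind ij(1) unfolding indep_on_def by blast
    then show False by (simp add: c_def)
  qed
  have key: "c j = 0" if c: "(\<Sum>j\<in>J. ?sc (c j) (f j)) \<in> vanishing_ideal Y" and "j \<in> J" for c j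
  proof -
    have "\<forall>v\<in>cone Y. (\<Sum>j\<in>J. c j * eval (f j) v) = 0"
      using c unfolding vanishing_ideal_cone by (simp add: eval_sum)
    then show ?thesis using ind that(2) unfolding indep_on_def by blast
  qed
  have disj: "B \<inter> f ` J = {}"
  proof (rule ccontr)
    assume "B \<inter> f ` J \<noteq> {}"
    then obtain j where j: "j \<in> J" "f j \<in> B" by blast
    have "(\<Sum>k\<in>J. ?sc (if k = j then 1 else 0) (f k)) = f j"
      using fin j(1) by (subst sum.mono_neutral_right[of J "{j}"]) auto
    then have "(1::complex) = 0" using key[of "\<lambda>k. if k = j then 1 else 0" j] j B(1) by auto
    then show False by simp
  qed
  have ind2: "mpoly.independent (B \<union> f ` J)"
  proof (rule mpoly.independent_if_scalars_zero)
    show "finite (B \<union> f ` J)" using finB fin by simp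
    fix u x assume u: "(\<Sum>x\<in>B \<union> f ` J. ?sc (u x) x) = 0" and x: "x \<in> B \<union> f ` J"
    have split: "(\<Sum>x\<in>B. ?sc (u x) x) + (\<Sum>j\<in>J. ?sc (u (f j)) (f j)) = 0"
      using u disj finB fin by (simp add: sum.union_disjoint sum.reindex[OF injf])
    have "(\<Sum>x\<in>B. ?sc (u x) x) \<in> ?I"
      unfolding spB[symmetric] by (intro mpoly.span_sum mpoly.span_scale mpoly.span_base)
    then have "- (\<Sum>x\<in>B. ?sc (u x) x) \<in> ?I" by (rule mpoly.subspace_neg[OF subI])
    moreover have "(\<Sum>j\<in>J. ?sc (u (f j)) (f j)) = - (\<Sum>x\<in>B. ?sc (u x) x)"
      using split by (simp add: eq_neg_iff_add_eq_0 add.commute)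
    ultimately have "(\<Sum>j\<in>J. ?sc (u (f j)) (f j)) \<in> ?I" by simp
    then have z: "\<forall>j\<in>J. u (f j) = 0" using key[of "\<lambda>j. u (f j)"] by blast
    then have "(\<Sum>x\<in>B. ?sc (u x) x) = 0" using split by simp
    then have "\<forall>x\<in>B. u x = 0" using B(2) finB mpoly.independentD[of B B u] by blast
    then show "u x = 0" using z x by auto
  qed
  have "F \<subseteq> mpoly.span (B \<union> f ` J)"
  proof
    fix p assume "p \<in> F"
    then have p: "p \<in> forms d" by (simp add: F_def)
    obtain c where c: "\<forall>v\<in>cone Y. eval p v = (\<Sum>j\<in>J. c j * eval (f j) v)"
      using span[OF p] unfolding combination_on_def by blast
    let ?s = "\<Sum>j\<in>J. ?sc (c j) (f j)"
    have s: "?s \<in> mpoly.span (f ` J)" by (intro mpoly.span_sum mpoly.span_scale mpoly.span_base) auto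
    have "?s \<in> forms d" by (intro forms_sum forms_scale f)
    then have "p - ?s \<in> ?I" using c forms_diff[OF p] by (auto simp: vanishing_ideal_cone eval_diff eval_sum)
    then have "p - ?s \<in> mpoly.span B" using spB by simp
    then have "(p - ?s) + ?s \<in> mpoly.span (B \<union> f ` J)"
      by (intro mpoly.span_add) (use s mpoly.span_mono in blast)+
    then show "p \<in> mpoly.span (B \<union> f ` J)" by simp
  qed
  moreover have "B \<union> f ` J \<subseteq> F" using B(1) f by (auto simp: F_def)
  ultimately have "mpoly.dim F = card (B \<union> f ` J)"
    using mpoly.basis_card_eq_dim[of "B \<union> f ` J" F] ind2 by simp
  also have "\<dots> = card B + card J" using disj finB fin by (simp add: card_Un_disjoint card_image[OF injf])
  finally show ?thesis unfolding hilbert_function_def F_def using B(4) by simp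
qed

section \<open>Growth of Hilbert functions and Krull dimension\<close>

lemma hilb_ge_0: "hilb_ge K d 0"
  by (auto simp: hilb_ge_def indep_on_def)

lemma sum_lessThan_add:
  "sum f {..<n + m} = sum f {..<n} + (\<Sum>j<m. f (n + j :: nat) :: 'a::comm_monoid_add)"
  by (induction m) (auto simp: add.assoc)

text \<open>If a form \<open>f\<close> of degree \<open>e\<close> vanishes on \<open>K\<close> but not on the larger irreducible \<open>K'\<close>, then
  multiplication with \<open>f\<close> embeds the degree \<open>d\<close> functions on \<open>K'\<close> into those of degree \<open>d + e\<close>,
  and the image meets the functions that are independent on \<open>K\<close> only in \<open>0\<close>.\<close>

lemma hilb_ge_step:
  assumes "K \<subseteq> K'" "prime_cone K'" and f: "f \<in> forms e" "\<forall>v\<in>K. eval f v = 0" "\<exists>v\<in>K'. eval f v \<noteq> 0"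
    and n: "hilb_ge K (d + e) n" and m: "hilb_ge K' d m"
  shows "hilb_ge K' (d + e) (n + m)"
proof -
  obtain g where g: "\<forall>i<n. g i \<in> forms (d + e)" "indep_on K {..<n} (\<lambda>i. eval (g i))"
    using n unfolding hilb_ge_def by blast
  obtain h where h: "\<forall>i<m. h i \<in> forms d" "indep_on K' {..<m} (\<lambda>i. eval (h i))"
    using m unfolding hilb_ge_def by blast
  define F where "F i = (if i < n then g i else f * h (i - n))" for i
  have "F i \<in> forms (d + e)" if "i < n + m" for i
    using g(1) h(1) that forms_mult[OF f(1), of "h (i - n)" d] by (auto simp: F_def add.commute)
  moreover have "indep_on K' {..<n + m} (\<lambda>i. eval (F i))"
    unfolding indep_on_def
  proof (intro conjI allI impI)
    fix c assume c: "\<forall>v\<in>K'. (\<Sum>i<n + m. c i * eval (F i) v) = 0"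
    have split: "(\<Sum>i<n + m. c i * eval (F i) v) =
        (\<Sum>i<n. c i * eval (g i) v) + eval f v * (\<Sum>j<m. c (n + j) * eval (h j) v)" for v
    proof -
      have "(\<Sum>i<n. c i * eval (F i) v) = (\<Sum>i<n. c i * eval (g i) v)"
        by (rule sum.cong) (auto simp: F_def)
      moreover have "(\<Sum>j<m. c (n + j) * eval (F (n + j)) v) = eval f v * (\<Sum>j<m. c (n + j) * eval (h j) v)"
        unfolding sum_distrib_left by (rule sum.cong[OF refl]) (simp add: F_def eval_mult)
      ultimately show ?thesis by (simp only: sum_lessThan_add)
    qed
    have "\<forall>v\<in>K. (\<Sum>i<n. c i * eval (g i) v) = 0"
    proof
      fix v assume v: "v \<in> K"
      then have "(\<Sum>i<n + m. c i * eval (F i) v) = 0" using c assms(1) by blast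
      then show "(\<Sum>i<n. c i * eval (g i) v) = 0" using split[of v] f(2) v by simp
    qed
    then have c0: "\<forall>i<n. c i = 0" using g(2) unfolding indep_on_def by blast
    let ?p = "\<Sum>j<m. Poly_Mapping.single 0 (c (n + j)) * h j"
    have p: "eval ?p v = (\<Sum>j<m. c (n + j) * eval (h j) v)" for v by (simp add: eval_sum)
    have "?p \<in> forms d" using h(1) by (intro forms_sum forms_scale) auto
    moreover have "\<forall>v\<in>K'. eval f v * eval ?p v = 0" using c split c0 p by simp
    ultimately have "\<forall>v\<in>K'. eval ?p v = 0"
      using assms(2) f(1,3) unfolding prime_cone_def by blast
    then have "\<forall>j<m. c (n + j) = 0" using h(2) p unfolding indep_on_def
      by (elim conjE allE[of _ "\<lambda>j. c (n + j)"]) auto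
    then show "\<forall>i\<in>{..<n + m}. c i = 0" using c0
      by (metis add_diff_inverse_nat lessThan_iff nat_add_left_cancel_less)
  qed simp
  ultimately show ?thesis unfolding hilb_ge_def by blast
qed

definition grows :: "(complex^'n::finite) set \<Rightarrow> nat \<Rightarrow> bool" where
  "grows K k \<longleftrightarrow> (\<exists>c>0. \<exists>d0. \<forall>d\<ge>d0. \<exists>n. hilb_ge K d n \<and> c * real d ^ k \<le> real n)"

definition bounded_growth :: "(complex^'n::finite) set \<Rightarrow> nat \<Rightarrow> bool" where
  "bounded_growth K k \<longleftrightarrow> (\<exists>C. \<forall>d\<ge>1. \<exists>n. hilb_le K d n \<and> real n \<le> C * real d ^ k)"

text \<open>Independent functions cannot outnumber spanning ones, so \<open>c d\<^sup>k \<le> C d\<^sup>l\<close>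
  for all large \<open>d\<close>.\<close>

lemma grows_bounded: 
  assumes "grows K k" "bounded_growth K l" shows "k \<le> l"
proof (rule ccontr)
  assume "\<not> k \<le> l"
  then have kl: "k = Suc (l + (k - l - 1))" by simp
  obtain c d0 where c: "c > 0" "\<forall>d\<ge>d0. \<exists>n. hilb_ge K d n \<and> c * real d ^ k \<le> real n"
    using assms(1) unfolding grows_def by blast
  obtain C where C: "\<forall>d\<ge>1. \<exists>n. hilb_le K d n \<and> real n \<le> C * real d ^ l"
    using assms(2) unfolding bounded_growth_def by blast
  obtain d where d: "real d > C / c" "d \<ge> max 1 d0"
    using reals_Archimedean2[of "max (C / c) (real (max 1 d0))"] by auto
  obtain n where n: "hilb_ge K d n" "c * real d ^ k \<le> real n" using c(2) d(2) by auto
  obtain m where m: "hilb_le K d m" "real m \<le> C * real d ^ l" using C d(2) by auto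
  have "c * real d ^ k \<le> C * real d ^ l" using n m hilb_ge_le[OF n(1) m(1)] by linarith
  moreover have "C * real d ^ l < c * real d ^ k"
  proof -
    have "real d ^ Suc l \<le> real d ^ k" by (rule power_increasing) (use kl d(2) in auto)
    moreover have "C < c * real d" using d(1) c(1) by (simp add: field_simps)
    then have "C * real d ^ l < c * real d * real d ^ l"
      using d(2) by (intro mult_strict_right_mono) auto
    moreover have "c * real d * real d ^ l = c * real d ^ Suc l" by simp
    moreover have "c * real d ^ Suc l \<le> c * real d ^ k"
      by (rule mult_left_mono) (use calculation(1) c(1) in auto)
    ultimately show ?thesis by linarith
  qed
  ultimately show False by simp
qed

lemma eval_form_0:
  assumes "p \<in> forms 0" shows "eval p v = eval p w"
  using eval_scale_form[OF assms, of 0 v] eval_scale_form[OF assms, of 0 w] by simp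

text \<open>Iterating \<open>hilb_ge_step\<close> bounds the Hilbert function of \<open>K\<close> from below by a
  sum of values of the smaller one, which gains one power of \<open>d\<close>.\<close>

lemma grows_step:
  assumes K: "K \<subseteq> K'" "prime_cone K'" "K \<noteq> {}" and f: "f \<in> forms e" "\<forall>v\<in>K. eval f v = 0" "\<exists>v\<in>K'. eval f v \<noteq> 0"
    and g: "grows K k"
  shows "grows K' (Suc k)"
proof -
  have e: "e > 0"
  proof (rule ccontr)
    assume "\<not> e > 0"
    then have "f \<in> forms 0" using f(1) by simp
    then show False using eval_form_0 f(2,3) K(3) by (metis ex_in_conv)
  qed
  obtain c d0 where c: "c > 0" "\<forall>d\<ge>d0. \<exists>n. hilb_ge K d n \<and> c * real d ^ k \<le> real n"
    using g unfolding grows_def by blast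
  have iter: "\<exists>n. hilb_ge K' d n \<and> real j * (c * real D ^ k) \<le> real n"
    if "D \<ge> d0" "d \<ge> D + j * e" for d D j
    using that
  proof (induction j arbitrary: d)
    case 0
    then show ?case using hilb_ge_0[of K' d] by auto
  next
    case (Suc j)
    have "d - e \<ge> D + j * e" using Suc.prems by simp
    then obtain m where m: "hilb_ge K' (d - e) m" "real j * (c * real D ^ k) \<le> real m"
      using Suc by blast
    obtain n where n: "hilb_ge K d n" "c * real d ^ k \<le> real n"
      using c(2) Suc.prems by (meson add_leE le_trans)
    have de: "d - e + e = d" using Suc.prems by simp
    have "hilb_ge K' (d - e + e) (n + m)"
      by (rule hilb_ge_step[OF K(1,2) f]) (use n(1) m(1) de in auto)
    moreover have "real (Suc j) * (c * real D ^ k) \<le> real (n + m)"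
    proof -
      have "real D ^ k \<le> real d ^ k" using Suc.prems by (intro power_mono) auto
      then have "c * real D ^ k \<le> c * real d ^ k" using c(1) by simp
      moreover have "real (Suc j) * (c * real D ^ k) = c * real D ^ k + real j * (c * real D ^ k)"
        by (simp only: of_nat_Suc distrib_right mult_1)
      ultimately show ?thesis using m(2) n(2) by (simp only: of_nat_add)
    qed
    ultimately show ?case using de by auto
  qed
  define c' where "c' = c / (2 ^ k * (8 * real e))"
  have "c' > 0" using c(1) e by (simp add: c'_def)
  moreover have "\<exists>n. hilb_ge K' d n \<and> c' * real d ^ Suc k \<le> real n" if d: "d \<ge> 2 * d0 + 4 * e" for d
  proof -
    define D where "D = d - d div 2"
    define j where "j = (d div 2) div e"
    have "j * e \<le> d div 2" unfolding j_def by simp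
    then have "D \<ge> d0" "d \<ge> D + j * e" using d unfolding D_def by linarith+
    then obtain n where n: "hilb_ge K' d n" "real j * (c * real D ^ k) \<le> real n" using iter by blast
    have D: "real D \<ge> real d / 2" unfolding D_def by linarith
    have "d div 2 = j * e + (d div 2) mod e" unfolding j_def by simp
    moreover have "(d div 2) mod e < e" using e by simp
    ultimately have "d div 2 < j * e + e" by linarith
    moreover have "d div 2 \<ge> 2 * e" using d by linarith
    ultimately have "8 * (j * e) \<ge> d" by linarith
    then have "real (8 * (j * e)) \<ge> real d" by (simp only: of_nat_le_iff)
    then have j: "real j \<ge> real d / (8 * real e)" using e
      by (simp add: pos_divide_le_eq mult.commute mult.left_commute)
    have "c' * real d ^ Suc k = (real d / (8 * real e)) * (c * (real d / 2) ^ k)"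
      by (simp add: c'_def power_divide) (simp only: mult_ac)
    also have "\<dots> \<le> real j * (c * real D ^ k)"
      using j D c(1) e by (intro mult_mono power_mono) auto
    finally show ?thesis using n by auto
  qed
  ultimately show ?thesis unfolding grows_def by blast
qed

text \<open>Along a chain of irreducible closed sets the growth exponent of the Hilbert function increases
  in each step.\<close>

lemma grows_0:
  fixes K :: "(complex^'n::finite) set"
  assumes "v \<in> K" "v \<noteq> 0" shows "grows K 0"
proof -
  obtain i where i: "v $ i \<noteq> 0" using assms(2) by (auto simp: Finite_Cartesian_Product.vec_eq_iff)
  have "hilb_ge K d 1" for d
    unfolding hilb_ge_def indep_on_def
  proof (intro exI[of _ "\<lambda>_. Var i ^ d"] conjI allI impI)
    show "(Var i :: ('n, complex) mpoly) ^ d \<in> forms d" using forms_power[OF forms_Var, of i d] by simp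
    fix c :: "nat \<Rightarrow> complex" assume "\<forall>v\<in>K. (\<Sum>j<1. c j * eval (Var i ^ d) v) = 0"
    then have "c 0 * (v $ i) ^ d = 0" using assms(1) by auto
    then show "\<forall>j\<in>{..<1}. c j = 0" using i by auto
  qed simp
  then show ?thesis unfolding grows_def by (intro exI[of _ 1]) auto
qed

text \<open>Closed sets are zero sets of forms, so that a point outside is detected by one form.\<close>

lemma closed_separating_form:
  assumes "closedin zariski Y" "P \<notin> Y"
  obtains f e v where "f \<in> forms e" "\<forall>v\<in>cone Y. eval f v = 0" "v \<in> hcoords P" "eval f v \<noteq> 0"
proof -
  obtain S where S: "S \<subseteq> (\<Union>d. forms d)" "Y = zeros S" using assms(1) unfolding closedin_zariski by blast
  obtain v where v: "v \<in> hcoords P" using hcoords_nonempty by blast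
  obtain f where f: "f \<in> S" "eval f v \<noteq> 0" using assms(2) zeros_cone[OF S(1) v] S(2) by blast
  moreover obtain e where "f \<in> forms e" using S(1) f(1) by blast
  moreover have "\<forall>v\<in>cone Y. eval f v = 0"
    using S f(1) by (auto simp: cone_def zeros_def vanishes_at_def)
  ultimately show ?thesis using that v by blast
qed

lemma proj_dim_le:
  assumes "closedin zariski Y" "bounded_growth (cone Y) k"
  shows "proj_dim Y \<le> real k"
  unfolding proj_dim_def krull_dim_def
proof (rule Sup_least, clarify)
  fix n Z
  assume Z: "\<forall>i\<le>n. closedin (subtopology zariski Y) (Z i) \<and>
      irreducible_space (subtopology (subtopology zariski Y) (Z i))" "\<forall>i<n. Z i \<subset> Z (Suc i)"
  have Zc: "closedin zariski (Z i)" "Z i \<subseteq> Y" if "i \<le> n" for i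
    using Z(1) that assms(1) by (meson closedin_trans_full, meson closedin_imp_subset)
  have Zi: "Z i \<noteq> {}" "prime_cone (cone (Z i))" if "i \<le> n" for i
    using Z(1) that Zc(2)[OF that] irreducible_space_iff[of "Z i"]
    by (auto simp: subtopology_subtopology Int_absorb1)
  have g: "grows (cone (Z i)) i" if "i \<le> n" for i
    using that
  proof (induction i)
    case 0
    then obtain P v where "P \<in> Z 0" "v \<in> hcoords P" using Zi(1) hcoords_nonempty by blast
    then show ?case using grows_0[of v "cone (Z 0)"] hcoords_nonzero by (auto simp: cone_def)
  next
    case (Suc i)
    then have i: "i \<le> n" "i < n" by auto
    then obtain P where P: "P \<in> Z (Suc i)" "P \<notin> Z i" using Z(2) by blast
    obtain f e v where f: "f \<in> forms e" "\<forall>v\<in>cone (Z i). eval f v = 0" "v \<in> hcoords P" "eval f v \<noteq> 0"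
      using closed_separating_form[OF Zc(1)[OF i(1)] P(2)] .
    have "cone (Z i) \<noteq> {}" using Zi(1)[OF i(1)] hcoords_nonempty by (auto simp: cone_def)
    moreover have "cone (Z i) \<subseteq> cone (Z (Suc i))" using Z(2) i(2) by (intro cone_mono) auto
    moreover have "v \<in> cone (Z (Suc i))" using P(1) f(3) by (auto simp: cone_def)
    ultimately show ?case using grows_step[OF _ Zi(2)[OF Suc.prems] _ f(1,2)] f(4) Suc.IH[OF i(1)] by blast
  qed
  have "bounded_growth (cone (Z n)) k"
  proof -
    have "hilb_le (cone (Z n)) d m" if "hilb_le (cone Y) d m" for d m
      using that cone_mono[OF Zc(2)[of n]] unfolding hilb_le_def combination_on_def by (meson order_refl subsetD)
    then show ?thesis using assms(2) unfolding bounded_growth_def by meson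
  qed
  then show "ereal (real n) \<le> ereal (real k)" using grows_bounded[OF g[of n]] by auto
qed

lemma proj_dim_ge:
  assumes "\<And>i. i \<le> n \<Longrightarrow> closedin zariski (Z i) \<and> Z i \<subseteq> Y \<and> irreducible_space (subtopology zariski (Z i))"
    "\<And>i. i < n \<Longrightarrow> Z i \<subset> Z (Suc i)"
  shows "proj_dim Y \<ge> real n"
  unfolding proj_dim_def krull_dim_def
proof (rule Sup_upper, intro CollectI exI conjI allI impI)
  show "ereal (real n) = ereal (real n)" ..
  fix i assume "i \<le> n"
  then show "closedin (subtopology zariski Y) (Z i)" 
    "irreducible_space (subtopology (subtopology zariski Y) (Z i))"
    using assms(1)[of i] by (auto simp: subtopology_subtopology Int_absorb1 closedin_subset_topspace)
qed (use assms(2) in auto)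

text \<open>A form that vanishes on a set also vanishes on its closure, so that primality passes to the closure.\<close>

lemma form_vanishes_closure:
  assumes "p \<in> forms d" "\<forall>v\<in>cone Z. eval p v = 0"
  shows "\<forall>v\<in>cone (zariski closure_of Z). eval p v = 0"
proof -
  have "Z \<subseteq> zeros {p}"
    using assms(2) by (auto simp: zeros_def vanishes_at_def cone_def)
  moreover have "closedin zariski (zeros {p})"
    unfolding closedin_zariski by (intro exI[of _ "{p}"]) (use assms in auto)
  ultimately have "zariski closure_of Z \<subseteq> zeros {p}" by (rule closure_of_minimal)
  then show ?thesis by (auto simp: zeros_def vanishes_at_def cone_def)
qed

lemma subset_closure_zariski: "Z \<subseteq> zariski closure_of Z"
  by (simp add: closure_of_subset)

lemma irreducible_closure:
  assumes "Z \<noteq> {}" "prime_cone (cone Z)"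
  shows "irreducible_space (subtopology zariski (zariski closure_of Z))"
  unfolding irreducible_space_iff prime_cone_def
proof (intro conjI allI ballI impI)
  show "zariski closure_of Z \<noteq> {}" using assms(1) subset_closure_zariski by blast
  fix a b and p q :: "('a, complex) mpoly"
  assume pq: "p \<in> forms a" "q \<in> forms b" "\<forall>v\<in>cone (zariski closure_of Z). eval p v * eval q v = 0"
  then have "\<forall>v\<in>cone Z. eval p v * eval q v = 0" using cone_mono[OF subset_closure_zariski] by blast
  then have "(\<forall>v\<in>cone Z. eval p v = 0) \<or> (\<forall>v\<in>cone Z. eval q v = 0)"
    using assms(2) pq unfolding prime_cone_def by blast
  then show "(\<forall>v\<in>cone (zariski closure_of Z). eval p v = 0) \<or> (\<forall>v\<in>cone (zariski closure_of Z). eval q v = 0)"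
    using form_vanishes_closure pq(1,2) by blast
qed

section \<open>Brackets and Pluecker coordinates\<close>

text \<open>The determinant with columns \<open>u, v, w\<close>, expanded along the first one.\<close>

definition br :: "complex^3 \<Rightarrow> complex^3 \<Rightarrow> complex^3 \<Rightarrow> complex" where
  "br u v w = u$1 * (v$2 * w$3 - v$3 * w$2) - u$2 * (v$1 * w$3 - v$3 * w$1)
     + u$3 * (v$1 * w$2 - v$2 * w$1)"

lemma det_columns: "det (transpose (vector [u, v, w] :: complex^3^3)) = br u v w"
  by (simp add: det_3 br_def transpose_def algebra_simps)

lemma br_same [simp]: "br u u w = 0" "br u w u = 0" "br w u u = 0"
  by (simp_all add: br_def algebra_simps)

lemma br_swap: "br v u w = - br u v w" "br u w v = - br u v w" "br w v u = - br u v w"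
  by (simp_all add: br_def algebra_simps)

lemma br_rotate: "br v w u = br u v w" "br w u v = br u v w"
  by (simp_all add: br_def algebra_simps)

lemma br_linear:
  "br (u + u') v w = br u v w + br u' v w" "br u (v + v') w = br u v w + br u v' w"
  "br u v (w + w') = br u v w + br u v w'"
  "br (c *s u) v w = c * br u v w" "br u (c *s v) w = c * br u v w" "br u v (c *s w) = c * br u v w"
  by (simp_all add: br_def algebra_simps)

lemma br_0 [simp]: "br 0 v w = 0" "br u 0 w = 0" "br u v 0 = 0"
  by (simp_all add: br_def)

text \<open>Cramer's rule: a vector is a combination of three others, with brackets as coefficients.\<close>

lemma cramer: "br a b c *s v = br v b c *s a + br a v c *s b + br a b v *s c"
  unfolding Finite_Cartesian_Product.vec_eq_iff forall_3
  by (simp add: br_def algebra_simps)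

lemma br_exchange:
  "br a b c * br u v w = br u b c * br a v w + br a u c * br b v w + br a b u * br c v w"
  by (simp add: br_def) algebra

lemma indices_triple:
  "1 \<le> i \<Longrightarrow> i < j \<Longrightarrow> j < k \<Longrightarrow> k \<le> 6 \<Longrightarrow> indices (triple (i, j, k)) = (i, j, k)"
  by (rule triple_inverse) simp

lemma indices_bounds:
  assumes "indices t = (i, j, k)" shows "1 \<le> i" "i < j" "j < k" "k \<le> 6"
  using indices[of t] assms by auto

lemma triple_eqI: "indices s = indices t \<Longrightarrow> s = t"
  by (simp add: indices_inject)

definition plk :: "(nat \<Rightarrow> complex^3) \<Rightarrow> complex^triple" where
  "plk V = (\<chi> t. case indices t of (i, j, k) \<Rightarrow> br (V i) (V j) (V k))"

lemma plk_triple: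
  "1 \<le> i \<Longrightarrow> i < j \<Longrightarrow> j < k \<Longrightarrow> k \<le> 6 \<Longrightarrow> plk V $ triple (i, j, k) = br (V i) (V j) (V k)"
  by (simp add: plk_def indices_triple)

lemma minors_plk: "minors M = plk (\<lambda>i. column (of_nat i) M)"
  unfolding minors_def plk_def det_columns ..

definition num6 :: "6 \<Rightarrow> nat" where
  "num6 c = (if c = 1 then 1 else if c = 2 then 2 else if c = 3 then 3 else if c = 4 then 4
     else if c = 5 then 5 else 6)"

lemma num6_of_nat: "1 \<le> i \<Longrightarrow> i \<le> 6 \<Longrightarrow> num6 (of_nat i) = i"
proof -
  assume "1 \<le> i" "i \<le> 6"
  then have "i = 1 \<or> i = 2 \<or> i = 3 \<or> i = 4 \<or> i = 5 \<or> i = 6" by auto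
  then show ?thesis by (auto simp: num6_def)
qed

lemma forall_6_nat: "(\<forall>i::6. P i) \<longleftrightarrow> (\<forall>i\<in>{1..6::nat}. P (of_nat i))"
proof
  assume *: "\<forall>i\<in>{1..6::nat}. P (of_nat i)"
  show "\<forall>i::6. P i"
  proof
    fix i :: 6
    have "i \<in> {1,2,3,4,5,6}"
    proof (cases i rule: bit0_cases)
      case (of_int z)
      then have "z = 0 \<or> z = 1 \<or> z = 2 \<or> z = 3 \<or> z = 4 \<or> z = 5" by auto
      then show ?thesis using of_int by auto
    qed
    then show "P i" using *[rule_format, of 1] *[rule_format, of 2] *[rule_format, of 3]
        *[rule_format, of 4] *[rule_format, of 5] *[rule_format, of 6] by auto
  qed
qed auto

lemma plk_minors: "\<exists>M. plk V = minors M"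
proof
  show "plk V = minors (\<chi> r c. V (num6 c) $ r)"
    unfolding minors_plk
  proof (simp add: plk_def Finite_Cartesian_Product.vec_eq_iff, intro allI)
    fix t
    obtain i j k where t: "indices t = (i, j, k)" by (metis prod_cases3)
    note b = indices_bounds[OF t]
    have "V l = column (of_nat l) (\<chi> r c. V (num6 c) $ r)" if "1 \<le> l" "l \<le> 6" for l
      using that by (simp add: column_def Finite_Cartesian_Product.vec_eq_iff num6_of_nat)
    then show "(case indices t of (i, j, k) \<Rightarrow> br (V i) (V j) (V k)) = (case indices t of (i, j, k) \<Rightarrow>
        br (column (of_nat i) (\<chi> r c. V (num6 c) $ r)) (column (of_nat j) (\<chi> r c. V (num6 c) $ r))
          (column (of_nat k) (\<chi> r c. V (num6 c) $ r)))"
      using b unfolding t by simp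
  qed
qed

lemma rank_3_of_minor:
  fixes M :: "complex^6^3"
  assumes "minors M \<noteq> 0" shows "rank M = 3"
proof -
  obtain t where t: "minors M $ t \<noteq> 0" using assms by (auto simp: Finite_Cartesian_Product.vec_eq_iff)
  obtain i j k where ijk: "indices t = (i, j, k)" by (metis prod_cases3)
  define a b c where "a = column (of_nat i) M" and "b = column (of_nat j) M" and "c = column (of_nat k) M"
  have n: "br a b c \<noteq> 0" using t unfolding minors_plk plk_def a_def b_def c_def by (simp add: ijk)
  have zero: "g r = 0" if g: "(\<Sum>r\<in>UNIV. g r *s row r M) = 0" for g r
  proof -
    have "g 1 * column (of_nat l) M $ 1 + g 2 * column (of_nat l) M $ 2 + g 3 * column (of_nat l) M $ 3 = 0" for l
    proof -
      have "(\<Sum>r\<in>UNIV. g r *s row r M) $ of_nat l = 0" using g by simp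
      then show ?thesis by (simp add: sum_3 row_def column_def)
    qed
    then have "g 1 * a $ 1 + g 2 * a $ 2 + g 3 * a $ 3 = 0" "g 1 * b $ 1 + g 2 * b $ 2 + g 3 * b $ 3 = 0"
      "g 1 * c $ 1 + g 2 * c $ 2 + g 3 * c $ 3 = 0" unfolding a_def b_def c_def by blast+
    then have "g 1 * br a b c = 0" "g 2 * br a b c = 0" "g 3 * br a b c = 0" unfolding br_def by algebra+
    then have "g 1 = 0" "g 2 = 0" "g 3 = 0" using n by auto
    then show ?thesis using exhaust_3[of r] by auto
  qed
  have inj: "inj (\<lambda>r. row r M)"
  proof (rule injI, rule ccontr)
    fix r s assume rs: "row r M = row s M" "r \<noteq> s"
    have "(\<Sum>q\<in>UNIV. (if q = r then 1 else if q = s then -1 else 0) *s row q M)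
        = (\<Sum>q\<in>{r, s}. (if q = r then 1 else if q = s then -1 else 0) *s row q M)"
      by (rule sum.mono_neutral_right) auto
    also have "\<dots> = 0" using rs by simp
    finally have "(if r = r then 1 else if r = s then -1 else 0 :: complex) = 0"
      using zero[of "\<lambda>q. if q = r then 1 else if q = s then -1 else 0" r] by blast
    then show False by simp
  qed
  have rows: "rows M = range (\<lambda>r. row r M)" by (auto simp: rows_def)
  have "vec.independent (rows M)"
  proof (rule vec.independent_if_scalars_zero)
    show "finite (rows M)" by (simp add: rows)
    fix u x assume u: "(\<Sum>x\<in>rows M. u x *s x) = 0" and x: "x \<in> rows M"
    then have "(\<Sum>r\<in>UNIV. u (row r M) *s row r M) = 0" by (simp add: rows sum.reindex[OF inj])
    then show "u x = 0" using zero[of "\<lambda>r. u (row r M)"] x by (auto simp: rows)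
  qed
  then have "vec.dim (rows M) = card (rows M)" by (rule vec.dim_eq_card_independent)
  then show ?thesis unfolding row_rank_def_gen rows card_image[OF inj] by simp
qed

lemma cone_Gr36: "cone Gr36 = {plk V | V. plk V \<noteq> 0}"
proof (intro set_eqI iffI)
  fix x assume "x \<in> cone Gr36"
  then obtain P M where P: "x \<in> hcoords P" "minors M \<in> hcoords P" by (auto simp: cone_def Gr36_def)
  then obtain c where c: "x = c *s minors M" "c \<noteq> 0" using hcoords_ray[OF P(2)] by auto
  define V where "V i = (\<chi> r. if r = 1 then c * column (of_nat i) M $ r else column (of_nat i) M $ r)" for i
  have one: "(2::3) \<noteq> 1" "(3::3) \<noteq> 1" by auto
  have "x = plk V" unfolding c(1) minors_plk
    by (simp add: Finite_Cartesian_Product.vec_eq_iff plk_def split: prod.split)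
      (simp add: br_def V_def one algebra_simps)
  then show "x \<in> {plk V | V. plk V \<noteq> 0}" using hcoords_nonzero[OF P(1)] by auto
next
  fix x assume "x \<in> {plk V | V. plk V \<noteq> 0}"
  then obtain V where V: "x = plk V" "plk V \<noteq> 0" by blast
  obtain M where M: "x = minors M" using plk_minors[of V] V by auto
  obtain P where P: "x \<in> hcoords P" using hcoords_ex[of x] V by auto
  have "rank M = 3" using rank_3_of_minor[of M] M V by auto
  then have "P \<in> Gr36" unfolding Gr36_def using M P by blast
  then show "x \<in> cone Gr36" using P by (auto simp: cone_def)
qed

lemma Gr36_iff: "v \<in> hcoords P \<Longrightarrow> P \<in> Gr36 \<longleftrightarrow> v \<in> {plk V | V. plk V \<noteq> 0}"
  unfolding cone_Gr36[symmetric] cone_def using hcoords_unique by blast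

text \<open>Pencils of configurations are rational curves, so the Grassmannian is irreducible.\<close>

lemma polynomial_fun_plk:
  assumes "\<And>i r. 1 \<le> i \<Longrightarrow> i \<le> 6 \<Longrightarrow> polynomial_fun (\<lambda>t. V t i $ r)"
  shows "polynomial_fun (\<lambda>t. plk (V t) $ s)"
proof -
  obtain i j k where s: "indices s = (i, j, k)" by (metis prod_cases3)
  note b = indices_bounds[OF s]
  have "polynomial_fun (\<lambda>t. V t i $ r)" "polynomial_fun (\<lambda>t. V t j $ r)" "polynomial_fun (\<lambda>t. V t k $ r)" for r
    using assms b by auto
  then have "polynomial_fun (\<lambda>t. br (V t i) (V t j) (V t k))"
    unfolding br_def by (intro polynomial_fun_add polynomial_fun_diff polynomial_fun_mult)
  then show ?thesis by (simp add: plk_def s)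
qed

lemma finite_vec_zeros:
  fixes g :: "complex \<Rightarrow> complex^'n::finite"
  assumes "\<And>i. polynomial_fun (\<lambda>t. g t $ i)" "g a \<noteq> 0"
  shows "finite {t. g t = 0}"
proof -
  obtain i where "g a $ i \<noteq> 0" using assms(2) by (auto simp: Finite_Cartesian_Product.vec_eq_iff)
  then have "finite {t. g t $ i = 0}" by (intro polynomial_fun_finite_zeros[of _ a] assms(1))
  then show ?thesis by (rule rev_finite_subset) auto
qed

lemma plk_cong: "(\<And>i. 1 \<le> i \<Longrightarrow> i \<le> 6 \<Longrightarrow> V i = W i) \<Longrightarrow> plk V = plk W"
proof -
  assume *: "\<And>i. 1 \<le> i \<Longrightarrow> i \<le> 6 \<Longrightarrow> V i = W i"
  have "plk V $ t = plk W $ t" for t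
  proof -
    obtain i j k where t: "indices t = (i, j, k)" by (metis prod_cases3)
    then show ?thesis using indices_bounds[OF t] * by (simp add: plk_def t)
  qed
  then show ?thesis by (simp add: Finite_Cartesian_Product.vec_eq_iff)
qed

text \<open>Two members of a linear family of configurations are joined by a line, whose Pluecker coordinates are
  polynomials in the parameter; \<open>prime_cone_curves\<close> applies to it.\<close>

lemma prime_cone_linear_family:
  assumes "\<And>V W t. V \<in> L \<Longrightarrow> W \<in> L \<Longrightarrow> (\<lambda>i. V i + t *s (W i - V i)) \<in> L"
  shows "prime_cone {plk V | V. V \<in> L \<and> plk V \<noteq> 0}"
proof (rule prime_cone_curves)
  fix x y assume "x \<in> {plk V | V. V \<in> L \<and> plk V \<noteq> 0}" "y \<in> {plk V | V. V \<in> L \<and> plk V \<noteq> 0}"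
  then obtain V W where V: "x = plk V" "V \<in> L" "plk V \<noteq> 0" and W: "y = plk W" "W \<in> L" "plk W \<noteq> 0"
    by blast
  define g where "g t = plk (\<lambda>i. V i + t *s (W i - V i))" for t
  have g: "polynomial_fun (\<lambda>t. g t $ s)" for s
    unfolding g_def by (intro polynomial_fun_plk) 
      (auto intro!: polynomial_fun_add polynomial_fun_mult)
  have "g 0 = x" "g 1 = y" by (simp_all add: g_def V W)
  moreover have "finite {t. g t = 0}" by (rule finite_vec_zeros[OF g, of 0]) (simp add: calculation V)
  then have "finite {t. g t \<notin> {plk V | V. V \<in> L \<and> plk V \<noteq> 0}}"
    by (rule rev_finite_subset) (use assms[OF V(2) W(2)] in \<open>auto simp: g_def\<close>)
  ultimately show "\<exists>g. (\<forall>i. polynomial_fun (\<lambda>t. g t $ i)) \<and> g 0 = x \<and> g 1 = y \<and>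
      finite {t. g t \<notin> {plk V | V. V \<in> L \<and> plk V \<noteq> 0}}"
    using g by blast
qed

lemma prime_cone_Gr36: "prime_cone (cone Gr36)"
  using prime_cone_linear_family[of UNIV] unfolding cone_Gr36 by simp

section \<open>The weak Nullstellensatz\<close>

lemma exists_maximal_ideal:
  fixes G :: "'a::comm_ring_1 set"
  assumes "1 \<notin> ideal.span G"
  obtains M where "ideal.subspace M" "G \<subseteq> M" "1 \<notin> M"
    "\<forall>p. p \<notin> M \<longrightarrow> (\<exists>k. k * p - 1 \<in> M)"
proof -
  let ?A = "{I. ideal.subspace I \<and> G \<subseteq> I \<and> 1 \<notin> I}"
  have "\<exists>M\<in>?A. \<forall>X\<in>?A. M \<subseteq> X \<longrightarrow> X = M"
  proof (rule subset_Zorn_nonempty)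
    show "?A \<noteq> {}" using assms ideal.subspace_span ideal.span_superset by blast
    fix \<C> assume ne: "\<C> \<noteq> {}" and ch: "subset.chain ?A \<C>"
    have sub: "I \<in> ?A" if "I \<in> \<C>" for I using ch that by (auto simp: subset.chain_def)
    have tot: "I \<subseteq> J \<or> J \<subseteq> I" if "I \<in> \<C>" "J \<in> \<C>" for I J
      using ch that by (auto simp: subset.chain_def)
    have "ideal.subspace (\<Union>\<C>)" unfolding ideal.subspace_def
    proof (intro conjI ballI allI)
      obtain I where "I \<in> \<C>" using ne by blast
      then show "0 \<in> \<Union>\<C>" using sub ideal.subspace_0 by blast
    next
      fix x y assume "x \<in> \<Union>\<C>" "y \<in> \<Union>\<C>"
      then obtain I J where "I \<in> \<C>" "x \<in> I" "J \<in> \<C>" "y \<in> J" by blast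
      then obtain K where "K \<in> \<C>" "x \<in> K" "y \<in> K" using tot by blast
      then show "x + y \<in> \<Union>\<C>" using sub ideal.subspace_add by blast
    next
      fix c x assume "x \<in> \<Union>\<C>"
      then obtain I where "I \<in> \<C>" "x \<in> I" by blast
      then show "c * x \<in> \<Union>\<C>" using sub ideal.subspace_scale by blast
    qed
    moreover obtain I where "I \<in> \<C>" using ne by blast
    then have "G \<subseteq> \<Union>\<C>" using sub[of I] by auto
    moreover have "1 \<notin> \<Union>\<C>" using sub by auto
    ultimately show "\<Union>\<C> \<in> ?A" by simp
  qed
  then obtain M where M0: "M \<in> ?A" and max: "\<forall>X\<in>?A. M \<subseteq> X \<longrightarrow> X = M" ..
  from M0 have M: "ideal.subspace M" "G \<subseteq> M" "1 \<notin> M" by simp_all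
  have "\<exists>k. k * p - 1 \<in> M" if "p \<notin> M" for p
  proof -
    let ?X = "ideal.span (insert p M)"
    have X: "p \<in> ?X" "M \<subseteq> ?X" by (auto intro: ideal.span_base)
    have "1 \<in> ?X"
    proof (rule ccontr)
      assume "1 \<notin> ?X"
      then have "?X \<in> ?A" using X(2) M(2) by (auto intro: ideal.subspace_span)
      then have "?X = M" using max X(2) by metis
      then show False using X(1) that by simp
    qed
    then obtain k where "1 - k * p \<in> ideal.span M" unfolding ideal.span_insert by blast
    then have "1 - k * p \<in> M" using M(1) ideal.span_eq_iff by blast
    then have "- (1 - k * p) \<in> M" by (rule ideal.subspace_neg[OF M(1)])
    then show ?thesis by auto
  qed
  then show ?thesis using that M by blast
qed

abbreviation (input) Const :: "complex \<Rightarrow> ('n::finite, complex) mpoly" where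
  "Const c \<equiv> Poly_Mapping.single 0 c"

lemma Const_simps: "Const (a + b) = Const a + Const b" "Const (a * b) = Const a * Const b" "Const 0 = 0" "Const 1 = 1"
  by (simp_all add: single_add mult_single)

definition subst :: "('n::finite, complex) mpoly \<Rightarrow> complex poly \<Rightarrow> ('n, complex) mpoly" where
  "subst z p = poly (map_poly (Poly_Mapping.single 0) p) z"

lemma subst_pCons: "subst z (pCons a p) = Const a + z * subst z p"
  by (simp add: subst_def map_poly_pCons)

lemma subst_0 [simp]: "subst z 0 = 0" by (simp add: subst_def)

lemma subst_add: "subst z (p + q) = subst z p + subst z q"
  by (induction p q rule: poly_induct2) (simp_all add: subst_pCons Const_simps algebra_simps)

lemma subst_smult: "subst z (smult a p) = Const a * subst z p"
  by (induction p) (simp_all add: subst_pCons Const_simps(2) algebra_simps)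

lemma subst_mult: "subst z (p * q) = subst z p * subst z q"
  by (induction p) (simp_all add: subst_pCons subst_add subst_smult Const_simps(3) algebra_simps)

lemma subst_linear: "subst z [:- c, 1:] = z - Const c"
  by (simp add: subst_pCons Const_simps(4) single_uminus)

lemma subst_1: "subst z 1 = 1"
  by (simp add: one_pCons subst_pCons Const_simps(4))

lemma subst_sum: "subst z (sum f A) = (\<Sum>a\<in>A. subst z (f a))"
  by (induction A rule: infinite_finite_induct) (simp_all add: subst_add)

lemma subst_prod: "subst z (prod f A) = (\<Prod>a\<in>A. subst z (f a))"
  by (induction A rule: infinite_finite_induct) (simp_all add: subst_mult subst_1)

lemma subst_in_prime:
  fixes M :: "('n::finite, complex) mpoly set"
  assumes M: "ideal.subspace M" "1 \<notin> M" and prime: "\<And>p q. p * q \<in> M \<Longrightarrow> p \<in> M \<or> q \<in> M"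
    and p: "p \<noteq> 0" "subst z p \<in> M"
  shows "\<exists>c. z - Const c \<in> M"
  using p
proof (induction "degree p" arbitrary: p rule: less_induct)
  case less
  show ?case
  proof (cases "degree p = 0")
    case True
    then obtain a where a: "p = [:a:]" by (metis degree_eq_zeroE)
    then have "Const (inverse a) * Const a \<in> M"
      using less.prems(2) ideal.subspace_scale[OF M(1)] by (simp add: subst_pCons Const_simps)
    moreover have "a \<noteq> 0" using a less.prems(1) by auto
    ultimately show ?thesis using M(2) by (simp add: mult_single)
  next
    case False
    then have "\<not> constant (poly p)" by (simp add: constant_degree)
    from fundamental_theorem_of_algebra[OF this] obtain c where "poly p c = 0" ..
    then obtain q where q: "p = [:- c, 1:] * q" using poly_eq_0_iff_dvd by (metis dvdE)
    have "(z - Const c) * subst z q \<in> M" using less.prems(2) unfolding q subst_mult subst_linear .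
    then have "z - Const c \<in> M \<or> subst z q \<in> M" by (rule prime)
    moreover have "q \<noteq> 0" using less.prems(1) q by auto
    moreover have "degree q < degree p" unfolding q using \<open>q \<noteq> 0\<close> by (subst degree_mult_eq) auto
    ultimately show ?thesis using less.hyps by blast
  qed
qed

lemma finite_bounded_exponents: "finite {m :: 'n::finite \<Rightarrow>\<^sub>0 nat. \<forall>i. Poly_Mapping.lookup m i \<le> N}"
proof (rule finite_imageD)
  show "finite (Poly_Mapping.lookup ` {m :: 'n \<Rightarrow>\<^sub>0 nat. \<forall>i. Poly_Mapping.lookup m i \<le> N})"
  proof (rule finite_subset)
    show "Poly_Mapping.lookup ` {m :: 'n \<Rightarrow>\<^sub>0 nat. \<forall>i. Poly_Mapping.lookup m i \<le> N} \<subseteq> (UNIV :: 'n set) \<rightarrow>\<^sub>E {..N}"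
      by auto
    show "finite ((UNIV :: 'n set) \<rightarrow>\<^sub>E {..N})" by (intro finite_PiE) auto
  qed
  show "inj_on Poly_Mapping.lookup {m :: 'n \<Rightarrow>\<^sub>0 nat. \<forall>i. Poly_Mapping.lookup m i \<le> N}"
    by (rule inj_onI) (simp add: poly_mapping_eqI)
qed

lemma exponents_bound: "\<exists>N. \<forall>m\<in>Poly_Mapping.keys (p :: ('n::finite, complex) mpoly). \<forall>i. Poly_Mapping.lookup m i \<le> N"
proof -
  let ?S = "(\<lambda>(m, i). Poly_Mapping.lookup m i) ` (Poly_Mapping.keys p \<times> UNIV)"
  have "finite ?S" by auto
  then have "\<forall>m\<in>Poly_Mapping.keys p. \<forall>i. Poly_Mapping.lookup m i \<le> Max (insert 0 ?S)"
    by (auto intro!: Max_ge)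
  then show ?thesis by blast
qed

lemma mpoly_as_sum: "p = (\<Sum>m\<in>Poly_Mapping.keys p. Poly_Mapping.single m (Poly_Mapping.lookup p m))"
proof (rule poly_mapping_eqI)
  fix k
  have "Poly_Mapping.lookup (\<Sum>m\<in>Poly_Mapping.keys p. Poly_Mapping.single m (Poly_Mapping.lookup p m)) k
      = (\<Sum>m\<in>Poly_Mapping.keys p. if m = k then Poly_Mapping.lookup p m else 0)"
    by (simp add: lookup_sum lookup_single when_def)
  then show "Poly_Mapping.lookup p k = Poly_Mapping.lookup
      (\<Sum>m\<in>Poly_Mapping.keys p. Poly_Mapping.single m (Poly_Mapping.lookup p m)) k"
    by (simp add: in_keys_iff)
qed

lemma prod_single: "(\<Prod>i\<in>A. Poly_Mapping.single (f i) (1::complex)) = Poly_Mapping.single (\<Sum>i\<in>A. f i) 1"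
  by (induction A rule: infinite_finite_induct) (simp_all add: mult_single)

lemma single_eq_prod_Var:
  "Poly_Mapping.single m c = Const c * (\<Prod>i\<in>(UNIV::'n::finite set). Var i ^ Poly_Mapping.lookup m i)"
proof -
  have p: "Var i ^ k = Poly_Mapping.single (Poly_Mapping.single i k) (1::complex)" for i :: 'n and k
    by (induction k) (simp_all add: Var_def mult_single single_add[symmetric])
  have "(\<Sum>i\<in>(UNIV::'n set). Poly_Mapping.single i (Poly_Mapping.lookup m i)) = m"
    by (rule poly_mapping_eqI) (simp add: lookup_sum lookup_single when_def)
  then show ?thesis unfolding p prod_single by (simp add: mult_single)
qed

text \<open>The complex numbers are uncountable, but there are only countably many monomials; so modulo a
  maximal ideal, a variable cannot be transcendental over the constants.\<close>

lemma variable_mod_maximal: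
  fixes M :: "('n::finite, complex) mpoly set"
  assumes M: "ideal.subspace M" "1 \<notin> M" and max: "\<And>p. p \<notin> M \<Longrightarrow> \<exists>k. k * p - 1 \<in> M"
  shows "\<exists>c. z - Const c \<in> M"
proof (rule ccontr)
  assume no: "\<not> ?thesis"
  note sub = ideal.subspace_add[OF M(1)] ideal.subspace_scale[OF M(1)] ideal.subspace_diff[OF M(1)]
  have prime: "p \<in> M \<or> q \<in> M" if "p * q \<in> M" for p q
  proof (rule disjCI)
    assume "q \<notin> M"
    then obtain k where "k * q - 1 \<in> M" using max by blast
    then have "p * (k * q - 1) \<in> M" "k * (p * q) \<in> M" using sub that by blast+
    then have "k * (p * q) - p * (k * q - 1) \<in> M" using sub(3) by blast
    then show "p \<in> M" by (simp add: algebra_simps)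
  qed
  have "\<forall>c. \<exists>k. k * (z - Const c) - 1 \<in> M" using max no by blast
  then obtain g where g: "\<And>c. g c * (z - Const c) - 1 \<in> M" by metis
  have g_inj: "inj g"
  proof (rule injI, rule ccontr)
    fix a b assume ab: "g a = g b" "a \<noteq> b"
    have "(g a * (z - Const a) - 1) - (g a * (z - Const b) - 1) \<in> M"
      using sub(3)[OF g[of a] g[of b]] ab(1) by simp
    then have "g a * (Const b - Const a) \<in> M" by (simp add: algebra_simps)
    moreover have "Const b - Const a = Const (b - a)" by (simp add: single_diff)
    ultimately have "Const (inverse (b - a)) * (g a * Const (b - a)) \<in> M" using sub(2) by metis
    moreover have "Const (inverse (b - a)) * (g a * Const (b - a)) = g a * (Const (inverse (b - a)) * Const (b - a))"
      by (simp only: mult.left_commute)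
    moreover have "Const (inverse (b - a)) * Const (b - a) = (1 :: ('n, complex) mpoly)"
      using ab(2) by (simp add: mult_single)
    ultimately have "g a \<in> M" by simp
    then have "(z - Const a) * g a - (g a * (z - Const a) - 1) \<in> M" using sub g by blast
    then show False using M(2) by (simp add: mult.commute)
  qed
  let ?mon = "\<lambda>N. {m :: 'n \<Rightarrow>\<^sub>0 nat. \<forall>i. Poly_Mapping.lookup m i \<le> N}"
  have "\<exists>N. infinite {c. Poly_Mapping.keys (g c) \<subseteq> ?mon N}"
  proof (rule ccontr)
    assume "\<not> ?thesis"
    then have "countable (\<Union>N. {c. Poly_Mapping.keys (g c) \<subseteq> ?mon N})"
      by (intro countable_UN) (auto intro: countable_finite)
    moreover have "UNIV = (\<Union>N. {c. Poly_Mapping.keys (g c) \<subseteq> ?mon N})"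
    proof (rule UNIV_eq_I, rule UN_I[OF UNIV_I])
      fix c
      let ?N = "SOME N. \<forall>m\<in>Poly_Mapping.keys (g c). \<forall>i. Poly_Mapping.lookup m i \<le> N"
      show "c \<in> {c. Poly_Mapping.keys (g c) \<subseteq> ?mon ?N}"
        using someI_ex[OF exponents_bound[of "g c"]] by blast
    qed
    ultimately show False using uncountable_UNIV_complex by metis
  qed
  then obtain N where N: "infinite {c. Poly_Mapping.keys (g c) \<subseteq> ?mon N}" by blast
  obtain T where T: "T \<subseteq> {c. Poly_Mapping.keys (g c) \<subseteq> ?mon N}" "finite T" "card T = Suc (card (?mon N))"
    using infinite_arbitrarily_large[OF N] by blast
  let ?B = "(\<lambda>m. Poly_Mapping.single m (1::complex)) ` ?mon N"
  have "g c \<in> mpoly.span ?B" if "c \<in> T" for c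
  proof -
    have "Poly_Mapping.single m (Poly_Mapping.lookup (g c) m) \<in> mpoly.span ?B" if "m \<in> Poly_Mapping.keys (g c)" for m
    proof -
      have "m \<in> ?mon N" using T(1) \<open>c \<in> T\<close> that by blast
      then have "Const (Poly_Mapping.lookup (g c) m) * Poly_Mapping.single m 1 \<in> mpoly.span ?B"
        by (intro mpoly.span_scale mpoly.span_base) blast
      then show ?thesis by (simp add: mult_single)
    qed
    then show ?thesis by (subst mpoly_as_sum) (rule mpoly.span_sum)
  qed
  then have sp: "g ` T \<subseteq> mpoly.span ?B" by blast
  have cT: "card (g ` T) = Suc (card (?mon N))" using T(3) card_image[OF inj_on_subset[OF g_inj], of T] by simp
  have "mpoly.dependent (g ` T)"
  proof (rule ccontr)
    assume "\<not> ?thesis"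
    then have "card (g ` T) \<le> card ?B"
      using mpoly.independent_span_bound[OF finite_imageI[OF finite_bounded_exponents] _ sp] by blast
    also have "\<dots> \<le> card (?mon N)" by (rule card_image_le[OF finite_bounded_exponents])
    finally show False using cT by simp
  qed
  then obtain u0 where u0: "\<exists>v\<in>g ` T. u0 v \<noteq> 0" "(\<Sum>v\<in>g ` T. Const (u0 v) * v) = 0"
    using mpoly.dependent_finite[of "g ` T"] T(2) by auto
  define u where "u c = u0 (g c)" for c
  have u: "(\<Sum>c\<in>T. Const (u c) * g c) = 0"
    using u0(2) by (simp add: sum.reindex[OF inj_on_subset[OF g_inj subset_UNIV]] u_def)
  obtain c0 where c0: "c0 \<in> T" "u c0 \<noteq> 0" using u0(1) by (auto simp: u_def)
  define p where "p = (\<Sum>c\<in>T. smult (u c) (\<Prod>d\<in>T - {c}. [:- d, 1:]))"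
  have "poly p c0 = (\<Sum>c\<in>T. u c * (\<Prod>d\<in>T - {c}. c0 - d))"
    by (simp add: p_def poly_sum poly_prod)
  also have "\<dots> = (\<Sum>c\<in>{c0}. u c * (\<Prod>d\<in>T - {c}. c0 - d))"
  proof (rule sum.mono_neutral_right)
    show "\<forall>c\<in>T - {c0}. u c * (\<Prod>d\<in>T - {c}. c0 - d) = 0" using c0(1) T(2) by auto
  qed (use c0 T(2) in auto)
  also have "\<dots> \<noteq> 0" using c0(2) T(2) by simp
  finally have p0: "p \<noteq> 0" by auto
  have "subst z p \<in> M"
  proof -
    have eq: "subst z p = (\<Sum>c\<in>T. Const (u c) * (\<Prod>d\<in>T - {c}. z - Const d))"
      unfolding p_def subst_sum subst_smult subst_prod subst_linear ..
    have "(\<Sum>c\<in>T. Const (u c) * (\<Prod>d\<in>T - {c}. z - Const d) * (g c * (z - Const c) - 1)) \<in> M"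
      using g sub(2) by (intro ideal.subspace_sum[OF M(1)]) blast
    moreover have "Const (u c) * (\<Prod>d\<in>T - {c}. z - Const d) * (g c * (z - Const c) - 1) =
        (\<Prod>d\<in>T. z - Const d) * (Const (u c) * g c) - Const (u c) * (\<Prod>d\<in>T - {c}. z - Const d)" if "c \<in> T" for c
      unfolding prod.remove[OF T(2) that] by (simp add: algebra_simps)
    ultimately have "(\<Prod>d\<in>T. z - Const d) * (\<Sum>c\<in>T. Const (u c) * g c) - subst z p \<in> M"
      unfolding eq sum_distrib_left sum_subtractf[symmetric] by (simp cong: sum.cong)
    then have "- subst z p \<in> M" unfolding u by simp
    then show ?thesis using ideal.subspace_neg[OF M(1)] by fastforce
  qed
  then show False using subst_in_prime[OF M prime p0] no by blast
qed

text \<open>If \<open>1\<close> is not in the ideal, then modulo a maximal ideal above it each variable is congruent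
  to a constant. These constants form a common zero, because a polynomial is congruent to its value there.\<close>

lemma weak_nullstellensatz:
  fixes G :: "('n::finite, complex) mpoly set"
  assumes "\<And>v. \<exists>g\<in>G. eval g v \<noteq> 0"
  shows "1 \<in> ideal.span G"
proof (rule ccontr)
  assume "1 \<notin> ideal.span G"
  then obtain M where M: "ideal.subspace M" "G \<subseteq> M" "1 \<notin> M" and max: "\<forall>p. p \<notin> M \<longrightarrow> (\<exists>k. k * p - 1 \<in> M)"
    using exists_maximal_ideal[of G] by blast
  note sub = ideal.subspace_add[OF M(1)] ideal.subspace_scale[OF M(1)] ideal.subspace_diff[OF M(1)]
  have "\<forall>i. \<exists>c. Var i - Const c \<in> M" using variable_mod_maximal[OF M(1,3) max[rule_format]] by blast
  then obtain w where w: "\<And>i. Var i - Const (w i) \<in> M" by metis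
  define v where "v = (\<chi> i. w i)"
  define cong where "cong p \<longleftrightarrow> p - Const (eval p v) \<in> M" for p :: "('n, complex) mpoly"
  have cong_add: "cong p \<Longrightarrow> cong q \<Longrightarrow> cong (p + q)" for p q
    using sub(1)[of "p - Const (eval p v)" "q - Const (eval q v)"]
    by (simp add: cong_def eval_add Const_simps(1) algebra_simps)
  have cong_mult: "cong (p * q)" if "cong p" "cong q" for p q
  proof -
    have "q * (p - Const (eval p v)) + Const (eval p v) * (q - Const (eval q v)) \<in> M"
      using that sub unfolding cong_def by blast
    then show ?thesis unfolding cong_def eval_mult Const_simps(2) by (simp add: algebra_simps)
  qed
  have cong_const: "cong (Const c)" for c using ideal.subspace_0[OF M(1)] by (simp add: cong_def eval_single)
  have cong_Var: "cong (Var i)" for i using w by (simp add: cong_def v_def)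
  have cong_power: "cong (Var i ^ k)" for i k
    by (induction k) (use cong_const[of 1] cong_Var cong_mult in \<open>auto simp: Const_simps\<close>)
  have cong_prod: "cong (\<Prod>i\<in>A. Var i ^ f i)" for A f
    by (induction A rule: infinite_finite_induct) (use cong_const[of 1] cong_power cong_mult in \<open>auto simp: Const_simps\<close>)
  have "cong p" for p
  proof (induction p rule: mpoly_induct)
    case zero
    then show ?case using cong_const[of 0] by (simp add: Const_simps)
  next
    case (add_single m c q)
    have "cong (Poly_Mapping.single m c)" by (subst single_eq_prod_Var) (intro cong_mult cong_const cong_prod)
    then show ?case using add_single cong_add by blast
  qed
  obtain g where g: "g \<in> G" "eval g v \<noteq> 0" using assms by blast
  have "g - (g - Const (eval g v)) \<in> M" using \<open>cong g\<close> g(1) M(2) sub(3) unfolding cong_def by blast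
  then have "Const (inverse (eval g v)) * Const (eval g v) \<in> M" using sub(2) by simp
  then show False using g(2) M(3) by (simp add: mult_single)
qed

lemma in_span_image:
  fixes f :: "'i \<Rightarrow> 'a::comm_ring_1"
  assumes "p \<in> ideal.span (f ` I)" "finite I"
  shows "\<exists>b. p = (\<Sum>i\<in>I. b i * f i)"
proof -
  have "ideal.span (f ` I) \<subseteq> {p. \<exists>b. p = (\<Sum>i\<in>I. b i * f i)}"
  proof (rule ideal.span_minimal)
    show "f ` I \<subseteq> {p. \<exists>b. p = (\<Sum>i\<in>I. b i * f i)}"
    proof clarify
      fix i assume "i \<in> I"
      then have "f i = (\<Sum>j\<in>I. (if j = i then 1 else 0) * f j)"
        using assms(2) by (subst sum.mono_neutral_right[of I "{i}"]) auto
      then show "\<exists>b. f i = (\<Sum>j\<in>I. b j * f j)" by (intro exI[of _ "\<lambda>j. if j = i then 1 else 0"])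
    qed
    show "ideal.subspace {p. \<exists>b. p = (\<Sum>i\<in>I. b i * f i)}" unfolding ideal.subspace_def
    proof (intro conjI ballI allI)
      show "0 \<in> {p. \<exists>b. p = (\<Sum>i\<in>I. b i * f i)}" by (intro CollectI exI[of _ "\<lambda>_. 0"]) simp
    next
      fix x y assume "x \<in> {p. \<exists>b. p = (\<Sum>i\<in>I. b i * f i)}" "y \<in> {p. \<exists>b. p = (\<Sum>i\<in>I. b i * f i)}"
      then obtain b c where "x = (\<Sum>i\<in>I. b i * f i)" "y = (\<Sum>i\<in>I. c i * f i)" by blast
      then show "x + y \<in> {p. \<exists>b. p = (\<Sum>i\<in>I. b i * f i)}"
        by (intro CollectI exI[of _ "\<lambda>i. b i + c i"]) (simp add: distrib_right sum.distrib)
    next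
      fix c x assume "x \<in> {p. \<exists>b. p = (\<Sum>i\<in>I. b i * f i)}"
      then obtain b where "x = (\<Sum>i\<in>I. b i * f i)" by blast
      then show "c * x \<in> {p. \<exists>b. p = (\<Sum>i\<in>I. b i * f i)}"
        by (intro CollectI exI[of _ "\<lambda>i. c * b i"]) (simp add: sum_distrib_left mult.assoc)
    qed
  qed
  then show ?thesis using assms(1) by blast
qed

section \<open>Polygons of vectors\<close>

definition crs :: "complex^3 \<Rightarrow> complex^3 \<Rightarrow> complex^3" where
  "crs a b = vector [a$2 * b$3 - a$3 * b$2, a$3 * b$1 - a$1 * b$3, a$1 * b$2 - a$2 * b$1]"

definition dot :: "complex^3 \<Rightarrow> complex^3 \<Rightarrow> complex" where
  "dot a b = a$1 * b$1 + a$2 * b$2 + a$3 * b$3"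

lemma crs_nth [simp]: "crs a b $ 1 = a$2 * b$3 - a$3 * b$2" "crs a b $ 2 = a$3 * b$1 - a$1 * b$3"
  "crs a b $ 3 = a$1 * b$2 - a$2 * b$1"
  by (simp_all add: crs_def)

lemma vec3_eq: "(a :: complex^3) = b \<longleftrightarrow> a$1 = b$1 \<and> a$2 = b$2 \<and> a$3 = b$3"
  by (simp add: Finite_Cartesian_Product.vec_eq_iff forall_3)

text \<open>The bivector \<open>\<Sum> v\<^sub>i \<times> v\<^sub>j\<close> over \<open>i < j\<close>. For a closed
  polygon with edges \<open>v\<^sub>i\<close> it is the area, up to a factor; like \<open>star\<close>
  below it depends on the order of the list, as minors do.\<close>

fun pairs :: "(complex^3) list \<Rightarrow> complex^3" where
  "pairs [] = 0" | "pairs (v # vs) = crs v (sum_list vs) + pairs vs"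

text \<open>The sum of the brackets of all ordered triples of \<open>xs @ v # ys\<close> which contain
  \<open>v\<close>: a derivative of the multilinear cubic, multiplied by its variable.\<close>

definition star :: "(complex^3) list \<Rightarrow> complex^3 \<Rightarrow> (complex^3) list \<Rightarrow> complex" where
  "star xs v ys = dot v (pairs xs) + dot v (pairs ys) - br v (sum_list xs) (sum_list ys)"

lemma pairs_append: "pairs (xs @ ys) = pairs xs + pairs ys + crs (sum_list xs) (sum_list ys)"
  by (induction xs) (simp_all add: vec3_eq algebra_simps)

text \<open>The dependence on the position of \<open>v\<close> is isolated in one bracket of the partial sums before
  and after \<open>v\<close>, that is, of two consecutive vertices of the polygon.\<close>

lemma star_total:
  "star xs v ys = dot v (pairs (xs @ v # ys)) + 2 * br (sum_list (xs @ v # ys)) (sum_list xs) (sum_list xs + v)"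
  by (simp add: star_def pairs_append dot_def br_def algebra_simps)

lemma dot_crs: "dot a (crs b c) = br a b c" "dot (crs a b) c = br a b c"
  by (simp_all add: dot_def br_def algebra_simps)

lemma dot_add: "dot (a + b) c = dot a c + dot b c" "dot a (b + c) = dot a b + dot a c"
  by (simp_all add: dot_def algebra_simps)

lemma dot_zero_of_basis:
  assumes "br u v w \<noteq> 0" "dot u b = 0" "dot v b = 0" "dot w b = 0" shows "b = 0"
proof -
  have "br u v w * b $ 1 = 0" using assms(2-4) unfolding dot_def br_def by algebra
  moreover have "br u v w * b $ 2 = 0" using assms(2-4) unfolding dot_def br_def by algebra
  moreover have "br u v w * b $ 3 = 0" using assms(2-4) unfolding dot_def br_def by algebra
  ultimately show ?thesis using assms(1) by (simp add: vec3_eq)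
qed

text \<open>The cross product with \<open>s\<close> maps onto the orthogonal complement of \<open>s\<close>. This is
  used to move the origin of the polygon such that \<open>pairs\<close> disappears from the critical
  equations.\<close>

lemma crs_solvable:
  assumes "s \<noteq> 0" "dot s b = 0" obtains e where "crs s e = b"
proof -
  have "s $ 1 \<noteq> 0 \<or> s $ 2 \<noteq> 0 \<or> s $ 3 \<noteq> 0" using assms(1) by (auto simp: vec3_eq)
  then consider "s $ 1 \<noteq> 0" | "s $ 2 \<noteq> 0" | "s $ 3 \<noteq> 0" by blast
  then show ?thesis
  proof cases
    case 1
    have "s $ 1 * b $ 1 = - s$2 * b$2 - s$3 * b$3" using assms(2) unfolding dot_def by algebra
    then show ?thesis
      using 1 by (intro that[of "vector [0, b$3 / s$1, - b$2 / s$1]"]) (simp add: vec3_eq field_simps)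
  next
    case 2
    define i where "i = inverse (s $ 2)"
    have i: "i * s $ 2 = 1" using 2 by (simp add: i_def)
    have "s $ 2 * (b$1 * i) = b $ 1" "s $ 3 * (- b$3 * i) - s $ 1 * (b$1 * i) = b $ 2" "- (s $ 2 * (- b$3 * i)) = b $ 3"
      using assms(2) i unfolding dot_def by algebra+
    then show ?thesis by (intro that[of "vector [- b$3 * i, 0, b$1 * i]"]) (simp add: vec3_eq)
  next
    case 3
    have "s $ 3 * b $ 3 = - s$1 * b$1 - s$2 * b$2" using assms(2) unfolding dot_def by algebra
    then show ?thesis
      using 3 by (intro that[of "vector [b$2 / s$3, - b$1 / s$3, 0]"]) (simp add: vec3_eq field_simps)
  qed
qed

text \<open>For \<open>s \<noteq> 0\<close> this means that \<open>x\<close> is a multiple of \<open>s\<close>.\<close>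

definition par :: "complex^3 \<Rightarrow> complex^3 \<Rightarrow> bool" where "par s x \<longleftrightarrow> crs s x = 0"

lemma par_br: "par s x \<Longrightarrow> br s x z = 0" "par s x \<Longrightarrow> br s z x = 0"
  unfolding par_def using dot_crs[of s x z] dot_crs(1)[of z s x] br_rotate[of s x z] br_swap[of s x z]
  by (auto simp: dot_def)

lemma plane_br:
  assumes "\<not> par s p" "br s p x = 0" "br s p z = 0" "br s p w = 0" shows "br x z w = 0"
proof (rule ccontr)
  assume n: "br x z w \<noteq> 0"
  have "crs s p = 0"
    by (rule dot_zero_of_basis[OF n]) (use assms(2-4) in \<open>simp_all add: dot_crs br_rotate\<close>)
  then show False using assms(1) by (simp add: par_def)
qed

lemma plane_trans:
  assumes "\<not> par s p" "br s p x = 0" "br s p z = 0" shows "br s x z = 0"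
  by (rule plane_br[OF assms(1)]) (use assms in simp_all)

lemma par_diff: "par s x \<Longrightarrow> par s z \<Longrightarrow> par s (z - x)"
  unfolding par_def by (simp add: vec3_eq algebra_simps)

lemma par_plane: "par s x \<Longrightarrow> br s z w = 0 \<Longrightarrow> s \<noteq> 0 \<Longrightarrow> br x z w = 0"
proof -
  assume p: "par s x" and b: "br s z w = 0" and s: "s \<noteq> 0"
  have "s $ i *s x = x $ i *s s" for i
    using p exhaust_3[of i] unfolding par_def by (auto simp: vec3_eq algebra_simps)
  then have "s $ i * br x z w = x $ i * br s z w" for i by (metis br_linear(4))
  then have "s $ i * br x z w = 0" for i using b by simp
  moreover obtain i where "s $ i \<noteq> 0" using s by (auto simp: Finite_Cartesian_Product.vec_eq_iff)
  ultimately show ?thesis by (metis mult_eq_0_iff)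
qed

lemma br_diff: "br s x (y - z) = br s x y - br s x z"
  by (simp add: br_def algebra_simps)

text \<open>Consecutive vertices \<open>r\<^sub>0, r\<^sub>1, \<dots>\<close> of a polygon that are pairwise dependent modulo \<open>s\<close>: if no three
  consecutive edges are coplanar, then exactly every other vertex is a multiple of \<open>s\<close>.\<close>

lemma not_both_nonzero:
  assumes "br s r0 r1 = 0" "br s r1 r2 = 0" "br s r2 r3 = 0" "br (r1 - r0) (r2 - r1) (r3 - r2) \<noteq> 0"
  shows "par s r1 \<or> par s r2"
proof (rule ccontr)
  assume "\<not> ?thesis"
  then have n: "\<not> par s r1" "\<not> par s r2" by auto
  have "br s r1 r0 = 0" "br s r1 r1 = 0" "br s r2 r1 = 0" using assms br_swap(2)[of s r0 r1] br_swap(2)[of s r1 r2] by auto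
  moreover have "br s r1 r3 = 0" by (rule plane_trans[OF n(2)]) (use calculation assms in auto)
  ultimately have "br s r1 (r1 - r0) = 0" "br s r1 (r2 - r1) = 0" "br s r1 (r3 - r2) = 0"
    using assms(2) by (simp_all add: br_diff)
  then show False using plane_br[OF n(1)] assms(4) by blast
qed

lemma alternating:
  assumes s: "s \<noteq> 0" and w: "br s r0 r1 = 0" "br s r1 r2 = 0" "br s r2 r3 = 0" "br s r3 r4 = 0"
    and n: "br (r1 - r0) (r2 - r1) (r3 - r2) \<noteq> 0" "br (r2 - r1) (r3 - r2) (r4 - r3) \<noteq> 0"
  shows "par s r1 \<longleftrightarrow> \<not> par s r2"
proof (rule iffI)
  show "\<not> par s r2 \<Longrightarrow> par s r1" using not_both_nonzero[OF w(1-3) n(1)] by blast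
  assume p1: "par s r1"
  show "\<not> par s r2"
  proof
    assume p2: "par s r2"
    have e: "par s (r2 - r1)" by (rule par_diff[OF p1 p2])
    have "br s (r3 - r2) (r4 - r3) = 0"
    proof -
      have "br s (r3 - r2) (r4 - r3) = br s r3 r4 - br s r2 r4 + br s r2 r3"
        by (simp add: br_def algebra_simps)
      moreover have "br s r2 r4 = 0" "br s r2 r3 = 0" using par_br(1)[OF p2] by blast+
      ultimately show ?thesis using w(4) by simp
    qed
    then have "br (r2 - r1) (r3 - r2) (r4 - r3) = 0" by (rule par_plane[OF e _ s])
    then show False using n(2) by blast
  qed
qed

lemma par_shift: "par s (x + s) \<longleftrightarrow> par s x"
  unfolding par_def by (simp add: vec3_eq algebra_simps)

lemma br_shift: "br s (x + s) z = br s x z" "br s x (z + s) = br s x z"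
  by (simp_all add: br_def algebra_simps)

text \<open>With the origin moved by \<open>e / 2\<close>, the critical equation of an edge says that its two
  vertices are dependent modulo \<open>s\<close>.\<close>

lemma star_polygon:
  assumes e: "crs s e = pairs (xs @ v # ys)" "s = sum_list (xs @ v # ys)" and z: "star xs v ys = 0"
  shows "br s (sum_list xs + (1/2) *s e) (sum_list xs + v + (1/2) *s e) = 0"
proof -
  have "star xs v ys = dot v (crs s e) + 2 * br s (sum_list xs) (sum_list xs + v)"
    unfolding star_total e(1)[symmetric] e(2)[symmetric] ..
  also have "\<dots> = 2 * br s (sum_list xs + (1/2) *s e) (sum_list xs + v + (1/2) *s e)"
    by (simp add: dot_def br_def field_simps)
  finally show ?thesis using z by simp
qed

lemma star_sum_zero:
  assumes "sum_list (xs @ v # ys) = 0" shows "star xs v ys = dot v (pairs (xs @ v # ys))"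
  unfolding star_total assms by (simp add: br_def)

text \<open>If \<open>s\<close> lies in each of the planes \<open>ab\<close>, \<open>cd\<close>, \<open>ef\<close>,
  then these planes have a common line. The difference of products is the resulting determinant condition.\<close>

lemma concurrent:
  assumes s: "s \<noteq> 0" and z: "br s a b = 0" "br s c d = 0" "br s e f = 0" and n: "br c d a \<noteq> 0"
  shows "br a b c * br d e f - br a b d * br c e f = 0"
proof -
  define D \<alpha> \<beta> where "D = br c d a" "\<alpha> = br s d a" "\<beta> = br c s a"
  note d = this
  have "br c d s = 0" using z(2) br_rotate[of s c d] by simp
  then have ds: "D *s s = \<alpha> *s c + \<beta> *s d"
    using cramer[of c d a s] unfolding d by simp
  have ab: "\<alpha> * br c x w + \<beta> * br d x w = D * br s x w" for x w
  proof -
    have "br (D *s s) x w = br (\<alpha> *s c + \<beta> *s d) x w" unfolding ds ..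
    then show ?thesis unfolding br_linear by simp
  qed
  have 1: "\<alpha> * br c a b + \<beta> * br d a b = 0" "\<alpha> * br c e f + \<beta> * br d e f = 0" unfolding ab z by simp_all
  have "\<alpha> \<noteq> 0 \<or> \<beta> \<noteq> 0"
  proof (rule ccontr)
    assume "\<not> ?thesis"
    then have "D *s s = 0" using ds by simp
    then show False using s n unfolding d by (auto simp: vec3_eq)
  qed
  moreover have "\<alpha> * (br c a b * br d e f - br d a b * br c e f) = 0"
    "\<beta> * (br c a b * br d e f - br d a b * br c e f) = 0" using 1 by algebra+
  ultimately have "br c a b * br d e f - br d a b * br c e f = 0" by (metis mult_eq_0_iff)
  then show ?thesis using br_rotate[of a b c] br_rotate[of a b d] by simp
qed

text \<open>For vectors in general position with nonzero sum, the critical equations will be contradictory unless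
  the list has six elements such that the planes \<open>12, 34, 56\<close> or the planes \<open>23, 45,
  61\<close> have a common line.\<close>

definition critical :: "(complex^3) list \<Rightarrow> bool" where
  "critical vs \<longleftrightarrow> (\<forall>xs v ys. vs = xs @ v # ys \<longrightarrow> star xs v ys = 0)"

lemma criticalD: "critical vs \<Longrightarrow> vs = xs @ v # ys \<Longrightarrow> star xs v ys = 0"
  unfolding critical_def by blast

text \<open>Summing the critical equations with the partial sums telescopes. This is the solvability condition for
  \<open>crs_solvable\<close>.\<close>

lemma critical_sum_dot:
  assumes "critical vs" shows "dot (sum_list vs) (pairs vs) = 0"
proof -
  have gen: "dot (sum_list us) (pairs vs) + 2 * dot (sum_list vs) (pairs us) = 0" if "vs = us @ ws" for us ws
    using that
  proof (induction us arbitrary: ws rule: rev_induct)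
    case Nil
    then show ?case by (simp add: dot_def)
  next
    case (snoc v us)
    have IH: "dot (sum_list us) (pairs vs) + 2 * dot (sum_list vs) (pairs us) = 0"
      using snoc.IH[of "v # ws"] snoc.prems by simp
    have "star us v ws = 0" using criticalD[OF assms, of us v ws] snoc.prems by simp
    then have "dot v (pairs vs) + 2 * br (sum_list vs) (sum_list us) (sum_list us + v) = 0"
      unfolding star_total using snoc.prems by simp
    moreover have "dot (sum_list vs) (pairs (us @ [v])) = dot (sum_list vs) (pairs us) + br (sum_list vs) (sum_list us) (sum_list us + v)"
      unfolding pairs_append by (simp add: dot_def br_def algebra_simps)
    moreover have "dot (sum_list (us @ [v])) (pairs vs) = dot (sum_list us) (pairs vs) + dot v (pairs vs)"
      by (simp add: dot_add)
    ultimately show ?case using IH by algebra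
  qed
  have "dot (sum_list vs) (pairs vs) + 2 * dot (sum_list vs) (pairs vs) = 0" using gen[of vs "[]"] by simp
  then show ?thesis by simp
qed

lemma not_critical_3:
  assumes "critical [a, b, c]" "br a b c \<noteq> 0" shows False
  using criticalD[OF assms(1), of "[]" a "[b, c]"] assms(2) by (simp add: star_def br_def dot_def algebra_simps)

text \<open>The four equations in the four brackets form an invertible linear system.\<close>

lemma not_critical_4:
  assumes "critical [a, b, c, d]" "br a b c \<noteq> 0" shows False
proof -
  have "br a b c + br a b d + br a c d = 0" "br a b c + br a b d + br b c d = 0"
    "br a b c + br a c d + br b c d = 0" "br a b d + br a c d + br b c d = 0"
    using criticalD[OF assms(1), of "[]" a "[b, c, d]"] criticalD[OF assms(1), of "[a]" b "[c, d]"]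
      criticalD[OF assms(1), of "[a, b]" c "[d]"] criticalD[OF assms(1), of "[a, b, c]" d "[]"]
    by (simp_all add: star_def dot_def br_def algebra_simps)
  then have "br a b c = 0" by algebra
  then show False using assms(2) by blast
qed

text \<open>In a closed chain of five vertices, multiples of \<open>s\<close> cannot alternate with vertices that
  are not.\<close>

lemma not_critical_5:
  assumes cr: "critical [a, b, c, d, e]" and s: "a + b + c + d + e \<noteq> 0"
    and n: "br a b c \<noteq> 0" "br b c d \<noteq> 0" "br c d e \<noteq> 0" "br d e a \<noteq> 0" "br e a b \<noteq> 0"
  shows False
proof -
  define S where "S = a + b + c + d + e"
  have sl: "sum_list [a, b, c, d, e] = S" by (simp add: S_def add.assoc)
  obtain k where k: "crs S k = pairs [a, b, c, d, e]"
    using crs_solvable[of S] critical_sum_dot[OF cr] s unfolding sl S_def by blast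
  define h where "h = (1/2) *s k"
  define r0 r1 r2 r3 r4 where "r0 = h" "r1 = a + h" "r2 = a + b + h" "r3 = a + b + c + h" "r4 = a + b + c + d + h"
  note r = this
  have W: "br S (sum_list xs + h) (sum_list xs + v + h) = 0" if "[a, b, c, d, e] = xs @ v # ys" for xs v ys
  proof -
    have "crs S k = pairs (xs @ v # ys)" using k by (simp only: that)
    moreover have "S = sum_list (xs @ v # ys)" using sl by (simp only: that)
    ultimately show ?thesis unfolding h_def using criticalD[OF cr that] by (rule star_polygon)
  qed
  have vertices: "sum_list [] + h = r0" "sum_list [] + a + h = r1" "sum_list [a] + h = r1" "sum_list [a] + b + h = r2"
    "sum_list [a, b] + h = r2" "sum_list [a, b] + c + h = r3" "sum_list [a, b, c] + h = r3" "sum_list [a, b, c] + d + h = r4"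
    "sum_list [a, b, c, d] + h = r4" "sum_list [a, b, c, d] + e + h = r0 + S"
    by (simp_all add: r S_def add_ac)
  have w: "br S r0 r1 = 0" "br S r1 r2 = 0" "br S r2 r3 = 0" "br S r3 r4 = 0" "br S r4 (r0 + S) = 0"
    using W[of "[]" a "[b, c, d, e]"]
      W[of "[a]" b "[c, d, e]"]
      W[of "[a, b]" c "[d, e]"]
      W[of "[a, b, c]" d "[e]"]
      W[of "[a, b, c, d]" e "[]"]
    unfolding vertices by simp_all
  have w5: "br S (r0 + S) (r1 + S) = 0" "br S (r1 + S) (r2 + S) = 0" "br S (r2 + S) (r3 + S) = 0"
    using w by (simp_all add: br_shift)
  have "par S r1 \<longleftrightarrow> \<not> par S r2"
    by (rule alternating[OF _ w(1-4)]) (use s n in \<open>simp_all add: r S_def\<close>)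
  moreover have "par S r2 \<longleftrightarrow> \<not> par S r3"
    by (rule alternating[OF _ w(2-5)]) (use s n in \<open>simp_all add: r S_def algebra_simps\<close>)
  moreover have "par S r3 \<longleftrightarrow> \<not> par S r4"
    by (rule alternating[OF _ w(3-5) w5(1)]) (use s n in \<open>simp_all add: r S_def algebra_simps\<close>)
  moreover have "par S r4 \<longleftrightarrow> \<not> par S (r0 + S)"
    by (rule alternating[OF _ w(4,5) w5(1,2)]) (use s n in \<open>simp_all add: r S_def algebra_simps\<close>)
  moreover have "par S (r0 + S) \<longleftrightarrow> \<not> par S (r1 + S)"
    by (rule alternating[OF _ w(5) w5]) (use s n in \<open>simp_all add: r S_def algebra_simps\<close>)
  ultimately show False unfolding par_shift by blast
qed

text \<open>The six vertices modulo \<open>s\<close> alternate between zero and nonzero. The two edges between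
  consecutive multiples of \<open>s\<close> span a plane through \<open>s\<close>, so that three planes of
  two edges each have the line of \<open>s\<close> in common.\<close>

lemma not_critical_6:
  assumes cr: "critical [a, b, c, d, e, f]" and s: "a + b + c + d + e + f \<noteq> 0"
    and n: "br a b c \<noteq> 0" "br b c d \<noteq> 0" "br c d e \<noteq> 0" "br d e f \<noteq> 0" "br e f a \<noteq> 0" "br f a b \<noteq> 0"
      "br c d a \<noteq> 0" "br d e b \<noteq> 0"
    and q: "br a b c * br d e f - br a b d * br c e f \<noteq> 0" "br b c d * br e f a - br b c e * br d f a \<noteq> 0"
  shows False
proof -
  define S where "S = a + b + c + d + e + f"
  have sl: "sum_list [a, b, c, d, e, f] = S" by (simp add: S_def add.assoc)
  obtain k where k: "crs S k = pairs [a, b, c, d, e, f]"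
    using crs_solvable[of S] critical_sum_dot[OF cr] s unfolding sl S_def by blast
  define h where "h = (1/2) *s k"
  define r0 r1 r2 r3 r4 r5 where "r0 = h" "r1 = a + h" "r2 = a + b + h" "r3 = a + b + c + h" "r4 = a + b + c + d + h"
    "r5 = a + b + c + d + e + h"
  note r = this
  have W: "br S (sum_list xs + h) (sum_list xs + v + h) = 0" if "[a, b, c, d, e, f] = xs @ v # ys" for xs v ys
  proof -
    have "crs S k = pairs (xs @ v # ys)" using k by (simp only: that)
    moreover have "S = sum_list (xs @ v # ys)" using sl by (simp only: that)
    ultimately show ?thesis unfolding h_def using criticalD[OF cr that] by (rule star_polygon)
  qed
  have vertices: "sum_list [] + h = r0" "sum_list [] + a + h = r1" "sum_list [a] + h = r1" "sum_list [a] + b + h = r2"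
    "sum_list [a, b] + h = r2" "sum_list [a, b] + c + h = r3" "sum_list [a, b, c] + h = r3" "sum_list [a, b, c] + d + h = r4"
    "sum_list [a, b, c, d] + h = r4" "sum_list [a, b, c, d] + e + h = r5" "sum_list [a, b, c, d, e] + h = r5" "sum_list [a, b, c, d, e] + f + h = r0 + S"
    by (simp_all add: r S_def add_ac)
  have w: "br S r0 r1 = 0" "br S r1 r2 = 0" "br S r2 r3 = 0" "br S r3 r4 = 0" "br S r4 r5 = 0" "br S r5 (r0 + S) = 0"
    using W[of "[]" a "[b, c, d, e, f]"]
      W[of "[a]" b "[c, d, e, f]"]
      W[of "[a, b]" c "[d, e, f]"]
      W[of "[a, b, c]" d "[e, f]"]
      W[of "[a, b, c, d]" e "[f]"]
      W[of "[a, b, c, d, e]" f "[]"]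
    unfolding vertices by simp_all
  have w6: "br S (r0 + S) (r1 + S) = 0" "br S (r1 + S) (r2 + S) = 0" "br S (r2 + S) (r3 + S) = 0"
    using w by (simp_all add: br_shift)
  have "par S r1 \<longleftrightarrow> \<not> par S r2"
    by (rule alternating[OF _ w(1-4)]) (use s n in \<open>simp_all add: r S_def\<close>)
  moreover have "par S r2 \<longleftrightarrow> \<not> par S r3"
    by (rule alternating[OF _ w(2-5)]) (use s n in \<open>simp_all add: r S_def algebra_simps\<close>)
  moreover have "par S r3 \<longleftrightarrow> \<not> par S r4"
    by (rule alternating[OF _ w(3-6)]) (use s n in \<open>simp_all add: r S_def algebra_simps\<close>)
  moreover have "par S r4 \<longleftrightarrow> \<not> par S r5"
    by (rule alternating[OF _ w(4-6) w6(1)]) (use s n in \<open>simp_all add: r S_def algebra_simps\<close>)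
  moreover have "par S r5 \<longleftrightarrow> \<not> par S (r0 + S)"
    by (rule alternating[OF _ w(5,6) w6(1,2)]) (use s n in \<open>simp_all add: r S_def algebra_simps\<close>)
  ultimately consider (even) "par S r0" "par S r2" "par S r4" | (odd) "par S r1" "par S r3" "par S r5"
    unfolding par_shift by blast
  then show False
  proof cases
    case even
    have "br S a b = 0" "br S c d = 0" "br S e f = 0"
    proof -
      have "br S a (a + b) = 0" using par_br(2)[OF par_diff[OF even(1,2)], of a] unfolding r by (simp add: algebra_simps)
      then show "br S a b = 0" by (simp add: br_linear)
      have "br S c (c + d) = 0" using par_br(2)[OF par_diff[OF even(2,3)], of c] unfolding r by (simp add: algebra_simps)
      then show "br S c d = 0" by (simp add: br_linear)
      have "par S ((r0 + S) - r4)" by (rule par_diff) (use even par_shift in auto)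
      then have "br S e (e + f) = 0" using par_br(2)[of S "(r0 + S) - r4" e] unfolding r S_def by (simp add: algebra_simps)
      then show "br S e f = 0" by (simp add: br_linear)
    qed
    then show False using concurrent[of S a b c d e f] s n(7) q(1) unfolding S_def by blast
  next
    case odd
    have "br S b c = 0" "br S d e = 0" "br S f a = 0"
    proof -
      have "br S b (b + c) = 0" using par_br(2)[OF par_diff[OF odd(1,2)], of b] unfolding r by (simp add: algebra_simps)
      then show "br S b c = 0" by (simp add: br_linear)
      have "br S d (d + e) = 0" using par_br(2)[OF par_diff[OF odd(2,3)], of d] unfolding r by (simp add: algebra_simps)
      then show "br S d e = 0" by (simp add: br_linear)
      have "par S ((r1 + S) - r5)" by (rule par_diff) (use odd par_shift in auto)
      then have "br S f (f + a) = 0" using par_br(2)[of S "(r1 + S) - r5" f] unfolding r S_def by (simp add: algebra_simps)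
      then show "br S f a = 0" by (simp add: br_linear)
    qed
    then show False using concurrent[of S b c d e f a] s n(8) q(2) unfolding S_def by blast
  qed
qed

section \<open>Straightening monomials in brackets along three lines\<close>

text \<open>Six vectors come in three pairs. \<open>Mix\<close> picks one vector of each pair; \<open>Fwd p s\<close> and
  \<open>Bwd p s\<close> contain the whole pair \<open>p\<close> and one vector of the pair after, respectively before it.
  The sign in \<open>Fwd\<close> makes all relations below binomial with coefficients \<open>1\<close> and \<open>- 1\<close> up to
  lower terms.\<close>

datatype pr = A | B | C
datatype tri = Mix bool bool bool | Fwd pr bool | Bwd pr bool

fun nxt :: "pr \<Rightarrow> pr" where "nxt A = B" | "nxt B = C" | "nxt C = A"
fun prv :: "pr \<Rightarrow> pr" where "prv A = C" | "prv B = A" | "prv C = B"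

lemma nxt_prv [simp]: "nxt (prv p) = p" "prv (nxt p) = p" "nxt (nxt p) = prv p" "prv (prv p) = nxt p"
  by (cases p; simp)+
lemma nxt_neq [simp]: "nxt p \<noteq> p" "p \<noteq> nxt p" "prv p \<noteq> p" "p \<noteq> prv p" "nxt p \<noteq> prv p" "prv p \<noteq> nxt p"
  by (cases p; simp)+
lemma all_pr: "(\<forall>p. P p) \<longleftrightarrow> P A \<and> P B \<and> P C" by (metis pr.exhaust)

type_synonym config = "pr \<Rightarrow> bool \<Rightarrow> complex^3"

fun y :: "config \<Rightarrow> tri \<Rightarrow> complex" where
  "y v (Mix a b c) = br (v A a) (v B b) (v C c)"
| "y v (Fwd p s) = - br (v p False) (v p True) (v (nxt p) s)"
| "y v (Bwd p s) = br (v p False) (v p True) (v (prv p) s)"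

text \<open>\<open>concurrency v = 0\<close> expresses that the three lines spanned by the pairs have a common point.\<close>

definition concurrency :: "config \<Rightarrow> complex" where
  "concurrency v = br (v A False) (v A True) (v B False) * br (v B True) (v C False) (v C True)
     - br (v A False) (v A True) (v B True) * br (v B False) (v C False) (v C True)"

fun mixat :: "pr \<Rightarrow> bool \<Rightarrow> bool \<Rightarrow> bool \<Rightarrow> tri" where
  "mixat A s t u = Mix s t u" | "mixat B s t u = Mix u s t" | "mixat C s t u = Mix t u s"

lemma y_mixat: "y v (mixat p s t u) = br (v p s) (v (nxt p) t) (v (prv p) u)"
  by (cases p) (auto simp: br_rotate)

fun isMix :: "tri \<Rightarrow> bool" where
  "isMix (Mix _ _ _) = True" | "isMix _ = False"

text \<open>The value \<open>None\<close> stands for triples with both or none of the two vectors.\<close>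

fun side :: "pr \<Rightarrow> tri \<Rightarrow> bool option" where
  "side p (Mix a b c) = Some (case p of A \<Rightarrow> a | B \<Rightarrow> b | C \<Rightarrow> c)"
| "side p (Fwd q s) = (if p = nxt q then Some s else None)"
| "side p (Bwd q s) = (if p = prv q then Some s else None)"

fun setside :: "pr \<Rightarrow> bool \<Rightarrow> tri \<Rightarrow> tri" where
  "setside p s (Mix a b c) = Mix (if p = A then s else a) (if p = B then s else b) (if p = C then s else c)"
| "setside p s (Fwd q t) = (if p = nxt q then Fwd q s else Fwd q t)"
| "setside p s (Bwd q t) = (if p = prv q then Bwd q s else Bwd q t)"

lemma single_cases:
  assumes "side p I = Some s"
  obtains t u where "I = mixat p s t u" | "I = Fwd (prv p) s" | "I = Bwd (nxt p) s"
  using assms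
proof (cases I)
  case (Mix a b c)
  then show ?thesis using assms that(1)[of b c] that(1)[of c a] that(1)[of a b] by (cases p) auto
qed (auto split: if_splits intro: that)

lemma setside_simps [simp]:
  "setside p s (mixat p s' t u) = mixat p s t u" "setside p s (Fwd (prv p) s') = Fwd (prv p) s"
  "setside p s (Bwd (nxt p) s') = Bwd (nxt p) s"
  by (cases p; simp)+

lemma isMix_mixat [simp]: "isMix (mixat p s t u)" by (cases p) auto

definition mon :: "tri multiset \<Rightarrow> config \<Rightarrow> complex" where
  "mon W v = prod_mset (image_mset (y v) W)"

definition nMix :: "tri multiset \<Rightarrow> nat" where "nMix W = size (filter_mset isMix W)"

lemma mon_simps [simp]: "mon {#} v = 1" "mon (add_mset T W) v = y v T * mon W v" "mon (W + X) v = mon W v * mon X v"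
  by (simp_all add: mon_def)
lemma nMix_simps [simp]: "nMix {#} = 0" "nMix (add_mset T W) = (if isMix T then 1 else 0) + nMix W"
  "nMix (W + X) = nMix W + nMix X"
  by (simp_all add: nMix_def)

text \<open>Modulo these functions the relations between brackets become binomial. Induction on the number of mixed
  factors takes care of the first kind, and the second kind vanishes on the configurations with concurrent
  lines.\<close>

definition lows :: "nat \<Rightarrow> nat \<Rightarrow> (config \<Rightarrow> complex) set" where
  "lows k d = fn.span ({mon X | X. size X = d \<and> nMix X < k} \<union>
      {(\<lambda>v. concurrency v * mon X v) | X. size X + 2 = d})"

lemma lows_0: "(\<lambda>v. 0) \<in> lows k d"
  unfolding lows_def using fn.span_zero by (simp add: zero_fun_def)
lemma lows_scale: "f \<in> lows k d \<Longrightarrow> (\<lambda>v. c * f v) \<in> lows k d"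
  unfolding lows_def by (rule fn.span_scale)
lemma lows_add: "f \<in> lows k d \<Longrightarrow> g \<in> lows k d \<Longrightarrow> (\<lambda>v. f v + g v) \<in> lows k d"
  unfolding lows_def using fn.span_add[of f _ g] by (simp add: plus_fun_def)
lemma lows_minus: "f \<in> lows k d \<Longrightarrow> (\<lambda>v. - f v) \<in> lows k d"
  using lows_scale[of f k d "-1"] by simp
lemma lows_mon: "size X = d \<Longrightarrow> nMix X < k \<Longrightarrow> mon X \<in> lows k d"
  unfolding lows_def by (rule fn.span_base) blast
lemma lows_q: "size X + 2 = d \<Longrightarrow> (\<lambda>v. concurrency v * mon X v) \<in> lows k d"
  unfolding lows_def by (rule fn.span_base) blast

lemma lows_mult:
  assumes "f \<in> lows k d" shows "(\<lambda>v. f v * mon X v) \<in> lows (k + nMix X) (d + size X)"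
  using assms unfolding lows_def[of k d]
proof (induction rule: fn.span_induct_alt)
  case base
  then show ?case using lows_0 by (simp add: zero_fun_def)
next
  case (step c g h)
  have "(\<lambda>v. g v * mon X v) \<in> lows (k + nMix X) (d + size X)"
  proof (cases "\<exists>Y. g = mon Y \<and> size Y = d \<and> nMix Y < k")
    case True
    then obtain Y where Y: "g = mon Y" "size Y = d" "nMix Y < k" by blast
    have "mon (Y + X) \<in> lows (k + nMix X) (d + size X)" by (rule lows_mon) (use Y in auto)
    moreover have "mon (Y + X) = (\<lambda>v. g v * mon X v)" by (rule ext) (simp add: Y(1))
    ultimately show ?thesis by simp
  next
    case False
    then obtain Y where Y: "g = (\<lambda>v. concurrency v * mon Y v)" "size Y + 2 = d" using step(1) by blast
    have "(\<lambda>v. concurrency v * mon (Y + X) v) \<in> lows (k + nMix X) (d + size X)"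
      by (rule lows_q) (use Y in auto)
    then show ?thesis using Y by (simp add: mult.assoc)
  qed
  then show ?case using step(2) lows_add lows_scale
    by (auto simp: plus_fun_def distrib_right mult.assoc)
qed

text \<open>A bracket with two vectors of one pair is, up to sign, a coordinate that is not mixed.\<close>

lemma pair_bracket:
  assumes "r \<noteq> p"
  obtains T c where "\<not> isMix T" "\<forall>v. br (v p s) (v p t) (v r u) = c * y v T"
proof (cases "s = t")
  case True
  show ?thesis by (rule that[of "Fwd A True" 0]) (simp_all add: True)
next
  case False
  define e where "e = (if s then -1 else 1 :: complex)"
  have e: "br (v p s) (v p t) w = e * br (v p False) (v p True) w" for v :: config and w
    using False by (cases s; cases t) (auto simp: e_def br_swap(1)[of "v p True"])
  consider "r = nxt p" | "r = prv p" using assms by (cases p; cases r) auto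
  then show ?thesis
  proof cases
    case 1
    show ?thesis by (rule that[of "Fwd p u" "- e"]) (simp_all add: e 1)
  next
    case 2
    show ?thesis by (rule that[of "Bwd p u" e]) (simp_all add: e 2)
  qed
qed

lemma pair_bracket_product:
  assumes "r \<noteq> p" "r' \<noteq> p'" "k > 0"
  shows "(\<lambda>v. br (v p s) (v p t) (v r u) * br (v p' s') (v p' t') (v r' u')) \<in> lows k 2"
proof -
  obtain T c where T: "\<not> isMix T" "\<forall>v. br (v p s) (v p t) (v r u) = c * y v T"
    by (rule pair_bracket[OF assms(1), of s t u])
  obtain T' c' where T': "\<not> isMix T'" "\<forall>v. br (v p' s') (v p' t') (v r' u') = c' * y v T'"
    by (rule pair_bracket[OF assms(2), of s' t' u'])
  have "mon {#T, T'#} \<in> lows k 2" by (rule lows_mon) (use T(1) T'(1) assms(3) in auto)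
  then have "(\<lambda>v. (c * c') * mon {#T, T'#} v) \<in> lows k 2" by (rule lows_scale)
  then show ?thesis unfolding T(2)[rule_format] T'(2)[rule_format] by (simp add: mult_ac)
qed

lemma br_swap_pair:
  "br a i i' * br a' j j' - br a' i i' * br a j j' = br a a' i' * br i j j' - br a a' i * br i' j j'"
  using br_exchange[of a i i' a' j j'] br_swap(2)[of a i a'] by (simp add: algebra_simps)

lemma concurrency_alt:
  "br (v (prv p) False) (v (prv p) True) (v p False) * br (v (nxt p) False) (v (nxt p) True) (v p True)
   - br (v (prv p) False) (v (prv p) True) (v p True) * br (v (nxt p) False) (v (nxt p) True) (v p False)
   = concurrency v"
proof (cases p)
  case A
  then show ?thesis
    using br_swap_pair[of "v B False" "v A False" "v A True" "v B True" "v C False" "v C True"]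
    by (simp add: concurrency_def br_rotate)
next
  case B
  then show ?thesis by (simp add: concurrency_def br_rotate)
next
  case C
  then show ?thesis
    using br_swap_pair[of "v C False" "v B False" "v B True" "v C True" "v A False" "v A True"]
    by (simp add: concurrency_def br_rotate)
qed

text \<open>Exchanging the two vectors of a pair between two triples changes a monomial only by
  lower terms. The exceptional case, in which the concurrency polynomial itself appears, is that of
  the two triples containing one of the other pairs each.\<close>

lemma swap_relation_mixed:
  assumes J: "side p J = Some (\<not> s)"
  shows "(\<lambda>v. y v (mixat p s t u) * y v J - y v (mixat p (\<not> s) t u) * y v (setside p s J))
      \<in> lows (Suc (nMix {#J#})) 2"
proof -
  obtain t' u' where "J = mixat p (\<not> s) t' u' \<or> J = Fwd (prv p) (\<not> s) \<or> J = Bwd (nxt p) (\<not> s)"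
    using single_cases[OF J] by metis
  then consider (m) "J = mixat p (\<not> s) t' u'" | (f) "J = Fwd (prv p) (\<not> s)" | (b) "J = Bwd (nxt p) (\<not> s)"
    by blast
  then show ?thesis
  proof cases
    case m
    have "(\<lambda>v. br (v p s) (v p (\<not> s)) (v (prv p) u) * br (v (nxt p) t) (v (nxt p) t') (v (prv p) u')
       + - (br (v p s) (v p (\<not> s)) (v (nxt p) t) * br (v (prv p) u') (v (prv p) u) (v (nxt p) t')))
       \<in> lows (Suc (nMix {#J#})) 2"
      by (intro lows_add lows_minus pair_bracket_product) simp_all
    then show ?thesis unfolding m setside_simps y_mixat br_swap_pair
      by (simp only: br_rotate(2)[of "v (prv p) u'" "v (prv p) u" "v (nxt p) t'" for v] diff_conv_add_uminus)
  next
    case f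
    have "(\<lambda>v. - (br (v p s) (v p (\<not> s)) (v (prv p) u) * br (v (prv p) False) (v (prv p) True) (v (nxt p) t)))
       \<in> lows (Suc (nMix {#J#})) 2"
      by (intro lows_minus pair_bracket_product) simp_all
    moreover have "y v (mixat p s t u) * y v J - y v (mixat p (\<not> s) t u) * y v (setside p s J) =
      - (br (v p s) (v p (\<not> s)) (v (prv p) u) * br (v (prv p) False) (v (prv p) True) (v (nxt p) t))" for v
      using br_swap_pair[of "v p s" "v (nxt p) t" "v (prv p) u" "v p (\<not> s)" "v (prv p) False" "v (prv p) True"]
      unfolding f setside_simps y_mixat y.simps nxt_prv by (cases u) (simp_all add: br_rotate algebra_simps)
    ultimately show ?thesis by simp
  next
    case b
    have "(\<lambda>v. - (br (v p s) (v p (\<not> s)) (v (nxt p) t) * br (v (nxt p) False) (v (nxt p) True) (v (prv p) u)))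
       \<in> lows (Suc (nMix {#J#})) 2"
      by (intro lows_minus pair_bracket_product) simp_all
    moreover have "y v (mixat p s t u) * y v J - y v (mixat p (\<not> s) t u) * y v (setside p s J) =
      - (br (v p s) (v p (\<not> s)) (v (nxt p) t) * br (v (nxt p) False) (v (nxt p) True) (v (prv p) u))" for v
      using br_swap_pair[of "v p s" "v (nxt p) t" "v (prv p) u" "v p (\<not> s)" "v (nxt p) False" "v (nxt p) True"]
      unfolding b setside_simps y_mixat y.simps nxt_prv by (cases t) (simp_all add: br_rotate algebra_simps)
    ultimately show ?thesis by simp
  qed
qed

lemma swap_relation:
  assumes I: "side p I = Some s" and J: "side p J = Some (\<not> s)"
  shows "(\<lambda>v. y v I * y v J - y v (setside p (\<not> s) I) * y v (setside p s J)) \<in> lows (nMix {#I, J#}) 2"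
proof -
  obtain t u where "I = mixat p s t u \<or> I = Fwd (prv p) s \<or> I = Bwd (nxt p) s"
    using single_cases[OF I] by metis
  moreover obtain t' u' where "J = mixat p (\<not> s) t' u' \<or> J = Fwd (prv p) (\<not> s) \<or> J = Bwd (nxt p) (\<not> s)"
    using single_cases[OF J] by metis
  ultimately consider (mI) "I = mixat p s t u" | (mJ) "J = mixat p (\<not> s) t' u'"
    | (ff) "I = Fwd (prv p) s" "J = Fwd (prv p) (\<not> s)" | (fb) "I = Fwd (prv p) s" "J = Bwd (nxt p) (\<not> s)"
    | (bf) "I = Bwd (nxt p) s" "J = Fwd (prv p) (\<not> s)" | (bb) "I = Bwd (nxt p) s" "J = Bwd (nxt p) (\<not> s)"
    by blast
  then show ?thesis
  proof cases
    case mI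
    then show ?thesis using swap_relation_mixed[OF J, of t u] by simp
  next
    case mJ
    have "side p I = Some (\<not> (\<not> s))" using I by simp
    from swap_relation_mixed[OF this, of t' u'] show ?thesis unfolding mJ by (simp add: mult.commute add.commute)
  next
    case ff
    then show ?thesis using lows_0 by (simp add: mult.commute)
  next
    case bb
    then show ?thesis using lows_0 by (simp add: mult.commute)
  next
    case fb
    have "(\<lambda>v. (if s then 1 else -1) * (concurrency v * mon {#} v)) \<in> lows (nMix {#I, J#}) 2"
      by (intro lows_scale lows_q) simp
    moreover have "y v I * y v J - y v (setside p (\<not> s) I) * y v (setside p s J) =
        (if s then 1 else -1) * (concurrency v * mon {#} v)" for v
      unfolding fb setside_simps y.simps nxt_prv concurrency_alt[of v p, symmetric]
      by (cases s) (simp_all add: algebra_simps)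
    ultimately show ?thesis by simp
  next
    case bf
    have "(\<lambda>v. (if s then -1 else 1) * (concurrency v * mon {#} v)) \<in> lows (nMix {#I, J#}) 2"
      by (intro lows_scale lows_q) simp
    moreover have "y v I * y v J - y v (setside p (\<not> s) I) * y v (setside p s J) =
        (if s then -1 else 1) * (concurrency v * mon {#} v)" for v
      unfolding bf setside_simps y.simps nxt_prv concurrency_alt[of v p, symmetric]
      by (cases s) (simp_all add: algebra_simps)
    ultimately show ?thesis by simp
  qed
qed

text \<open>Going around the triangle of pairs in the two directions gives the same product, up to a
  multiple of the concurrency polynomial.\<close>

lemma br_three_term:
  "br a b c * br a d e - br a b d * br a c e + br a b e * br a c d = 0"
  by (simp add: br_def) algebra

lemma triangle_brackets:
  "br a a' b * br b b' c * br c c' d + br a a' c * br b b' d * br c c' b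
   = - (br a a' b * br b' c c' - br a a' b' * br b c c') * br d b c"
  if "d = a"
proof -
  have "br a b c * br b' c c' = - br b b' c * br c c' a + br b c c' * br a b' c"
  proof -
    have "br c a b = br a b c" "br c b' c' = - br b' c c'" "br c a b' = br a b' c" "br c b c' = - br b c c'"
      "br c a c' = - br c c' a" "br c b b' = br b b' c" by (simp_all add: br_def algebra_simps)
    note e = this
    show ?thesis using br_three_term[of c a b b' c'] unfolding e by algebra
  qed
  moreover have "br a a' b' * br a b c = br a a' c * br b b' a + br a a' b * br a b' c"
  proof -
    have "br a b' b = - br b b' a" by (simp add: br_def algebra_simps)
    note e = this
    show ?thesis using br_three_term[of a a' b' b c] unfolding e
      by (subst right_minus_eq[symmetric]) (simp add: algebra_simps)
  qed
  moreover have "br c c' b = br b c c'" by (simp add: br_def algebra_simps)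
  ultimately show ?thesis unfolding that by algebra
qed

lemma triangle_relation:
  "(\<lambda>v. y v (Fwd A b) * y v (Fwd B c) * y v (Fwd C a) - y v (Bwd A c) * y v (Bwd B a) * y v (Bwd C b)) \<in> lows k 3"
proof -
  define e where "e = (1 :: complex)"
  have "(\<lambda>v. e * (concurrency v * mon {#Mix a b c#} v)) \<in> lows k 3"
    by (intro lows_scale lows_q) simp
  moreover have "y v (Fwd A b) * y v (Fwd B c) * y v (Fwd C a) - y v (Bwd A c) * y v (Bwd B a) * y v (Bwd C b)
      = e * (concurrency v * mon {#Mix a b c#} v)" for v
  proof -
    define ea eb ec where "ea = (if a then -1 else 1 :: complex)" "eb = (if b then -1 else 1 :: complex)"
      "ec = (if c then -1 else 1 :: complex)"
    note e_defs = this
    have e: "ea * ea = 1" "eb * eb = 1" "ec * ec = 1" by (simp_all add: e_defs)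
    have *: "br (v A False) (v A True) w = ea * br (v A a) (v A (\<not> a)) w"
      "br (v B False) (v B True) w = eb * br (v B b) (v B (\<not> b)) w"
      "br (v C False) (v C True) w = ec * br (v C c) (v C (\<not> c)) w" for w
      by (auto simp: e_defs br_swap(1)[of "v _ True"])
    have "concurrency v = br (v A False) (v A True) (v B False) * br (v C False) (v C True) (v B True)
        - br (v A False) (v A True) (v B True) * br (v C False) (v C True) (v B False)"
      by (simp add: concurrency_def br_rotate)
    also have "\<dots> = ea * ec * (br (v A a) (v A (\<not> a)) (v B False) * br (v C c) (v C (\<not> c)) (v B True)
        - br (v A a) (v A (\<not> a)) (v B True) * br (v C c) (v C (\<not> c)) (v B False))"
      unfolding * by algebra
    also have "\<dots> = ea * eb * ec * (br (v A a) (v A (\<not> a)) (v B b) * br (v C c) (v C (\<not> c)) (v B (\<not> b))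
        - br (v A a) (v A (\<not> a)) (v B (\<not> b)) * br (v C c) (v C (\<not> c)) (v B b))"
      by (cases b) (simp_all add: e_defs algebra_simps)
    finally have conc: "concurrency v = ea * eb * ec *
        (br (v A a) (v A (\<not> a)) (v B b) * br (v B (\<not> b)) (v C c) (v C (\<not> c))
       - br (v A a) (v A (\<not> a)) (v B (\<not> b)) * br (v B b) (v C c) (v C (\<not> c)))"
      by (simp add: br_rotate)
    have "y v (Fwd A b) * y v (Fwd B c) * y v (Fwd C a) - y v (Bwd A c) * y v (Bwd B a) * y v (Bwd C b) =
      - (ea * eb * ec) * (br (v A a) (v A (\<not> a)) (v B b) * br (v B b) (v B (\<not> b)) (v C c) * br (v C c) (v C (\<not> c)) (v A a)
      + br (v A a) (v A (\<not> a)) (v C c) * br (v B b) (v B (\<not> b)) (v A a) * br (v C c) (v C (\<not> c)) (v B b))"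
      unfolding y.simps nxt.simps prv.simps * by algebra
    also have "\<dots> = e * (concurrency v * mon {#Mix a b c#} v)"
      unfolding triangle_brackets[OF refl] conc e_def by (simp add: algebra_simps)
    finally show ?thesis .
  qed
  ultimately show ?thesis by simp
qed

definition singles :: "pr \<Rightarrow> tri multiset \<Rightarrow> nat" where
  "singles p W = size (filter_mset (\<lambda>T. side p T \<noteq> None) W)"
definition trues :: "pr \<Rightarrow> tri multiset \<Rightarrow> nat" where
  "trues p W = size (filter_mset (\<lambda>T. side p T = Some True) W)"
definition fwds :: "pr \<Rightarrow> tri multiset \<Rightarrow> nat" where
  "fwds p W = size (filter_mset (\<lambda>T. \<exists>s. T = Fwd p s) W)"
definition bwds :: "pr \<Rightarrow> tri multiset \<Rightarrow> nat" where
  "bwds p W = size (filter_mset (\<lambda>T. \<exists>s. T = Bwd p s) W)"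

lemmas count_defs = singles_def trues_def fwds_def bwds_def

text \<open>The numbers of the three kinds of \<open>Fwd\<close> only enter by their differences, because exchanging
  one of each kind for one \<open>Bwd\<close> of each kind is a relation. Monomials with the same key will
  turn out to have the same leading term along a curve.\<close>

definition key :: "tri multiset \<Rightarrow> nat \<times> (pr \<Rightarrow> nat) \<times> (pr \<Rightarrow> nat) \<times> (pr \<Rightarrow> int)" where
  "key W = (nMix W, \<lambda>p. singles p W, \<lambda>p. trues p W, \<lambda>p. int (fwds p W) - int (fwds (nxt p) W))"

lemma key_eq_iff: "key W = key X \<longleftrightarrow> nMix W = nMix X \<and> (\<forall>p. singles p W = singles p X) \<and>
    (\<forall>p. trues p W = trues p X) \<and> (\<forall>p. int (fwds p W) - int (fwds (nxt p) W) = int (fwds p X) - int (fwds (nxt p) X))"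
  by (auto simp: key_def fun_eq_iff)

lemma count_union [simp]:
  "singles p (W + X) = singles p W + singles p X" "trues p (W + X) = trues p W + trues p X"
  "fwds p (W + X) = fwds p W + fwds p X" "bwds p (W + X) = bwds p W + bwds p X"
  by (simp_all add: count_defs)

lemma count_empty [simp]: "singles p {#} = 0" "trues p {#} = 0" "fwds p {#} = 0" "bwds p {#} = 0"
  by (simp_all add: count_defs)

lemma count_add_mset [simp]:
  "singles p (add_mset T W) = (if side p T \<noteq> None then 1 else 0) + singles p W"
  "trues p (add_mset T W) = (if side p T = Some True then 1 else 0) + trues p W"
  "fwds p (add_mset T W) = (if \<exists>s. T = Fwd p s then 1 else 0) + fwds p W"
  "bwds p (add_mset T W) = (if \<exists>s. T = Bwd p s then 1 else 0) + bwds p W"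
  by (simp_all add: count_defs)

lemma key_union: "key W = key W' \<Longrightarrow> key (W + X) = key (W' + X)"
  unfolding key_eq_iff by auto

text \<open>With a common factor cancelled, two monomials can be compared by induction on the degree.\<close>

lemma key_cancel: "key (W + X) = key (W' + X) \<Longrightarrow> key W = key W'"
  unfolding key_eq_iff by auto

lemma singles_eq: "singles p W = nMix W + fwds (prv p) W + bwds (nxt p) W"
proof (induction W)
  case (add T W)
  then show ?case by (cases T) auto
qed simp

definition equiv_mon :: "tri multiset \<Rightarrow> tri multiset \<Rightarrow> bool" (infix "\<doteq>" 50) where
  "W \<doteq> X \<longleftrightarrow> size W = size X \<and> key W = key X \<and> (\<lambda>v. mon W v - mon X v) \<in> lows (nMix W) (size W)"

lemma equiv_mon_refl: "W \<doteq> W" by (simp add: equiv_mon_def lows_0)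

lemma equiv_mon_trans: "W \<doteq> X \<Longrightarrow> X \<doteq> Z \<Longrightarrow> W \<doteq> Z"
  unfolding equiv_mon_def key_eq_iff
  using lows_add[of "\<lambda>v. mon W v - mon X v" "nMix W" "size W" "\<lambda>v. mon X v - mon Z v"] by auto

lemma equiv_mon_union: "W \<doteq> X \<Longrightarrow> W + Z \<doteq> X + Z"
  unfolding equiv_mon_def using lows_mult[of "\<lambda>v. mon W v - mon X v" "nMix W" "size W" Z] key_union[of W X Z]
  by (auto simp: algebra_simps)

lemma setside_side [simp]: "side p T = Some s \<Longrightarrow> side p (setside p s' T) = Some s'"
  by (cases T; cases p) (auto split: if_splits)
lemma setside_other [simp]: "q \<noteq> p \<Longrightarrow> side q (setside p s' T) = side q T"
  by (cases T; cases p; cases q) auto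
lemma setside_isMix [simp]: "isMix (setside p s T) = isMix T" by (cases T) auto
lemma setside_Fwd [simp]: "(\<exists>t. setside p s T = Fwd q t) = (\<exists>t. T = Fwd q t)" by (cases T) auto
lemma setside_Bwd [simp]: "(\<exists>t. setside p s T = Bwd q t) = (\<exists>t. T = Bwd q t)" by (cases T) auto
lemma setside_id: "side p T = Some s \<Longrightarrow> setside p s T = T"
  by (cases T; cases p) (auto split: if_splits)

lemma swap_equiv:
  assumes I: "side p I = Some s" and J: "side p J = Some (\<not> s)"
  shows "{#I, J#} \<doteq> {#setside p (\<not> s) I, setside p s J#}"
proof -
  have "singles q {#I, J#} = singles q {#setside p (\<not> s) I, setside p s J#} \<and>
      trues q {#I, J#} = trues q {#setside p (\<not> s) I, setside p s J#}" for q
    using I J setside_side[OF I] setside_side[OF J] by (cases "q = p"; cases s) auto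
  then have "key {#I, J#} = key {#setside p (\<not> s) I, setside p s J#}" unfolding key_eq_iff by simp
  moreover have "(\<lambda>v. mon {#I, J#} v - mon {#setside p (\<not> s) I, setside p s J#} v)
      = (\<lambda>v. y v I * y v J - y v (setside p (\<not> s) I) * y v (setside p s J))"
    by (rule ext) simp
  moreover have "size {#I, J#} = 2" "size {#setside p (\<not> s) I, setside p s J#} = 2" by simp_all
  ultimately show ?thesis unfolding equiv_mon_def using swap_relation[OF I J] by (simp only: simp_thms)
qed

lemma triangle_equiv: "{#Fwd A b, Fwd B c, Fwd C a#} \<doteq> {#Bwd A c, Bwd B a, Bwd C b#}"
proof -
  have "key {#Fwd A b, Fwd B c, Fwd C a#} = key {#Bwd A c, Bwd B a, Bwd C b#}"
    unfolding key_eq_iff by (auto simp: all_pr)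
  moreover have "(\<lambda>v. mon {#Fwd A b, Fwd B c, Fwd C a#} v - mon {#Bwd A c, Bwd B a, Bwd C b#} v)
      = (\<lambda>v. y v (Fwd A b) * y v (Fwd B c) * y v (Fwd C a) - y v (Bwd A c) * y v (Bwd B a) * y v (Bwd C b))"
    by (rule ext) (simp add: mult.assoc)
  moreover have "size {#Fwd A b, Fwd B c, Fwd C a#} = 3" "size {#Bwd A c, Bwd B a, Bwd C b#} = 3" by simp_all
  ultimately show ?thesis unfolding equiv_mon_def using triangle_relation[of b c a] by (simp only: simp_thms)
qed

lemma triangle_equiv': "{#Bwd A c, Bwd B a, Bwd C b#} \<doteq> {#Fwd A b, Fwd B c, Fwd C a#}"
  using triangle_equiv[of b c a] lows_minus[of "\<lambda>v. mon {#Fwd A b, Fwd B c, Fwd C a#} v - mon {#Bwd A c, Bwd B a, Bwd C b#} v"]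
  unfolding equiv_mon_def key_eq_iff by simp

text \<open>If a triple \<open>I\<close> occurs in \<open>W'\<close>, then any monomial \<open>W\<close> with the same key can be moved to one that
  contains \<open>I\<close> as well: first a triple \<open>J\<close> of the same type is produced, then its sides are adjusted
  one after the other.\<close>

lemma size_filter_pos: "size (filter_mset P W) > 0 \<longleftrightarrow> (\<exists>T. T \<in># W \<and> P T)"
  by (induction W) auto

text \<open>The number of factors that take the side \<open>True\<close> of a pair is fixed by the key; if a factor
  has the wrong side, then another factor has the opposite one and both can be exchanged.\<close>

lemma adjust_side:
  assumes eq: "key W = key W'" and I: "I \<in># W'" "side p I = Some s" and J: "J \<in># W" "side p J \<noteq> None"
  shows "\<exists>X. W \<doteq> X \<and> setside p s J \<in># X"
proof (cases "side p J = Some s")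
  case True
  then show ?thesis using J(1) equiv_mon_refl setside_id by metis
next
  case False
  then have Js: "side p J = Some (\<not> s)" using J(2) by (cases "side p J") auto
  have cnt: "size (filter_mset (\<lambda>T. side p T = Some s) Z) = (if s then trues p Z else singles p Z - trues p Z)" for Z
  proof -
    have "singles p Z = trues p Z + size (filter_mset (\<lambda>T. side p T = Some False) Z)"
      by (induction Z) auto
    then show ?thesis by (cases s) (simp_all add: trues_def)
  qed
  have "I \<in># filter_mset (\<lambda>T. side p T = Some s) W'" using I by simp
  then have "size (filter_mset (\<lambda>T. side p T = Some s) W') \<noteq> 0" by auto
  then have "size (filter_mset (\<lambda>T. side p T = Some s) W) \<noteq> 0"
    using eq unfolding cnt key_eq_iff by (cases s) auto
  then obtain K where K: "K \<in># W" "side p K = Some s"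
    using size_filter_pos[of "\<lambda>T. side p T = Some s" W] by auto
  have KJ: "K \<noteq> J" using K(2) Js by auto
  obtain Z where Z: "W = {#K, J#} + Z"
    using K(1) J(1) KJ by (metis add_mset_add_single insert_noteq_member mset_add union_commute union_mset_add_mset_left add_mset_commute add_0)
  have "W \<doteq> {#setside p (\<not> s) K, setside p s J#} + Z"
    unfolding Z by (rule equiv_mon_union[OF swap_equiv[OF K(2) Js]])
  then show ?thesis by (intro exI[of _ "{#setside p (\<not> s) K, setside p s J#} + Z"]) auto
qed

lemma equiv_mon_key: "W \<doteq> X \<Longrightarrow> key W = key X" by (simp add: equiv_mon_def)

lemma nMix_pos: "nMix W > 0 \<longleftrightarrow> (\<exists>a b c. Mix a b c \<in># W)"
proof -
  have "nMix W > 0 \<longleftrightarrow> (\<exists>T. T \<in># W \<and> isMix T)"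
    unfolding nMix_def by (rule size_filter_pos)
  also have "\<dots> \<longleftrightarrow> (\<exists>a b c. Mix a b c \<in># W)" by (metis isMix.elims(2) isMix.simps(1))
  finally show ?thesis .
qed

lemma fwds_pos: "fwds p W > 0 \<longleftrightarrow> (\<exists>s. Fwd p s \<in># W)"
  unfolding fwds_def size_filter_pos by auto
lemma bwds_pos: "bwds p W > 0 \<longleftrightarrow> (\<exists>s. Bwd p s \<in># W)"
  unfolding bwds_def size_filter_pos by auto

lemma three_elements:
  assumes "a \<in># W" "b \<in># W" "c \<in># W" "a \<noteq> b" "b \<noteq> c" "a \<noteq> c"
  obtains Z where "W = {#a, b, c#} + Z"
proof -
  have "{#a, b, c#} \<subseteq># W"
    using assms by (auto simp: insert_subset_eq_iff in_diff_count)
  then show ?thesis using that by (metis subset_mset.add_diff_inverse)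
qed

lemma fwds_shift:
  assumes "key W = key W'"
  shows "int (fwds p W') - int (fwds p W) = int (fwds A W') - int (fwds A W)"
    "int (bwds p W) - int (bwds p W') = int (fwds A W') - int (fwds A W)"
proof -
  have d: "int (fwds q W) - int (fwds (nxt q) W) = int (fwds q W') - int (fwds (nxt q) W')" for q
    using assms unfolding key_eq_iff by blast
  show *: "int (fwds p W') - int (fwds p W) = int (fwds A W') - int (fwds A W)" for p
    using d[of A] d[of B] d[of C] by (cases p) auto
  have "singles (prv p) W = singles (prv p) W'" "nMix W = nMix W'"
    using assms unfolding key_eq_iff by auto
  then show "int (bwds p W) - int (bwds p W') = int (fwds A W') - int (fwds A W)"
    using *[of "nxt p"] unfolding singles_eq[of "prv p"] by auto
qed

text \<open>If no factor of the required type is there, then equality of the keys provides enough factors of the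
  other types for a triangle relation.\<close>

lemma same_type:
  assumes eq: "key W = key W'" and I: "I \<in># W'"
  shows "\<exists>X J. W \<doteq> X \<and> J \<in># X \<and> (case I of Mix _ _ _ \<Rightarrow> isMix J | Fwd p _ \<Rightarrow> \<exists>s. J = Fwd p s | Bwd p _ \<Rightarrow> \<exists>s. J = Bwd p s)"
proof (cases I)
  case (Mix a b c)
  then have "nMix W' > 0" using I nMix_pos by auto
  then have "nMix W > 0" using eq by (simp add: key_eq_iff)
  then show ?thesis unfolding nMix_pos using Mix equiv_mon_refl by fastforce
next
  case (Fwd p s)
  show ?thesis
  proof (cases "fwds p W > 0")
    case True
    then show ?thesis unfolding fwds_pos using Fwd equiv_mon_refl by fastforce
  next
    case False
    have "fwds p W' > 0" using I Fwd fwds_pos by auto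
    then have "bwds q W > 0" for q
      using fwds_shift[OF eq, of p] fwds_shift(2)[OF eq, of q] False by linarith
    then obtain a b c where "Bwd A a \<in># W" "Bwd B b \<in># W" "Bwd C c \<in># W" unfolding bwds_pos by blast
    then obtain Z where "W = {#Bwd A a, Bwd B b, Bwd C c#} + Z" by (rule three_elements) auto
    then have "W \<doteq> {#Fwd A c, Fwd B a, Fwd C b#} + Z" using equiv_mon_union[OF triangle_equiv'] by blast
    moreover have "\<exists>s. Fwd p s \<in># {#Fwd A c, Fwd B a, Fwd C b#} + Z" by (cases p) auto
    ultimately obtain X s' where "W \<doteq> X" "Fwd p s' \<in># X" by blast
    then show ?thesis using Fwd by auto
  qed
next
  case (Bwd p s)
  show ?thesis
  proof (cases "bwds p W > 0")
    case True
    then show ?thesis unfolding bwds_pos using Bwd equiv_mon_refl by fastforce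
  next
    case False
    have "bwds p W' > 0" using I Bwd bwds_pos by auto
    then have "fwds q W > 0" for q
      using fwds_shift(2)[OF eq, of p] fwds_shift(1)[OF eq, of q] False by linarith
    then obtain a b c where "Fwd A a \<in># W" "Fwd B b \<in># W" "Fwd C c \<in># W" unfolding fwds_pos by blast
    then obtain Z where "W = {#Fwd A a, Fwd B b, Fwd C c#} + Z" by (rule three_elements) auto
    then have "W \<doteq> {#Bwd A b, Bwd B c, Bwd C a#} + Z" using equiv_mon_union[OF triangle_equiv] by blast
    moreover have "\<exists>s. Bwd p s \<in># {#Bwd A b, Bwd B c, Bwd C a#} + Z" by (cases p) auto
    ultimately obtain X s' where "W \<doteq> X" "Bwd p s' \<in># X" by blast
    then show ?thesis using Bwd by auto
  qed
qed

lemma common_triple: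
  assumes eq: "key W = key W'" and I: "I \<in># W'"
  shows "\<exists>X. W \<doteq> X \<and> I \<in># X"
proof -
  obtain X J where X: "W \<doteq> X" "J \<in># X"
    and J: "case I of Mix _ _ _ \<Rightarrow> isMix J | Fwd p _ \<Rightarrow> \<exists>s. J = Fwd p s | Bwd p _ \<Rightarrow> \<exists>s. J = Bwd p s"
    using same_type[OF assms] by blast
  have eqX: "key X = key W'" using equiv_mon_key[OF X(1)] eq by simp
  show ?thesis
  proof (cases I)
    case (Mix a b c)
    then obtain a' b' c' where J': "J = Mix a' b' c'" using J by (cases J) auto
    obtain X1 where X1: "X \<doteq> X1" "Mix a b' c' \<in># X1"
      using adjust_side[OF eqX I _ X(2), of A a] by (auto simp: Mix J')
    have e1: "key X1 = key W'" using equiv_mon_key[OF X1(1)] eqX by simp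
    obtain X2 where X2: "X1 \<doteq> X2" "Mix a b c' \<in># X2"
      using adjust_side[OF e1 I _ X1(2), of B b] by (auto simp: Mix)
    have e2: "key X2 = key W'" using equiv_mon_key[OF X2(1)] e1 by simp
    obtain X3 where X3: "X2 \<doteq> X3" "Mix a b c \<in># X3"
      using adjust_side[OF e2 I _ X2(2), of C c] by (auto simp: Mix)
    show ?thesis using equiv_mon_trans X(1) X1(1) X2(1) X3 Mix by blast
  next
    case (Fwd p s)
    then obtain s' where "J = Fwd p s'" using J by auto
    then obtain X1 where "X \<doteq> X1" "I \<in># X1"
      using adjust_side[OF eqX I _ X(2), of "nxt p" s] by (auto simp: Fwd)
    then show ?thesis using equiv_mon_trans X(1) by blast
  next
    case (Bwd p s)
    then obtain s' where "J = Bwd p s'" using J by auto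
    then obtain X1 where "X \<doteq> X1" "I \<in># X1"
      using adjust_side[OF eqX I _ X(2), of "prv p" s] by (auto simp: Bwd)
    then show ?thesis using equiv_mon_trans X(1) by blast
  qed
qed

lemma same_key_equiv:
  assumes "size W = size W'" "key W = key W'"
  shows "W \<doteq> W'"
  using assms
proof (induction W' arbitrary: W)
  case empty
  then show ?case using equiv_mon_refl by auto
next
  case (add I W')
  obtain X where X: "W \<doteq> X" "I \<in># X" using common_triple[OF add.prems(2), of I] by auto
  then obtain Z where Z: "X = add_mset I Z" by (metis mset_add)
  have k: "key (Z + {#I#}) = key (W' + {#I#})" "size Z = size W'"
    using X(1) add.prems unfolding Z equiv_mon_def by auto
  have "Z \<doteq> W'" using add.IH[OF k(2) key_cancel[OF k(1)]] .
  from equiv_mon_union[OF this, of "{#I#}"] show ?case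
    using equiv_mon_trans[OF X(1)] unfolding Z by simp
qed

definition keys_of_degree :: "nat \<Rightarrow> (nat \<times> (pr \<Rightarrow> nat) \<times> (pr \<Rightarrow> nat) \<times> (pr \<Rightarrow> int)) set" where
  "keys_of_degree d = key ` {W. size W = d}"

definition rep :: "nat \<Rightarrow> nat \<times> (pr \<Rightarrow> nat) \<times> (pr \<Rightarrow> nat) \<times> (pr \<Rightarrow> int) \<Rightarrow> tri multiset" where
  "rep d k = (SOME W. size W = d \<and> key W = k)"

lemma rep: "k \<in> keys_of_degree d \<Longrightarrow> size (rep d k) = d \<and> key (rep d k) = k"
  unfolding rep_def keys_of_degree_def by (rule someI_ex) auto

text \<open>Each monomial is equivalent to the representative of its key up to lower terms, which have fewer mixed
  factors and are treated by induction.\<close>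

lemma straightening:
  assumes "size W = d"
  shows "mon W \<in> fn.span ({mon (rep d k) | k. k \<in> keys_of_degree d} \<union>
      {(\<lambda>v. concurrency v * mon X v) | X. size X + 2 = d})" (is "_ \<in> fn.span ?S")
  using assms
proof (induction "nMix W" arbitrary: W rule: less_induct)
  case less
  define R where "R = rep d (key W)"
  have k: "key W \<in> keys_of_degree d" using less.prems by (auto simp: keys_of_degree_def)
  have R: "size R = d" "key R = key W" using rep[OF k] by (auto simp: R_def)
  have "W \<doteq> R" by (rule same_key_equiv) (use R less.prems in auto)
  then have "(\<lambda>v. mon W v - mon R v) \<in> lows (nMix W) d"
    unfolding equiv_mon_def less.prems by (elim conjE)
  moreover have "lows (nMix W) d \<subseteq> fn.span ?S" unfolding lows_def
  proof (rule fn.span_minimal[OF _ fn.subspace_span], rule Un_least)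
    show "{mon X |X. size X = d \<and> nMix X < nMix W} \<subseteq> fn.span ?S" using less.hyps by blast
    show "{(\<lambda>v. concurrency v * mon X v) | X. size X + 2 = d} \<subseteq> fn.span ?S"
      by (rule order_trans[OF _ fn.span_superset]) blast
  qed
  moreover have "mon R \<in> fn.span ?S" by (rule fn.span_base) (use k R_def in blast)
  ultimately have "(\<lambda>v. mon W v - mon R v) + mon R \<in> fn.span ?S" using fn.span_add by blast
  then show ?case by (simp add: plus_fun_def)
qed

section \<open>The two labellings of six vectors\<close>

text \<open>A triple of the first labelling pairs the vectors as \<open>12|34|56\<close>; rotating the indices gives
  the pairs \<open>23|45|61\<close>. A rotation of three indices is an even permutation, so that it does not
  change the signs of brackets.\<close>

fun corner :: "pr \<Rightarrow> bool \<Rightarrow> nat" where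
  "corner A s = (if s then 2 else 1)" | "corner B s = (if s then 4 else 3)" | "corner C s = (if s then 6 else 5)"

definition shift :: "nat \<Rightarrow> nat \<Rightarrow> nat" where
  "shift r i = (if i + r \<le> 6 then i + r else i + r - 6)"

definition conf :: "nat \<Rightarrow> (nat \<Rightarrow> complex^3) \<Rightarrow> config" where
  "conf r V p s = V (shift r (corner p s))"

fun corners :: "tri \<Rightarrow> nat \<times> nat \<times> nat" where
  "corners (Mix a b c) = (corner A a, corner B b, corner C c)"
| "corners (Fwd A s) = (1, 2, corner B s)" | "corners (Fwd B s) = (3, 4, corner C s)"
| "corners (Fwd C s) = (corner A s, 5, 6)"
| "corners (Bwd A s) = (1, 2, corner C s)" | "corners (Bwd B s) = (corner A s, 3, 4)"
| "corners (Bwd C s) = (corner B s, 5, 6)"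

definition shift_corners :: "nat \<Rightarrow> nat \<times> nat \<times> nat \<Rightarrow> nat \<times> nat \<times> nat" where
  "shift_corners r = (\<lambda>(i, j, k). if k + r \<le> 6 then (i + r, j + r, k + r) else (k + r - 6, i + r, j + r))"

definition idx :: "nat \<Rightarrow> tri \<Rightarrow> triple" where
  "idx r T = triple (shift_corners r (corners T))"

fun sg :: "tri \<Rightarrow> complex" where
  "sg (Fwd p s) = -1" | "sg (Mix a b c) = 1" | "sg (Bwd p s) = 1"

lemma sg_sq [simp]: "sg T * sg T = 1" "sg T \<noteq> 0" "sg T * (sg T * x) = x"
  by (cases T; simp)+

lemma tri_cases:
  "(\<And>a b c. P (Mix a b c)) \<Longrightarrow> (\<And>s. P (Fwd A s)) \<Longrightarrow> (\<And>s. P (Fwd B s)) \<Longrightarrow> (\<And>s. P (Fwd C s)) \<Longrightarrow>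
   (\<And>s. P (Bwd A s)) \<Longrightarrow> (\<And>s. P (Bwd B s)) \<Longrightarrow> (\<And>s. P (Bwd C s)) \<Longrightarrow> P T"
proof (cases T)
  case (Mix a b c)
  assume "\<And>a b c. P (Mix a b c)"
  then show "P T" unfolding Mix .
next
  case (Fwd p s)
  assume "\<And>s. P (Fwd A s)" "\<And>s. P (Fwd B s)" "\<And>s. P (Fwd C s)"
  then show "P T" unfolding Fwd by (cases p) simp_all
next
  case (Bwd p s)
  assume "\<And>s. P (Bwd A s)" "\<And>s. P (Bwd B s)" "\<And>s. P (Bwd C s)"
  then show "P T" unfolding Bwd by (cases p) simp_all
qed

lemma indices_idx:
  assumes "r \<le> 1" shows "indices (idx r T) = shift_corners r (corners T)"
proof -
  have "shift_corners r (corners T) \<in> {(i, j, k). 1 \<le> i \<and> i < j \<and> j < k \<and> k \<le> 6}"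
    using assms by (induction T rule: tri_cases) (auto simp: shift_corners_def)
  then show ?thesis unfolding idx_def by (rule triple_inverse)
qed

lemma y_conf:
  assumes "r \<le> 1" shows "y (conf r V) T = sg T * plk V $ idx r T"
proof -
  from assms have "r = 0 \<or> r = 1" by auto
  then show ?thesis unfolding plk_def
    by (induction T rule: tri_cases)
      (auto simp: indices_idx shift_corners_def conf_def shift_def br_rotate eval_nat_numeral)
qed

lemma triple_list:
  assumes "1 \<le> i" "i < j" "j < k" "k \<le> (6::nat)"
  shows "(i, j, k) \<in> {(1,2,3),(1,2,4),(1,2,5),(1,2,6),(1,3,4),(1,3,5),(1,3,6),(1,4,5),(1,4,6),(1,5,6),
    (2,3,4),(2,3,5),(2,3,6),(2,4,5),(2,4,6),(2,5,6),(3,4,5),(3,4,6),(3,5,6),(4,5,6)}"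
proof -
  have "i = 1 \<or> i = 2 \<or> i = 3 \<or> i = 4" "j = 2 \<or> j = 3 \<or> j = 4 \<or> j = 5" "k = 3 \<or> k = 4 \<or> k = 5 \<or> k = 6"
    using assms by linarith+
  then show ?thesis using assms by (elim disjE) simp_all
qed

text \<open>The inverse of \<open>corners\<close>: the classification of the triples by the number of elements in
  each pair.\<close>

definition of_corners :: "nat \<times> nat \<times> nat \<Rightarrow> tri" where
  "of_corners = (\<lambda>(i, j, k).
    if i \<le> 2 \<and> 3 \<le> j \<and> j \<le> 4 \<and> 5 \<le> k then Mix (i = 2) (j = 4) (k = 6)
     else if j = 2 then (if k \<le> 4 then Fwd A (k = 4) else Bwd A (k = 6))
     else if j = 5 then (if i \<le> 2 then Fwd C (i = 2) else Bwd C (i = 4))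
     else if i = 3 then Fwd B (k = 6) else Bwd B (i = 2))"

lemma corners_inverse: "of_corners (corners T) = T"
proof -
  have "\<forall>a b c. of_corners (corners (Mix a b c)) = Mix a b c"
    by (simp add: all_bool_eq of_corners_def)
  moreover have "\<forall>s. of_corners (corners (Fwd A s)) = Fwd A s" "\<forall>s. of_corners (corners (Fwd B s)) = Fwd B s"
    "\<forall>s. of_corners (corners (Fwd C s)) = Fwd C s" "\<forall>s. of_corners (corners (Bwd A s)) = Bwd A s"
    "\<forall>s. of_corners (corners (Bwd B s)) = Bwd B s" "\<forall>s. of_corners (corners (Bwd C s)) = Bwd C s"
    by (simp_all add: all_bool_eq of_corners_def)
  ultimately show ?thesis using tri_cases[of "\<lambda>T. of_corners (corners T) = T" T] by blast
qed

text \<open>Injectivity suffices, since both types have twenty elements.\<close>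

lemma bij_idx:
  assumes "r \<le> 1" shows "bij (idx r)"
proof -
  have r: "r = 0 \<or> r = 1" using assms by auto
  have "inj (idx r)"
  proof (rule injI)
    fix S T assume "idx r S = idx r T"
    then have "shift_corners r (corners S) = shift_corners r (corners T)" using indices_idx[OF assms] by metis
    moreover have "fst (corners X) > 0 \<and> fst (corners X) < fst (snd (corners X)) \<and> snd (snd (corners X)) \<le> 6" for X
      by (induction X rule: tri_cases) simp_all
    from this[of S] this[of T] calculation have "corners S = corners T"
      using r by (cases "corners S"; cases "corners T") (auto simp: shift_corners_def split: if_splits)
    then show "S = T" using corners_inverse by metis
  qed
  moreover have "surj (idx r)"
  proof -
    let ?S = "{Mix True True True, Mix True True False, Mix True False True, Mix True False False,
      Mix False True True, Mix False True False, Mix False False True, Mix False False False,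
      Fwd A True, Fwd A False, Fwd B True, Fwd B False, Fwd C True, Fwd C False,
      Bwd A True, Bwd A False, Bwd B True, Bwd B False, Bwd C True, Bwd C False}"
    let ?L = "{(1,2,3),(1,2,4),(1,2,5),(1,2,6),(1,3,4),(1,3,5),(1,3,6),(1,4,5),(1,4,6),(1,5,6),
    (2,3,4),(2,3,5),(2,3,6),(2,4,5),(2,4,6),(2,5,6),(3,4,5),(3,4,6),(3,5,6),(4,5,6)} :: (nat \<times> nat \<times> nat) set"
    have "UNIV \<subseteq> triple ` ?L"
    proof
      fix t
      obtain i j k where t: "indices t = (i, j, k)" by (metis prod_cases3)
      have "t = triple (i, j, k)" using t by (metis indices_inverse)
      then show "t \<in> triple ` ?L" by (rule image_eqI[OF _ triple_list[OF indices_bounds[OF t]]])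
    qed
    then have "card (UNIV :: triple set) \<le> card (triple ` ?L)" by (intro card_mono) auto
    also have "\<dots> \<le> card ?L" by (rule card_image_le) simp
    also have "\<dots> \<le> 20" by simp
    also have "20 \<le> card (idx r ` ?S)"
    proof -
      have "card (idx r ` ?S) = card ?S" by (rule card_image[OF inj_on_subset[OF \<open>inj (idx r)\<close> subset_UNIV]])
      then show ?thesis by simp
    qed
    finally have "card (UNIV :: triple set) \<le> card (idx r ` ?S)" .
    from card_seteq[OF finite subset_UNIV this] have "idx r ` ?S = UNIV" .
    then show ?thesis by blast
  qed
  ultimately show ?thesis by (rule bijI)
qed

lemma finite_tri: "finite (UNIV :: tri set)"
  by (rule finite_imageD[of "idx 0"]) (use bij_is_inj[OF bij_idx[of 0]] in simp_all)

lemma eval_const [simp]: "eval (Poly_Mapping.single 0 c) v = c"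
  by (simp add: eval_single)

lemma finite_keys: "finite (keys_of_degree d)"
proof -
  have "{W :: tri multiset. size W = d} \<subseteq> mset ` {xs. set xs \<subseteq> UNIV \<and> length xs = d}"
    by (auto simp: image_iff) (metis ex_mset size_mset)
  then show ?thesis unfolding keys_of_degree_def
    using finite_lists_length_eq[OF finite_tri, of d] by (meson finite_imageI finite_subset)
qed

text \<open>The monomials in the signed coordinates, as polynomials in the Pluecker coordinates.\<close>

definition YM :: "nat \<Rightarrow> tri multiset \<Rightarrow> (triple, complex) mpoly" where
  "YM r W = prod_mset (image_mset (\<lambda>T. Poly_Mapping.single 0 (sg T) * Var (idx r T)) W)"

lemma YM_forms: "YM r W \<in> forms (size W)"
proof (induction W)
  case (add T W)
  have "Poly_Mapping.single 0 (sg T) * Var (idx r T) \<in> forms 1" by (rule forms_scale[OF forms_Var])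
  from forms_mult[OF this add] show ?case by (simp add: YM_def)
qed (simp add: YM_def forms_one)

lemma eval_YM: assumes "r \<le> 1" shows "eval (YM r W) (plk V) = mon W (conf r V)"
  by (induction W) (simp_all add: YM_def eval_mult y_conf[OF assms])

lemma monomial_YM:
  assumes "r \<le> 1" "(\<Sum>t\<in>UNIV. Poly_Mapping.lookup m t) = d"
  obtains W c where "size W = d"
    "\<And>V. eval (Poly_Mapping.single m 1) (plk V) = c * mon W (conf r V)"
proof -
  define f where "f t = replicate_mset (Poly_Mapping.lookup m t) (inv (idx r) t)" for t
  define c where "c = (\<Prod>t\<in>UNIV. sg (inv (idx r) t) ^ Poly_Mapping.lookup m t)"
  have rep: "mon (replicate_mset n T) v = y v T ^ n" for n T v by (induction n) simp_all
  have mon_sum: "mon (\<Sum>t\<in>S. f t) v = (\<Prod>t\<in>S. mon (f t) v)" if "finite S" for S v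
    using that by (induction S rule: finite_induct) simp_all
  have size_sum: "size (\<Sum>t\<in>S. f t) = (\<Sum>t\<in>S. Poly_Mapping.lookup m t)" if "finite S" for S
    using that by (induction S rule: finite_induct) (simp_all add: f_def)
  have inv: "idx r (inv (idx r) t) = t" for t
    using bij_idx[OF assms(1)] by (simp add: bij_is_surj surj_f_inv_f)
  have "eval (Poly_Mapping.single m 1) (plk V) = c * mon (\<Sum>t\<in>UNIV. f t) (conf r V)" for V
  proof -
    have "sg (inv (idx r) t) * y (conf r V) (inv (idx r) t) = plk V $ t" for t
      unfolding y_conf[OF assms(1)] inv by simp
    then have "(plk V $ t) ^ Poly_Mapping.lookup m t
        = sg (inv (idx r) t) ^ Poly_Mapping.lookup m t * mon (f t) (conf r V)" for t
      unfolding f_def rep by (metis power_mult_distrib)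
    then show ?thesis unfolding c_def mon_sum[OF finite] eval_single by (simp add: prod.distrib)
  qed
  moreover have "size (\<Sum>t\<in>UNIV. f t) = d" using size_sum[OF finite] assms(2) by simp
  ultimately show ?thesis using that by blast
qed

definition quadric :: "nat \<Rightarrow> (triple, complex) mpoly" where
  "quadric r = YM r {#Fwd A True, Bwd C False#} - YM r {#Fwd A False, Bwd C True#}"

lemma eval_quadric: "r \<le> 1 \<Longrightarrow> eval (quadric r) (plk V) = concurrency (conf r V)"
  by (simp add: quadric_def eval_diff eval_YM concurrency_def br_rotate)

text \<open>Reducibility is compatible with sums and multiples, so that the straightening of monomials extends to
  all forms.\<close>

definition reduces :: "nat \<Rightarrow> nat \<Rightarrow> (config \<Rightarrow> complex) \<Rightarrow> bool" where
  "reduces r d f \<longleftrightarrow> (\<exists>c. \<exists>p\<in>(if d < 2 then {0} else forms (d - 2)). \<forall>V. f (conf r V) =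
     (\<Sum>k\<in>keys_of_degree d. c k * mon (rep d k) (conf r V)) + concurrency (conf r V) * eval p (plk V))"

lemma reduces_add: "reduces r d f \<Longrightarrow> reduces r d g \<Longrightarrow> reduces r d (\<lambda>v. f v + g v)"
proof -
  assume "reduces r d f" "reduces r d g"
  then obtain c p c' p' where c: "p \<in> (if d < 2 then {0} else forms (d - 2))" "\<forall>V. f (conf r V) =
     (\<Sum>k\<in>keys_of_degree d. c k * mon (rep d k) (conf r V)) + concurrency (conf r V) * eval p (plk V)"
    and c': "p' \<in> (if d < 2 then {0} else forms (d - 2))" "\<forall>V. g (conf r V) =
     (\<Sum>k\<in>keys_of_degree d. c' k * mon (rep d k) (conf r V)) + concurrency (conf r V) * eval p' (plk V)"
    unfolding reduces_def by blast
  have "p + p' \<in> (if d < 2 then {0} else forms (d - 2))" using c(1) c'(1) by (auto intro: forms_add)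
  then show ?thesis unfolding reduces_def using c(2) c'(2)
    by (intro exI[of _ "\<lambda>k. c k + c' k"] bexI[of _ "p + p'"]) (simp_all add: distrib_left distrib_right sum.distrib eval_add)
qed

lemma reduces_scale: "reduces r d f \<Longrightarrow> reduces r d (\<lambda>v. a * f v)"
proof -
  assume "reduces r d f"
  then obtain c p where c: "p \<in> (if d < 2 then {0} else forms (d - 2))" "\<forall>V. f (conf r V) =
     (\<Sum>k\<in>keys_of_degree d. c k * mon (rep d k) (conf r V)) + concurrency (conf r V) * eval p (plk V)"
    unfolding reduces_def by blast
  have "Poly_Mapping.single 0 a * p \<in> (if d < 2 then {0} else forms (d - 2))"
    using c(1) by (auto intro: forms_scale)
  then show ?thesis unfolding reduces_def using c(2)
    by (intro exI[of _ "\<lambda>k. a * c k"] bexI[of _ "Poly_Mapping.single 0 a * p"])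
      (simp_all add: distrib_left sum_distrib_left mult.assoc mult.left_commute)
qed

lemma reduces_mon:
  assumes r: "r \<le> 1" and W: "size W = d" shows "reduces r d (mon W)"
  using straightening[OF W]
proof (induction rule: fn.span_induct_alt)
  case base
  show ?case unfolding reduces_def by (intro exI[of _ "\<lambda>_. 0"] bexI[of _ 0]) auto
next
  case (step a f g)
  have "reduces r d f"
  proof (cases "\<exists>k. f = mon (rep d k) \<and> k \<in> keys_of_degree d")
    case True
    then obtain k where k: "f = mon (rep d k)" "k \<in> keys_of_degree d" by blast
    have "(\<Sum>j\<in>keys_of_degree d. (if j = k then 1 else 0) * mon (rep d j) v) = mon (rep d k) v" for v
      using k(2) finite_keys[of d] by (subst sum.mono_neutral_right[of _ "{k}"]) auto
    then show ?thesis unfolding reduces_def k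
      by (intro exI[of _ "\<lambda>j. if j = k then 1 else 0"] bexI[of _ 0]) auto
  next
    case False
    then obtain X where X: "f = (\<lambda>v. concurrency v * mon X v)" "size X + 2 = d" using step(1) by blast
    then have "YM r X \<in> (if d < 2 then {0} else forms (d - 2))" using YM_forms[of r X] by auto
    then show ?thesis unfolding reduces_def X(1)
      by (intro exI[of _ "\<lambda>_. 0"] bexI[of _ "YM r X"]) (simp_all add: eval_YM[OF r])
  qed
  then show ?case using reduces_add[OF reduces_scale[of r d f a] step(2)] by (simp add: plus_fun_def)
qed

lemma forms_reduce:
  assumes r: "r \<le> 1" and p: "p \<in> forms d"
  shows "\<exists>c. \<exists>q\<in>(if d < 2 then {0} else forms (d - 2)). \<forall>V. eval p (plk V) =
     (\<Sum>k\<in>keys_of_degree d. c k * mon (rep d k) (conf r V)) + concurrency (conf r V) * eval q (plk V)"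
proof -
  have "\<exists>f. reduces r d f \<and> (\<forall>V. eval p (plk V) = f (conf r V))"
    using p
  proof (induction rule: forms_induct)
    case zero
    have "reduces r d (\<lambda>v. 0)"
      unfolding reduces_def by (intro exI[of _ "\<lambda>_. 0"] bexI[of _ 0]) auto
    then show ?case by auto
  next
    case (add p q)
    then show ?case using reduces_add unfolding eval_add by metis
  next
    case (scale m c)
    obtain W b where W: "size W = d" "\<And>V. eval (Poly_Mapping.single m 1) (plk V) = b * mon W (conf r V)"
      using monomial_YM[OF r scale] by blast
    have "eval (Poly_Mapping.single m c) v = c * eval (Poly_Mapping.single m 1) v" for v
      by (simp add: eval_single)
    then have "eval (Poly_Mapping.single m c) (plk V) = (c * b) * mon W (conf r V)" for V
      using W(2) by simp
    then show ?case using reduces_scale[OF reduces_mon[OF r W(1)], of "c * b"] by blast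
  qed
  then obtain f c q where "q \<in> (if d < 2 then {0} else forms (d - 2))" "\<forall>V. eval p (plk V) = f (conf r V)"
    "\<forall>V. f (conf r V) = (\<Sum>k\<in>keys_of_degree d. c k * mon (rep d k) (conf r V)) + concurrency (conf r V) * eval q (plk V)"
    unfolding reduces_def by blast
  then show ?thesis by (intro exI[of _ c] bexI[of _ q]) simp_all
qed

definition KV :: "nat \<Rightarrow> (complex^triple) set" where
  "KV r = {plk V | V. plk V \<noteq> 0 \<and> concurrency (conf r V) = 0}"

lemma KV_reduce:
  assumes "r \<le> 1" "p \<in> forms d"
  shows "combination_on (KV r) (keys_of_degree d) (\<lambda>k. eval (YM r (rep d k))) (eval p)"
proof -
  obtain c q where c: "\<forall>V. eval p (plk V) = (\<Sum>k\<in>keys_of_degree d. c k * mon (rep d k) (conf r V))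
      + concurrency (conf r V) * eval q (plk V)"
    using forms_reduce[OF assms] by blast
  show ?thesis unfolding combination_on_def KV_def
    by (intro exI[of _ c]) (use c in \<open>auto simp: eval_YM[OF assms(1)]\<close>)
qed

text \<open>On the whole Grassmannian the quotient by the quadric is reduced again, in degree \<open>d - 2\<close>,
  so that the representatives times powers of the quadric span.\<close>

lemma hilb_le_Gr:
  "hilb_le (cone Gr36) d (\<Sum>i\<le>d div 2. card (keys_of_degree (d - 2 * i)))"
proof (induction d rule: less_induct)
  case (less d)
  show ?case
  proof (cases "d < 2")
    case True
    have "hilb_le (cone Gr36) d (card (keys_of_degree d))"
    proof (rule hilb_leI[OF finite_keys])
      fix p :: "(triple, complex) mpoly" assume p: "p \<in> forms d"
      show "combination_on (cone Gr36) (keys_of_degree d) (\<lambda>k. eval (YM 0 (rep d k))) (eval p)"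
        using forms_reduce[OF _ p, of 0] True unfolding combination_on_def cone_Gr36
        by (auto simp: eval_YM)
    qed
    then show ?thesis using True by simp
  next
    case False
    define n where "n = (\<Sum>i\<le>(d - 2) div 2. card (keys_of_degree (d - 2 - 2 * i)))"
    have "hilb_le (cone Gr36) (d - 2) n" unfolding n_def by (rule less) (use False in auto)
    then obtain f where f: "\<forall>p\<in>forms (d - 2). combination_on (cone Gr36) {..<n} f (eval p)"
      unfolding hilb_le_def by blast
    let ?J = "Inl ` keys_of_degree d \<union> Inr ` {..<n}"
    let ?g = "case_sum (\<lambda>k. eval (YM 0 (rep d k))) (\<lambda>i v. eval (quadric 0) v * f i v)"
    have "hilb_le (cone Gr36) d (card ?J)"
    proof (rule hilb_leI)
      show "finite ?J" using finite_keys by auto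
      fix p :: "(triple, complex) mpoly" assume p: "p \<in> forms d"
      obtain c q where q: "q \<in> forms (d - 2)" and c: "\<forall>V. eval p (plk V) =
         (\<Sum>k\<in>keys_of_degree d. c k * mon (rep d k) (conf 0 V)) + concurrency (conf 0 V) * eval q (plk V)"
        using forms_reduce[OF _ p, of 0] False by auto
      obtain b where b: "\<forall>v\<in>cone Gr36. eval q v = (\<Sum>i<n. b i * f i v)"
        using f q unfolding combination_on_def by blast
      have "eval p v = (\<Sum>j\<in>?J. case_sum c b j * ?g j v)" if v: "v \<in> cone Gr36" for v
      proof -
        obtain V where V: "v = plk V" using v by (auto simp: cone_Gr36)
        have "(\<Sum>j\<in>?J. case_sum c b j * ?g j v) = (\<Sum>k\<in>keys_of_degree d. c k * eval (YM 0 (rep d k)) v)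
            + (\<Sum>i<n. b i * (eval (quadric 0) v * f i v))"
          using finite_keys by (subst sum.union_disjoint) (auto simp: sum.reindex inj_on_def)
        also have "(\<Sum>i<n. b i * (eval (quadric 0) v * f i v)) = eval (quadric 0) v * eval q v"
          unfolding b[rule_format, OF v] sum_distrib_left by (rule sum.cong) (simp_all add: mult_ac)
        finally show ?thesis unfolding V using c by (simp add: eval_YM eval_quadric)
      qed
      then show "combination_on (cone Gr36) ?J ?g (eval p)"
        unfolding combination_on_def by blast
    qed
    moreover have "card ?J = card (keys_of_degree d) + n"
      using finite_keys by (subst card_Un_disjoint) (auto simp: card_image)
    moreover have "(\<Sum>i\<le>d div 2. card (keys_of_degree (d - 2 * i))) = card (keys_of_degree d) + n"
    proof -
      have "d div 2 = Suc ((d - 2) div 2)" using False by (metis div2_Suc_Suc add_2_eq_Suc le_add_diff_inverse not_less)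
      then show ?thesis unfolding n_def by (simp add: sum.atMost_Suc_shift del: sum.atMost_Suc)
    qed
    ultimately show ?thesis by simp
  qed
qed

section \<open>Generic configurations with concurrent lines\<close>

text \<open>Up to the action of the linear group, the pairs \<open>(u, p + b u)\<close> with a common vector \<open>p\<close>, scaled
  by arbitrary factors, are the configurations with concurrent lines. The basis is normalised such
  that the coordinates are monomials, up to the factors belonging to mixed triples.\<close>

fun base :: "complex \<Rightarrow> pr \<Rightarrow> complex^3" where
  "base \<rho> A = vector [0, 1, 0]" | "base \<rho> B = vector [0, 0, 1]" | "base \<rho> C = vector [\<rho>, -1, -1]"

definition apex :: "complex^3" where "apex = vector [1, 0, 0]"

definition pencil :: "complex \<Rightarrow> (pr \<Rightarrow> complex) \<Rightarrow> (pr \<Rightarrow> bool \<Rightarrow> complex) \<Rightarrow> config" where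
  "pencil \<rho> b t p s = t p s *s (if s then apex + b p *s base \<rho> p else base \<rho> p)"

lemma vec3_simps [simp]:
  "apex $ 1 = 1" "apex $ 2 = 0" "apex $ 3 = 0"
  "base \<rho> A $ 1 = 0" "base \<rho> A $ 2 = 1" "base \<rho> A $ 3 = 0"
  "base \<rho> B $ 1 = 0" "base \<rho> B $ 2 = 0" "base \<rho> B $ 3 = 1"
  "base \<rho> C $ 1 = \<rho>" "base \<rho> C $ 2 = -1" "base \<rho> C $ 3 = -1"
  by (simp_all add: apex_def)

definition scaling :: "(pr \<Rightarrow> bool \<Rightarrow> 'a::comm_monoid_mult) \<Rightarrow> tri \<Rightarrow> 'a" where
  "scaling t T = (case T of Mix a b c \<Rightarrow> t A a * t B b * t C c
     | Fwd p s \<Rightarrow> t p False * t p True * t (nxt p) s | Bwd p s \<Rightarrow> t p False * t p True * t (prv p) s)"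

definition slopes :: "(pr \<Rightarrow> 'a::comm_monoid_mult) \<Rightarrow> tri \<Rightarrow> 'a" where
  "slopes b T = (\<Prod>p\<in>{A, B, C}. if side p T = Some True then b p else 1)"

definition mixed_factor :: "complex \<Rightarrow> (pr \<Rightarrow> complex) \<Rightarrow> tri \<Rightarrow> complex" where
  "mixed_factor \<rho> b T = (if isMix T then \<rho> + (\<Sum>p\<in>{A, B, C}. if side p T = Some True then inverse (b p) else 0) else 1)"

lemma y_pencil:
  assumes "\<And>p. b p \<noteq> 0"
  shows "y (pencil \<rho> b t) T = scaling t T * slopes b T * mixed_factor \<rho> b T"
proof -
  have "b A \<noteq> 0" "b B \<noteq> 0" "b C \<noteq> 0" using assms by auto
  then show ?thesis
    by (induction T rule: tri_cases)
      (auto simp: pencil_def scaling_def slopes_def mixed_factor_def br_def field_simps split: if_splits)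
qed

lemma concurrency_pencil: "concurrency (pencil \<rho> b t) = 0"
  unfolding concurrency_def pencil_def br_def by simp

definition unconf :: "nat \<Rightarrow> config \<Rightarrow> nat \<Rightarrow> complex^3" where
  "unconf r v i = (let j = (if i > r then i - r else i + 6 - r) in
     if j = 1 then v A False else if j = 2 then v A True else if j = 3 then v B False
     else if j = 4 then v B True else if j = 5 then v C False else v C True)"

lemma unconf_ex: "\<exists>p s. \<forall>v. unconf r v i = v p s"
proof -
  define j where "j = (if i > r then i - r else i + 6 - r)"
  show ?thesis unfolding unconf_def j_def[symmetric] Let_def
    by (cases "j = 1"; cases "j = 2"; cases "j = 3"; cases "j = 4"; cases "j = 5") auto
qed

lemma conf_unconf: "r \<le> 1 \<Longrightarrow> conf r (unconf r v) = v"
proof (intro ext)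
  fix p s assume "r \<le> 1"
  then have "r = 0 \<or> r = 1" by auto
  then show "conf r (unconf r v) p s = v p s"
    by (cases p; cases s) (auto simp: conf_def unconf_def shift_def Let_def)
qed

definition KW :: "nat \<Rightarrow> (complex^triple) set" where
  "KW r = {plk (unconf r (pencil \<rho> b t)) | \<rho> b t. (\<forall>p. b p \<noteq> 0) \<and> (\<forall>p s. t p s \<noteq> 0)}"

lemma plk_nonzero_if: "r \<le> 1 \<Longrightarrow> y (conf r V) T \<noteq> 0 \<Longrightarrow> plk V \<noteq> 0"
  by (auto simp: y_conf)

lemma KW_nonzero:
  assumes r: "r \<le> 1" and "\<forall>p. b p \<noteq> 0" "\<forall>p s. t p s \<noteq> 0"
  shows "plk (unconf r (pencil \<rho> b t)) \<noteq> 0"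
proof (rule plk_nonzero_if[OF r, of _ "Fwd A False"])
  show "y (conf r (unconf r (pencil \<rho> b t))) (Fwd A False) \<noteq> 0"
    unfolding conf_unconf[OF r] using y_pencil[of b \<rho> t "Fwd A False"] assms
    by (simp add: scaling_def slopes_def mixed_factor_def)
qed

lemma KW_subset_KV: "r \<le> 1 \<Longrightarrow> KW r \<subseteq> KV r"
  unfolding KW_def KV_def using KW_nonzero by (auto simp: conf_unconf concurrency_pencil)

text \<open>The set of these configurations is irreducible, being parametrised by an open subset of a
  vector space.\<close>

lemma prime_cone_KW:
  assumes r: "r \<le> 1" shows "prime_cone (KW r)"
proof (rule prime_cone_curves)
  fix x z assume "x \<in> KW r" "z \<in> KW r"
  then obtain \<rho> b t \<rho>' b' t' where x: "x = plk (unconf r (pencil \<rho> b t))" "\<forall>p. b p \<noteq> 0" "\<forall>p s. t p s \<noteq> 0"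
    and z: "z = plk (unconf r (pencil \<rho>' b' t'))" "\<forall>p. b' p \<noteq> 0" "\<forall>p s. t' p s \<noteq> 0"
    unfolding KW_def by blast
  define R where "R s = \<rho> + s * (\<rho>' - \<rho>)" for s
  define bb where "bb s p = b p + s * (b' p - b p)" for s p
  define tt where "tt s p q = t p q + s * (t' p q - t p q)" for s p q
  define g where "g s = plk (unconf r (pencil (R s) (bb s) (tt s)))" for s
  have lin: "polynomial_fun R" "polynomial_fun (\<lambda>s. bb s p)" "polynomial_fun (\<lambda>s. tt s p q)" for p q
    unfolding R_def[abs_def] bb_def tt_def by (intro polynomial_fun_add polynomial_fun_mult; simp)+
  have bs: "polynomial_fun (\<lambda>s. base (R s) p $ i)" for p i
    using exhaust_3[of i] lin(1) by (cases p) auto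
  have pn: "polynomial_fun (\<lambda>s. pencil (R s) (bb s) (tt s) p q $ i)" for p q i
    unfolding pencil_def by (cases q)
      (simp_all add: polynomial_fun_mult polynomial_fun_add lin bs)
  have "polynomial_fun (\<lambda>s. g s $ i)" for i
    unfolding g_def
  proof (rule polynomial_fun_plk)
    fix j k
    obtain p s where "\<forall>v. unconf r v j = v p s" using unconf_ex by blast
    then show "polynomial_fun (\<lambda>s. unconf r (pencil (R s) (bb s) (tt s)) j $ k)" by (simp add: pn)
  qed
  moreover have "g 0 = x" "g 1 = z"
    by (simp_all add: g_def x z R_def bb_def[abs_def] tt_def[abs_def])
  moreover have "finite {s. g s \<notin> KW r}"
  proof -
    have fb: "finite {s. bb s p = 0}" for p
      by (rule polynomial_fun_finite_zeros[OF lin(2), of 0]) (use x in \<open>simp add: bb_def\<close>)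
    have ft: "finite {s. tt s p q = 0}" for p q
      by (rule polynomial_fun_finite_zeros[OF lin(3), of 0]) (use x in \<open>simp add: tt_def\<close>)
    have "finite ((\<Union>p\<in>{A,B,C}. {s. bb s p = 0}) \<union> (\<Union>p\<in>{A,B,C}. \<Union>q\<in>{True,False}. {s. tt s p q = 0}))"
      using fb ft by (intro finite_UnI finite_UN_I) auto
    moreover have "{s. g s \<notin> KW r} \<subseteq> (\<Union>p\<in>{A,B,C}. {s. bb s p = 0}) \<union> (\<Union>p\<in>{A,B,C}. \<Union>q\<in>{True,False}. {s. tt s p q = 0})"
    proof
      fix s assume "s \<in> {s. g s \<notin> KW r}"
      then have "\<not> ((\<forall>p. bb s p \<noteq> 0) \<and> (\<forall>p q. tt s p q \<noteq> 0))" unfolding KW_def g_def by blast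
      then show "s \<in> (\<Union>p\<in>{A,B,C}. {s. bb s p = 0}) \<union> (\<Union>p\<in>{A,B,C}. \<Union>q\<in>{True,False}. {s. tt s p q = 0})"
      proof -
        have all: "{A, B, C} = UNIV" "{True, False} = UNIV" by (auto intro: pr.exhaust)
        show ?thesis using \<open>\<not> _\<close> unfolding all by blast
      qed
    qed
    ultimately show ?thesis by (rule rev_finite_subset)
  qed
  ultimately show "\<exists>g. (\<forall>i. polynomial_fun (\<lambda>t. g t $ i)) \<and> g 0 = x \<and> g 1 = z \<and> finite {t. g t \<notin> KW r}"
    by blast
qed

section \<open>Monomials with different keys are independent\<close>

lemma prod_mset_mult: "prod_mset (image_mset (\<lambda>x. f x * g x :: 'a::comm_monoid_mult) W)
    = prod_mset (image_mset f W) * prod_mset (image_mset g W)"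
  by (induction W) (auto simp: mult_ac)

text \<open>The exponents of the leading monomial: of \<open>\<rho>\<close>, of the \<open>b p\<close>, and of the \<open>t p s\<close>.\<close>

definition fulls :: "pr \<Rightarrow> tri multiset \<Rightarrow> nat" where "fulls p W = fwds p W + bwds p W"

definition falses :: "pr \<Rightarrow> tri multiset \<Rightarrow> nat" where
  "falses p W = size (filter_mset (\<lambda>T. side p T = Some False) W)"

lemma falses_simps [simp]: "falses p {#} = 0"
  "falses p (add_mset T W) = (if side p T = Some False then 1 else 0) + falses p W"
  by (simp_all add: falses_def)

lemma singles_split: "singles p W = trues p W + falses p W"
proof (induction W)
  case (add T W)
  then show ?case by (cases "side p T") auto
qed simp

definition expts :: "tri multiset \<Rightarrow> nat list" where
  "expts W = [nMix W, trues A W, trues B W, trues C W,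
     fulls A W + falses A W, fulls B W + falses B W, fulls C W + falses C W,
     fulls A W + trues A W, fulls B W + trues B W, fulls C W + trues C W]"

lemma expts_le: "e \<in> set (expts W) \<Longrightarrow> e \<le> size W"
proof -
  have f: "fulls p W + singles p W \<le> size W" for p
    unfolding fulls_def
  proof (induction W)
    case (add T W)
    then show ?case by (cases T) auto
  qed simp
  have n: "nMix W \<le> size W" unfolding nMix_def by (rule size_filter_mset_lesseq)
  assume "e \<in> set (expts W)"
  then show ?thesis using f[of A] f[of B] f[of C] n unfolding expts_def singles_split by auto
qed

lemma key_of_expts:
  assumes "expts W = expts X" shows "key W = key X"
proof -
  have t: "trues p W = trues p X" for p using assms by (cases p) (auto simp: expts_def)
  have n: "nMix W = nMix X" using assms by (simp add: expts_def)
  have f: "fulls p W = fulls p X" for p using assms t by (cases p) (auto simp: expts_def)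
  have s: "singles p W = singles p X" for p
    using assms t[of p] f[of p] unfolding singles_split by (cases p) (auto simp: expts_def)
  have "int (fwds p W) - int (fwds (nxt p) W) = int (fwds p X) - int (fwds (nxt p) X)" for p
    using s[of "prv p"] f[of p] n unfolding singles_eq[of "prv p"] fulls_def by simp
  then show ?thesis using t n s unfolding key_eq_iff by blast
qed

fun digits :: "nat \<Rightarrow> nat list \<Rightarrow> nat" where
  "digits N [] = 0" | "digits N (e # es) = e + N * digits N es"

lemma digits_inj:
  assumes "length es = length fs" "\<forall>e\<in>set es. e < N" "\<forall>e\<in>set fs. e < N" "digits N es = digits N fs"
  shows "es = fs"
  using assms
proof (induction es fs rule: list_induct2)
  case (Cons e es f fs)
  then have "e + N * digits N es = f + N * digits N fs" "e < N" "f < N" by auto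
  then have "e = f" "digits N es = digits N fs"
    by (metis mod_mult_self2 mod_less, metis add_left_imp_eq div_mult_self2 div_less mod_mult_self2 mod_less nat_mult_eq_cancel1 not_less_zero neq0_conv)
  then show ?case using Cons by auto
qed simp

definition weight :: "tri multiset \<Rightarrow> nat" where
  "weight W = digits (Suc (size W)) (expts W)"

lemma weight_inj:
  assumes "size W = size X" "weight W = weight X" shows "key W = key X"
proof (rule key_of_expts, rule digits_inj[where N = "Suc (size X)"])
  show "length (expts W) = length (expts X)" by (simp add: expts_def)
  show "\<forall>e\<in>set (expts W). e < Suc (size X)" using expts_le[of _ W] assms(1) le_imp_less_Suc by metis
  show "\<forall>e\<in>set (expts X). e < Suc (size X)" using expts_le[of _ X] le_imp_less_Suc by metis
  show "digits (Suc (size X)) (expts W) = digits (Suc (size X)) (expts X)"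
    using assms unfolding weight_def by simp
qed

lemma prod_scaling:
  "prod_mset (image_mset (scaling t) W) = (\<Prod>p\<in>{A, B, C}. t p False ^ (fulls p W + falses p W)) *
     (\<Prod>p\<in>{A, B, C}. t p True ^ (fulls p W + trues p W) :: complex)"
proof (induction W)
  case (add T W)
  show ?case unfolding image_mset_add_mset prod_mset.add_mset add
    by (induction T rule: tri_cases) (auto simp: scaling_def fulls_def split: if_splits)
qed (simp add: fulls_def)

lemma prod_slopes:
  "prod_mset (image_mset (slopes b) W) = (\<Prod>p\<in>{A, B, C}. b p ^ trues p W :: complex)"
proof (induction W)
  case (add T W)
  then show ?case by (simp add: slopes_def)
qed simp

definition correction :: "complex \<Rightarrow> (pr \<Rightarrow> complex) \<Rightarrow> tri \<Rightarrow> complex" where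
  "correction \<rho> b T = (if isMix T then 1 + (\<Sum>p\<in>{A, B, C}. if side p T = Some True then inverse (b p) * inverse \<rho> else 0) else 1)"

lemma prod_mixed_factor:
  assumes "\<rho> \<noteq> 0"
  shows "prod_mset (image_mset (mixed_factor \<rho> b) W) = \<rho> ^ nMix W * prod_mset (image_mset (correction \<rho> b) W)"
proof (induction W)
  case (add T W)
  have cancel: "\<rho> * (inverse (b p) * inverse \<rho>) = inverse (b p)" for p
    using assms by (simp add: mult.left_commute[of \<rho>])
  have "mixed_factor \<rho> b T = (if isMix T then \<rho> else 1) * correction \<rho> b T"
    unfolding mixed_factor_def correction_def by (simp add: distrib_left cancel)
  then show ?case using add by simp
qed simp

text \<open>The curve along which \<open>\<rho>\<close>, \<open>b\<close> and \<open>t\<close> grow like \<open>x\<close> to the powers \<open>1, N, N\<^sup>2, \<dots>\<close>: there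
  the order of growth of a monomial is its weight.\<close>

fun pos :: "pr \<Rightarrow> nat" where "pos A = 0" | "pos B = 1" | "pos C = 2"

definition grow_b :: "nat \<Rightarrow> real \<Rightarrow> pr \<Rightarrow> complex" where
  "grow_b N x p = of_real x ^ (N ^ (1 + pos p))"
definition grow_t :: "nat \<Rightarrow> real \<Rightarrow> pr \<Rightarrow> bool \<Rightarrow> complex" where
  "grow_t N x p s = of_real x ^ (N ^ (if s then 7 + pos p else 4 + pos p))"

lemma mon_growth:
  assumes "x > 0" "size W = d"
  shows "mon W (pencil (of_real x) (grow_b (Suc d) x) (grow_t (Suc d) x)) =
    of_real x ^ weight W * prod_mset (image_mset (correction (of_real x) (grow_b (Suc d) x)) W)"
proof -
  let ?z = "of_real x :: complex" and ?N = "Suc d"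
  have nz: "?z \<noteq> 0" using assms(1) by simp
  have nb: "grow_b ?N x p \<noteq> 0" for p using nz by (simp add: grow_b_def)
  have "mon W (pencil ?z (grow_b ?N x) (grow_t ?N x)) =
      prod_mset (image_mset (scaling (grow_t ?N x)) W) * prod_mset (image_mset (slopes (grow_b ?N x)) W)
       * prod_mset (image_mset (mixed_factor ?z (grow_b ?N x)) W)"
    unfolding mon_def y_pencil[of "grow_b ?N x", OF nb] prod_mset_mult ..
  also have "\<dots> = ?z ^ weight W * prod_mset (image_mset (correction ?z (grow_b ?N x)) W)"
  proof -
    define X where "X i = ?z ^ (?N ^ i)" for i
    have digit: "?z ^ (?N ^ i * digits ?N (e # es)) = X i ^ e * ?z ^ (?N ^ Suc i * digits ?N es)" for i e es
    proof -
      have "?N ^ i * digits ?N (e # es) = ?N ^ i * e + ?N ^ Suc i * digits ?N es"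
        by (simp add: algebra_simps)
      then show ?thesis by (simp only: X_def power_add power_mult)
    qed
    have "?z ^ weight W = ?z ^ (?N ^ 0 * digits ?N (expts W))" by (simp add: weight_def assms(2))
    also have "\<dots> = X 0 ^ nMix W * (X 1 ^ trues A W * (X 2 ^ trues B W * (X 3 ^ trues C W *
        (X 4 ^ (fulls A W + falses A W) * (X 5 ^ (fulls B W + falses B W) * (X 6 ^ (fulls C W + falses C W) *
        (X 7 ^ (fulls A W + trues A W) * (X 8 ^ (fulls B W + trues B W) * X 9 ^ (fulls C W + trues C W)))))))))"
      unfolding expts_def digit by (simp add: eval_nat_numeral)
    finally have w: "?z ^ weight W = \<dots>" .
    have b: "grow_b ?N x A = X 1" "grow_b ?N x B = X 2" "grow_b ?N x C = X 3"
      by (simp_all add: grow_b_def X_def eval_nat_numeral)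
    have t: "grow_t ?N x A False = X 4" "grow_t ?N x B False = X 5" "grow_t ?N x C False = X 6"
      "grow_t ?N x A True = X 7" "grow_t ?N x B True = X 8" "grow_t ?N x C True = X 9"
      by (simp_all add: grow_t_def X_def)
    have "X 0 = ?z" by (simp add: X_def)
    then show ?thesis
      unfolding prod_scaling prod_slopes prod_mixed_factor[OF nz] w by (simp add: b t mult_ac del: power_add)
  qed
  finally show ?thesis .
qed

lemma correction_tendsto:
  "((\<lambda>x. prod_mset (image_mset (correction (of_real x) (grow_b (Suc d) x)) W)) \<longlongrightarrow> 1) at_top"
proof (induction W)
  case (add T W)
  have z: "((\<lambda>x. inverse (grow_b (Suc d) x p) * inverse (complex_of_real x)) \<longlongrightarrow> 0) at_top" for p
  proof -
    have "((\<lambda>x::real. inverse x ^ (Suc d ^ (1 + pos p)) * inverse x) \<longlongrightarrow> 0 ^ (Suc d ^ (1 + pos p)) * 0) at_top"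
      by (intro tendsto_intros tendsto_inverse_0_at_top filterlim_ident)
    then have "((\<lambda>x::real. complex_of_real (inverse x ^ (Suc d ^ (1 + pos p)) * inverse x)) \<longlongrightarrow> of_real 0) at_top"
      by (intro tendsto_of_real) simp
    then show ?thesis by (simp add: grow_b_def power_inverse)
  qed
  have "((\<lambda>x. correction (of_real x) (grow_b (Suc d) x) T) \<longlongrightarrow> 1) at_top"
  proof (cases "isMix T")
    case True
    have "((\<lambda>x. 1 + (\<Sum>p\<in>{A, B, C}. if side p T = Some True then inverse (grow_b (Suc d) x p) * inverse (complex_of_real x) else 0))
        \<longlongrightarrow> 1 + (\<Sum>p\<in>{A, B, C}. 0)) at_top"
    proof (intro tendsto_add tendsto_sum tendsto_const)
      fix p
      show "((\<lambda>x. if side p T = Some True then inverse (grow_b (Suc d) x p) * inverse (complex_of_real x) else 0) \<longlongrightarrow> 0) at_top"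
        using z[of p] by (cases "side p T = Some True") simp_all
    qed
    then show ?thesis using True by (simp add: correction_def)
  qed (simp add: correction_def)
  from tendsto_mult[OF this add] show ?case by simp
qed simp

text \<open>In a relation, divide by the largest order of growth that occurs. In the limit only the coefficient of
  one representative survives, as different keys have different weights.\<close>

lemma KW_indep:
  assumes r: "r \<le> 1"
  shows "indep_on (KW r) (keys_of_degree d) (\<lambda>k. eval (YM r (rep d k)))"
  unfolding indep_on_def
proof (intro conjI allI impI finite_keys)
  fix c assume c: "\<forall>v\<in>KW r. (\<Sum>k\<in>keys_of_degree d. c k * eval (YM r (rep d k)) v) = 0"
  define w where "w k = weight (rep d k)" for k
  define H where "H k x = prod_mset (image_mset (correction (of_real x) (grow_b (Suc d) x)) (rep d k))" for k and x :: real
  have eq0: "(\<Sum>k\<in>keys_of_degree d. c k * (of_real x ^ w k * H k x)) = 0" if x: "x > 0" for x :: real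
  proof -
    have "plk (unconf r (pencil (of_real x) (grow_b (Suc d) x) (grow_t (Suc d) x))) \<in> KW r"
      unfolding KW_def using x by (intro CollectI exI conjI) (rule refl, auto simp: grow_b_def grow_t_def)
    then have "(\<Sum>k\<in>keys_of_degree d. c k * mon (rep d k) (pencil (of_real x) (grow_b (Suc d) x) (grow_t (Suc d) x))) = 0"
      using c by (auto simp: eval_YM[OF r] conf_unconf[OF r])
    then show ?thesis using mon_growth[OF x] rep by (simp add: w_def H_def)
  qed
  show "\<forall>k\<in>keys_of_degree d. c k = 0"
  proof (rule ccontr)
    assume "\<not> ?thesis"
    then have ne: "{k \<in> keys_of_degree d. c k \<noteq> 0} \<noteq> {}" by auto
    have fin: "finite {k \<in> keys_of_degree d. c k \<noteq> 0}" using finite_keys by auto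
    define m where "m = Max (w ` {k \<in> keys_of_degree d. c k \<noteq> 0})"
    have "m \<in> w ` {k \<in> keys_of_degree d. c k \<noteq> 0}" unfolding m_def using ne fin by (intro Max_in) auto
    then obtain k0 where k0: "k0 \<in> keys_of_degree d" "c k0 \<noteq> 0" "w k0 = m" by auto
    have less: "w k < m" if k: "k \<in> keys_of_degree d" "c k \<noteq> 0" "k \<noteq> k0" for k
    proof -
      have "w k \<le> m" unfolding m_def using fin k by (intro Max_ge) auto
      moreover have "w k \<noteq> w k0"
      proof
        assume "w k = w k0"
        then have "key (rep d k) = key (rep d k0)" unfolding w_def using rep k(1) k0(1) by (intro weight_inj) auto
        then show False using rep k k0(1) by metis
      qed
      ultimately show ?thesis using k0(3) by simp
    qed
    have lim: "((\<lambda>x. c k * (of_real (x ^ w k / x ^ m) * H k x)) \<longlongrightarrow> c k * (if k = k0 then 1 else 0)) at_top"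
      if k: "k \<in> keys_of_degree d" for k
    proof (cases "c k = 0")
      case False
      have "((\<lambda>x::real. x ^ w k / x ^ m) \<longlongrightarrow> (if k = k0 then 1 else 0)) at_top"
      proof (cases "k = k0")
        case True
        have "\<forall>\<^sub>F x::real in at_top. x ^ w k / x ^ m = 1"
          using eventually_gt_at_top[of 0] by eventually_elim (use True k0(3) in simp)
        then show ?thesis using True by (auto intro!: tendsto_eventually elim: eventually_mono)
      next
        case k: False
        have wk: "w k < m" using less[OF \<open>k \<in> keys_of_degree d\<close> False k] .
        have "\<forall>\<^sub>F x::real in at_top. inverse x ^ (m - w k) = x ^ w k / x ^ m"
          using eventually_gt_at_top[of 0]
        proof eventually_elim
          case (elim x)
          have "x ^ m = x ^ w k * x ^ (m - w k)" using wk by (simp flip: power_add)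
          then show ?case using elim by (simp add: field_simps)
        qed
        moreover have "((\<lambda>x::real. inverse x ^ (m - w k)) \<longlongrightarrow> 0 ^ (m - w k)) at_top"
          by (intro tendsto_intros tendsto_inverse_0_at_top filterlim_ident)
        ultimately show ?thesis using k wk tendsto_cong by (force simp: power_0_left)
      qed
      from tendsto_mult[OF tendsto_const tendsto_mult[OF tendsto_of_real[OF this] correction_tendsto[of d "rep d k"]], of "c k"]
      show ?thesis unfolding H_def by (auto split: if_splits)
    qed simp
    have "((\<lambda>x. \<Sum>k\<in>keys_of_degree d. c k * (of_real (x ^ w k / x ^ m) * H k x)) \<longlongrightarrow>
        (\<Sum>k\<in>keys_of_degree d. c k * (if k = k0 then 1 else 0))) at_top"
      by (rule tendsto_sum) (rule lim)
    moreover have "(\<Sum>k\<in>keys_of_degree d. c k * (if k = k0 then 1 else 0)) = c k0"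
      using k0(1) finite_keys by (subst sum.mono_neutral_right[of _ "{k0}"]) auto
    moreover have "\<forall>\<^sub>F x in at_top. (\<Sum>k\<in>keys_of_degree d. c k * (of_real (x ^ w k / x ^ m) * H k x)) = 0"
      using eventually_gt_at_top[of 0]
    proof eventually_elim
      case (elim x)
      have "(\<Sum>k\<in>keys_of_degree d. c k * (of_real (x ^ w k / x ^ m) * H k x)) =
          inverse (of_real x ^ m) * (\<Sum>k\<in>keys_of_degree d. c k * (of_real x ^ w k * H k x))"
        unfolding sum_distrib_left by (rule sum.cong) (simp_all add: field_simps)
      then show ?case using eq0[OF elim] by simp
    qed
    ultimately have "((\<lambda>x. 0) \<longlongrightarrow> c k0) (at_top :: real filter)" using tendsto_cong by force
    then have "c k0 = 0" by (simp add: tendsto_const_iff)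
    then show False using k0(2) by simp
  qed
qed

text \<open>Hence the chosen monomials are a basis in each degree, and no form can distinguish the generic
  configurations from all configurations with concurrent lines.\<close>

lemma vanishes_KW_KV:
  assumes r: "r \<le> 1" and p: "p \<in> forms d" and z: "\<forall>v\<in>KW r. eval p v = 0"
  shows "\<forall>v\<in>KV r. eval p v = 0"
proof -
  obtain c where c: "\<forall>v\<in>KV r. eval p v = (\<Sum>k\<in>keys_of_degree d. c k * eval (YM r (rep d k)) v)"
    using KV_reduce[OF r p] unfolding combination_on_def by blast
  then have "\<forall>v\<in>KW r. (\<Sum>k\<in>keys_of_degree d. c k * eval (YM r (rep d k)) v) = 0"
    using z subsetD[OF KW_subset_KV[OF r]] by auto
  then have "\<forall>k\<in>keys_of_degree d. c k = 0" using KW_indep[OF r, of d] unfolding indep_on_def by blast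
  then show ?thesis using c by simp
qed

lemma KV_indep:
  assumes r: "r \<le> 1"
  shows "indep_on (KV r) (keys_of_degree d) (\<lambda>k. eval (YM r (rep d k)))"
  using KW_indep[OF r, of d] KW_subset_KV[OF r] unfolding indep_on_def by (meson subsetD)

lemma prime_cone_KV:
  assumes r: "r \<le> 1" shows "prime_cone (KV r)"
  unfolding prime_cone_def
proof (intro allI ballI impI)
  fix a b p q assume pq: "p \<in> forms a" "q \<in> forms b" "\<forall>v\<in>KV r. eval p v * eval q v = 0"
  then have "\<forall>v\<in>KW r. eval p v * eval q v = 0" using KW_subset_KV[OF r] by blast
  then have "(\<forall>v\<in>KW r. eval p v = 0) \<or> (\<forall>v\<in>KW r. eval q v = 0)"
    using prime_cone_KW[OF r] pq(1,2) unfolding prime_cone_def by blast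
  then show "(\<forall>v\<in>KV r. eval p v = 0) \<or> (\<forall>v\<in>KV r. eval q v = 0)"
    using vanishes_KW_KV[OF r] pq(1,2) by blast
qed

section \<open>Counting the keys\<close>

text \<open>A greedy construction: factors are added one by one, with side \<open>True\<close> as long as this is
  still required.\<close>

lemma realize_counts:
  fixes f g k :: "pr \<Rightarrow> nat"
  assumes "n = m + (f A + f B + f C) + (g A + g B + g C)" "\<And>p. k p \<le> m + f (prv p) + g (nxt p)"
  shows "\<exists>W. nMix W = m \<and> (\<forall>p. fwds p W = f p) \<and> (\<forall>p. bwds p W = g p) \<and> (\<forall>p. trues p W = k p)"
  using assms
proof (induction n arbitrary: m f g k)
  case 0
  then have "m = 0" "f A = 0" "f B = 0" "f C = 0" "g A = 0" "g B = 0" "g C = 0" by auto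
  moreover have "k A = 0" "k B = 0" "k C = 0" using 0(2)[of A] 0(2)[of B] 0(2)[of C] calculation by auto
  ultimately show ?case by (intro exI[of _ "{#}"]) (auto simp: all_pr)
next
  case (Suc n)
  consider "m > 0" | p where "f p > 0" | p where "g p > 0"
  proof -
    assume *: "m > 0 \<Longrightarrow> thesis" "\<And>p. f p > 0 \<Longrightarrow> thesis" "\<And>p. g p > 0 \<Longrightarrow> thesis"
    have "m > 0 \<or> f A > 0 \<or> f B > 0 \<or> f C > 0 \<or> g A > 0 \<or> g B > 0 \<or> g C > 0" using Suc.prems(1) by auto
    then show thesis using * by blast
  qed
  then show ?case
  proof cases
    case 1
    define k' where "k' p = k p - (if k p > 0 then 1 else 0)" for p
    have "\<exists>W. nMix W = m - 1 \<and> (\<forall>p. fwds p W = f p) \<and> (\<forall>p. bwds p W = g p) \<and> (\<forall>p. trues p W = k' p)"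
    proof (rule Suc.IH)
      show "n = m - 1 + (f A + f B + f C) + (g A + g B + g C)" using Suc.prems(1) 1 by simp
      show "k' p \<le> m - 1 + f (prv p) + g (nxt p)" for p using Suc.prems(2)[of p] 1 by (auto simp: k'_def)
    qed
    then obtain W where W: "nMix W = m - 1" "\<forall>p. fwds p W = f p" "\<forall>p. bwds p W = g p" "\<forall>p. trues p W = k' p" by blast
    show ?thesis
      by (intro exI[of _ "add_mset (Mix (k A > 0) (k B > 0) (k C > 0)) W"]) (use W 1 in \<open>auto simp: k'_def all_pr\<close>)
  next
    case (2 q)
    define k' where "k' p = k p - (if p = nxt q \<and> k p > 0 then 1 else 0)" for p
    define f' where "f' p = f p - (if p = q then 1 else 0)" for p
    have "\<exists>W. nMix W = m \<and> (\<forall>p. fwds p W = f' p) \<and> (\<forall>p. bwds p W = g p) \<and> (\<forall>p. trues p W = k' p)"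
    proof (rule Suc.IH)
      show "n = m + (f' A + f' B + f' C) + (g A + g B + g C)" using Suc.prems(1) 2 by (cases q) (auto simp: f'_def)
      show "k' p \<le> m + f' (prv p) + g (nxt p)" for p
        using Suc.prems(2)[of p] 2 by (cases p; cases q) (auto simp: k'_def f'_def)
    qed
    then obtain W where W: "nMix W = m" "\<forall>p. fwds p W = f' p" "\<forall>p. bwds p W = g p" "\<forall>p. trues p W = k' p" by blast
    show ?thesis
      by (intro exI[of _ "add_mset (Fwd q (k (nxt q) > 0)) W"]) (use W 2 in \<open>auto simp: k'_def f'_def\<close>)
  next
    case (3 q)
    define k' where "k' p = k p - (if p = prv q \<and> k p > 0 then 1 else 0)" for p
    define g' where "g' p = g p - (if p = q then 1 else 0)" for p
    have "\<exists>W. nMix W = m \<and> (\<forall>p. fwds p W = f p) \<and> (\<forall>p. bwds p W = g' p) \<and> (\<forall>p. trues p W = k' p)"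
    proof (rule Suc.IH)
      show "n = m + (f A + f B + f C) + (g' A + g' B + g' C)" using Suc.prems(1) 3 by (cases q) (auto simp: g'_def)
      show "k' p \<le> m + f (prv p) + g' (nxt p)" for p
        using Suc.prems(2)[of p] 3 by (cases p; cases q) (auto simp: k'_def g'_def)
    qed
    then obtain W where W: "nMix W = m" "\<forall>p. fwds p W = f p" "\<forall>p. bwds p W = g' p" "\<forall>p. trues p W = k' p" by blast
    show ?thesis
      by (intro exI[of _ "add_mset (Bwd q (k (prv q) > 0)) W"]) (use W 3 in \<open>auto simp: k'_def g'_def\<close>)
  qed
qed

lemma size_counts: "size W = nMix W + (fwds A W + fwds B W + fwds C W) + (bwds A W + bwds B W + bwds C W)"
proof (induction W)
  case (add T W)
  then show ?case by (induction T rule: tri_cases) auto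
qed simp

definition tuple :: "'a \<Rightarrow> 'a \<Rightarrow> 'a \<Rightarrow> pr \<Rightarrow> 'a" where
  "tuple u v w p = (case p of A \<Rightarrow> u | B \<Rightarrow> v | C \<Rightarrow> w)"

lemma tuple_simps [simp]: "tuple u v w A = u" "tuple u v w B = v" "tuple u v w C = w"
  by (simp_all add: tuple_def)

lemma tuple_eq: "tuple u v w = f \<longleftrightarrow> u = f A \<and> v = f B \<and> w = f C"
  by (auto simp: fun_eq_iff all_pr)

text \<open>Up to exchanging one \<open>Fwd\<close> of each kind for one \<open>Bwd\<close> of each kind, some \<open>Fwd\<close> does not occur;
  \<open>u, v, w\<close> are the numbers of the three kinds of \<open>Fwd\<close> after such an exchange.\<close>

definition cyc :: "nat \<Rightarrow> nat \<Rightarrow> nat \<Rightarrow> (nat \<times> nat \<times> nat) set" where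
  "cyc a b c = ({..a} \<times> {..b} \<times> {..c}) - ({1..a} \<times> {1..b} \<times> {1..c})"

definition parameters :: "nat \<Rightarrow> (nat \<times> nat \<times> nat \<times> (nat \<times> nat \<times> nat) \<times> nat \<times> nat \<times> nat) set" where
  "parameters d = (SIGMA a:{..d}. SIGMA b:{..d - a}. SIGMA c:{..d - a - b}.
     cyc a b c \<times> {..d - b - c} \<times> {..d - a - c} \<times> {..d - a - b})"

fun key_of :: "nat \<Rightarrow> nat \<times> nat \<times> nat \<times> (nat \<times> nat \<times> nat) \<times> nat \<times> nat \<times> nat \<Rightarrow>
    nat \<times> (pr \<Rightarrow> nat) \<times> (pr \<Rightarrow> nat) \<times> (pr \<Rightarrow> int)" where
  "key_of d (a, b, c, (u, v, w), kA, kB, kC) =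
    (d - a - b - c, tuple (d - b - c) (d - a - c) (d - a - b), tuple kA kB kC,
     tuple (int v - int w) (int w - int u) (int u - int v))"

lemma key_of_inj: "inj_on (key_of d) (parameters d)"
proof (rule inj_onI)
  fix s t assume par: "s \<in> parameters d" "t \<in> parameters d" and eq: "key_of d s = key_of d t"
  obtain a b c r kA kB kC where s: "s = (a, b, c, r, kA, kB, kC)" by (rule prod_cases7)
  obtain a' b' c' r' kA' kB' kC' where t: "t = (a', b', c', r', kA', kB', kC')" by (rule prod_cases7)
  obtain u v w where r: "r = (u, v, w)" by (rule prod_cases3)
  obtain u' v' w' where r': "r' = (u', v', w')" by (rule prod_cases3)
  have "a \<le> d \<and> b \<le> d - a \<and> c \<le> d - a - b" "a' \<le> d \<and> b' \<le> d - a' \<and> c' \<le> d - a' - b'"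
    and mem: "(u, v, w) \<in> cyc a b c" "(u', v', w') \<in> cyc a' b' c'"
    using par unfolding s t r r' by (simp_all add: parameters_def)
  then have le: "a + b + c \<le> d" "a' + b' + c' \<le> d" by linarith+
  have z: "u = 0 \<or> v = 0 \<or> w = 0" "u' = 0 \<or> v' = 0 \<or> w' = 0"
    using mem unfolding cyc_def by (auto simp: not_le)
  note * = eq[unfolded s t r r' key_of.simps prod.inject tuple_eq tuple_simps]
  have e: "d - a - b - c = d - a' - b' - c'" "d - b - c = d - b' - c'" "d - a - c = d - a' - c'"
    "d - a - b = d - a' - b'" "kA = kA'" "kB = kB'" "kC = kC'"
    "int v - int w = int v' - int w'" "int w - int u = int w' - int u'" "int u - int v = int u' - int v'"
    using * by blast+
  have "a + b + c = a' + b' + c'" using e(1) le by linarith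
  moreover have "b + c = b' + c'" using e(2) le by linarith
  moreover have "a + c = a' + c'" using e(3) le by linarith
  ultimately have "a = a'" "b = b'" "c = c'" by linarith+
  moreover have "u = u' \<and> v = v' \<and> w = w'" using z e(8-10) by (elim disjE) linarith+
  ultimately show "s = t" using e(5-7) unfolding s t r r' by simp
qed

lemma key_of_image: "key_of d ` parameters d = keys_of_degree d"
proof (rule set_eqI, rule iffI)
  fix \<kappa> assume "\<kappa> \<in> key_of d ` parameters d"
  then obtain a b c u v w kA kB kC where p: "(a, b, c, (u, v, w), kA, kB, kC) \<in> parameters d"
    and k: "\<kappa> = key_of d (a, b, c, (u, v, w), kA, kB, kC)" by (auto simp: parameters_def)
  have le: "a \<le> d" "b \<le> d - a" "c \<le> d - a - b" "u \<le> a" "v \<le> b" "w \<le> c"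
    "kA \<le> d - b - c" "kB \<le> d - a - c" "kC \<le> d - a - b" using p by (auto simp: parameters_def cyc_def)
  have "\<exists>W. nMix W = d - a - b - c \<and> (\<forall>p. fwds p W = tuple v w u p) \<and>
      (\<forall>p. bwds p W = tuple (c - w) (a - u) (b - v) p) \<and> (\<forall>p. trues p W = tuple kA kB kC p)"
  proof (rule realize_counts[OF refl])
    fix p show "tuple kA kB kC p \<le> d - a - b - c + tuple v w u (prv p) + tuple (c - w) (a - u) (b - v) (nxt p)"
      using le by (cases p) auto
  qed
  then obtain W where W: "nMix W = d - a - b - c" "\<forall>p. fwds p W = tuple v w u p"
    "\<forall>p. bwds p W = tuple (c - w) (a - u) (b - v) p" "\<forall>p. trues p W = tuple kA kB kC p" by blast
  have "size W = d" unfolding size_counts using W le by simp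
  moreover have "key W = \<kappa>" unfolding key_def k key_of.simps singles_eq
    using W le by (auto simp: fun_eq_iff all_pr)
  ultimately show "\<kappa> \<in> keys_of_degree d" unfolding keys_of_degree_def by blast
next
  fix \<kappa> assume "\<kappa> \<in> keys_of_degree d"
  then obtain W where W: "size W = d" "\<kappa> = key W" unfolding keys_of_degree_def by blast
  define m where "m = min (fwds A W) (min (fwds B W) (fwds C W))"
  define a b c where "a = fwds C W + bwds B W" "b = fwds A W + bwds C W" "c = fwds B W + bwds A W"
  note abc = this
  have d: "nMix W + a + b + c = d" using W(1) unfolding size_counts abc by simp
  have s: "singles A W = nMix W + a" "singles B W = nMix W + b" "singles C W = nMix W + c"
    unfolding singles_eq abc by simp_all
  have t: "trues p W \<le> singles p W" for p unfolding singles_split by simp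
  have mle: "m \<le> fwds A W" "m \<le> fwds B W" "m \<le> fwds C W" and meq: "m = fwds A W \<or> m = fwds B W \<or> m = fwds C W"
    unfolding m_def by auto
  have "(a, b, c, (fwds C W - m, fwds A W - m, fwds B W - m), trues A W, trues B W, trues C W) \<in> parameters d"
    using t[of A] t[of B] t[of C] d meq mle unfolding s parameters_def cyc_def
    by (auto simp: abc)
  moreover have "key_of d (a, b, c, (fwds C W - m, fwds A W - m, fwds B W - m), trues A W, trues B W, trues C W) = \<kappa>"
    unfolding W(2) key_def key_of.simps using d s mle by (auto simp: tuple_eq)
  ultimately show "\<kappa> \<in> key_of d ` parameters d" by (metis image_eqI)
qed

lemma card_cyc: "card (cyc a b c) = (a + 1) * (b + 1) * (c + 1) - a * b * c"
proof -
  have sub: "{1..a} \<times> {1..b} \<times> {1..c} \<subseteq> {..a} \<times> {..b} \<times> {..c}" by auto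
  have "card ({..a} \<times> {..b} \<times> {..c}) = (a + 1) * (b + 1) * (c + 1)"
    by (simp only: card_cartesian_product card_atMost Suc_eq_plus1 mult.assoc)
  moreover have "card ({1..a} \<times> {1..b} \<times> {1..c}) = a * b * c"
    by (simp add: card_cartesian_product mult.assoc)
  ultimately show ?thesis unfolding cyc_def by (subst card_Diff_subset[OF _ sub]) simp_all
qed

text \<open>Here \<open>a, b, c\<close> count the factors that are not mixed by the pair of which they contain a
  single vector. Given these, the \<open>trues\<close> vary independently between zero and the number of
  factors with a single vector of the respective pair.\<close>

lemma card_keys: "card (keys_of_degree d) = (\<Sum>a\<le>d. \<Sum>b\<le>d - a. \<Sum>c\<le>d - a - b.
    ((a + 1) * (b + 1) * (c + 1) - a * b * c) * ((d - b - c + 1) * ((d - a - c + 1) * (d - a - b + 1))))"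
proof -
  let ?C = "\<lambda>a b c. cyc a b c \<times> {..d - b - c} \<times> {..d - a - c} \<times> {..d - a - b}"
  have fin: "finite (?C a b c)" for a b c by (simp add: cyc_def)
  have "card (keys_of_degree d) = card (parameters d)"
    using card_image[OF key_of_inj] key_of_image by metis
  also have "\<dots> = (\<Sum>a\<le>d. card (SIGMA b:{..d - a}. SIGMA c:{..d - a - b}. ?C a b c))"
    unfolding parameters_def by (intro card_SigmaI ballI finite_SigmaI fin finite_atMost)
  also have "\<dots> = (\<Sum>a\<le>d. \<Sum>b\<le>d - a. card (SIGMA c:{..d - a - b}. ?C a b c))"
    by (intro sum.cong refl card_SigmaI ballI finite_SigmaI fin finite_atMost)
  also have "\<dots> = (\<Sum>a\<le>d. \<Sum>b\<le>d - a. \<Sum>c\<le>d - a - b. card (?C a b c))"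
    by (intro sum.cong refl card_SigmaI ballI fin finite_atMost)
  finally show ?thesis by (simp only: card_cartesian_product card_cyc card_atMost Suc_eq_plus1)
qed

text \<open>Antidifferences turn each of the three nested sums into an identity between polynomials.\<close>

lemma telescope:
  fixes F :: "real \<Rightarrow> real"
  assumes "\<And>i. i \<le> n \<Longrightarrow> g i = F (real i + 1) - F (real i)" "F 0 = 0"
  shows "(\<Sum>i\<le>n. g i) = F (real n + 1)"
  using assms(1)
proof (induction n)
  case (Suc n)
  then have "(\<Sum>i\<le>n. g i) = F (real n + 1)" by auto
  then show ?case using Suc.prems[of "Suc n"] by (simp add: add.commute)
qed (use assms(2) in simp)

definition inner_sum :: "real \<Rightarrow> real \<Rightarrow> real \<Rightarrow> real" where
  "inner_sum d a b = ((1) * b^6 + (- 2 * a - 3 * d - 4) * b^5 + (- 5 * a^2 + 5 * a * d + 2 * d^2 + 3 * d - 2) * b^4 + (-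
    4 * a^3 + 6 * a^2 * d - 4 * a^2 - 4 * a * d^2 + 2 * d^3 + 14 * d^2 + 31 * d + 20) * b^3 + (- 5 * a^4
    + 6 * a^3 * d - 4 * a^3 + 18 * a^2 * d + 16 * a^2 + 2 * a * d^3 + 6 * a * d^2 + 17 * a * d + 16 * a
    - 3 * d^4 - 20 * d^3 - 47 * d^2 - 43 * d - 11) * b^2 + (- 2 * a^5 + 5 * a^4 * d - 4 * a^3 * d^2 + 2
    * a^2 * d^3 + 6 * a^2 * d^2 + 17 * a^2 * d + 16 * a^2 - 2 * a * d^4 - 12 * a * d^3 - 26 * a * d^2 -
    18 * a * d + 2 * a + d^5 + 6 * d^4 + 9 * d^3 - 8 * d^2 - 28 * d - 16) * b + (a^6 - 3 * a^5 * d - 4 *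
    a^5 + 2 * a^4 * d^2 + 3 * a^4 * d - 2 * a^4 + 2 * a^3 * d^3 + 14 * a^3 * d^2 + 31 * a^3 * d + 20 *
    a^3 - 3 * a^2 * d^4 - 20 * a^2 * d^3 - 47 * a^2 * d^2 - 43 * a^2 * d - 11 * a^2 + a * d^5 + 6 * a *
    d^4 + 9 * a * d^3 - 8 * a * d^2 - 28 * a * d - 16 * a + d^5 + 9 * d^4 + 31 * d^3 + 51 * d^2 + 40 * d
    + 12)) / 12"

definition middle_sum :: "real \<Rightarrow> real \<Rightarrow> real" where
  "middle_sum d a = ((- 170) * a^7 + (735 * d + 875) * a^6 + (- 1134 * d^2 - 2331 * d - 1001) * a^5 + (595 * d^3 + 735 *
    d^2 - 1540 * d - 1960) * a^4 + (210 * d^4 + 2870 * d^3 + 9450 * d^2 + 11725 * d + 5005) * a^3 + (-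
    315 * d^5 - 2835 * d^4 - 9100 * d^3 - 13020 * d^2 - 8015 * d - 1435) * a^2 + (70 * d^6 + 525 * d^5 +
    1015 * d^4 - 1295 * d^3 - 7091 * d^2 - 8974 * d - 3834) * a + (9 * d^7 + 161 * d^6 + 1176 * d^5 +
    4550 * d^4 + 10101 * d^3 + 12929 * d^2 + 8874 * d + 2520)) / 2520"

definition keys_poly :: "real poly" where
  "keys_poly = smult (1 / 1440) [:1440, 5328, 8420, 7512, 4187, 1512, 350, 48, 3:]"

lemma inner_telescope:
  assumes "a + b \<le> d"
  shows "(\<Sum>c\<le>d - a - b. ((real a + 1) * (real b + 1) * (real c + 1) - real a * real b * real c) *
     ((real d - real b - real c + 1) * ((real d - real a - real c + 1) * (real d - real a - real b + 1))))
     = inner_sum (real d) (real a) (real b)"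
proof -
  define rd ra rb where "rd = real d" "ra = real a" "rb = real b"
  note r = this
  define F where "F c = ((- 3 * ra^2 - 6 * ra * rb + 3 * ra * rd - 3 * rb^2 + 3 * rb * rd + 3 * rd + 3) * c^4 + (- 4 * ra^3 - 16 * ra^2
    * rb + 12 * ra^2 * rd + 10 * ra^2 - 16 * ra * rb^2 + 28 * ra * rb * rd + 24 * ra * rb - 8 * ra * rd^2 - 6 * ra * rd
    + 4 * ra - 4 * rb^3 + 12 * rb^2 * rd + 10 * rb^2 - 8 * rb * rd^2 - 6 * rb * rd + 4 * rb - 8 * rd^2 - 18 * rd -
    10) * c^3 + (- 12 * ra^3 * rb + 6 * ra^3 * rd + 6 * ra^3 - 24 * ra^2 * rb^2 + 42 * ra^2 * rb * rd + 42 * ra^2 *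
    rb - 12 * ra^2 * rd^2 - 18 * ra^2 * rd - 3 * ra^2 - 12 * ra * rb^3 + 42 * ra * rb^2 * rd + 42 * ra * rb^2 - 36 *
    ra * rb * rd^2 - 60 * ra * rb * rd - 18 * ra * rb + 6 * ra * rd^3 + 6 * ra * rd^2 - 9 * ra * rd - 6 * ra + 6 * rb^3
    * rd + 6 * rb^3 - 12 * rb^2 * rd^2 - 18 * rb^2 * rd - 3 * rb^2 + 6 * rb * rd^3 + 6 * rb * rd^2 - 9 * rb * rd - 6
    * rb + 6 * rd^3 + 18 * rd^2 + 15 * rd + 3) * c^2 + (- 12 * ra^3 * rb^2 + 12 * ra^3 * rb * rd + 12 * ra^3 * rb +
    6 * ra^3 * rd + 10 * ra^3 - 12 * ra^2 * rb^3 + 36 * ra^2 * rb^2 * rd + 36 * ra^2 * rb^2 - 24 * ra^2 * rb * rd^2 -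
    42 * ra^2 * rb * rd - 14 * ra^2 * rb - 12 * ra^2 * rd^2 - 30 * ra^2 * rd - 16 * ra^2 + 12 * ra * rb^3 * rd + 12 *
    ra * rb^3 - 24 * ra * rb^2 * rd^2 - 42 * ra * rb^2 * rd - 14 * ra * rb^2 + 12 * ra * rb * rd^3 + 24 * ra * rb * rd^2
    + 8 * ra * rb * rd + 6 * ra * rd^3 + 14 * ra * rd^2 - 10 * ra + 6 * rb^3 * rd + 10 * rb^3 - 12 * rb^2 * rd^2 - 30
    * rb^2 * rd - 16 * rb^2 + 6 * rb * rd^3 + 14 * rb * rd^2 - 10 * rb + 6 * rd^3 + 26 * rd^2 + 36 * rd + 16) * c)
    / 12" for c :: real
  show ?thesis
  proof (subst telescope[where F = F])
    show "((real a + 1) * (real b + 1) * (real c + 1) - real a * real b * real c) *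
      ((real d - real b - real c + 1) * ((real d - real a - real c + 1) * (real d - real a - real b + 1)))
      = F (real c + 1) - F (real c)" for c
      unfolding F_def r by algebra
    have "real (d - a - b) = rd - ra - rb" using assms by (simp add: of_nat_diff r)
    then show "F (real (d - a - b) + 1) = inner_sum (real d) (real a) (real b)"
      unfolding F_def inner_sum_def r(1)[symmetric] r(2)[symmetric] r(3)[symmetric] by algebra
  qed (simp add: F_def)
qed

lemma middle_telescope:
  assumes "a \<le> d"
  shows "(\<Sum>b\<le>d - a. inner_sum (real d) (real a) (real b)) = middle_sum (real d) (real a)"
proof -
  define rd ra where "rd = real d" "ra = real a"
  note r = this
  define k1 k2 k3 k4 k5 k6 k7 where
    "k1 = 210 * ra^6 - 630 * ra^5 * rd - 630 * ra^5 + 420 * ra^4 * rd^2 + 105 * ra^4 * rd - 595 * ra^4 + 420 * ra^3 *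
      rd^3 + 3360 * ra^3 * rd^2 + 6720 * ra^3 * rd + 4060 * ra^3 - 630 * ra^2 * rd^4 - 4410 * ra^2 * rd^3 - 10500 *
      ra^2 * rd^2 - 10185 * ra^2 * rd - 3395 * ra^2 + 210 * ra * rd^5 + 1470 * ra * rd^4 + 3220 * ra * rd^3 + 1260 *
      ra * rd^2 - 3430 * ra * rd - 3010 * ra + 105 * rd^5 + 1155 * rd^4 + 4865 * rd^3 + 9891 * rd^2 + 9814 * rd +
      3834"
    "k2 = - 210 * ra^5 + 525 * ra^4 * rd + 525 * ra^4 - 420 * ra^3 * rd^2 - 630 * ra^3 * rd + 210 * ra^3 + 210 * ra^2 *
      rd^3 + 630 * ra^2 * rd^2 + 210 * ra^2 * rd - 210 * ra^2 - 210 * ra * rd^4 - 1470 * ra * rd^3 - 3570 * ra *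
      rd^2 - 3675 * ra * rd - 1435 * ra + 105 * rd^5 + 945 * rd^4 + 3150 * rd^3 + 4830 * rd^2 + 3255 * rd + 595"
    "k3 = - 350 * ra^4 + 420 * ra^3 * rd + 140 * ra^3 + 630 * ra^2 * rd + 1190 * ra^2 + 140 * ra * rd^3 + 840 * ra *
      rd^2 + 1540 * ra * rd + 1120 * ra - 210 * rd^4 - 1610 * rd^3 - 4620 * rd^2 - 6055 * rd - 3045"
    "k4 = - 210 * ra^3 + 315 * ra^2 * rd + 315 * ra^2 - 210 * ra * rd^2 - 525 * ra * rd - 175 * ra + 105 * rd^3 + 525 *
      rd^2 + 1050 * rd + 910"
    "k5 = - 210 * ra^2 + 210 * ra * rd + 210 * ra + 84 * rd^2 + 441 * rd + 441"
    "k6 = - 70 * ra - 105 * rd - 245"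
    "k7 = (30::real)"
  note k = this
  define F where "F b = (k7 * b^7 + k6 * b^6 + k5 * b^5 + k4 * b^4 + k3 * b^3 + k2 * b^2 + k1 * b) / 2520" for b
  \<comment> \<open>The difference of \<open>F\<close> is compared with \<open>inner_sum\<close> one power of \<open>b\<close> at a time.\<close>
  have c: "k1 + k2 + k3 + k4 + k5 + k6 + k7 = 210 * (ra^6 - 3 * ra^5 * rd - 4 * ra^5 + 2 * ra^4 * rd^2 + 3 * ra^4 * rd - 2 * ra^4 + 2 * ra^3 * rd^3 + 14 * ra^3 *
      rd^2 + 31 * ra^3 * rd + 20 * ra^3 - 3 * ra^2 * rd^4 - 20 * ra^2 * rd^3 - 47 * ra^2 * rd^2 - 43 * ra^2 * rd -
      11 * ra^2 + ra * rd^5 + 6 * ra * rd^4 + 9 * ra * rd^3 - 8 * ra * rd^2 - 28 * ra * rd - 16 * ra + rd^5 + 9 *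
      rd^4 + 31 * rd^3 + 51 * rd^2 + 40 * rd + 12)"
    "2 * k2 + 3 * k3 + 4 * k4 + 5 * k5 + 6 * k6 + 7 * k7 = 210 * (- 2 * ra^5 + 5 * ra^4 * rd - 4 * ra^3 * rd^2 + 2 * ra^2 * rd^3 + 6 * ra^2 * rd^2 + 17 * ra^2 * rd + 16 * ra^2
      - 2 * ra * rd^4 - 12 * ra * rd^3 - 26 * ra * rd^2 - 18 * ra * rd + 2 * ra + rd^5 + 6 * rd^4 + 9 * rd^3 - 8 *
      rd^2 - 28 * rd - 16)"
    "3 * k3 + 6 * k4 + 10 * k5 + 15 * k6 + 21 * k7 = 210 * (- 5 * ra^4 + 6 * ra^3 * rd - 4 * ra^3 + 18 * ra^2 * rd + 16 * ra^2 + 2 * ra * rd^3 + 6 * ra * rd^2 + 17 * ra *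
      rd + 16 * ra - 3 * rd^4 - 20 * rd^3 - 47 * rd^2 - 43 * rd - 11)"
    "4 * k4 + 10 * k5 + 20 * k6 + 35 * k7 = 210 * (- 4 * ra^3 + 6 * ra^2 * rd - 4 * ra^2 - 4 * ra * rd^2 + 2 * rd^3 + 14 * rd^2 + 31 * rd + 20)"
    "5 * k5 + 15 * k6 + 35 * k7 = 210 * (- 5 * ra^2 + 5 * ra * rd + 2 * rd^2 + 3 * rd - 2)"
    "6 * k6 + 21 * k7 = 210 * (- 2 * ra - 3 * rd - 4)"
    "7 * k7 = 210 * (1)"
    unfolding k by algebra+
  show ?thesis
  proof (subst telescope[where F = F])
    fix b
    define x where "x = real b"
    have scale: "(210 * n6 * x^6 + 210 * n5 * x^5 + 210 * n4 * x^4 + 210 * n3 * x^3 + 210 * n2 * x^2 + 210 * n1 * x + 210 * n0) / 2520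
        = (n6 * x^6 + n5 * x^5 + n4 * x^4 + n3 * x^3 + n2 * x^2 + n1 * x + n0) / 12" for n0 n1 n2 n3 n4 n5 n6
      by (simp add: add_divide_distrib)
    have p: "(x + 1)^2 - x^2 = 2 * x + 1"
      "(x + 1)^3 - x^3 = 3 * x^2 + 3 * x + 1"
      "(x + 1)^4 - x^4 = 4 * x^3 + 6 * x^2 + 4 * x + 1"
      "(x + 1)^5 - x^5 = 5 * x^4 + 10 * x^3 + 10 * x^2 + 5 * x + 1"
      "(x + 1)^6 - x^6 = 6 * x^5 + 15 * x^4 + 20 * x^3 + 15 * x^2 + 6 * x + 1"
      "(x + 1)^7 - x^7 = 7 * x^6 + 21 * x^5 + 35 * x^4 + 35 * x^3 + 21 * x^2 + 7 * x + 1"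
      by algebra+
    have "F (x + 1) - F x = (k7 * ((x + 1)^7 - x^7) + k6 * ((x + 1)^6 - x^6) + k5 * ((x + 1)^5 - x^5) + k4 * ((x + 1)^4 - x^4) + k3 * ((x + 1)^3 - x^3) + k2 * ((x + 1)^2 - x^2) + k1) / 2520"
      by (simp add: F_def right_diff_distrib distrib_left add_divide_distrib diff_divide_distrib)
    also have "\<dots> = ((7 * k7) * x^6 + (6 * k6 + 21 * k7) * x^5 + (5 * k5 + 15 * k6 + 35 * k7) * x^4 + (4 * k4 + 10 * k5 + 20 * k6 + 35 * k7) * x^3 + (3 * k3 + 6 * k4 + 10 * k5 + 15 * k6 + 21 * k7) * x^2 + (2 * k2 + 3 * k3 + 4 * k4 + 5 * k5 + 6 * k6 + 7 * k7) * x + (k1 + k2 + k3 + k4 + k5 + k6 + k7)) / 2520"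
      unfolding p by (simp add: algebra_simps)
    also have "\<dots> = inner_sum rd ra x"
      unfolding c(1) unfolding c(2) unfolding c(3) unfolding c(4) unfolding c(5) unfolding c(6) unfolding c(7) inner_sum_def
      by (rule scale)
    finally show "inner_sum (real d) (real a) (real b) = F (real b + 1) - F (real b)"
      unfolding x_def r by simp
    have "real (d - a) = rd - ra" using assms by (simp add: of_nat_diff r)
    then show "F (real (d - a) + 1) = middle_sum (real d) (real a)"
      unfolding F_def k middle_sum_def r(1)[symmetric] r(2)[symmetric] by algebra
  qed (simp add: F_def)
qed

lemma outer_telescope: "(\<Sum>a\<le>d. middle_sum (real d) (real a)) = poly keys_poly (real d)"
proof -
  define rd where "rd = real d"
  note r = this
  define F where "F a = ((- 85) * a^8 + (420 * rd + 840) * a^7 + (- 756 * rd^2 - 3024 * rd - 2814) * a^6 + (476 * rd^3 + 2856 *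
    rd^2 + 4900 * rd + 2184) * a^5 + (210 * rd^4 + 1680 * rd^3 + 6090 * rd^2 + 10920 * rd + 7455) * a^4 + (-
    420 * rd^5 - 4200 * rd^4 - 17080 * rd^3 - 35280 * rd^2 - 36680 * rd - 15120) * a^3 + (140 * rd^6 + 1680 *
    rd^5 + 7910 * rd^4 + 18480 * rd^3 + 21686 * rd^2 + 10584 * rd + 484) * a^2 + (36 * rd^7 + 504 * rd^6 + 3444
    * rd^5 + 14280 * rd^4 + 36848 * rd^3 + 57120 * rd^2 + 48376 * rd + 17136) * a) / 10080" for a :: real
  show ?thesis
  proof (subst telescope[where F = F])
    show "middle_sum (real d) (real a) = F (real a + 1) - F (real a)" for a
      unfolding F_def r middle_sum_def by algebra
    have "poly keys_poly rd = (1440 + 5328 * rd + 8420 * rd^2 + 7512 * rd^3 + 4187 * rd^4 + 1512 * rd^5 + 350 * rd^6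
        + 48 * rd^7 + 3 * rd^8) / 1440"
      by (simp add: keys_poly_def) algebra
    then show "F (real d + 1) = poly keys_poly (real d)"
      unfolding F_def r(1)[symmetric] by algebra
  qed (simp add: F_def)
qed

lemma card_keys_poly: "real (card (keys_of_degree d)) = poly keys_poly (real d)"
proof -
  have "real (card (keys_of_degree d)) = (\<Sum>a\<le>d. \<Sum>b\<le>d - a. inner_sum (real d) (real a) (real b))"
    unfolding card_keys of_nat_sum
  proof (intro sum.cong refl)
    fix a b assume "a \<in> {..d}" "b \<in> {..d - a}"
    then have ab: "a + b \<le> d" by auto
    have "real (((a + 1) * (b + 1) * (c + 1) - a * b * c) * ((d - b - c + 1) * ((d - a - c + 1) * (d - a - b + 1))))
      = ((real a + 1) * (real b + 1) * (real c + 1) - real a * real b * real c) *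
     ((real d - real b - real c + 1) * ((real d - real a - real c + 1) * (real d - real a - real b + 1)))"
      if "c \<in> {..d - a - b}" for c
    proof -
      have le: "a * b * c \<le> (a + 1) * (b + 1) * (c + 1)" by (intro mult_mono) auto
      have "real (d - b - c) = real d - real b - real c" "real (d - a - c) = real d - real a - real c"
        "real (d - a - b) = real d - real a - real b" using that ab by (simp_all add: of_nat_diff)
      then show ?thesis by (simp only: of_nat_mult of_nat_diff[OF le] of_nat_add of_nat_1)
    qed
    then show "(\<Sum>c\<le>d - a - b. real (((a + 1) * (b + 1) * (c + 1) - a * b * c) * ((d - b - c + 1) * ((d - a - c + 1) * (d - a - b + 1)))))
       = inner_sum (real d) (real a) (real b)"
      unfolding inner_telescope[OF ab, symmetric] by (rule sum.cong[OF refl])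
  qed
  also have "\<dots> = (\<Sum>a\<le>d. middle_sum (real d) (real a))"
    by (rule sum.cong) (auto simp: middle_telescope)
  finally show ?thesis using outer_telescope by simp
qed

section \<open>The two varieties\<close>

text \<open>Antisymmetric in the indices, as brackets are.\<close>

definition xb :: "nat \<Rightarrow> nat \<Rightarrow> nat \<Rightarrow> (triple, 'a::comm_ring_1) mpoly" where
  "xb i j k = (if i < j \<and> j < k then Var (triple (i, j, k)) else if j < k \<and> k < i then Var (triple (j, k, i))
     else if k < i \<and> i < j then Var (triple (k, i, j)) else if i < k \<and> k < j then - Var (triple (i, k, j))
     else if j < i \<and> i < k then - Var (triple (j, i, k)) else if k < j \<and> j < i then - Var (triple (k, j, i))
     else 0)"

definition exchange :: "nat \<Rightarrow> nat \<Rightarrow> nat \<Rightarrow> nat \<Rightarrow> nat \<Rightarrow> nat \<Rightarrow> (triple, 'a::comm_ring_1) mpoly" where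
  "exchange a b c i j k = xb a b c * xb i j k - xb i b c * xb a j k - xb a i c * xb b j k - xb a b i * xb c j k"

lemma lookup_complexify: "Poly_Mapping.lookup (complexify p) m = complex_of_real (Poly_Mapping.lookup p m)"
  by (simp add: complexify_def Poly_Mapping.map.rep_eq when_def)

lemma complexify_single: "complexify (Poly_Mapping.single m c) = Poly_Mapping.single m (complex_of_real c)"
  by (rule poly_mapping_eqI) (auto simp: lookup_complexify lookup_single when_def)

lemma complexify_add: "complexify (p + q) = complexify p + complexify q"
  by (rule poly_mapping_eqI) (simp add: lookup_complexify lookup_add)

lemma complexify_zero [simp]: "complexify 0 = 0"
  by (rule poly_mapping_eqI) (simp add: lookup_complexify)

lemma complexify_uminus: "complexify (- p) = - complexify p"
  using complexify_add[of p "- p"] by (simp add: add_eq_0_iff)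

lemma complexify_diff: "complexify (p - q) = complexify p - complexify q"
  using complexify_add[of p "- q"] by (simp add: complexify_uminus)

lemma complexify_mult: "complexify (p * q) = complexify p * complexify q"
proof (induction p rule: mpoly_induct)
  case (add_single m c p)
  have "complexify (Poly_Mapping.single m c * q) = complexify (Poly_Mapping.single m c) * complexify q"
  proof (induction q rule: mpoly_induct)
    case (add_single m' c' q)
    then show ?case by (simp add: distrib_left complexify_add mult_single complexify_single)
  qed simp
  then show ?case using add_single by (simp add: distrib_right complexify_add)
qed simp

lemma complexify_Var [simp]: "complexify (Var i) = Var i"
  by (simp add: Var_def complexify_single)

lemma complexify_xb [simp]: "complexify (xb i j k) = xb i j k"
  by (simp add: xb_def complexify_uminus)

lemma complexify_exchange [simp]: "complexify (exchange a b c i j k) = exchange a b c i j k"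
  by (simp add: exchange_def complexify_diff complexify_mult)

lemma xb_forms: "xb i j k \<in> forms 1"
  unfolding xb_def by (auto simp del: One_nat_def intro: forms_Var forms_uminus)

lemma exchange_forms: "exchange a b c i j k \<in> forms 2"
  using forms_mult[OF xb_forms xb_forms] unfolding exchange_def
  by (intro forms_diff) (simp_all add: numeral_2_eq_2)

lemma eval_xb_plk:
  assumes "i \<in> {1..6}" "j \<in> {1..6}" "k \<in> {1..6}"
  shows "eval (xb i j k) (plk V) = br (V i) (V j) (V k)"
proof -
  consider "i < j \<and> j < k" | "j < k \<and> k < i" | "k < i \<and> i < j" | "i < k \<and> k < j" | "j < i \<and> i < k"
    | "k < j \<and> j < i" | "i = j" | "j = k" | "i = k" by linarith
  then show ?thesis
  proof cases
    case 1 then show ?thesis using assms by (simp add: xb_def plk_triple)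
  next
    case 2 then show ?thesis using assms br_rotate(1)[of "V j" "V k" "V i"] by (simp add: xb_def plk_triple)
  next
    case 3 then show ?thesis using assms br_rotate(2)[of "V k" "V i" "V j"] by (simp add: xb_def plk_triple)
  next
    case 4 then show ?thesis using assms br_swap(2)[of "V i" "V k" "V j"] by (simp add: xb_def plk_triple)
  next
    case 5 then show ?thesis using assms br_swap(1)[of "V j" "V i" "V k"] by (simp add: xb_def plk_triple)
  next
    case 6 then show ?thesis using assms br_swap(3)[of "V k" "V j" "V i"] by (simp add: xb_def plk_triple)
  qed (auto simp: xb_def)
qed

lemma eval_exchange_plk:
  assumes "a \<in> {1..6}" "b \<in> {1..6}" "c \<in> {1..6}" "i \<in> {1..6}" "j \<in> {1..6}" "k \<in> {1..6}"
  shows "eval (exchange a b c i j k) (plk V) = 0"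
  using assms br_exchange[of "V a" "V b" "V c" "V i" "V j" "V k"]
  by (simp add: exchange_def eval_diff eval_mult eval_xb_plk)

lemma xb_antisym: "xb j i k = - xb i j k" "xb i k j = - xb i j k"
proof -
  consider "i < j \<and> j < k" | "j < k \<and> k < i" | "k < i \<and> i < j" | "i < k \<and> k < j" | "j < i \<and> i < k"
    | "k < j \<and> j < i" | "i = j" | "j = k" | "i = k" by linarith
  then have "xb j i k = - xb i j k \<and> xb i k j = - xb i j k" by cases (auto simp: xb_def)
  then show "xb j i k = - xb i j k" "xb i k j = - xb i j k" by blast+
qed

lemma xb_same: "xb i i k = 0" "xb i k k = 0" "xb i k i = 0"
  by (auto simp: xb_def)

text \<open>Near a nonzero coordinate \<open>abc\<close>, the vectors with the coordinates \<open>lbc, alc,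
  abl\<close> form a configuration with the given brackets, up to a factor; the exchange relations give
  the remaining brackets by Cramer's rule.\<close>

lemma in_Gr36_if_exchange:
  assumes v: "v \<in> hcoords P"
    and ex: "\<And>a b c i j k. {a, b, c, i, j, k} \<subseteq> {1..6} \<Longrightarrow> eval (exchange a b c i j k) v = 0"
  shows "P \<in> Gr36"
proof -
  obtain t where t: "v $ t \<noteq> 0" using hcoords_nonzero[OF v] by (auto simp: Finite_Cartesian_Product.vec_eq_iff)
  obtain a b c where abc: "indices t = (a, b, c)" by (metis prod_cases3)
  note bd = indices_bounds[OF abc]
  define X where "X i j k = eval (xb i j k :: (triple, complex) mpoly) v" for i j k
  have anti: "X j i k = - X i j k" "X i k j = - X i j k" "X i i k = 0" "X i k k = 0" "X i k i = 0" for i j k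
    unfolding X_def by (simp_all add: xb_antisym(1)[of j i k] xb_antisym(2)[of i k j] xb_same)
  have rel: "X a b c * X i j k = X i b c * X a j k + X a i c * X b j k + X a b i * X c j k"
    if "{i, j, k} \<subseteq> {1..6}" for i j k
  proof -
    have "eval (exchange a b c i j k) v = 0" by (rule ex) (use that bd in auto)
    then show ?thesis unfolding exchange_def eval_diff eval_mult X_def by algebra
  qed
  have X0: "X i j k = v $ triple (i, j, k)" if "i < j" "j < k" for i j k
    using that unfolding X_def xb_def by simp
  have tt: "triple (a, b, c) = t" using abc by (metis indices_inverse)
  define V where "V l = (vector [X l b c, X a l c, X a b l] :: complex^3)" for l
  have key: "br (V i) (V j) (V k) = (X a b c)^2 * X i j k" if ijk: "{i, j, k} \<subseteq> {1..6}" for i j k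
  proof -
    have mem: "a \<in> {1..6}" "b \<in> {1..6}" "c \<in> {1..6}" using bd by auto
    have 1: "X a b c * X j k a = X a j c * X b k a + X a b j * X c k a"
      using rel[of j k a] ijk mem anti(5)[of a k] by simp
    have 2: "X a b c * X j k b = X j b c * X a k b + X a b j * X c k b"
      using rel[of j k b] ijk mem anti(5)[of b k] by simp
    have 3: "X a b c * X j k c = X j b c * X a k c + X a j c * X b k c"
      using rel[of j k c] ijk mem anti(5)[of c k] by simp
    have r: "X x j k = X j k x" for x using anti(1)[of j x k] anti(2)[of j k x] by simp
    have "(X a b c)^2 * X i j k = X a b c * (X i b c * X j k a + X a i c * X j k b + X a b i * X j k c)"
      using rel[OF ijk] unfolding r by (simp add: power2_eq_square)
    also have "\<dots> = X i b c * (X a j c * X b k a + X a b j * X c k a) + X a i c * (X j b c * X a k b + X a b j * X c k b)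
        + X a b i * (X j b c * X a k c + X a j c * X b k c)"
      unfolding 1[symmetric] 2[symmetric] 3[symmetric] by (simp add: algebra_simps)
    also have "\<dots> = br (V i) (V j) (V k)"
    proof -
      have swap: "X p q l = - X q p l" "X p q l = - X p l q" for p q l by (rule anti)+
      have "X b k a = X a b k" using swap(2)[of b k a] swap(1)[of b a k] by simp
      moreover have "X c k a = - X a k c" using swap(2)[of c k a] swap(1)[of c a k] swap(2)[of a c k] by simp
      moreover have "X a k b = - X a b k" by (rule swap)
      moreover have "X c k b = X k b c" using swap(1)[of c k b] swap(2)[of k c b] by simp
      moreover have "X b k c = - X k b c" by (rule swap)
      ultimately show ?thesis by (simp add: br_def V_def algebra_simps)
    qed
    finally show ?thesis by simp
  qed
  have "plk V = (X a b c)^2 *s v"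
    unfolding Finite_Cartesian_Product.vec_eq_iff
  proof
    fix s
    obtain i j k where s: "indices s = (i, j, k)" by (metis prod_cases3)
    note bs = indices_bounds[OF s]
    have "triple (i, j, k) = s" using s by (metis indices_inverse)
    then show "plk V $ s = ((X a b c)^2 *s v) $ s"
      using key[of i j k] bs X0[of i j k] by (simp add: plk_def s)
  qed
  moreover have "X a b c \<noteq> 0" using X0[of a b c] bd t tt by simp
  ultimately have "plk V \<in> hcoords P" using scale_in_hcoords[OF v, of "(X a b c)^2"] by simp
  then show ?thesis using Gr36_iff[of "plk V" P] hcoords_nonzero by blast
qed

lemma closedin_Gr36: "closedin zariski Gr36"
proof -
  let ?S = "{exchange a b c i j k | a b c i j k. {a, b, c, i, j, k} \<subseteq> {1..6}} :: (triple, complex) mpoly set"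
  have S: "?S \<subseteq> (\<Union>d. forms d)" 
  proof clarify
    fix a b c i j k :: nat
    show "exchange a b c i j k \<in> (\<Union>d. forms d)" using exchange_forms by (rule UN_I[OF UNIV_I])
  qed
  have "P \<in> Gr36 \<longleftrightarrow> P \<in> zeros ?S" for P
  proof -
    obtain v where v: "v \<in> hcoords P" using hcoords_nonempty by blast
    show ?thesis unfolding zeros_cone[OF S v]
    proof
      assume "P \<in> Gr36"
      then obtain V where "v = plk V" using Gr36_iff[OF v] by blast
      then show "\<forall>p\<in>?S. eval p v = 0" using eval_exchange_plk by auto
    next
      assume "\<forall>p\<in>?S. eval p v = 0"
      then have all: "\<And>p. p \<in> ?S \<Longrightarrow> eval p v = 0" by (rule bspec)
      show "P \<in> Gr36"
      proof (rule in_Gr36_if_exchange[OF v])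
        fix a b c i j k :: nat assume "{a, b, c, i, j, k} \<subseteq> {1..6}"
        then have "exchange a b c i j k \<in> ?S"
          by (intro CollectI exI[of _ a] exI[of _ b] exI[of _ c] exI[of _ i] exI[of _ j] exI[of _ k]) simp
        then show "eval (exchange a b c i j k) v = 0" by (rule all)
      qed
    qed
  qed
  then have "Gr36 = zeros ?S" by blast
  then show ?thesis unfolding closedin_zariski using S by blast
qed

lemma exchange_in_I_Gr36: "{a, b, c, i, j, k} \<subseteq> {1..6} \<Longrightarrow> exchange a b c i j k \<in> I_Gr36"
  unfolding I_Gr36_def by (auto simp: vanishing_ideal_cone cone_Gr36 eval_exchange_plk)

text \<open>The exchange relations are contained in the real ideal of the Grassmannian and already cut it out over
  the complex numbers; conversely the ideal vanishes there.\<close>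

lemma variety_iff:
  assumes v: "v \<in> hcoords P" and q: "complexify q \<in> forms d"
  shows "P \<in> variety (ideal.span (I_Gr36 \<union> {q})) \<longleftrightarrow> P \<in> Gr36 \<and> eval (complexify q) v = 0"
proof
  assume "P \<in> variety (ideal.span (I_Gr36 \<union> {q}))"
  then have *: "vanishes_at (complexify p) P" if "p \<in> I_Gr36 \<union> {q}" for p
    using ideal.span_base[OF that] by (auto simp: variety_def zeros_def)
  have "P \<in> Gr36"
  proof (rule in_Gr36_if_exchange[OF v])
    fix a b c i j k :: nat assume "{a, b, c, i, j, k} \<subseteq> {1..6}"
    then show "eval (exchange a b c i j k) v = 0"
      using *[of "exchange a b c i j k"] exchange_in_I_Gr36 v by (simp add: vanishes_at_def)
  qed
  then show "P \<in> Gr36 \<and> eval (complexify q) v = 0" using *[of q] v by (simp add: vanishes_at_def)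
next
  assume P: "P \<in> Gr36 \<and> eval (complexify q) v = 0"
  have "vanishes_at (complexify p) P" if "p \<in> ideal.span (I_Gr36 \<union> {q})" for p
    using that
  proof (induction rule: ideal.span_induct_alt)
    case base
    then show ?case by (simp add: vanishes_at_def)
  next
    case (step c p r)
    have "vanishes_at (complexify p) P"
      using step(1) P vanishes_at_form[OF q v] by (auto simp: I_Gr36_def vanishing_ideal_def)
    then show ?case using step(2) by (simp add: vanishes_at_def complexify_add complexify_mult eval_add eval_mult)
  qed
  then show "P \<in> variety (ideal.span (I_Gr36 \<union> {q}))" by (auto simp: variety_def zeros_def)
qed

definition defining_quadric :: "nat \<Rightarrow> (triple, real) mpoly" where
  "defining_quadric r = (if r = 0 then xvar 1 2 3 * xvar 4 5 6 - xvar 1 2 4 * xvar 3 5 6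
     else xvar 1 2 6 * xvar 3 4 5 - xvar 1 3 6 * xvar 2 4 5)"

definition Vty :: "nat \<Rightarrow> triple proj set" where
  "Vty r = variety (ideal.span (I_Gr36 \<union> {defining_quadric r}))"

lemma complexify_xvar: "complexify (xvar i j k) = Var (triple (i, j, k))"
  by (simp add: xvar_def)

lemma defining_quadric_forms: "complexify (defining_quadric r) \<in> forms 2"
  unfolding defining_quadric_def complexify_diff complexify_mult complexify_xvar if_distrib[of complexify]
  using forms_mult[OF forms_Var forms_Var] by (auto intro!: forms_diff simp: numeral_2_eq_2)

lemma eval_defining_quadric:
  assumes "r \<le> 1" shows "eval (complexify (defining_quadric r)) (plk V) = concurrency (conf r V)"
proof (cases "r = 0")
  case True
  then show ?thesis by (simp add: defining_quadric_def complexify_diff complexify_mult complexify_xvar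
      eval_diff eval_mult plk_triple concurrency_def conf_def shift_def)
next
  case False
  then have "r = 1" using assms by simp
  then show ?thesis using concurrency_alt[of "conf r V" A]
    by (simp del: One_nat_def add: defining_quadric_def complexify_diff complexify_mult complexify_xvar
      eval_diff eval_mult plk_triple conf_def shift_def br_rotate) simp
qed

lemma cone_Vty: assumes r: "r \<le> 1" shows "cone (Vty r) = KV r"
proof (intro set_eqI iffI)
  fix v assume "v \<in> cone (Vty r)"
  then obtain P where P: "P \<in> Vty r" "v \<in> hcoords P" by (auto simp: cone_def)
  then have "P \<in> Gr36" "eval (complexify (defining_quadric r)) v = 0"
    using variety_iff[OF P(2) defining_quadric_forms] by (auto simp: Vty_def)
  then show "v \<in> KV r" using Gr36_iff[OF P(2)] eval_defining_quadric[OF r] by (auto simp: KV_def)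
next
  fix v assume "v \<in> KV r"
  then obtain V where V: "v = plk V" "plk V \<noteq> 0" "concurrency (conf r V) = 0" by (auto simp: KV_def)
  then obtain P where P: "v \<in> hcoords P" using hcoords_ex[of v] by auto
  have "P \<in> Vty r" unfolding Vty_def variety_iff[OF P defining_quadric_forms]
    using V Gr36_iff[OF P] eval_defining_quadric[OF r] by auto
  then show "v \<in> cone (Vty r)" using P by (auto simp: cone_def)
qed

lemma Vty_subset_Gr36: "Vty r \<subseteq> Gr36"
  using variety_iff[OF _ defining_quadric_forms] hcoords_nonempty unfolding Vty_def by blast

lemma closedin_Vty: "closedin zariski (Vty r)"
proof -
  have "Vty r = Gr36 \<inter> zeros {complexify (defining_quadric r)}"
  proof (rule set_eqI)
    fix P :: "triple proj"
    obtain v where v: "v \<in> hcoords P" using hcoords_nonempty by blast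
    show "P \<in> Vty r \<longleftrightarrow> P \<in> Gr36 \<inter> zeros {complexify (defining_quadric r)}"
      unfolding Vty_def variety_iff[OF v defining_quadric_forms]
      using zeros_cone[OF _ v, of "{complexify (defining_quadric r)}"] defining_quadric_forms by auto
  qed
  moreover have "closedin zariski (zeros {complexify (defining_quadric r)})"
    unfolding closedin_zariski using defining_quadric_forms by (intro exI[of _ "{complexify (defining_quadric r)}"]) auto
  ultimately show ?thesis using closedin_Gr36 by auto
qed

lemma hilbert_function_Vty:
  assumes "r \<le> 1" shows "hilbert_function (Vty r) d = card (keys_of_degree d)"
  by (rule hilbert_function_eq_card[where f = "\<lambda>k. YM r (rep d k)"])
    (use assms KV_indep KV_reduce YM_forms rep in \<open>auto simp: cone_Vty, metis\<close>)

lemma poly_eq_if_eventually_eq: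
  fixes p q :: "real poly"
  assumes "\<forall>\<^sub>F d in sequentially. poly p (real d) = poly q (real d)" shows "p = q"
proof (rule ccontr)
  assume "p \<noteq> q"
  then have fin: "finite {x. poly (p - q) x = 0}" by (intro poly_roots_finite) simp
  obtain N where N: "\<forall>d\<ge>N. poly p (real d) = poly q (real d)"
    using assms by (auto simp: eventually_sequentially)
  then have "real ` {N..} \<subseteq> {x. poly (p - q) x = 0}" by auto
  then have "finite (real ` {N..})" using fin by (rule finite_subset)
  then have "finite {N..}" by (rule finite_imageD) (auto simp: inj_on_def)
  then show False using infinite_Ici by blast
qed

lemma hilbert_polynomial_Vty:
  assumes "r \<le> 1" shows "hilbert_polynomial (Vty r) = keys_poly"
  unfolding hilbert_polynomial_def hilbert_function_Vty[OF assms] card_keys_poly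
  by (rule the_equality) (auto intro: poly_eq_if_eventually_eq)

lemma proj_degree_Vty:
  assumes "r \<le> 1" shows "proj_degree (Vty r) = 84"
proof -
  have "degree keys_poly = 8" "lead_coeff keys_poly = 3 / 1440" by (simp_all add: keys_poly_def)
  then show ?thesis unfolding proj_degree_def hilbert_polynomial_Vty[OF assms] by (simp add: fact_numeral)
qed

lemma keys_poly_bounds:
  assumes "d \<ge> 1" shows "poly keys_poly (real d) \<le> 21 * real d ^ 8" "real d ^ 8 / 480 \<le> poly keys_poly (real d)"
proof -
  define x where "x = real d"
  have x: "1 \<le> x" using assms by (simp add: x_def)
  have "x ^ i \<le> x ^ 8" if "i \<le> 8" for i by (rule power_increasing[OF that x])
  note le = this[of 1] this[of 2] this[of 3] this[of 4] this[of 5] this[of 6] this[of 7] this[of 0]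
  have eq: "poly keys_poly x = (1440 + 5328 * x + 8420 * x ^ 2 + 7512 * x ^ 3 + 4187 * x ^ 4
     + 1512 * x ^ 5 + 350 * x ^ 6 + 48 * x ^ 7 + 3 * x ^ 8) / 1440"
    by (simp add: keys_poly_def) algebra
  have "poly keys_poly x \<le> 21 * x ^ 8" unfolding eq using le by simp
  moreover have "x ^ 8 / 480 \<le> poly keys_poly x" unfolding eq using x by simp
  ultimately show "poly keys_poly (real d) \<le> 21 * real d ^ 8" "real d ^ 8 / 480 \<le> poly keys_poly (real d)"
    unfolding x_def by blast+
qed

lemma bounded_growth_Vty:
  assumes "r \<le> 1" shows "bounded_growth (cone (Vty r)) 8"
  unfolding bounded_growth_def
proof (rule exI[of _ 21], intro allI impI)
  fix d :: nat assume "1 \<le> d"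
  have "hilb_le (KV r) d (card (keys_of_degree d))"
    by (rule hilb_leI[OF finite_keys]) (rule KV_reduce[OF assms])
  then show "\<exists>n. hilb_le (cone (Vty r)) d n \<and> real n \<le> 21 * real d ^ 8"
    using keys_poly_bounds(1)[OF \<open>1 \<le> d\<close>] card_keys_poly[of d] cone_Vty[OF assms] by auto
qed

lemma grows_Vty:
  assumes "r \<le> 1" shows "grows (cone (Vty r)) 8"
  unfolding grows_def
proof (rule exI[of _ "1 / 480"], rule conjI, simp, rule exI[of _ 1], intro allI impI)
  fix d :: nat assume "1 \<le> d"
  have "hilb_ge (KV r) d (card (keys_of_degree d))"
    by (rule hilb_geI[OF KV_indep[OF assms]]) (use YM_forms rep in metis)
  then show "\<exists>n. hilb_ge (cone (Vty r)) d n \<and> 1 / 480 * real d ^ 8 \<le> real n"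
    using keys_poly_bounds(2)[OF \<open>1 \<le> d\<close>] card_keys_poly[of d] cone_Vty[OF assms] by auto
qed

lemma bounded_growth_Gr36: "bounded_growth (cone Gr36) 9"
  unfolding bounded_growth_def
proof (rule exI[of _ 42], intro allI impI)
  fix d :: nat assume d: "1 \<le> d"
  have "real (card (keys_of_degree (d - 2 * i))) \<le> 21 * real d ^ 8" for i
  proof (cases "d - 2 * i \<ge> 1")
    case True
    have "real (d - 2 * i) ^ 8 \<le> real d ^ 8" by (intro power_mono) auto
    then show ?thesis using keys_poly_bounds(1)[OF True] card_keys_poly[of "d - 2 * i"] by linarith
  next
    case False
    then have "real (card (keys_of_degree (d - 2 * i))) = 1" by (simp add: card_keys_poly keys_poly_def)
    moreover have "1 \<le> real d ^ 8" using d by (intro one_le_power) auto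
    ultimately show ?thesis by linarith
  qed
  then have "(\<Sum>i\<le>d div 2. real (card (keys_of_degree (d - 2 * i)))) \<le> (\<Sum>i\<le>d div 2. 21 * real d ^ 8)"
    by (intro sum_mono)
  also have "\<dots> = real (d div 2 + 1) * (21 * real d ^ 8)" by simp
  also have "\<dots> \<le> (2 * real d) * (21 * real d ^ 8)"
    by (rule mult_right_mono) (use d in linarith, simp)
  finally have "real (\<Sum>i\<le>d div 2. card (keys_of_degree (d - 2 * i))) \<le> 42 * real d ^ 9"
    by (simp add: eval_nat_numeral mult_ac)
  then show "\<exists>n. hilb_le (cone Gr36) d n \<and> real n \<le> 42 * real d ^ 9" using hilb_le_Gr by blast
qed

lemma irreducible_Vty: "r \<le> 1 \<Longrightarrow> irreducible_space (subtopology zariski (Vty r))"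
  unfolding irreducible_space_iff
proof
  assume r: "r \<le> 1"
  have "KW r \<noteq> {}" unfolding KW_def by (intro ex_in_conv[THEN iffD1] exI CollectI conjI) (rule refl, auto intro: one_neq_zero)
  then have "cone (Vty r) \<noteq> {}" using KW_subset_KV[OF r] cone_Vty[OF r] by auto
  then show "Vty r \<noteq> {}" by (auto simp: cone_def)
  show "prime_cone (cone (Vty r))" using prime_cone_KV[OF r] cone_Vty[OF r] by simp
qed

section \<open>Critical points of the multilinear cubic\<close>

definition support :: "triple \<Rightarrow> nat set" where
  "support t = (case indices t of (i, j, k) \<Rightarrow> {i, j, k})"

definition weighted :: "(nat \<Rightarrow> complex) \<Rightarrow> complex^triple \<Rightarrow> complex^triple" where
  "weighted l x = (\<chi> t. x $ t * prod l (support t))"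

text \<open>The sum of the terms of the cubic which involve the variable \<open>i\<close>, evaluated at \<open>(1, \<dots>, 1)\<close>.\<close>

definition star_sum :: "complex^triple \<Rightarrow> nat \<Rightarrow> complex" where
  "star_sum x i = (\<Sum>t\<in>UNIV. if i \<in> support t then x $ t else 0)"

lemma support_indices: "indices t = (i, j, k) \<Longrightarrow> support t = {i, j, k}"
  by (simp add: support_def)

lemma of_nat_6_inj: "1 \<le> i \<Longrightarrow> i \<le> 6 \<Longrightarrow> 1 \<le> j \<Longrightarrow> j \<le> 6 \<Longrightarrow> (of_nat i :: 6) = of_nat j \<longleftrightarrow> i = j"
  by (metis num6_of_nat)

lemma partial_deriv_star_sum:
  assumes i: "i \<in> {1..6}"
  shows "l $ of_nat i * partial_deriv (of_nat i) (hyp_poly a) l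
    = star_sum (weighted (\<lambda>j. l $ of_nat j) a) i"
proof -
  let ?i = "of_nat i :: 6"
  define cof where "cof t = a $ t * (\<Prod>j\<in>support t - {i}. l $ of_nat j)" for t
  define rest where "rest t = a $ t * (\<Prod>j\<in>support t. l $ of_nat j)" for t
  have upd: "hyp_poly a (\<chi> j. if j = ?i then s else l $ j) =
      (\<Sum>t\<in>UNIV. if i \<in> support t then s * cof t else rest t)" for s
    unfolding hyp_poly_def
  proof (rule sum.cong[OF refl])
    fix t
    obtain p q r where t: "indices t = (p, q, r)" by (metis prod_cases3)
    note b = indices_bounds[OF t]
    have ip: "?i = of_nat p \<longleftrightarrow> i = p" "?i = of_nat q \<longleftrightarrow> i = q" "?i = of_nat r \<longleftrightarrow> i = r"
      "of_nat p = ?i \<longleftrightarrow> i = p" "of_nat q = ?i \<longleftrightarrow> i = q" "of_nat r = ?i \<longleftrightarrow> i = r"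
      using of_nat_6_inj[of i p] of_nat_6_inj[of i q] of_nat_6_inj[of i r] i b by auto
    have d: "p \<noteq> q" "q \<noteq> r" "p \<noteq> r" using b by auto
    have "{p, q, r} - {p} = {q, r}" "{p, q, r} - {q} = {p, r}" "{p, q, r} - {r} = {p, q}" using d by auto
    then show "(case indices t of (i', j, k) \<Rightarrow> a $ t * (\<chi> j. if j = ?i then s else l $ j) $ of_nat i' *
        (\<chi> j. if j = ?i then s else l $ j) $ of_nat j * (\<chi> j. if j = ?i then s else l $ j) $ of_nat k)
        = (if i \<in> support t then s * cof t else rest t)"
      unfolding cof_def rest_def support_indices[OF t] using d by (auto simp: t ip)
  qed
  have "((\<lambda>s. \<Sum>t\<in>UNIV. if i \<in> support t then s * cof t else rest t) has_field_derivative
      (\<Sum>t\<in>UNIV. if i \<in> support t then cof t else 0)) (at (l $ ?i))"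
  proof (rule DERIV_sum)
    fix t
    show "((\<lambda>s. if i \<in> support t then s * cof t else rest t) has_field_derivative
        (if i \<in> support t then cof t else 0)) (at (l $ ?i))"
      by (cases "i \<in> support t") (auto intro!: derivative_eq_intros)
  qed
  then have "partial_deriv ?i (hyp_poly a) l = (\<Sum>t\<in>UNIV. if i \<in> support t then cof t else 0)"
    unfolding partial_deriv_def upd by (rule DERIV_imp_deriv)
  moreover have "l $ ?i * (if i \<in> support t then cof t else 0) =
      (if i \<in> support t then weighted (\<lambda>j. l $ of_nat j) a $ t else 0)" for t
  proof -
    have "finite (support t)" by (simp add: support_def split: prod.split)
    then show ?thesis by (simp add: cof_def weighted_def prod.remove[of "support t" i])
  qed
  ultimately show ?thesis by (simp add: star_sum_def sum_distrib_left)
qed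

definition critical_points :: "triple proj set" where
  "critical_points = {P. \<exists>a\<in>hcoords P. \<exists>l. (\<forall>i. l $ i \<noteq> 0) \<and> (\<forall>i. partial_deriv i (hyp_poly a) l = 0)}"

lemma hypersimplex_discriminant_closure: "hypersimplex_discriminant = zariski closure_of critical_points"
  unfolding hypersimplex_discriminant_def critical_points_def ..

lemma critical_pointsI:
  assumes "a \<in> hcoords P" "\<And>i. i \<in> {1..6} \<Longrightarrow> l i \<noteq> 0" "\<And>i. i \<in> {1..6} \<Longrightarrow> star_sum (weighted l a) i = 0"
  shows "P \<in> critical_points"
proof -
  define L where "L = (\<chi> c::6. l (num6 c))"
  have Ll: "L $ of_nat i = l i" if "i \<in> {1..6}" for i using that by (simp add: L_def num6_of_nat)
  have w: "weighted (\<lambda>j. L $ of_nat j) a = weighted l a"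
    unfolding weighted_def Finite_Cartesian_Product.vec_eq_iff
  proof (intro allI, simp)
    fix t
    obtain p q r where t: "indices t = (p, q, r)" by (metis prod_cases3)
    have "prod (\<lambda>j. L $ of_nat j) (support t) = prod l (support t)"
      by (rule prod.cong) (use indices_bounds[OF t] Ll support_indices[OF t] in auto)
    then show "a $ t = 0 \<or> prod (\<lambda>j. L $ of_nat j) (support t) = prod l (support t)" by simp
  qed
  have nz: "\<forall>i. L $ i \<noteq> 0" unfolding forall_6_nat using assms(2) Ll by simp
  have "\<forall>i. partial_deriv i (hyp_poly a) L = 0" unfolding forall_6_nat
  proof
    fix i :: nat assume i: "i \<in> {1..6}"
    have "L $ of_nat i * partial_deriv (of_nat i) (hyp_poly a) L = 0"
      unfolding partial_deriv_star_sum[OF i] w using assms(3)[OF i] .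
    then show "partial_deriv (of_nat i) (hyp_poly a) L = 0" using nz by simp
  qed
  then show ?thesis unfolding critical_points_def using assms(1) nz by blast
qed

lemma critical_pointsE:
  assumes "P \<in> critical_points"
  obtains a l where "a \<in> hcoords P" "\<And>i. i \<in> {1..6} \<Longrightarrow> l i \<noteq> 0" "\<And>i. i \<in> {1..6} \<Longrightarrow> star_sum (weighted l a) i = 0"
proof -
  obtain a l where a: "a \<in> hcoords P" "\<forall>i. l $ i \<noteq> 0" "\<forall>i. partial_deriv i (hyp_poly a) l = 0"
    using assms unfolding critical_points_def by blast
  show ?thesis
    by (rule that[OF a(1), of "\<lambda>i. l $ of_nat i"])
      (use a in \<open>simp_all flip: partial_deriv_star_sum\<close>)
qed

lemma weighted_plk: "weighted l (plk V) = plk (\<lambda>i. l i *s V i)"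
  unfolding weighted_def Finite_Cartesian_Product.vec_eq_iff
proof (intro allI)
  fix t
  obtain p q r where t: "indices t = (p, q, r)" by (metis prod_cases3)
  then show "(\<chi> t. plk V $ t * prod l (support t)) $ t = plk (\<lambda>i. l i *s V i) $ t"
    using indices_bounds[OF t] by (simp add: plk_def t support_indices[OF t] br_linear mult_ac)
qed

fun contains :: "pr \<Rightarrow> bool \<Rightarrow> tri \<Rightarrow> bool" where
  "contains p s (Mix a b c) = (side p (Mix a b c) = Some s)"
| "contains p s (Fwd q u) = (p = q \<or> p = nxt q \<and> s = u)"
| "contains p s (Bwd q u) = (p = q \<or> p = prv q \<and> s = u)"

lemma sum_tri:
  fixes f :: "tri \<Rightarrow> 'a::comm_monoid_add"
  shows "(\<Sum>T\<in>UNIV. f T) = (\<Sum>a\<in>UNIV. \<Sum>b\<in>UNIV. \<Sum>c\<in>UNIV. f (Mix a b c)) + (\<Sum>p\<in>{A,B,C}. \<Sum>s\<in>UNIV. f (Fwd p s))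
    + (\<Sum>p\<in>{A,B,C}. \<Sum>s\<in>UNIV. f (Bwd p s))"
proof -
  have U: "UNIV = (\<lambda>(a, b, c). Mix a b c) ` UNIV \<union> ((\<lambda>(p, s). Fwd p s) ` ({A,B,C} \<times> UNIV) \<union> (\<lambda>(p, s). Bwd p s) ` ({A,B,C} \<times> UNIV))"
    (is "_ = ?M \<union> (?F \<union> ?B)")
  proof (rule UNIV_eq_I)
    fix T :: tri
    show "T \<in> ?M \<union> (?F \<union> ?B)"
    proof (cases T)
      case (Fwd p s) then show ?thesis by (cases p) auto
    next
      case (Bwd p s) then show ?thesis by (cases p) auto
    qed (auto simp: image_iff)
  qed
  have "(\<Sum>T\<in>UNIV. f T) = sum f ?M + (sum f ?F + sum f ?B)"
    by (subst U, subst sum.union_disjoint, simp, simp, force, subst sum.union_disjoint) auto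
  also have "sum f ?M = (\<Sum>a\<in>UNIV. \<Sum>b\<in>UNIV. \<Sum>c\<in>UNIV. f (Mix a b c))"
    by (subst sum.reindex) (auto simp: inj_on_def UNIV_bool add_ac simp flip: UNIV_Times_UNIV sum.cartesian_product intro!: sum.cong)
  also have "sum f ?F = (\<Sum>(p, s)\<in>{A,B,C} \<times> UNIV. f (Fwd p s))"
    by (subst sum.reindex) (auto simp: inj_on_def split_def comp_def)
  also have "\<dots> = (\<Sum>p\<in>{A,B,C}. \<Sum>s\<in>UNIV. f (Fwd p s))" by (rule sum.cartesian_product[symmetric])
  also have "sum f ?B = (\<Sum>(p, s)\<in>{A,B,C} \<times> UNIV. f (Bwd p s))"
    by (subst sum.reindex) (auto simp: inj_on_def split_def comp_def)
  also have "\<dots> = (\<Sum>p\<in>{A,B,C}. \<Sum>s\<in>UNIV. f (Bwd p s))" by (rule sum.cartesian_product[symmetric])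
  finally show ?thesis by (simp add: add.assoc)
qed

lemma support_idx:
  assumes r: "r \<le> 1" shows "shift r (corner p s) \<in> support (idx r T) \<longleftrightarrow> contains p s T"
proof -
  obtain i j k where c: "corners T = (i, j, k)" by (metis prod_cases3)
  have "0 < fst (corners T) \<and> fst (corners T) < fst (snd (corners T)) \<and>
      fst (snd (corners T)) < snd (snd (corners T)) \<and> snd (snd (corners T)) \<le> 6"
    by (induction T rule: tri_cases) simp_all
  then have ijk: "0 < i" "i < j" "j < k" "k \<le> 6" unfolding c by simp_all
  have "support (idx r T) = shift r ` {i, j, k}"
    unfolding support_def indices_idx[OF r] c using r ijk by (auto simp: shift_corners_def shift_def)
  moreover have "inj_on (shift r) {1..6}"
    by (rule inj_onI) (use r in \<open>auto simp: shift_def split: if_splits\<close>)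
  moreover have "corner p s \<in> {1..6}" by (cases p; cases s) simp_all
  ultimately have "shift r (corner p s) \<in> support (idx r T) \<longleftrightarrow> corner p s \<in> {i, j, k}"
    using ijk by (simp del: image_insert add: inj_on_image_mem_iff)
  also have "\<dots> \<longleftrightarrow> corner p s \<in> (case corners T of (i, j, k) \<Rightarrow> {i, j, k})" by (simp add: c)
  also have "\<dots> \<longleftrightarrow> contains p s T"
    by (induction T rule: tri_cases; cases p; cases s) simp_all
  finally show ?thesis .
qed

lemma star_sum_tri:
  assumes r: "r \<le> 1"
  shows "star_sum (plk V) (shift r (corner p s)) = (\<Sum>T\<in>UNIV. if contains p s T then sg T * y (conf r V) T else 0)"
proof -
  have "star_sum (plk V) (shift r (corner p s)) =
      (\<Sum>T\<in>UNIV. if shift r (corner p s) \<in> support (idx r T) then plk V $ idx r T else 0)"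
    unfolding star_sum_def
    by (rule sum.reindex_bij_betw[OF bij_idx[OF r], symmetric])
  then show ?thesis unfolding support_idx[OF r] y_conf[OF r] by (simp cong: if_cong)
qed

lemma shift_corner_surj:
  assumes "r \<le> 1" "i \<in> {1..6}" obtains p s where "i = shift r (corner p s)"
proof -
  have "r = 0 \<or> r = 1" using assms by auto
  moreover have "i = 1 \<or> i = 2 \<or> i = 3 \<or> i = 4 \<or> i = 5 \<or> i = 6" using assms(2) by auto
  ultimately have "\<exists>p s. i = shift r (corner p s)"
    by (elim disjE; simp add: shift_def)
      (rule exI[of _ A] exI[of _ B] exI[of _ C], rule exI[of _ True] exI[of _ False], simp)+
  then show ?thesis using that by blast
qed

text \<open>With concurrent lines, the columns can be rescaled such that the two vectors of each pair
  add up to a multiple of the common vector and the three bivectors add up to zero; then all partial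
  derivatives vanish at \<open>(1, \<dots>, 1)\<close>.\<close>

lemma star_sum_pencil:
  assumes r: "r \<le> 1" and \<beta>: "\<And>p. \<beta> p \<noteq> 0"
  shows "star_sum (plk (unconf r (pencil \<rho> (\<lambda>p. (\<beta> p)^2) (\<lambda>p s. if s then inverse (\<beta> p) else - \<beta> p)))) (shift r (corner p s)) = 0"
proof -
  have n: "(\<beta> p)^2 \<noteq> 0" for p using \<beta> by simp
  have b: "\<beta> A \<noteq> 0" "\<beta> B \<noteq> 0" "\<beta> C \<noteq> 0" using \<beta> by auto
  show ?thesis unfolding star_sum_tri[OF r] conf_unconf[OF r] y_pencil[of "\<lambda>p. (\<beta> p)^2", OF n] sum_tri
    by (cases p; cases s) (simp_all add: UNIV_bool scaling_def slopes_def mixed_factor_def b field_simps power2_eq_square)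
qed

text \<open>The rescaling of the columns is a point of the torus at which the cubic is singular.\<close>

lemma KW_critical:
  assumes r: "r \<le> 1" and x: "x \<in> KW r" "x \<in> hcoords P"
  shows "P \<in> critical_points"
proof -
  obtain \<rho> b t where x': "x = plk (unconf r (pencil \<rho> b t))" "\<forall>p. b p \<noteq> 0" "\<forall>p s. t p s \<noteq> 0"
    using x(1) unfolding KW_def by blast
  define \<beta> where "\<beta> p = csqrt (b p)" for p
  have \<beta>: "\<beta> p \<noteq> 0" "b p = (\<beta> p)^2" for p using x'(2) by (simp_all add: \<beta>_def)
  define \<tau> where "\<tau> p s = (if s then inverse (\<beta> p) else - \<beta> p)" for p s
  define l where "l i = unconf r (\<lambda>p s. vector [\<tau> p s / t p s, 0, 0]) i $ 1" for i
  have lc: "l (shift r (corner p s)) = \<tau> p s / t p s" for p s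
    using conf_unconf[OF r, of "\<lambda>p s. vector [\<tau> p s / t p s, 0, 0]"] unfolding l_def conf_def fun_eq_iff
    by simp
  have w: "weighted l x = plk (unconf r (pencil \<rho> b \<tau>))"
    unfolding x'(1) weighted_plk
  proof (rule plk_cong)
    fix i assume "1 \<le> i" "i \<le> (6::nat)"
    then obtain p s where i: "i = shift r (corner p s)" using shift_corner_surj[OF r, of i] by auto
    have "unconf r v i = v p s" for v using conf_unconf[OF r, of v] unfolding i conf_def fun_eq_iff by simp
    then show "l i *s unconf r (pencil \<rho> b t) i = unconf r (pencil \<rho> b \<tau>) i"
      using x'(3) unfolding i lc by (simp add: pencil_def vector_smult_assoc)
  qed
  show ?thesis
  proof (rule critical_pointsI[OF x(2)])
    fix i :: nat assume "i \<in> {1..6}"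
    then obtain p s where i: "i = shift r (corner p s)" using shift_corner_surj[OF r] by blast
    show "l i \<noteq> 0" unfolding i lc using x'(3) \<beta>(1) by (simp add: \<tau>_def)
    show "star_sum (weighted l x) i = 0"
    proof -
      have "b = (\<lambda>p. (\<beta> p)^2)" "\<tau> = (\<lambda>p s. if s then inverse (\<beta> p) else - \<beta> p)"
        by (intro ext, rule \<beta>(2), intro ext, simp add: \<tau>_def)
      then show ?thesis unfolding w i using star_sum_pencil[OF r, of \<beta> \<rho> p s] \<beta>(1) by metis
    qed
  qed
qed

text \<open>A form that vanishes on the discriminant vanishes on the generic configurations with concurrent lines,
  hence on all of them.\<close>

lemma Vty_subset_discriminant:
  assumes r: "r \<le> 1" shows "Vty r \<subseteq> hypersimplex_discriminant"
proof
  fix P assume P: "P \<in> Vty r"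
  show "P \<in> hypersimplex_discriminant"
  proof (rule ccontr)
    assume "P \<notin> hypersimplex_discriminant"
    then obtain f e v where f: "f \<in> forms e" "\<forall>v\<in>cone hypersimplex_discriminant. eval f v = 0"
      "v \<in> hcoords P" "eval f v \<noteq> 0"
      using closed_separating_form[of hypersimplex_discriminant P] unfolding hypersimplex_discriminant_closure by auto
    have "\<forall>x\<in>KW r. eval f x = 0"
    proof
      fix x assume x: "x \<in> KW r"
      then have "x \<noteq> 0" using KW_nonzero[OF r] by (auto simp: KW_def)
      then obtain Q where Q: "x \<in> hcoords Q" using hcoords_ex by blast
      have "Q \<in> hypersimplex_discriminant"
        using KW_critical[OF r x Q] subset_closure_zariski unfolding hypersimplex_discriminant_closure by blast
      then show "eval f x = 0" using f(2) Q by (auto simp: cone_def)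
    qed
    then have "\<forall>x\<in>KV r. eval f x = 0" by (rule vanishes_KW_KV[OF r f(1)])
    moreover have "v \<in> KV r" using P f(3) by (auto simp: cone_Vty[OF r, symmetric] cone_def)
    ultimately show False using f(4) by blast
  qed
qed

section \<open>A chain of Schubert varieties\<close>

text \<open>Each of the three rows is supported in an initial segment of the six columns, so that a minor can only
  be nonzero if its columns are bounded by the ends of the segments.\<close>

fun echelon :: "nat \<times> nat \<times> nat \<Rightarrow> (nat \<Rightarrow> complex^3) set" where
  "echelon (a, b, c) = {U. (\<forall>i\<in>{a<..6}. U i $ 1 = 0) \<and> (\<forall>i\<in>{b<..6}. U i $ 2 = 0) \<and> (\<forall>i\<in>{c<..6}. U i $ 3 = 0)}"

lemma echelon_br:
  assumes "U \<in> echelon (a, b, c)" "a \<le> b" "b \<le> c" "i < j" "j < k" "k \<le> 6" "\<not> (i \<le> a \<and> j \<le> b \<and> k \<le> c)"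
  shows "br (U i) (U j) (U k) = 0"
proof -
  consider "i > a" | "j > b" | "k > c" using assms(7) by linarith
  then show ?thesis
    by cases (use assms in \<open>simp_all add: br_def\<close>)
qed

text \<open>The Pluecker vectors of the cyclically shifted echelon matrices; their rays are dense in a Schubert
  variety.\<close>

definition schubert_cone :: "nat \<Rightarrow> nat \<times> nat \<times> nat \<Rightarrow> (complex^triple) set" where
  "schubert_cone r m = {plk V | V. V \<in> {V. (\<lambda>i. V (shift r i)) \<in> echelon m} \<and> plk V \<noteq> 0}"

definition schubert :: "nat \<Rightarrow> nat \<times> nat \<times> nat \<Rightarrow> triple proj set" where
  "schubert r m = zariski closure_of {P. \<exists>v\<in>hcoords P. v \<in> schubert_cone r m}"

lemma prime_schubert_cone: "prime_cone (schubert_cone r m)"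
  unfolding schubert_cone_def
proof (rule prime_cone_linear_family)
  fix V W t assume "V \<in> {V. (\<lambda>i. V (shift r i)) \<in> echelon m}" "W \<in> {V. (\<lambda>i. V (shift r i)) \<in> echelon m}"
  then show "(\<lambda>i. V i + t *s (W i - V i)) \<in> {V. (\<lambda>i. V (shift r i)) \<in> echelon m}"
    by (cases m) simp
qed

lemma eval_on_cone_rays:
  assumes "p \<in> forms d" "\<forall>v\<in>K. eval p v = 0"
  shows "\<forall>v\<in>cone {P. \<exists>v\<in>hcoords P. v \<in> K}. eval p v = 0"
proof
  fix v assume "v \<in> cone {P. \<exists>v\<in>hcoords P. v \<in> K}"
  then obtain P w where P: "v \<in> hcoords P" "w \<in> hcoords P" "w \<in> K" by (auto simp: cone_def)
  then obtain c where "v = c *s w" using hcoords_ray[OF P(2)] by auto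
  then show "eval p v = 0" using eval_scale_form[OF assms(1)] assms(2) P(3) by simp
qed

lemma prime_cone_rays:
  assumes "prime_cone K" "0 \<notin> K" shows "prime_cone (cone {P. \<exists>v\<in>hcoords P. v \<in> K})"
  unfolding prime_cone_def
proof (intro allI ballI impI)
  fix a b p q assume pq: "p \<in> forms a" "q \<in> forms b" "\<forall>v\<in>cone {P. \<exists>v\<in>hcoords P. v \<in> K}. eval p v * eval q v = 0"
  have "K \<subseteq> cone {P. \<exists>v\<in>hcoords P. v \<in> K}"
  proof
    fix v assume v: "v \<in> K"
    then obtain P where "v \<in> hcoords P" using hcoords_ex[of v] assms(2) by metis
    then show "v \<in> cone {P. \<exists>v\<in>hcoords P. v \<in> K}" using v by (auto simp: cone_def)
  qed
  then have "(\<forall>v\<in>K. eval p v = 0) \<or> (\<forall>v\<in>K. eval q v = 0)"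
    using pq assms(1) unfolding prime_cone_def by blast
  then show "(\<forall>v\<in>cone {P. \<exists>v\<in>hcoords P. v \<in> K}. eval p v = 0) \<or> (\<forall>v\<in>cone {P. \<exists>v\<in>hcoords P. v \<in> K}. eval q v = 0)"
    using eval_on_cone_rays pq(1,2) by blast
qed

lemma plk_shift:
  assumes "r \<le> 1" "1 \<le> i" "i < j" "j < k" "k \<le> 6"
  shows "plk V $ triple (shift_corners r (i, j, k)) = br (V (shift r i)) (V (shift r j)) (V (shift r k))"
proof -
  from assms(1) have "r = 0 \<or> r = 1" by auto
  then show ?thesis using assms by (auto simp: shift_corners_def shift_def plk_triple br_rotate)
qed

lemma schubert_coordinate_0:
  assumes r: "r \<le> 1" and m: "a \<le> b" "b \<le> c" and i: "1 \<le> i" "i < j" "j < k" "k \<le> 6"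
    and n: "\<not> (i \<le> a \<and> j \<le> b \<and> k \<le> c)" and v: "v \<in> schubert_cone r (a, b, c)"
  shows "v $ triple (shift_corners r (i, j, k)) = 0"
proof -
  obtain V where V: "v = plk V" "(\<lambda>i. V (shift r i)) \<in> echelon (a, b, c)"
    using v unfolding schubert_cone_def by blast
  show ?thesis unfolding V(1) plk_shift[OF r i] using echelon_br[OF V(2) m i(2-4) n] by simp
qed

lemma schubert_coordinate_nz:
  assumes r: "r \<le> 1" and m: "1 \<le> a" "a < b" "b < c" "c \<le> 6"
  shows "\<exists>v\<in>schubert_cone r (a, b, c). v $ triple (shift_corners r (a, b, c)) \<noteq> 0"
proof -
  define V where "V l = (if l = shift r a then vector [1, 0, 0] else if l = shift r b then vector [0, 1, 0]
     else if l = shift r c then vector [0, 0, 1] else 0 :: complex^3)" for l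
  have inj: "shift r i = shift r j \<longleftrightarrow> i = j" if "i \<ge> 1" "j \<ge> 1" "j \<le> 6" "i \<le> 6" for i j
    using r that by (auto simp: shift_def)
  have abc: "V (shift r a) = vector [1, 0, 0]" "V (shift r b) = vector [0, 1, 0]" "V (shift r c) = vector [0, 0, 1]"
    using m inj[of b a] inj[of c a] inj[of c b] by (auto simp: V_def)
  have nz: "plk V $ triple (shift_corners r (a, b, c)) = 1"
    unfolding plk_shift[OF r m] abc by (simp add: br_def)
  have "V (shift r i) = (if i = a then vector [1, 0, 0] else if i = b then vector [0, 1, 0]
     else if i = c then vector [0, 0, 1] else 0)" if "i \<in> {1..6}" for i
    using inj[of i a] inj[of i b] inj[of i c] m that by (auto simp: V_def)
  then have "(\<lambda>i. V (shift r i)) \<in> echelon (a, b, c)" using m by auto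
  moreover have "plk V \<noteq> 0" using nz by auto
  ultimately have "plk V \<in> schubert_cone r (a, b, c)" unfolding schubert_cone_def by blast
  then show ?thesis using nz by (intro bexI[of _ "plk V"]) auto
qed

lemma schubert_cone_nonzero: "0 \<notin> schubert_cone r m"
  unfolding schubert_cone_def by auto

lemma schubert_cone_subset: "schubert_cone r m \<subseteq> cone (schubert r m)"
proof
  fix v assume v: "v \<in> schubert_cone r m"
  then obtain P where P: "v \<in> hcoords P" using hcoords_ex[of v] schubert_cone_nonzero by metis
  have "P \<in> schubert r m" unfolding schubert_def
  proof (rule subsetD[OF subset_closure_zariski], rule CollectI)
    show "\<exists>v\<in>hcoords P. v \<in> schubert_cone r m" using P v by blast
  qed
  then show "v \<in> cone (schubert r m)" using P by (auto simp: cone_def)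
qed

lemma schubert_vanishes:
  assumes "p \<in> forms d" "\<forall>v\<in>schubert_cone r m. eval p v = 0"
  shows "\<forall>v\<in>cone (schubert r m). eval p v = 0"
  unfolding schubert_def by (rule form_vanishes_closure[OF assms(1) eval_on_cone_rays[OF assms]])

lemma irreducible_schubert:
  assumes r: "r \<le> 1" and m: "1 \<le> a" "a < b" "b < c" "c \<le> 6"
  shows "irreducible_space (subtopology zariski (schubert r (a, b, c)))"
  unfolding schubert_def
proof (rule irreducible_closure)
  obtain v where v: "v \<in> schubert_cone r (a, b, c)" using schubert_coordinate_nz[OF assms] by blast
  then obtain P where "v \<in> hcoords P" using hcoords_ex[of v] schubert_cone_nonzero by metis
  then show "{P. \<exists>v\<in>hcoords P. v \<in> schubert_cone r (a, b, c)} \<noteq> {}" using v by blast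
qed (rule prime_cone_rays[OF prime_schubert_cone schubert_cone_nonzero])

lemma schubert_strict:
  assumes r: "r \<le> 1" and m: "a < b" "b < c" and m': "1 \<le> a'" "a' < b'" "b' < c'" "c' \<le> 6"
    and le: "a \<le> a'" "b \<le> b'" "c \<le> c'" and ne: "(a, b, c) \<noteq> (a', b', c')"
  shows "schubert r (a, b, c) \<subset> schubert r (a', b', c')"
proof -
  have "echelon (a, b, c) \<subseteq> echelon (a', b', c')" using le by auto
  then have "schubert_cone r (a, b, c) \<subseteq> schubert_cone r (a', b', c')" unfolding schubert_cone_def by blast
  then have sub: "schubert r (a, b, c) \<subseteq> schubert r (a', b', c')"
    unfolding schubert_def by (intro closure_of_mono) blast
  let ?x = "Var (triple (shift_corners r (a', b', c'))) :: (triple, complex) mpoly"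
  have "\<forall>v\<in>cone (schubert r (a, b, c)). eval ?x v = 0"
  proof (rule schubert_vanishes[OF forms_Var], rule ballI)
    fix v assume v: "v \<in> schubert_cone r (a, b, c)"
    have "\<not> (a' \<le> a \<and> b' \<le> b \<and> c' \<le> c)" using le ne by auto
    from schubert_coordinate_0[OF r _ _ m' this v] show "eval ?x v = 0" using m by simp
  qed
  moreover have "\<exists>v\<in>cone (schubert r (a', b', c')). eval ?x v \<noteq> 0"
    using schubert_coordinate_nz[OF r m'] schubert_cone_subset by (metis eval_Var subsetD)
  ultimately have "schubert r (a, b, c) \<noteq> schubert r (a', b', c')" by auto
  then show ?thesis using sub by blast
qed

text \<open>On the largest Schubert variety, one of the brackets in each term of the defining quadric vanishes: the
  vectors \<open>5, 6\<close> are multiples of one vector.\<close>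

lemma schubert_346_subset_Vty:
  assumes r: "r \<le> 1" shows "schubert r (3, 4, 6) \<subset> Vty r"
proof -
  have "{P. \<exists>v\<in>hcoords P. v \<in> schubert_cone r (3, 4, 6)} \<subseteq> Vty r"
  proof clarify
    fix P v assume v: "v \<in> hcoords P" "v \<in> schubert_cone r (3, 4, 6)"
    then obtain V where V: "v = plk V" "plk V \<noteq> 0" "(\<lambda>i. V (shift r i)) \<in> echelon (3, 4, 6)"
      unfolding schubert_cone_def by blast
    have "br (V (shift r 4)) (V (shift r 5)) (V (shift r 6)) = 0" "br (V (shift r 3)) (V (shift r 5)) (V (shift r 6)) = 0"
      using echelon_br[OF V(3), of 4 5 6] echelon_br[OF V(3), of 3 5 6] by simp_all
    then have "concurrency (conf r V) = 0" by (simp add: concurrency_def conf_def)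
    then have "v \<in> KV r" using V by (auto simp: KV_def)
    then obtain Q where "Q \<in> Vty r" "v \<in> hcoords Q" unfolding cone_Vty[OF r, symmetric] by (auto simp: cone_def)
    then show "P \<in> Vty r" using hcoords_unique v(1) by blast
  qed
  then have sub: "schubert r (3, 4, 6) \<subseteq> Vty r"
    unfolding schubert_def by (rule closure_of_minimal[OF _ closedin_Vty])
  let ?x = "Var (idx r (Bwd C True)) :: (triple, complex) mpoly"
  have "\<forall>v\<in>cone (schubert r (3, 4, 6)). eval ?x v = 0"
    by (rule schubert_vanishes[OF forms_Var])
      (use schubert_coordinate_0[OF r, of 3 4 6 4 5 6] in \<open>auto simp: idx_def\<close>)
  moreover have "\<exists>v\<in>cone (Vty r). eval ?x v \<noteq> 0"
  proof -
    let ?V = "unconf r (pencil 1 (\<lambda>_. 1) (\<lambda>_ _. 1))"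
    have "plk ?V \<in> cone (Vty r)" unfolding cone_Vty[OF r]
      using KW_subset_KV[OF r] unfolding KW_def by (rule subsetD) (intro CollectI exI conjI, rule refl, auto)
    moreover have "y (conf r ?V) (Bwd C True) \<noteq> 0"
      unfolding conf_unconf[OF r] using y_pencil[of "\<lambda>_. 1" 1 "\<lambda>_ _. 1" "Bwd C True"]
      by (simp add: scaling_def slopes_def mixed_factor_def)
    then have "eval ?x (plk ?V) \<noteq> 0" unfolding y_conf[OF r] by simp
    ultimately show ?thesis by blast
  qed
  ultimately have "schubert r (3, 4, 6) \<noteq> Vty r" by auto
  then show ?thesis using sub by blast
qed

lemma proj_dim_Vty:
  assumes r: "r \<le> 1" shows "proj_dim (Vty r) = 8"
proof (rule antisym)
  show "proj_dim (Vty r) \<le> 8" using proj_dim_le[OF closedin_Vty bounded_growth_Vty[OF r]] by simp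
  define ms :: "(nat \<times> nat \<times> nat) list" where
    "ms = [(1,2,3), (1,2,4), (1,2,5), (1,2,6), (1,3,6), (1,4,6), (2,4,6), (3,4,6)]"
  define Z where "Z i = (if i < 8 then schubert r (ms ! i) else Vty r)" for i
  have step: "Z i \<subset> Z (Suc i)" if "i < 8" for i
  proof -
    consider "i = 7" | "i = 0" | "i = 1" | "i = 2" | "i = 3" | "i = 4" | "i = 5" | "i = 6" using \<open>i < 8\<close> by linarith
    then show ?thesis
      by cases (use schubert_346_subset_Vty[OF r] schubert_strict[OF r] in \<open>auto simp: Z_def ms_def\<close>)
  qed
  have irr: "irreducible_space (subtopology zariski (Z i)) \<and> closedin zariski (Z i)" if "i \<le> 8" for i
  proof (cases "i = 8")
    case True
    then show ?thesis using irreducible_Vty[OF r] closedin_Vty by (simp add: Z_def)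
  next
    case False
    then consider "i = 7" | "i = 0" | "i = 1" | "i = 2" | "i = 3" | "i = 4" | "i = 5" | "i = 6" using \<open>i \<le> 8\<close> by linarith
    then have "irreducible_space (subtopology zariski (Z i))"
      by cases (use irreducible_schubert[OF r] in \<open>simp_all add: Z_def ms_def\<close>)
    moreover have "closedin zariski (Z i)" using False that by (simp add: Z_def schubert_def)
    ultimately show ?thesis by simp
  qed
  have sub: "Z i \<subseteq> Vty r" if "i \<le> 8" for i
    using that
  proof (induction "8 - i" arbitrary: i)
    case 0
    then show ?case by (simp add: Z_def)
  next
    case (Suc n)
    then show ?case using step[of i] by (metis Suc_diff_Suc Suc_leI diff_Suc_1 diff_is_0_eq' less_imp_le nat.simps(3) not_le order_trans psubset_imp_subset zero_less_diff)
  qed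
  have "proj_dim (Vty r) \<ge> real 8"
    by (rule proj_dim_ge[where Z = Z]) (use irr sub step in auto)
  then show "8 \<le> proj_dim (Vty r)" by simp
qed

section \<open>The varieties are components\<close>

text \<open>If the discriminant does not contain the Grassmannian, then there is no room for an irreducible set
  strictly between: it would have Hilbert functions of growth 9, and the Grassmannian of growth 10.\<close>

lemma component_Vty:
  assumes r: "r \<le> 1"
    and F: "F \<in> forms e" "\<forall>v\<in>cone hypersimplex_discriminant. eval F v = 0" "\<exists>v\<in>cone Gr36. eval F v \<noteq> 0"
  shows "Vty r \<in> irreducible_components (subtopology zariski (hypersimplex_discriminant \<inter> Gr36))"
proof -
  let ?X = "hypersimplex_discriminant \<inter> Gr36"
  have sub: "Vty r \<subseteq> ?X" using Vty_subset_discriminant[OF r] Vty_subset_Gr36 by blast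
  have maximal: "T = Vty r" if T: "Vty r \<subseteq> T" "T \<subseteq> ?X" "irreducible_space (subtopology zariski T)" for T
  proof (rule ccontr)
    assume "T \<noteq> Vty r"
    then obtain P where P: "P \<in> T" "P \<notin> Vty r" using T(1) by blast
    obtain f d v where f: "f \<in> forms d" "\<forall>v\<in>cone (Vty r). eval f v = 0" "v \<in> hcoords P" "eval f v \<noteq> 0"
      using closed_separating_form[OF closedin_Vty P(2)] .
    have prime: "prime_cone (cone T)" using T(3) irreducible_space_iff by blast
    have "Vty r \<noteq> {}" using irreducible_Vty[OF r] irreducible_space_iff by blast
    then have ne: "cone (Vty r) \<noteq> {}" using hcoords_nonempty by (auto simp: cone_def)
    have "v \<in> cone T" using P(1) f(3) by (auto simp: cone_def)
    then have g: "grows (cone T) (Suc 8)"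
      using grows_step[OF cone_mono[OF T(1)] prime ne f(1,2) _ grows_Vty[OF r]] f(4) by blast
    have "cone T \<subseteq> cone hypersimplex_discriminant" "cone T \<subseteq> cone Gr36" using T(2) by (auto intro!: cone_mono)
    moreover have "cone T \<noteq> {}" using \<open>v \<in> cone T\<close> by blast
    ultimately have "grows (cone Gr36) (Suc (Suc 8))"
      using grows_step[OF _ prime_cone_Gr36 _ F(1) _ F(3) g] F(2) by blast
    then show False using grows_bounded[OF _ bounded_growth_Gr36] by force
  qed
  have top: "topspace (subtopology zariski ?X) = ?X" by simp
  have subtop: "subtopology (subtopology zariski ?X) T = subtopology zariski T" if "T \<subseteq> ?X" for T
    using that by (simp add: subtopology_subtopology Int_absorb1)
  show ?thesis unfolding irreducible_components_def top
  proof (intro CollectI conjI allI impI)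
    show "Vty r \<subseteq> ?X" by (rule sub)
    show "irreducible_space (subtopology (subtopology zariski ?X) (Vty r))"
      unfolding subtop[OF sub] by (rule irreducible_Vty[OF r])
    fix T assume "Vty r \<subseteq> T \<and> T \<subseteq> ?X \<and> irreducible_space (subtopology (subtopology zariski ?X) T)"
    then show "T = Vty r" using maximal subtop by metis
  qed
qed

lemma Vty_distinct: "Vty 0 \<noteq> Vty 1"
proof
  assume eq: "Vty 0 = Vty 1"
  let ?V = "unconf 0 (pencil 1 (\<lambda>_. 1) (\<lambda>_ _. 1))"
  have "plk ?V \<in> KV 0"
    by (rule subsetD[OF KW_subset_KV]) (simp, unfold KW_def, intro CollectI exI conjI, rule refl, auto)
  then have "plk ?V \<in> KV 1" using cone_Vty[of 0] cone_Vty[of 1] eq by simp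
  then obtain W where W: "plk ?V = plk W" "concurrency (conf 1 W) = 0" unfolding KV_def by blast
  then have "concurrency (conf 1 ?V) = 0" using eval_quadric[of 1 ?V] eval_quadric[of 1 W] by simp
  then show False
    by (simp add: concurrency_def conf_def shift_def unconf_def pencil_def br_def)
qed

section \<open>Elimination on the toric variety of the hypersimplex\<close>

text \<open>In the chart of the triple \<open>I\<close>, with coordinates \<open>1 / \<lambda>\<^sub>j\<close> for \<open>j \<in> I\<close> and \<open>\<lambda>\<^sub>j\<close> for
  \<open>j \<notin> I\<close>, the ratio of the monomials of \<open>t\<close> and \<open>I\<close> is the product of the coordinates in the symmetric
  difference.\<close>

definition cols :: "triple \<Rightarrow> 6 set" where "cols t = of_nat ` support t"

definition chart_exp :: "triple \<Rightarrow> triple \<Rightarrow> 6 \<Rightarrow>\<^sub>0 nat" where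
  "chart_exp I t = (\<Sum>j\<in>sym_diff (cols I) (cols t). Poly_Mapping.single j 1)"

lemma lookup_chart_exp: "Poly_Mapping.lookup (chart_exp I t) j = (if j \<in> sym_diff (cols I) (cols t) then 1 else 0)"
  unfolding chart_exp_def by (simp add: lookup_sum lookup_single when_def)

definition chart_form :: "triple \<Rightarrow> (complex^triple) \<Rightarrow> 6 \<Rightarrow> (6, complex) mpoly" where
  "chart_form I x i = (\<Sum>t\<in>{t. i \<in> cols t}. Poly_Mapping.single (chart_exp I t) (x $ t))"

lemma eval_chart_form:
  "eval (chart_form I x i) z = (\<Sum>t\<in>{t. i \<in> cols t}. x $ t * (\<Prod>j\<in>sym_diff (cols I) (cols t). z $ j))"
proof -
  have "(\<Prod>j\<in>UNIV. z $ j ^ Poly_Mapping.lookup (chart_exp I t) j) = (\<Prod>j\<in>sym_diff (cols I) (cols t). z $ j)" for t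
    by (rule prod.mono_neutral_cong_right) (auto simp: lookup_chart_exp)
  then show ?thesis unfolding chart_form_def eval_sum eval_single by simp
qed

text \<open>The weight for which the chart coordinates of \<open>I\<close> have degree \<open>- 1\<close> and the others degree \<open>1\<close>.
  All coefficients can be assumed to have weight 0.\<close>

definition chart_weight :: "triple \<Rightarrow> (6 \<Rightarrow>\<^sub>0 nat) \<Rightarrow> int" where
  "chart_weight I m = (\<Sum>j\<in>UNIV. (if j \<in> cols I then -1 else 1) * int (Poly_Mapping.lookup m j))"

lemma chart_weight_add: "chart_weight I (m + n) = chart_weight I m + chart_weight I n"
  by (simp add: chart_weight_def lookup_add distrib_left sum.distrib)

lemma of_nat_num6: "of_nat (num6 c) = c"
proof -
  have "\<forall>c::6. of_nat (num6 c) = c" unfolding forall_6_nat by (simp add: num6_of_nat)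
  then show ?thesis by blast
qed

lemma card_cols: "card (cols t) = 3"
proof -
  obtain i j k where t: "indices t = (i, j, k)" by (metis prod_cases3)
  note b = indices_bounds[OF t]
  have "inj_on (of_nat :: nat \<Rightarrow> 6) (support t)"
    by (rule inj_onI) (use b of_nat_6_inj in \<open>auto simp: support_indices[OF t]\<close>)
  then have "card (cols t) = card (support t)" unfolding cols_def by (rule card_image)
  then show ?thesis using b by (simp add: support_indices[OF t])
qed

lemma chart_weight_chart_exp: "chart_weight I (chart_exp I t) = 0"
proof -
  have "chart_weight I (chart_exp I t) = (\<Sum>j\<in>UNIV. (if j \<in> cols t - cols I then 1 else 0) - (if j \<in> cols I - cols t then 1 else 0))"
    unfolding chart_weight_def by (rule sum.cong) (auto simp: lookup_chart_exp)
  also have "\<dots> = int (card (cols t - cols I)) - int (card (cols I - cols t))"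
    by (simp add: sum_subtractf sum.If_cases set_diff_eq)
  also have "\<dots> = 0"
    using card_cols[of t] card_cols[of I] card_Diff_subset_Int[of "cols t" "cols I"] card_Diff_subset_Int[of "cols I" "cols t"]
    by (simp add: Int_commute)
  finally show ?thesis .
qed

text \<open>Projection onto the part of weight zero. It is linear over the chart forms, which have weight zero
  themselves, so that it can be applied to a certificate.\<close>

definition balanced :: "triple \<Rightarrow> (6, complex) mpoly \<Rightarrow> (6, complex) mpoly" where
  "balanced I p = (\<Sum>m\<in>Poly_Mapping.keys p. if chart_weight I m = 0 then Poly_Mapping.single m (Poly_Mapping.lookup p m) else 0)"

lemma lookup_balanced:
  "Poly_Mapping.lookup (balanced I p) m = (if chart_weight I m = 0 then Poly_Mapping.lookup p m else 0)"
proof -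
  have "Poly_Mapping.lookup (balanced I p) m =
      (\<Sum>n\<in>Poly_Mapping.keys p. if n = m then (if chart_weight I m = 0 then Poly_Mapping.lookup p m else 0) else 0)"
    unfolding balanced_def lookup_sum by (rule sum.cong) (auto simp: lookup_single)
  then show ?thesis by (simp add: in_keys_iff)
qed

lemma balanced_add: "balanced I (p + q) = balanced I p + balanced I q"
  by (rule poly_mapping_eqI) (simp add: lookup_balanced lookup_add)

lemma balanced_0 [simp]: "balanced I 0 = 0"
  by (rule poly_mapping_eqI) (simp add: lookup_balanced)

lemma balanced_single: "balanced I (Poly_Mapping.single m c) = (if chart_weight I m = 0 then Poly_Mapping.single m c else 0)"
  by (rule poly_mapping_eqI) (auto simp: lookup_balanced lookup_single when_def)

lemma balanced_1 [simp]: "balanced I 1 = 1"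
  using balanced_single[of I 0 1] by (simp add: chart_weight_def)

lemma balanced_sum: "balanced I (sum f J) = (\<Sum>j\<in>J. balanced I (f j))"
  by (induction J rule: infinite_finite_induct) (simp_all add: balanced_add)

lemma balanced_mult_single:
  assumes "chart_weight I n = 0"
  shows "balanced I (p * Poly_Mapping.single n c) = balanced I p * Poly_Mapping.single n c"
proof (induction p rule: mpoly_induct)
  case (add_single m d q)
  then show ?case using assms
    by (simp add: distrib_right balanced_add mult_single balanced_single chart_weight_add)
qed simp

lemma balanced_mult_chart_form: "balanced I (p * chart_form I x i) = balanced I p * chart_form I x i"
  unfolding chart_form_def sum_distrib_left balanced_sum
  by (intro sum.cong refl balanced_mult_single chart_weight_chart_exp)

text \<open>Points with some coordinate zero are included: they describe the behaviour when some of the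
  \<open>\<lambda>\<^sub>j\<close> tend to zero or infinity.\<close>

definition nondegenerate :: "complex^triple \<Rightarrow> bool" where
  "nondegenerate x \<longleftrightarrow> (\<forall>I z. \<exists>i. eval (chart_form I x i) z \<noteq> 0)"

lemma chart_certificate:
  assumes "nondegenerate x"
  shows "\<exists>b. 1 = (\<Sum>i\<in>UNIV. balanced I (b i) * chart_form I x i)"
proof -
  have "1 \<in> ideal.span (range (chart_form I x))"
    by (rule weak_nullstellensatz) (use assms in \<open>auto simp: nondegenerate_def\<close>)
  then obtain b where "1 = (\<Sum>i\<in>UNIV. b i * chart_form I x i)"
    using in_span_image[of 1 "chart_form I x" UNIV] by auto
  from arg_cong[OF this, of "balanced I"] show ?thesis
    unfolding balanced_1 balanced_sum balanced_mult_chart_form by blast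
qed

text \<open>A singular point \<open>\<lambda>\<close> in the torus gives a common zero in every chart.\<close>

definition chart_point :: "triple \<Rightarrow> (6 \<Rightarrow> complex) \<Rightarrow> complex^6" where
  "chart_point I l = (\<chi> j. if j \<in> cols I then inverse (l j) else l j)"

lemma chart_product:
  assumes "\<And>j. j \<in> cols I \<Longrightarrow> l j \<noteq> 0"
  shows "prod l (cols I) * (\<Prod>j\<in>sym_diff (cols I) (cols t). chart_point I l $ j) = prod l (cols t)"
proof -
  have "(\<Prod>j\<in>sym_diff (cols I) (cols t). chart_point I l $ j) =
      (\<Prod>j\<in>cols I - cols t. chart_point I l $ j) * (\<Prod>j\<in>cols t - cols I. chart_point I l $ j)"
    by (rule prod.union_disjoint) auto
  also have "(\<Prod>j\<in>cols I - cols t. chart_point I l $ j) = inverse (prod l (cols I - cols t))"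
    unfolding prod_inversef[symmetric] comp_def by (rule prod.cong) (auto simp: chart_point_def)
  also have "(\<Prod>j\<in>cols t - cols I. chart_point I l $ j) = prod l (cols t - cols I)"
    by (rule prod.cong) (auto simp: chart_point_def)
  finally have e: "(\<Prod>j\<in>sym_diff (cols I) (cols t). chart_point I l $ j) =
      inverse (prod l (cols I - cols t)) * prod l (cols t - cols I)" .
  have s: "prod l (cols I) = prod l (cols I \<inter> cols t) * prod l (cols I - cols t)"
    "prod l (cols t) = prod l (cols I \<inter> cols t) * prod l (cols t - cols I)"
    using prod.Int_Diff[of "cols I" l "cols t"] prod.Int_Diff[of "cols t" l "cols I"] by (simp_all add: Int_commute)
  have "prod l (cols I - cols t) \<noteq> 0" using assms by (simp add: prod_zero_iff)
  then show ?thesis unfolding e s by (simp add: field_simps)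
qed

lemma inj_of_nat_6: "inj_on (of_nat :: nat \<Rightarrow> 6) {1..6}"
  by (rule inj_onI) (use of_nat_6_inj in auto)

lemma support_bounds: "support t \<subseteq> {1..6}"
proof -
  obtain p q r where t: "indices t = (p, q, r)" by (metis prod_cases3)
  then show ?thesis using indices_bounds[OF t] by (auto simp: support_indices[OF t])
qed

lemma mem_cols: "i \<in> {1..6} \<Longrightarrow> of_nat i \<in> cols t \<longleftrightarrow> i \<in> support t"
  unfolding cols_def using inj_on_image_mem_iff[OF inj_of_nat_6 _ support_bounds] .

lemma prod_cols: "prod l (cols t) = prod (\<lambda>k. l (of_nat k)) (support t)"
  unfolding cols_def by (rule prod.reindex[OF inj_on_subset[OF inj_of_nat_6 support_bounds], unfolded comp_def])

lemma star_sum_weighted_cols: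
  assumes "i \<in> {1..6}"
  shows "star_sum (weighted (\<lambda>k. l (of_nat k)) x) i = (\<Sum>t\<in>{t. of_nat i \<in> cols t}. x $ t * prod l (cols t))"
  unfolding star_sum_def weighted_def prod_cols mem_cols[OF assms] by (simp add: sum.If_cases)

lemma eval_chart_form_point:
  assumes "\<And>j. j \<in> cols I \<Longrightarrow> l j \<noteq> 0" "i \<in> {1..6}"
  shows "prod l (cols I) * eval (chart_form I x (of_nat i)) (chart_point I l)
    = star_sum (weighted (\<lambda>k. l (of_nat k)) x) i"
  unfolding eval_chart_form star_sum_weighted_cols[OF assms(2)] sum_distrib_left
  by (rule sum.cong[OF refl]) (use chart_product[OF assms(1)] in \<open>simp add: mult.left_commute\<close>)

text \<open>The last three vectors are chosen such that no minor and none of the two quadrics vanishes, and such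
  that \<open>sample_pairs\<close> holds.\<close>

definition sample :: "nat \<Rightarrow> complex^3" where
  "sample i = (if i = 1 then vector [1, 0, 0] else if i = 2 then vector [0, 1, 0] else if i = 3 then vector [0, 0, 1]
     else if i = 4 then vector [-1, 1, 2] else if i = 5 then vector [2, 1, 1] else vector [1, 1, -1])"

definition cert :: "triple \<Rightarrow> 6 \<Rightarrow> (6, complex) mpoly" where
  "cert I = (\<lambda>i. balanced I ((SOME b. 1 = (\<Sum>i\<in>UNIV. balanced I (b i) * chart_form I (plk sample) i)) i))"

text \<open>The combination of the critical equations that is \<open>1\<close> at the sample, as a function of
  \<open>x\<close>.\<close>

definition certified :: "triple \<Rightarrow> complex^triple \<Rightarrow> (6, complex) mpoly" where
  "certified I x = (\<Sum>i\<in>UNIV. cert I i * chart_form I x i)"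

lemma balanced_cert: "balanced I (cert I i) = cert I i"
  unfolding cert_def by (rule poly_mapping_eqI) (simp add: lookup_balanced)

lemma certified_sample:
  assumes "nondegenerate (plk sample)" shows "certified I (plk sample) = 1"
  using someI_ex[OF chart_certificate[OF assms, of I]] unfolding certified_def cert_def by simp

text \<open>Finitely many polynomials occur, so that a single bound serves for all charts.\<close>

definition exp_bound :: nat where
  "exp_bound = (SOME n. \<forall>I i t. \<forall>m\<in>Poly_Mapping.keys (cert I i * Poly_Mapping.single (chart_exp I t) 1).
     \<forall>j. Poly_Mapping.lookup m j \<le> n)"

lemma exp_bound:
  "m \<in> Poly_Mapping.keys (cert I i * Poly_Mapping.single (chart_exp I t) 1) \<Longrightarrow> Poly_Mapping.lookup m j \<le> exp_bound"
proof -
  define N where "N I i t = (SOME n. \<forall>m\<in>Poly_Mapping.keys (cert I i * Poly_Mapping.single (chart_exp I t) 1).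
     \<forall>j. Poly_Mapping.lookup m j \<le> n)" for I i t
  have N: "\<forall>m\<in>Poly_Mapping.keys (cert I i * Poly_Mapping.single (chart_exp I t) 1). \<forall>j. Poly_Mapping.lookup m j \<le> N I i t"
    for I i t
    unfolding N_def by (rule someI_ex[OF exponents_bound])
  have "N I i t \<le> (\<Sum>I\<in>UNIV. \<Sum>i\<in>UNIV. \<Sum>t\<in>UNIV. N I i t)" for I i t
  proof -
    have "N I i t \<le> (\<Sum>t\<in>UNIV. N I i t)" by (rule member_le_sum) auto
    also have "\<dots> \<le> (\<Sum>i\<in>UNIV. \<Sum>t\<in>UNIV. N I i t)" by (rule member_le_sum[of i UNIV "\<lambda>i. \<Sum>t\<in>UNIV. N I i t"]) auto
    also have "\<dots> \<le> (\<Sum>I\<in>UNIV. \<Sum>i\<in>UNIV. \<Sum>t\<in>UNIV. N I i t)"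
      by (rule member_le_sum[of I UNIV "\<lambda>I. \<Sum>i\<in>UNIV. \<Sum>t\<in>UNIV. N I i t"]) auto
    finally show ?thesis .
  qed
  then have "\<forall>I i t. \<forall>m\<in>Poly_Mapping.keys (cert I i * Poly_Mapping.single (chart_exp I t) 1).
     \<forall>j. Poly_Mapping.lookup m j \<le> (\<Sum>I\<in>UNIV. \<Sum>i\<in>UNIV. \<Sum>t\<in>UNIV. N I i t)"
    using N order_trans by meson
  from someI[of "\<lambda>n. \<forall>I i t. \<forall>m\<in>Poly_Mapping.keys (cert I i * Poly_Mapping.single (chart_exp I t) 1).
     \<forall>j. Poly_Mapping.lookup m j \<le> n", OF this]
  show "m \<in> Poly_Mapping.keys (cert I i * Poly_Mapping.single (chart_exp I t) 1) \<Longrightarrow> Poly_Mapping.lookup m j \<le> exp_bound"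
    unfolding exp_bound_def by blast
qed

text \<open>Large enough for three entries of an exponent of total degree \<open>3 height\<close> to be at least
  \<open>exp_bound\<close>, and for at most three to be within \<open>exp_bound\<close> of the maximum.\<close>

definition height :: nat where "height = 4 * exp_bound + 1"

text \<open>Exponents of the monomials in \<open>\<lambda>\<close> of degree \<open>height\<close> on the hypersimplex.\<close>

typedef expo = "{u :: 6 \<Rightarrow> nat. (\<forall>j. u j \<le> height) \<and> (\<Sum>j\<in>UNIV. u j) = 3 * height}"
  morphisms expo Abs_expo
proof -
  have "(\<Sum>j\<in>UNIV. if j \<in> {1, 2, 3::6} then height else 0) = (\<Sum>j\<in>{1, 2, 3::6}. height)"
    by (rule sum.mono_neutral_cong_right) auto
  also have "\<dots> = 3 * height" by simp
  finally have *: "(\<Sum>j\<in>UNIV. if j \<in> {1, 2, 3::6} then height else 0) = 3 * height" .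
  show ?thesis
    by (rule exI[of _ "\<lambda>j. if j \<in> {1, 2, 3} then height else 0"], rule CollectI, rule conjI, simp, rule *)
qed

instance expo :: finite
proof
  have "{u :: 6 \<Rightarrow> nat. (\<forall>j. u j \<le> height) \<and> (\<Sum>j\<in>UNIV. u j) = 3 * height} \<subseteq> UNIV \<rightarrow>\<^sub>E {..height}" by auto
  then have "finite {u :: 6 \<Rightarrow> nat. (\<forall>j. u j \<le> height) \<and> (\<Sum>j\<in>UNIV. u j) = 3 * height}"
    by (rule finite_subset) (intro finite_PiE, auto)
  then show "finite (UNIV :: expo set)"
    unfolding type_definition.univ[OF type_definition_expo] by (rule finite_imageI)
qed

lemma cols_surj: assumes "card S = 3" shows "\<exists>t. cols t = S"
proof -
  define T where "T = num6 ` S"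
  have inj: "inj_on num6 S"
  proof (rule inj_onI)
    fix a b :: 6 assume "num6 a = num6 b"
    then have "(of_nat (num6 a) :: 6) = of_nat (num6 b)" by simp
    then show "a = b" using of_nat_num6 by metis
  qed
  have cT: "card T = 3" "finite T" unfolding T_def using card_image[OF inj] assms by auto
  have sub: "T \<subseteq> {1..6}" unfolding T_def num6_def by auto
  define l where "l = sorted_list_of_set T"
  have l: "set l = T" "length l = 3" "sorted_wrt (<) l" using cT unfolding l_def by auto
  then obtain i j k where ijk: "l = [i, j, k]" by (auto simp: length_Suc_conv numeral_3_eq_3)
  have b: "1 \<le> i" "i < j" "j < k" "k \<le> 6" using l sub unfolding ijk by auto
  have "cols (triple (i, j, k)) = of_nat ` T"
    unfolding cols_def support_indices[OF indices_triple[OF b]] using l(1) unfolding ijk by simp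
  also have "\<dots> = S" unfolding T_def image_image of_nat_num6 by simp
  finally show ?thesis by blast
qed

text \<open>At least three entries are large, as otherwise the sum would be too small, and at most three are close
  to the maximum, as otherwise it would be too large. A set of three columns between these two sets is the
  chart in which the exponent can be moved freely.\<close>

lemma good_chart:
  "\<exists>I. (\<forall>j\<in>cols I. exp_bound \<le> expo u j) \<and> (\<forall>j. j \<notin> cols I \<longrightarrow> expo u j + exp_bound \<le> height)"
proof -
  have u: "expo u j \<le> height" "(\<Sum>j\<in>UNIV. expo u j) = 3 * height" for j using expo[of u] by auto
  define H where "H = {j. exp_bound \<le> expo u j}"
  define L where "L = {j. height < expo u j + exp_bound}"
  have LH: "L \<subseteq> H" unfolding L_def H_def height_def by auto
  have h3: "3 \<le> card H"
  proof (rule ccontr)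
    assume h: "\<not> card H \<ge> 3"
    have "(\<Sum>j\<in>UNIV. expo u j) = (\<Sum>j\<in>H. expo u j) + (\<Sum>j\<in>-H. expo u j)"
      by (metis Compl_eq_Diff_UNIV finite subset_UNIV sum.subset_diff add.commute)
    also have "\<dots> \<le> (\<Sum>j\<in>H. height) + (\<Sum>j\<in>-H. exp_bound)"
      by (intro add_mono sum_mono) (use u in \<open>auto simp: H_def\<close>)
    also have "\<dots> = card H * height + (6 - card H) * exp_bound" 
      using card_Diff_subset[of H UNIV] by (simp add: Compl_eq_Diff_UNIV)
    also have "\<dots> \<le> 2 * height + 4 * exp_bound"
    proof -
      consider "card H = 0" | "card H = 1" | "card H = 2" using h by linarith
      then show ?thesis by cases (simp_all add: height_def)
    qed
    also have "\<dots> < 3 * height" by (simp add: height_def)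
    finally show False using u(2) by simp
  qed
  have l3: "card L \<le> 3"
  proof (rule ccontr)
    assume "\<not> card L \<le> 3"
    then have c: "4 \<le> card L" by simp
    have "4 * (height + 1 - exp_bound) \<le> card L * (height + 1 - exp_bound)" using c by (rule mult_right_mono) simp
    also have "\<dots> = (\<Sum>j\<in>L. height + 1 - exp_bound)" by simp
    also have "\<dots> \<le> (\<Sum>j\<in>L. expo u j)" by (rule sum_mono) (auto simp: L_def)
    also have "\<dots> \<le> (\<Sum>j\<in>UNIV. expo u j)" by (rule sum_mono2) auto
    finally show False using u(2) by (simp add: height_def)
  qed
  obtain S where S: "L \<subseteq> S" "S \<subseteq> H" "card S = 3"
    using exists_subset_between[OF l3 h3 LH finite] by metis
  obtain I where "cols I = S" using cols_surj[OF S(3)] by blast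
  then show ?thesis using S unfolding L_def H_def by (intro exI[of _ I]) (auto simp: not_less subset_iff)
qed

definition chart_of :: "expo \<Rightarrow> triple" where
  "chart_of u = (SOME I. (\<forall>j\<in>cols I. exp_bound \<le> expo u j) \<and> (\<forall>j. j \<notin> cols I \<longrightarrow> expo u j + exp_bound \<le> height))"

lemma chart_of: "j \<in> cols (chart_of u) \<Longrightarrow> exp_bound \<le> expo u j" "j \<notin> cols (chart_of u) \<Longrightarrow> expo u j + exp_bound \<le> height"
  using someI_ex[OF good_chart[of u]] unfolding chart_of_def by blast+

definition small_exps :: "triple \<Rightarrow> (6 \<Rightarrow>\<^sub>0 nat) set" where
  "small_exps I = {m. (\<forall>j. Poly_Mapping.lookup m j \<le> exp_bound) \<and> chart_weight I m = 0}"

lemma finite_small_exps: "finite (small_exps I)"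
  by (rule finite_subset[OF _ finite_bounded_exponents[of exp_bound]]) (auto simp: small_exps_def)

text \<open>Multiplication with a monomial in the chart coordinates, on the exponents of \<open>\<lambda>\<close>.\<close>

definition move :: "expo \<Rightarrow> (6 \<Rightarrow>\<^sub>0 nat) \<Rightarrow> 6 \<Rightarrow> nat" where
  "move u m j = (if j \<in> cols (chart_of u) then expo u j - Poly_Mapping.lookup m j else expo u j + Poly_Mapping.lookup m j)"

lemma move_expo:
  assumes m: "m \<in> small_exps (chart_of u)" shows "expo (Abs_expo (move u m)) = move u m"
proof (rule Abs_expo_inverse, intro CollectI conjI allI)
  have ml: "Poly_Mapping.lookup m j \<le> exp_bound" for j using m by (simp add: small_exps_def)
  fix j
  have "expo u j \<le> height" using expo[of u] by auto
  then show "move u m j \<le> height" using chart_of(2)[of j u] ml[of j] unfolding move_def by auto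
next
  have ml: "Poly_Mapping.lookup m j \<le> exp_bound" for j using m by (simp add: small_exps_def)
  have "int (move u m j) = int (expo u j) + (if j \<in> cols (chart_of u) then -1 else 1) * int (Poly_Mapping.lookup m j)" for j
    using chart_of(1)[of j u] ml[of j] unfolding move_def by auto
  then have "int (\<Sum>j\<in>UNIV. move u m j) = int (\<Sum>j\<in>UNIV. expo u j) + chart_weight (chart_of u) m"
    by (simp add: chart_weight_def sum.distrib)
  moreover have "(\<Sum>j\<in>UNIV. expo u j) = 3 * height" "chart_weight (chart_of u) m = 0"
    using expo[of u] m by (simp_all add: small_exps_def)
  ultimately have "int (\<Sum>j\<in>UNIV. move u m j) = int (3 * height)" by (simp only: add_0_right)
  then show "(\<Sum>j\<in>UNIV. move u m j) = 3 * height" by (simp only: of_nat_eq_iff)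
qed

lemma move_eq_iff:
  assumes m: "m \<in> small_exps (chart_of u)" shows "Abs_expo (move u m) = u \<longleftrightarrow> m = 0"
proof
  assume "Abs_expo (move u m) = u"
  then have e: "move u m j = expo u j" for j using move_expo[OF m] by simp
  have "Poly_Mapping.lookup m j = 0" for j
  proof -
    have "Poly_Mapping.lookup m j \<le> exp_bound" using m by (simp add: small_exps_def)
    then show ?thesis using e[of j] chart_of(1)[of j u] unfolding move_def by (auto split: if_splits)
  qed
  then show "m = 0" by (intro poly_mapping_eqI) simp
next
  assume "m = 0"
  then have "move u m = expo u" by (simp add: move_def fun_eq_iff)
  then show "Abs_expo (move u m) = u" by (simp add: expo_inverse)
qed

text \<open>The matrix of the linear map that sends the monomial \<open>\<lambda>\<^sup>u\<close> to the combination of the critical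
  equations given by the certificate of a chart: it is the identity at the sample point, and
  its kernel contains the vector of all monomials at each critical point.\<close>

definition mcoeff :: "expo \<Rightarrow> expo \<Rightarrow> triple \<Rightarrow> complex" where
  "mcoeff u w t = (\<Sum>m\<in>{m \<in> small_exps (chart_of u). Abs_expo (move u m) = w}. \<Sum>i\<in>{i. i \<in> cols t}.
     Poly_Mapping.lookup (cert (chart_of u) i * Poly_Mapping.single (chart_exp (chart_of u) t) 1) m)"

definition mmatrix :: "(triple, complex) mpoly ^ expo ^ expo" where
  "mmatrix = (\<chi> u w. \<Sum>t\<in>UNIV. Poly_Mapping.single 0 (mcoeff u w t) * Var t)"

definition eliminant :: "(triple, complex) mpoly" where "eliminant = det mmatrix"

lemma mmatrix_forms: "mmatrix $ u $ w \<in> forms 1"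
  unfolding mmatrix_def vec_lambda_beta by (intro forms_sum forms_scale forms_Var)

lemma eliminant_forms: "eliminant \<in> forms CARD(expo)"
  unfolding eliminant_def det_def
proof (intro forms_sum)
  fix p :: "expo \<Rightarrow> expo"
  have "(\<Prod>u\<in>UNIV. mmatrix $ u $ p u) \<in> forms (\<Sum>u\<in>(UNIV :: expo set). 1)"
    by (rule forms_prod) (rule mmatrix_forms)
  then have "(\<Prod>u\<in>UNIV. mmatrix $ u $ p u) \<in> forms CARD(expo)" by simp
  then show "of_int (sign p) * (\<Prod>u\<in>UNIV. mmatrix $ u $ p u) \<in> forms CARD(expo)"
    by (cases "sign p = 1") (auto simp: sign_def intro: forms_uminus)
qed

lemma eval_eliminant: "eval eliminant x = det (\<chi> u w. eval (mmatrix $ u $ w) x)"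
proof -
  have "eval (of_int (sign p)) x = of_int (sign p)" for p :: "expo \<Rightarrow> expo" by (simp add: sign_def)
  then show ?thesis unfolding eliminant_def det_def eval_sum eval_mult eval_prod by simp
qed

lemma lookup_scale: "Poly_Mapping.lookup (p * Poly_Mapping.single n c) m = c * Poly_Mapping.lookup (p * Poly_Mapping.single n 1) m"
  for p :: "('n, complex) mpoly"
proof -
  have "p * Poly_Mapping.single n c = Poly_Mapping.single 0 c * (p * Poly_Mapping.single n 1)"
    by (simp add: mult.left_commute mult_single)
  moreover have "Poly_Mapping.lookup (Poly_Mapping.single 0 c * q) m = c * Poly_Mapping.lookup q m" for q :: "('n, complex) mpoly"
    by (induction q rule: mpoly_induct) (simp_all add: distrib_left mult_single lookup_add lookup_single when_def)
  ultimately show ?thesis by simp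
qed

lemma eval_mmatrix:
  "eval (mmatrix $ u $ w) x = (\<Sum>m\<in>{m \<in> small_exps (chart_of u). Abs_expo (move u m) = w}.
     Poly_Mapping.lookup (certified (chart_of u) x) m)"
proof -
  let ?I = "chart_of u"
  let ?c = "\<lambda>i t m. Poly_Mapping.lookup (cert ?I i * Poly_Mapping.single (chart_exp ?I t) 1) m"
  have "Poly_Mapping.lookup (certified ?I x) m = (\<Sum>t\<in>UNIV. x $ t * (\<Sum>i\<in>{i. i \<in> cols t}. ?c i t m))" for m
  proof -
    have "Poly_Mapping.lookup (certified ?I x) m = (\<Sum>i\<in>UNIV. \<Sum>t\<in>{t. i \<in> cols t}. x $ t * ?c i t m)"
      unfolding certified_def chart_form_def sum_distrib_left lookup_sum by (simp add: lookup_scale[of _ _ "x $ _"])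
    also have "\<dots> = (\<Sum>i\<in>UNIV. \<Sum>t\<in>UNIV. if i \<in> cols t then x $ t * ?c i t m else 0)"
      by (simp add: sum.If_cases)
    also have "\<dots> = (\<Sum>t\<in>UNIV. \<Sum>i\<in>UNIV. if i \<in> cols t then x $ t * ?c i t m else 0)"
      by (rule sum.swap)
    finally show ?thesis by (simp add: sum.If_cases sum_distrib_left)
  qed
  then have "(\<Sum>m\<in>{m \<in> small_exps ?I. Abs_expo (move u m) = w}. Poly_Mapping.lookup (certified ?I x) m) =
      (\<Sum>t\<in>UNIV. \<Sum>m\<in>{m \<in> small_exps ?I. Abs_expo (move u m) = w}. x $ t * (\<Sum>i\<in>{i. i \<in> cols t}. ?c i t m))"
    by (simp only: sum.swap[of _ UNIV])
  also have "\<dots> = (\<Sum>t\<in>UNIV. mcoeff u w t * x $ t)"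
    unfolding mcoeff_def sum_distrib_left[symmetric] by (simp only: mult.commute)
  finally show ?thesis unfolding mmatrix_def by (simp add: eval_sum)
qed

lemma keys_certified: "Poly_Mapping.keys (certified I x) \<subseteq> small_exps I"
proof
  fix m assume m: "m \<in> Poly_Mapping.keys (certified I x)"
  have "balanced I (certified I x) = certified I x"
    unfolding certified_def balanced_sum balanced_mult_chart_form balanced_cert ..
  then have "chart_weight I m = 0" using m lookup_balanced[of I "certified I x" m] by (auto simp: in_keys_iff split: if_splits)
  moreover have "Poly_Mapping.lookup m j \<le> exp_bound" for j
  proof (rule ccontr)
    assume "\<not> Poly_Mapping.lookup m j \<le> exp_bound"
    then have "m \<notin> Poly_Mapping.keys (cert I i * Poly_Mapping.single (chart_exp I t) 1)" for i t using exp_bound by blast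
    then have "Poly_Mapping.lookup (cert I i * Poly_Mapping.single (chart_exp I t) c) m = 0" for i t c
      unfolding lookup_scale[of _ _ c] by (simp add: in_keys_iff)
    then have "Poly_Mapping.lookup (certified I x) m = 0"
      unfolding certified_def chart_form_def sum_distrib_left lookup_sum by simp
    then show False using m by (simp add: in_keys_iff)
  qed
  ultimately show "m \<in> small_exps I" by (simp add: small_exps_def)
qed

text \<open>Each certificate is \<open>1\<close> at the sample, so the matrix is the identity.\<close>

lemma eliminant_sample:
  assumes "nondegenerate (plk sample)" shows "eval eliminant (plk sample) = 1"
proof -
  have "eval (mmatrix $ u $ w) (plk sample) = (if u = w then 1 else 0)" for u w
  proof -
    have l: "Poly_Mapping.lookup (certified (chart_of u) (plk sample)) m = (if m = 0 then 1 else 0)" for m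
      unfolding certified_sample[OF assms] by (simp add: lookup_one when_def)
    have z: "0 \<in> small_exps (chart_of u)" by (simp add: small_exps_def chart_weight_def)
    have "Abs_expo (move u 0) = u" using move_eq_iff[OF z] by simp
    then show ?thesis unfolding eval_mmatrix l using z finite_small_exps[of "chart_of u"]
      by (auto simp: sum.If_cases Int_def)
  qed
  then have "(\<chi> u w. eval (mmatrix $ u $ w) (plk sample)) = mat 1"
    by (simp add: mat_def)
  then show ?thesis unfolding eval_eliminant by simp
qed

lemma monomial_move:
  assumes l: "\<And>j. l j \<noteq> (0::complex)" and m: "m \<in> small_exps (chart_of u)"
  shows "(\<Prod>j\<in>UNIV. l j ^ move u m j) =
    (\<Prod>j\<in>UNIV. l j ^ expo u j) * (\<Prod>j\<in>UNIV. (chart_point (chart_of u) l $ j) ^ Poly_Mapping.lookup m j)"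
proof -
  have "l j ^ move u m j = l j ^ expo u j * (chart_point (chart_of u) l $ j) ^ Poly_Mapping.lookup m j" for j
  proof (cases "j \<in> cols (chart_of u)")
    case True
    have "Poly_Mapping.lookup m j \<le> exp_bound" using m by (simp add: small_exps_def)
    then have "Poly_Mapping.lookup m j \<le> expo u j" using chart_of(1)[OF True] by simp
    then have "l j ^ expo u j = l j ^ (expo u j - Poly_Mapping.lookup m j) * l j ^ Poly_Mapping.lookup m j"
      by (simp flip: power_add)
    then show ?thesis using True l[of j] by (simp add: move_def chart_point_def power_inverse)
  qed (simp add: move_def chart_point_def power_add)
  then show ?thesis by (simp add: prod.distrib)
qed

text \<open>At a critical point each certificate vanishes, so that the vector of the monomials
  \<open>\<lambda>\<^sup>u\<close> is in the kernel.\<close>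

lemma eliminant_critical:
  assumes l: "\<And>i. i \<in> {1..6} \<Longrightarrow> l i \<noteq> (0::complex)" and x: "\<And>i. i \<in> {1..6} \<Longrightarrow> star_sum (weighted l x) i = 0"
  shows "eval eliminant x = 0"
proof -
  define k where "k j = l (num6 j)" for j :: 6
  have num: "num6 j \<in> {1..6}" for j unfolding num6_def by auto
  have k: "k j \<noteq> 0" for j using l num by (simp add: k_def)
  have w: "weighted (\<lambda>i. k (of_nat i)) x = weighted l x"
    unfolding weighted_def Finite_Cartesian_Product.vec_eq_iff
  proof (intro allI, simp)
    fix t
    obtain p q r where t: "indices t = (p, q, r)" by (metis prod_cases3)
    have "prod (\<lambda>i. k (of_nat i)) (support t) = prod l (support t)"
      by (rule prod.cong) (use indices_bounds[OF t] in \<open>auto simp: support_indices[OF t] k_def num6_of_nat\<close>)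
    then show "x $ t = 0 \<or> prod (\<lambda>i. k (of_nat i)) (support t) = prod l (support t)" by simp
  qed
  have cf: "eval (chart_form I x j) (chart_point I k) = 0" for I j
  proof -
    have "prod k (cols I) * eval (chart_form I x (of_nat (num6 j))) (chart_point I k) = 0"
      unfolding eval_chart_form_point[OF k num] w by (rule x[OF num])
    then show ?thesis using k by (simp add: of_nat_num6 prod_zero_iff)
  qed
  have ct: "eval (certified I x) (chart_point I k) = 0" for I
    unfolding certified_def eval_sum eval_mult cf by simp
  define Y where "Y = (\<chi> u. \<Prod>j\<in>UNIV. k j ^ expo u j)"
  let ?C = "\<chi> u w. eval (mmatrix $ u $ w) x"
  have "(?C *v Y) $ u = 0" for u
  proof -
    let ?I = "chart_of u"
    let ?S = "small_exps ?I"
    have "(?C *v Y) $ u = (\<Sum>w\<in>UNIV. (\<Sum>m\<in>{m \<in> ?S. Abs_expo (move u m) = w}. Poly_Mapping.lookup (certified ?I x) m) * Y $ w)"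
      by (simp add: matrix_vector_mult_def eval_mmatrix)
    also have "\<dots> = (\<Sum>w\<in>UNIV. \<Sum>m\<in>{m \<in> ?S. Abs_expo (move u m) = w}. Poly_Mapping.lookup (certified ?I x) m * Y $ Abs_expo (move u m))"
      unfolding sum_distrib_right by (intro sum.cong refl) auto
    also have "\<dots> = (\<Sum>m\<in>?S. Poly_Mapping.lookup (certified ?I x) m * Y $ Abs_expo (move u m))"
      by (rule sum.group[OF finite_small_exps finite]) simp
    also have "\<dots> = (\<Sum>m\<in>?S. Y $ u * (Poly_Mapping.lookup (certified ?I x) m * (\<Prod>j\<in>UNIV. (chart_point ?I k $ j) ^ Poly_Mapping.lookup m j)))"
    proof (rule sum.cong[OF refl])
      fix m assume m: "m \<in> ?S"
      show "Poly_Mapping.lookup (certified ?I x) m * Y $ Abs_expo (move u m) =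
          Y $ u * (Poly_Mapping.lookup (certified ?I x) m * (\<Prod>j\<in>UNIV. (chart_point ?I k $ j) ^ Poly_Mapping.lookup m j))"
        unfolding Y_def using monomial_move[of k, OF k m] by (simp add: move_expo[OF m])
    qed
    also have "\<dots> = Y $ u * eval (certified ?I x) (chart_point ?I k)"
      unfolding sum_distrib_left[symmetric] eval_superset[OF finite_small_exps keys_certified] ..
    finally show ?thesis unfolding ct by simp
  qed
  then have "?C *v Y = 0" by (simp add: Finite_Cartesian_Product.vec_eq_iff)
  moreover have "Y \<noteq> 0"
  proof -
    have "Y $ u \<noteq> 0" for u using k by (simp add: Y_def prod_zero_iff)
    then show ?thesis by (metis zero_index)
  qed
  ultimately have "\<not> invertible ?C"
    unfolding invertible_left_inverse matrix_left_invertible_ker by blast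
  then show ?thesis unfolding eval_eliminant using invertible_det_nz by blast
qed

lemma eliminant_vanishes: "\<forall>v\<in>cone hypersimplex_discriminant. eval eliminant v = 0"
  unfolding hypersimplex_discriminant_closure
proof (rule form_vanishes_closure[OF eliminant_forms], rule ballI)
  fix v assume "v \<in> cone critical_points"
  then obtain P where P: "P \<in> critical_points" "v \<in> hcoords P" by (auto simp: cone_def)
  obtain a l where a: "a \<in> hcoords P" "\<And>i. i \<in> {1..6} \<Longrightarrow> l i \<noteq> 0" "\<And>i. i \<in> {1..6} \<Longrightarrow> star_sum (weighted l a) i = 0"
    using critical_pointsE[OF P(1)] by metis
  have "eval eliminant a = 0" by (rule eliminant_critical[OF a(2,3)])
  moreover obtain c where "v = c *s a" using hcoords_ray[OF a(1)] P(2) by auto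
  ultimately show "eval eliminant v = 0" using eval_scale_form[OF eliminant_forms] by simp
qed

section \<open>A nondegenerate configuration\<close>

lemma sum_triples:
  "(\<Sum>t\<in>UNIV. f t) = (\<Sum>p\<in>{(1,2,3),(1,2,4),(1,2,5),(1,2,6),(1,3,4),(1,3,5),(1,3,6),(1,4,5),(1,4,6),(1,5,6),
    (2,3,4),(2,3,5),(2,3,6),(2,4,5),(2,4,6),(2,5,6),(3,4,5),(3,4,6),(3,5,6),(4,5,6)}. f (triple p))"
  (is "_ = sum _ ?L")
proof -
  have "UNIV \<subseteq> triple ` ?L"
  proof
    fix t
    obtain i j k where t: "indices t = (i, j, k)" by (metis prod_cases3)
    have "t = triple (i, j, k)" using t by (metis indices_inverse)
    then show "t \<in> triple ` ?L" by (rule image_eqI[OF _ triple_list[OF indices_bounds[OF t]]])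
  qed
  then have U: "UNIV = triple ` ?L" by blast
  have inj: "inj_on triple ?L"
    by (rule inj_on_inverseI[where g = indices]) (auto simp: indices_triple)
  show ?thesis unfolding U sum.reindex[OF inj] comp_def ..
qed

lemma support_triple: "1 \<le> i \<Longrightarrow> i < j \<Longrightarrow> j < k \<Longrightarrow> k \<le> 6 \<Longrightarrow> support (triple (i, j, k)) = {i, j, k}"
  by (simp add: support_def indices_triple)

text \<open>Minors with increasing columns are the ordered triples of the list of the columns.\<close>

lemma star_sum_plk:
  assumes "i \<in> {1..6}"
  shows "star_sum (plk w) i = star (map w [1..<i]) (w i) (map w [Suc i..<7])"
proof -
  have i: "i = 1 \<or> i = 2 \<or> i = 3 \<or> i = 4 \<or> i = 5 \<or> i = 6" using assms by auto
  have l: "[1..<1] = []" "[1..<2] = [1]" "[1..<3] = [1, 2]" "[1..<4] = [1, 2, 3]" "[1..<5] = [1, 2, 3, 4]"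
    "[1..<6] = [1, 2, 3, 4, 5]" "[Suc 1..<7] = [2, 3, 4, 5, 6]" "[Suc 2..<7] = [3, 4, 5, 6]" "[Suc 3..<7] = [4, 5, 6]"
    "[Suc 4..<7] = [5, 6]" "[Suc 5..<7] = [6]" "[Suc 6..<7] = []"
    by (simp_all add: upt_rec)
  have s: "star_sum (plk w) i = (\<Sum>(p, q, r)\<in>{(1,2,3),(1,2,4),(1,2,5),(1,2,6),(1,3,4),(1,3,5),(1,3,6),(1,4,5),(1,4,6),(1,5,6),
    (2,3,4),(2,3,5),(2,3,6),(2,4,5),(2,4,6),(2,5,6),(3,4,5),(3,4,6),(3,5,6),(4,5,6)}.
      if i = p \<or> i = q \<or> i = r then br (w p) (w q) (w r) else 0)"
    unfolding star_sum_def sum_triples by (intro sum.cong refl) (auto simp: support_triple plk_triple)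
  show ?thesis using i unfolding s
    by (elim disjE; simp only: l list.map) (simp_all add: star_def dot_def br_def algebra_simps)
qed

lemma map_upt_split:
  assumes "map w [m..<n] = xs @ v # ys"
  obtains i where "m \<le> i" "i < n" "xs = map w [m..<i]" "v = w i" "ys = map w [Suc i..<n]"
proof
  let ?k = "length xs"
  have "length (map w [m..<n]) = length (xs @ v # ys)" using assms by simp
  then have k: "m + ?k < n" by simp
  show "m \<le> m + ?k" "m + ?k < n" using k by auto
  have "xs = take ?k (map w [m..<n])" using assms by simp
  then show "xs = map w [m..<m + ?k]" using k by (simp add: take_map)
  have "v = map w [m..<n] ! ?k" unfolding assms by simp
  then show "v = w (m + ?k)" using k by simp
  have "ys = drop (Suc ?k) (map w [m..<n])" unfolding assms by simp
  then show "ys = map w [Suc (m + ?k)..<n]" by (simp add: drop_map)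
qed

lemma critical_plk:
  assumes "\<And>i. i \<in> {1..6} \<Longrightarrow> star_sum (plk w) i = 0"
  shows "critical (map w [1..<7])"
  unfolding critical_def
proof (intro allI impI)
  fix xs v ys assume "map w [1..<7] = xs @ v # ys"
  then obtain i where "1 \<le> i" "i < 7" "xs = map w [1..<i]" "v = w i" "ys = map w [Suc i..<7]"
    by (rule map_upt_split)
  then show "star xs v ys = 0" using assms[of i] star_sum_plk[of i w] by simp
qed

lemma crs_0 [simp]: "crs 0 v = 0" "crs v 0 = 0"
  by (simp_all add: vec3_eq)

lemma sum_list_nonzero: "sum_list (filter (\<lambda>v. v \<noteq> 0) vs) = sum_list vs"
  by (induction vs) simp_all

lemma pairs_nonzero: "pairs (filter (\<lambda>v. v \<noteq> 0) vs) = pairs vs"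
  by (induction vs) (simp_all add: sum_list_nonzero)

lemma filter_split:
  "filter P vs = xs @ v # ys \<Longrightarrow> \<exists>us ws. vs = us @ v # ws \<and> xs = filter P us \<and> ys = filter P ws"
proof (induction vs arbitrary: xs)
  case (Cons a vs)
  show ?case
  proof (cases "P a")
    case True
    show ?thesis
    proof (cases xs)
      case Nil
      then show ?thesis using Cons.prems True by (intro exI[of _ "[]"] exI[of _ vs]) simp
    next
      case xs: (Cons b xs')
      then have eq: "filter P vs = xs' @ v # ys" "a = b" using Cons.prems True by simp_all
      obtain us ws where "vs = us @ v # ws" "xs' = filter P us" "ys = filter P ws" using Cons.IH[OF eq(1)] by blast
      then show ?thesis using True xs eq(2) by (intro exI[of _ "a # us"] exI[of _ ws]) simp
    qed
  next
    case False
    then have eq: "filter P vs = xs @ v # ys" using Cons.prems by simp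
    obtain us ws where "vs = us @ v # ws" "xs = filter P us" "ys = filter P ws" using Cons.IH[OF eq] by blast
    then show ?thesis using False by (intro exI[of _ "a # us"] exI[of _ ws]) simp
  qed
qed simp

text \<open>Columns with \<open>l\<^sub>i = 0\<close> do not contribute to the critical equations and can be left
  out.\<close>

lemma critical_nonzero: "critical vs \<Longrightarrow> critical (filter (\<lambda>v. v \<noteq> 0) vs)"
  unfolding critical_def[of "filter _ _"]
proof (intro allI impI)
  fix xs v ys assume cr: "critical vs" and "filter (\<lambda>v. v \<noteq> 0) vs = xs @ v # ys"
  then obtain us ws where *: "vs = us @ v # ws" "xs = filter (\<lambda>v. v \<noteq> 0) us" "ys = filter (\<lambda>v. v \<noteq> 0) ws"
    by (metis filter_split)
  have "star xs v ys = star us v ws" unfolding star_def *(2,3) sum_list_nonzero pairs_nonzero ..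
  then show "star xs v ys = 0" using criticalD[OF cr *(1)] by simp
qed

lemma sample_nth [simp]:
  "sample 1 $ 1 = 1" "sample 1 $ 2 = 0" "sample 1 $ 3 = 0" "sample 2 $ 1 = 0" "sample 2 $ 2 = 1" "sample 2 $ 3 = 0"
  "sample 3 $ 1 = 0" "sample 3 $ 2 = 0" "sample 3 $ 3 = 1" "sample 4 $ 1 = -1" "sample 4 $ 2 = 1" "sample 4 $ 3 = 2"
  "sample 5 $ 1 = 2" "sample 5 $ 2 = 1" "sample 5 $ 3 = 1" "sample 6 $ 1 = 1" "sample 6 $ 2 = 1" "sample 6 $ 3 = -1"
  by (simp_all add: sample_def)

lemma sample_minors_sorted:
  assumes "1 \<le> i" "i < j" "j < k" "k \<le> 6" shows "br (sample i) (sample j) (sample k) \<noteq> 0"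
  using triple_list[OF assms] by (elim insertE) (simp_all del: One_nat_def add: br_def)

lemma sample_minors:
  assumes "i \<in> {1..6}" "j \<in> {1..6}" "k \<in> {1..6}" "i \<noteq> j" "j \<noteq> k" "i \<noteq> k"
  shows "br (sample i) (sample j) (sample k) \<noteq> 0"
proof -
  consider "i < j" "j < k" | "i < k" "k < j" | "j < i" "i < k" | "j < k" "k < i" | "k < i" "i < j" | "k < j" "j < i"
    using assms(4-6) by linarith
  then show ?thesis
  proof cases
    case 1 then show ?thesis using sample_minors_sorted[of i j k] assms by simp
  next
    case 2 then show ?thesis using sample_minors_sorted[of i k j] assms br_swap(2)[of "sample i" "sample k" "sample j"] by simp
  next
    case 3 then show ?thesis using sample_minors_sorted[of j i k] assms br_swap(1)[of "sample j" "sample i" "sample k"] by simp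
  next
    case 4 then show ?thesis using sample_minors_sorted[of j k i] assms br_rotate(1)[of "sample j" "sample k" "sample i"] by simp
  next
    case 5 then show ?thesis using sample_minors_sorted[of k i j] assms br_rotate(2)[of "sample k" "sample i" "sample j"] by simp
  next
    case 6 then show ?thesis using sample_minors_sorted[of k j i] assms br_swap(3)[of "sample i" "sample j" "sample k"] by simp
  qed
qed

text \<open>The relations \<open>\<Sum> l\<^sub>i v\<^sub>i = 0\<close> and \<open>\<Sum> l\<^sub>i l\<^sub>j (v\<^sub>i \<times> v\<^sub>j) = 0\<close> have no common solution for the sample: after
  elimination of \<open>l\<^sub>1, l\<^sub>2, l\<^sub>3\<close> they are three quadrics in three variables, and the fourth power of the last
  variable is in the ideal of these.\<close>

lemma sample_pairs:
  assumes w: "\<And>i. w i = l i *s sample i"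
    and s: "sum_list (map w [1, 2, 3, 4, 5, 6]) = 0" and p: "pairs (map w [1, 2, 3, 4, 5, 6]) = 0"
  shows "\<forall>i\<in>{1..6}. l i = 0"
proof -
  define a b c where "a = l 4" "b = l 5" "c = l 6"
  have l: "l 1 = a - 2 * b - c" "l 2 = - a - b - c" "l 3 = - 2 * a - b + c"
  proof -
    have "sum_list (map w [1, 2, 3, 4, 5, 6]) $ i = 0" for i using s by simp
    from this[of 1] this[of 2] this[of 3]
    have "l 1 - a + 2 * b + c = 0" "l 2 + a + b + c = 0" "l 3 + 2 * a + b - c = 0"
      by (simp_all del: One_nat_def add: w a_b_c_def algebra_simps)
    then show "l 1 = a - 2 * b - c" "l 2 = - a - b - c" "l 3 = - 2 * a - b + c" by algebra+
  qed
  define Q1 Q2 Q3 where "Q1 = 2 * a^2 + 2 * a * b - 2 * a * c + b^2 - 2 * b * c - c^2"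
    "Q2 = 2 * a^2 + 2 * a * b - 2 * a * c - 2 * b^2 + 4 * b * c + c^2"
    "Q3 = - (a^2) - 2 * a * b - 2 * a * c + 2 * b^2 + 4 * b * c + c^2"
  note Q = this
  have z: "Q1 = 0" "Q2 = 0" "Q3 = 0"
  proof -
    have "pairs (map w [1, 2, 3, 4, 5, 6]) $ i = 0" for i using p by simp
    from this[of 1] this[of 2] this[of 3] show "Q1 = 0" "Q2 = 0" "Q3 = 0"
      unfolding Q by (simp_all del: One_nat_def add: w l a_b_c_def[symmetric] algebra_simps power2_eq_square)
  qed
  have "455615 * c^4 = (229280 * c^2 + 517368 * b * c + 252276 * b^2 - 2211336 * a * c - 504552 * a * b) * Q1 + (-1654103 * c^2 - 752484 * b * c + 126138 * b^2 + 1346562 * a * c + 882966 * a * b) * Q2 + (2338998 * c^2 - 1011168 * b * c - 1729548 * a * c + 756828 * a * b) * Q3"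
    unfolding Q by algebra
  then have c: "c = 0" using z by simp
  then have b: "b = 0" using z(1,2) unfolding Q by algebra
  then have a: "a = 0" using z(1) c unfolding Q by simp
  have "l 1 = 0" "l 2 = 0" "l 3 = 0" "l 4 = 0" "l 5 = 0" "l 6 = 0" using l a b c a_b_c_def by simp_all
  moreover have "{1..6} = {1, 2, 3, 4, 5, 6::nat}" by auto
  ultimately show ?thesis by simp
qed

text \<open>If the polygon is not closed, the analysis of polygons applies. If it is closed, the equations say that
  \<open>pairs\<close> is orthogonal to all edges and hence zero, which \<open>sample_pairs\<close>
  excludes.\<close>

lemma sample_not_critical:
  assumes w: "\<And>i. w i = l i *s sample i" and cr: "critical (map w [1..<7])"
    and n: "3 \<le> card {i \<in> {1..6}. l i \<noteq> 0}"
  shows False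
proof -
  define js where "js = filter (\<lambda>i. l i \<noteq> 0) [1..<7]"
  have set: "set js = {i \<in> {1..6}. l i \<noteq> 0}" unfolding js_def by auto
  have dist: "distinct js" unfolding js_def by simp
  have len: "3 \<le> length js" using n distinct_card[OF dist] unfolding set by simp
  have minor: "br (w i) (w j) (w k) \<noteq> 0" if "i \<in> set js" "j \<in> set js" "k \<in> set js" "i \<noteq> j" "j \<noteq> k" "i \<noteq> k" for i j k
    using that sample_minors[of i j k] unfolding set w by (simp add: br_linear)
  have "w i \<noteq> 0 \<longleftrightarrow> l i \<noteq> 0" if "i \<in> set [1..<7]" for i
  proof -
    have "\<exists>j\<in>{1..6}. \<exists>k\<in>{1..6}. i \<noteq> j \<and> j \<noteq> k \<and> i \<noteq> k"
      by (rule bexI[of _ "if i = 1 then 2 else 1"], rule bexI[of _ "if i = 3 then 4 else if i = 4 then 5 else if i = 1 then 3 else 4"]) auto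
    then obtain j k where "j \<in> {1..6}" "k \<in> {1..6}" "i \<noteq> j" "j \<noteq> k" "i \<noteq> k" by blast
    then have "br (sample i) (sample j) (sample k) \<noteq> 0" using sample_minors[of i j k] that by auto
    then have "sample i \<noteq> 0" by (metis br_0(1))
    then show ?thesis unfolding w by simp
  qed
  then have us: "filter (\<lambda>v. v \<noteq> 0) (map w [1..<7]) = map w js"
    unfolding js_def filter_map by (intro arg_cong[where f = "map w"] filter_cong) auto
  have cr': "critical (map w js)" using critical_nonzero[OF cr] unfolding us .
  obtain a b c r where abc: "js = a # b # c # r" using len by (metis Suc_le_length_iff numeral_3_eq_3)
  have six: "map w [1..<7] = map w [1, 2, 3, 4, 5, 6]" by (simp add: upt_rec numeral_eq_Suc)
  have s: "sum_list (map w js) \<noteq> 0"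
  proof
    assume s0: "sum_list (map w js) = 0"
    have "dot (w j) (pairs (map w js)) = 0" if jm: "j \<in> set js" for j
    proof -
      obtain xs ys where j: "js = xs @ j # ys" using split_list[OF jm] by blast
      then have m: "map w js = map w xs @ w j # map w ys" by simp
      show ?thesis using star_sum_zero[OF s0[unfolded m]] criticalD[OF cr' m] unfolding m by simp
    qed
    then have "dot (w a) (pairs (map w js)) = 0" "dot (w b) (pairs (map w js)) = 0" "dot (w c) (pairs (map w js)) = 0"
      unfolding abc by auto
    moreover have "br (w a) (w b) (w c) \<noteq> 0" using minor[of a b c] dist unfolding abc by auto
    ultimately have "pairs (map w js) = 0" using dot_zero_of_basis by blast
    then have "pairs (map w [1, 2, 3, 4, 5, 6]) = 0" unfolding us[symmetric] pairs_nonzero six .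
    moreover have "sum_list (map w [1, 2, 3, 4, 5, 6]) = 0" using s0 unfolding us[symmetric] sum_list_nonzero six .
    ultimately have "\<forall>i\<in>{1..6}. l i = 0" using sample_pairs[of w l] w by blast
    moreover have "a \<in> set js" unfolding abc by simp
    ultimately show False unfolding set by auto
  qed
  have le: "length js \<le> 6" unfolding js_def by (rule order_trans[OF length_filter_le]) simp
  consider "length js = 3" | "length js = 4" | "length js = 5" | "length js = 6" using len le by linarith
  then show False
  proof cases
    case 1
    then have "js = [a, b, c]" using abc by simp
    then show False using not_critical_3[of "w a" "w b" "w c"] cr' minor[of a b c] dist by auto
  next
    case 2
    then obtain d where "js = [a, b, c, d]" using abc by (auto simp: length_Suc_conv eval_nat_numeral)
    then show False using not_critical_4[of "w a" "w b" "w c" "w d"] cr' minor[of a b c] dist by auto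
  next
    case 3
    then obtain d e where js: "js = [a, b, c, d, e]" using abc by (auto simp: length_Suc_conv eval_nat_numeral)
    show False
      by (rule not_critical_5[of "w a" "w b" "w c" "w d" "w e"])
        (use cr' s dist minor in \<open>auto simp: js add.assoc\<close>)
  next
    case 4
    have "js = [1..<7]"
    proof (rule ccontr)
      assume "js \<noteq> [1..<7]"
      then obtain x where x: "x \<in> set [1..<7]" "\<not> l x \<noteq> 0" unfolding js_def by (meson filter_True)
      have "length js < length [1..<7]" unfolding js_def by (rule length_filter_less[where P = "\<lambda>i. l i \<noteq> 0", OF x])
      then show False using 4 by simp
    qed
    then have js: "js = [1, 2, 3, 4, 5, 6]" by (simp add: upt_rec)
    have "\<forall>i\<in>set js. l i \<noteq> 0" unfolding set by simp
    then have l: "l 1 * l 2 * l 3 * l 4 * l 5 * l 6 \<noteq> 0" unfolding js by simp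
    have "br (w 1) (w 2) (w 3) * br (w 4) (w 5) (w 6) - br (w 1) (w 2) (w 4) * br (w 3) (w 5) (w 6)
        = l 1 * l 2 * l 3 * l 4 * l 5 * l 6 * (br (sample 1) (sample 2) (sample 3) * br (sample 4) (sample 5) (sample 6)
          - br (sample 1) (sample 2) (sample 4) * br (sample 3) (sample 5) (sample 6))"
      by (simp del: One_nat_def add: w br_linear algebra_simps)
    then have q1: "br (w 1) (w 2) (w 3) * br (w 4) (w 5) (w 6) - br (w 1) (w 2) (w 4) * br (w 3) (w 5) (w 6) \<noteq> 0"
      using l by (simp del: One_nat_def add: br_def[of "sample _"])
    have "br (w 2) (w 3) (w 4) * br (w 5) (w 6) (w 1) - br (w 2) (w 3) (w 5) * br (w 4) (w 6) (w 1)
        = l 1 * l 2 * l 3 * l 4 * l 5 * l 6 * (br (sample 2) (sample 3) (sample 4) * br (sample 5) (sample 6) (sample 1)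
          - br (sample 2) (sample 3) (sample 5) * br (sample 4) (sample 6) (sample 1))"
      by (simp del: One_nat_def add: w br_linear algebra_simps)
    then have q2: "br (w 2) (w 3) (w 4) * br (w 5) (w 6) (w 1) - br (w 2) (w 3) (w 5) * br (w 4) (w 6) (w 1) \<noteq> 0"
      using l by (simp del: One_nat_def add: br_def[of "sample _"])
    have cr6: "critical [w 1, w 2, w 3, w 4, w 5, w 6]" using cr' unfolding js by simp
    have s6: "w 1 + w 2 + w 3 + w 4 + w 5 + w 6 \<noteq> 0" using s unfolding js by (simp add: add.assoc)
    show False
      by (rule not_critical_6[OF cr6 s6 _ _ _ _ _ _ _ _ q1 q2]; rule minor) (simp_all add: js)
  qed
qed

text \<open>When one of the \<open>l\<^sub>i\<close> tends to infinity, the critical equations become equations in the plane: the quotient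
  by the corresponding vector.\<close>

definition linked :: "complex^3 \<Rightarrow> (complex^3) list \<Rightarrow> bool" where
  "linked p vs \<longleftrightarrow> (\<forall>xs v ys. vs = xs @ v # ys \<longrightarrow> br p v (sum_list ys - sum_list xs) = 0)"

lemma linked_nonzero: "linked p vs \<Longrightarrow> linked p (filter (\<lambda>v. v \<noteq> 0) vs)"
  unfolding linked_def[of p "filter _ _"]
proof (intro allI impI)
  fix xs v ys assume cr: "linked p vs" and "filter (\<lambda>v. v \<noteq> 0) vs = xs @ v # ys"
  then obtain us ws where *: "vs = us @ v # ws" "xs = filter (\<lambda>v. v \<noteq> 0) us" "ys = filter (\<lambda>v. v \<noteq> 0) ws"
    by (metis filter_split)
  show "br p v (sum_list ys - sum_list xs) = 0"
    using cr *(1) unfolding linked_def *(2,3) sum_list_nonzero by blast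
qed

text \<open>The first and the last vector are parallel to the sum of all vectors, which is therefore zero; then the
  second vector is parallel to the first.\<close>

lemma not_linked:
  assumes li: "linked p (u # v # vs)" and n: "br p u v \<noteq> 0" "br p u (last (v # vs)) \<noteq> 0"
  shows False
proof -
  define z where "z = last (v # vs)"
  define us where "us = butlast (v # vs)"
  have uz: "u # v # vs = (u # us) @ z # []" unfolding us_def z_def by simp
  define s where "s = u + sum_list (v # vs)"
  have s2: "s = u + (sum_list us + z)"
  proof -
    have "v # vs = us @ [z]" unfolding us_def z_def by simp
    then show ?thesis unfolding s_def by simp
  qed
  have "br p u (sum_list (v # vs) - sum_list []) = 0"
    using li unfolding linked_def by (metis append_Nil)
  then have 1: "br p u s = 0" by (simp add: s_def br_linear)
  have "br p z (sum_list [] - sum_list (u # us)) = 0" using li uz unfolding linked_def by blast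
  then have 2: "br p z s = 0" unfolding s2 by (simp add: br_def algebra_simps)
  have "br p u z * br p v s = br p v z * br p u s + br p u v * br p z s"
    unfolding br_def by algebra
  then have 3: "br p v s = 0" using 1 2 n(2) z_def by simp
  have "u # v # vs = [u] @ v # vs" by simp
  then have "br p v (sum_list vs - sum_list [u]) = 0" using li unfolding linked_def by blast
  moreover have "sum_list vs - sum_list [u] = s - v - 2 *s u"
    by (simp add: s_def Finite_Cartesian_Product.vec_eq_iff)
  moreover have "br p v (s - v - 2 *s u) = br p v s + 2 * br p u v" by (simp add: br_def algebra_simps)
  ultimately have "br p v s + 2 * br p u v = 0" by metis
  then show False using 3 n(1) by simp
qed

lemma star_diff_left:
  "star (xs @ p # ys) v zs - star (xs @ 0 # ys) v zs = br p v (sum_list zs + sum_list xs - sum_list ys)"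
  by (simp add: star_def pairs_append dot_def br_def algebra_simps)

lemma star_diff_right:
  "star xs v (ys @ p # zs) - star xs v (ys @ 0 # zs) = br p v (sum_list ys - (sum_list zs + sum_list xs))"
  by (simp add: star_def pairs_append dot_def br_def algebra_simps)

definition link_sum :: "complex^triple \<Rightarrow> nat \<Rightarrow> nat \<Rightarrow> complex" where
  "link_sum x a i = (\<Sum>t\<in>UNIV. if i \<in> support t \<and> a \<in> support t then x $ t else 0)"

lemma link_sum_star_sum:
  assumes "i \<noteq> a" shows "link_sum (plk w) a i = star_sum (plk w) i - star_sum (plk (w(a := 0))) i"
  unfolding link_sum_def star_sum_def sum_subtractf[symmetric]
proof (rule sum.cong[OF refl])
  fix t
  obtain p q r where t: "indices t = (p, q, r)" by (metis prod_cases3)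
  show "(if i \<in> support t \<and> a \<in> support t then plk w $ t else 0) =
      (if i \<in> support t then plk w $ t else 0) - (if i \<in> support t then plk (w(a := 0)) $ t else 0)"
    by (auto simp: plk_def t support_indices[OF t])
qed

text \<open>The equations for the coefficient of \<open>l\<^sub>a\<close> are the differences of the critical
  equations with and without the vector \<open>a\<close>. Modulo this vector only the cyclic order of the
  others, starting after \<open>a\<close>, matters.\<close>

lemma linked_plk:
  assumes a: "a \<in> {1..6}" and z: "\<And>i. i \<in> {1..6} \<Longrightarrow> i \<noteq> a \<Longrightarrow> link_sum (plk w) a i = 0"
  shows "linked (w a) (map w ([Suc a..<7] @ [1..<a]))"
  unfolding linked_def
proof (intro allI impI)
  fix xs v ys assume eq: "map w ([Suc a..<7] @ [1..<a]) = xs @ v # ys"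
  have upd: "map (w(a := 0)) ks = map w ks" if "a \<notin> set ks" for ks using that by (auto intro: map_cong)
  have app: "[k..<n] = [k..<m] @ m # [Suc m..<n]" if "k \<le> m" "m < n" for k m n :: nat
    using that upt_add_eq_append[of k m "n - m"] upt_conv_Cons[of m n] by simp
  consider r where "map w [Suc a..<7] = xs @ v # r" "ys = r @ map w [1..<a]"
    | r where "xs = map w [Suc a..<7] @ r" "map w [1..<a] = r @ v # ys"
    using eq by (auto simp: append_eq_append_conv2 Cons_eq_append_conv append_eq_Cons_conv)
  then show "br (w a) v (sum_list ys - sum_list xs) = 0"
  proof cases
    case 1
    from 1(1) obtain i where i: "Suc a \<le> i" "i < 7" "xs = map w [Suc a..<i]" "v = w i" "r = map w [Suc i..<7]"
      by (rule map_upt_split)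
    have "link_sum (plk w) a i = star (map w [1..<a] @ w a # map w [Suc a..<i]) (w i) (map w [Suc i..<7])
        - star (map w [1..<a] @ 0 # map w [Suc a..<i]) (w i) (map w [Suc i..<7])"
      using i a app[of 1 a i] by (simp add: link_sum_star_sum star_sum_plk upd)
    then have "link_sum (plk w) a i = br (w a) v (sum_list ys - sum_list xs)"
      unfolding star_diff_left 1(2) i(3-5) by (simp add: add_ac)
    then show ?thesis using z[of i] i(1,2) by simp
  next
    case 2
    from 2(2) obtain i where i: "1 \<le> i" "i < a" "r = map w [1..<i]" "v = w i" "ys = map w [Suc i..<a]"
      by (rule map_upt_split)
    have "link_sum (plk w) a i = star (map w [1..<i]) (w i) (map w [Suc i..<a] @ w a # map w [Suc a..<7])
        - star (map w [1..<i]) (w i) (map w [Suc i..<a] @ 0 # map w [Suc a..<7])"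
      using i a app[of "Suc i" a 7] by (simp add: link_sum_star_sum star_sum_plk upd)
    then have "link_sum (plk w) a i = br (w a) v (sum_list ys - sum_list xs)"
      unfolding star_diff_right 2(1) i(3-5) by simp
    then show ?thesis using z[of i] i(1,2) a by simp
  qed
qed

lemma sample_not_linked:
  assumes w: "\<And>i. w i = l i *s sample i" and a: "a \<in> {1..6}" "l a \<noteq> 0"
    and li: "linked (w a) (map w ks)" and ks: "distinct ks" "set ks = {1..6} - {a}"
    and n: "2 \<le> card {i \<in> {1..6} - {a}. l i \<noteq> 0}"
  shows False
proof -
  define js where "js = filter (\<lambda>i. w i \<noteq> 0) ks"
  have us: "filter (\<lambda>v. v \<noteq> 0) (map w ks) = map w js" unfolding js_def filter_map comp_def ..
  have "w i \<noteq> 0 \<Longrightarrow> l i \<noteq> 0" for i unfolding w by auto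
  then have js: "i \<in> {1..6} \<and> i \<noteq> a \<and> l i \<noteq> 0" if "i \<in> set js" for i using that ks(2) unfolding js_def by auto
  have minor: "br (w a) (w i) (w j) \<noteq> 0" if "i \<in> {1..6}" "j \<in> {1..6}" "l i \<noteq> 0" "l j \<noteq> 0" "i \<noteq> a" "j \<noteq> a" "i \<noteq> j" for i j
    using that a sample_minors[of a i j] unfolding w by (simp add: br_linear)
  obtain i j where ij: "i \<in> {1..6} - {a}" "l i \<noteq> 0" "j \<in> {1..6} - {a}" "l j \<noteq> 0" "i \<noteq> j"
  proof -
    obtain S where S: "S \<subseteq> {i \<in> {1..6} - {a}. l i \<noteq> 0}" "card S = 2" by (rule obtain_subset_with_card_n[OF n])
    then obtain i j where "S = {i, j}" "i \<noteq> j" unfolding card_2_iff by blast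
    then show ?thesis using S(1) that[of i j] by auto
  qed
  then have "br (w a) (w i) (w j) \<noteq> 0" using minor by blast
  then have "w i \<noteq> 0" "w j \<noteq> 0" by (metis br_0(2), metis br_0(3))
  then have "i \<in> set js" "j \<in> set js" using ij ks(2) unfolding js_def by auto
  then obtain u v r where uv: "js = u # v # r" using \<open>i \<noteq> j\<close>
    by (metis empty_iff empty_set list.exhaust set_ConsD)
  have d: "distinct (u # v # r)" unfolding uv[symmetric] js_def using ks(1) by simp
  have m: "u \<in> set js" "v \<in> set js" "last (v # r) \<in> set js" unfolding uv using last_in_set[of "v # r"] by auto
  have "u \<noteq> v" "u \<noteq> last (v # r)" using d last_in_set[of "v # r"] by auto
  then have nz: "br (w a) (w u) (w v) \<noteq> 0" "br (w a) (w u) (w (last (v # r))) \<noteq> 0"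
    using minor js[OF m(1)] js[OF m(2)] js[OF m(3)] by blast+
  have "last (w v # map w r) = w (last (v # r))" using last_map[of "v # r" w] by simp
  moreover have "linked (w a) (w u # w v # map w r)" using linked_nonzero[OF li] unfolding us uv by simp
  ultimately show False using not_linked[of "w a" "w u" "w v" "map w r"] nz by simp
qed

lemma cols_inject: "cols s = cols t \<Longrightarrow> s = t"
proof -
  assume c: "cols s = cols t"
  have "support s = support t" using inj_on_image_eq_iff[OF inj_of_nat_6 support_bounds support_bounds] c unfolding cols_def by blast
  moreover obtain i j k where t: "indices t = (i, j, k)" by (metis prod_cases3)
  moreover obtain p q r where s: "indices s = (p, q, r)" by (metis prod_cases3)
  ultimately have "{p, q, r} = {i, j, k}" by (simp add: support_indices)
  moreover have "sorted_list_of_set {p, q, r} = [p, q, r]" "sorted_list_of_set {i, j, k} = [i, j, k]"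
    using sorted_list_of_set.idem_if_sorted_distinct[of "[p, q, r]"] indices_bounds[OF s]
      sorted_list_of_set.idem_if_sorted_distinct[of "[i, j, k]"] indices_bounds[OF t] by simp_all
  ultimately have "[p, q, r] = [i, j, k]" by metis
  then show "s = t" using s t by (simp add: triple_eqI)
qed

text \<open>At a point of the chart \<open>I\<close>, the coordinates with \<open>j \<in> I\<close> are \<open>1 /
  \<lambda>\<^sub>j\<close>. If none of them vanishes, then the point is given by finite
  \<open>\<lambda>\<close>. If one of them vanishes, the leading terms are the equations in the plane. If
  two of them vanish, then the equation of the third column \<open>c\<close> reduces to a single minor.\<close>

lemma nondegenerate_sample: "nondegenerate (plk sample)"
  unfolding nondegenerate_def
proof (intro allI, rule ccontr)
  fix I and z :: "complex^6"
  let ?x = "plk sample"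
  assume "\<nexists>i. eval (chart_form I ?x i) z \<noteq> 0"
  then have zero: "eval (chart_form I ?x i) z = 0" for i by blast
  define Z where "Z = {j \<in> cols I. z $ j = 0}"
  have fin: "finite (cols I)" by simp
  consider (two) c where "c \<in> cols I" "cols I - {c} \<subseteq> Z" | (none) "Z = {}" | (one) b where "b \<in> cols I" "Z = {b}"
  proof (cases "\<exists>b. Z \<subseteq> {b}")
    case True
    then show ?thesis using none one unfolding Z_def by (metis (no_types, lifting) insertI1 mem_Collect_eq subset_singletonD)
  next
    case False
    have "card Z \<noteq> 0" "card Z \<noteq> 1" using False by (auto simp: card_1_singleton_iff)
    moreover have "card (cols I - Z) = 3 - card Z"
      using card_Diff_subset[of Z "cols I"] card_cols[of I] unfolding Z_def by auto
    ultimately have "card (cols I - Z) \<le> 1" by linarith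
    then obtain c where c: "cols I - Z \<subseteq> {c}"
      by (metis card_le_Suc0_iff_eq finite One_nat_def insertCI subsetI)
    show ?thesis
    proof (cases "c \<in> cols I")
      case True
      then show ?thesis using two c by blast
    next
      case False
      then have "cols I \<subseteq> Z" using c by blast
      moreover obtain d where "d \<in> cols I" using card_cols[of I] by (metis card.empty ex_in_conv zero_neq_numeral)
      ultimately show ?thesis using two by blast
    qed
  qed
  then show False
  proof cases
    case two
    have "?x $ t * (\<Prod>j\<in>sym_diff (cols I) (cols t). z $ j) = (if t = I then ?x $ I else 0)" if "c \<in> cols t" for t
    proof (cases "t = I")
      case False
      have "\<not> cols I \<subseteq> cols t"
        using False cols_inject card_subset_eq[of "cols t" "cols I"] card_cols by (metis finite)
      then obtain j where "j \<in> cols I" "j \<notin> cols t" by blast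
      then have "j \<in> sym_diff (cols I) (cols t)" "z $ j = 0" using two that unfolding Z_def by auto
      then show ?thesis using False prod_zero[of "sym_diff (cols I) (cols t)" "\<lambda>j. z $ j"] by auto
    qed simp
    then have "eval (chart_form I ?x c) z = (\<Sum>t\<in>{t. c \<in> cols t}. if t = I then ?x $ I else 0)"
      unfolding eval_chart_form by (intro sum.cong refl) simp
    also have "\<dots> = ?x $ I" using two(1) by simp
    finally have "?x $ I = 0" using zero by simp
    moreover have "?x $ I \<noteq> 0"
    proof -
      obtain p q r where t: "indices I = (p, q, r)" by (metis prod_cases3)
      show ?thesis using sample_minors_sorted[OF indices_bounds[OF t]] by (simp add: plk_def t)
    qed
    ultimately show False by blast
  next
    case none
    define l where "l j = (if j \<in> cols I then inverse (z $ j) else z $ j)" for j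
    have l: "l j \<noteq> 0" if "j \<in> cols I" for j using that none unfolding l_def Z_def by auto
    have cp: "chart_point I l = z" by (simp add: chart_point_def l_def Finite_Cartesian_Product.vec_eq_iff)
    define w where "w i = l (of_nat i) *s sample i" for i
    have "star_sum (plk w) i = 0" if "i \<in> {1..6}" for i
    proof -
      have "prod l (cols I) * eval (chart_form I ?x (of_nat i)) (chart_point I l)
          = star_sum (weighted (\<lambda>k. l (of_nat k)) ?x) i"
        by (rule eval_chart_form_point[OF _ that]) (rule l)
      then show ?thesis unfolding cp zero weighted_plk w_def[abs_def] by simp
    qed
    then have "critical (map w [1..<7])" by (rule critical_plk)
    moreover have "3 \<le> card {i \<in> {1..6}. l (of_nat i) \<noteq> 0}"
    proof -
      have "card (support I) = card (cols I)"
        unfolding cols_def by (rule card_image[symmetric, OF inj_on_subset[OF inj_of_nat_6 support_bounds]])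
      moreover have "support I \<subseteq> {i \<in> {1..6}. l (of_nat i) \<noteq> 0}"
        using support_bounds[of I] l unfolding cols_def by auto
      from card_mono[OF _ this] have "card (support I) \<le> card {i \<in> {1..6}. l (of_nat i) \<noteq> 0}" by simp
      ultimately show ?thesis using card_cols by simp
    qed
    ultimately show False by (rule sample_not_critical[OF w_def])
  next
    case one
    define a where "a = num6 b"
    have ba: "b = of_nat a" unfolding a_def by (simp add: of_nat_num6)
    have a: "a \<in> {1..6}" unfolding a_def num6_def by auto
    have aI: "a \<in> support I" using one(1) mem_cols[OF a] unfolding ba by blast
    define l where "l j = (if j = b then 1 else if j \<in> cols I then inverse (z $ j) else z $ j)" for j
    have l: "l j \<noteq> 0" if "j \<in> cols I" for j using that one unfolding l_def Z_def by auto
    have zb: "z $ b = 0" using one unfolding Z_def by blast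
    have cp: "chart_point I l $ j = z $ j" if "j \<noteq> b" for j using that by (simp add: chart_point_def l_def)
    define w where "w i = l (of_nat i) *s sample i" for i
    have "link_sum (plk w) a i = 0" if i: "i \<in> {1..6}" "i \<noteq> a" for i
    proof -
      have summand: "prod l (cols I) * (?x $ t * (\<Prod>j\<in>sym_diff (cols I) (cols t). z $ j))
          = (if a \<in> support t then plk w $ t else 0)" for t
      proof (cases "a \<in> support t")
        case True
        then have "b \<in> cols t" using mem_cols[OF a] unfolding ba by blast
        then have "(\<Prod>j\<in>sym_diff (cols I) (cols t). z $ j) = (\<Prod>j\<in>sym_diff (cols I) (cols t). chart_point I l $ j)"
          using one(1) by (intro prod.cong refl cp[symmetric]) auto
        moreover have "prod l (cols I) * (\<Prod>j\<in>sym_diff (cols I) (cols t). chart_point I l $ j) = prod l (cols t)"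
          by (rule chart_product) (rule l)
        ultimately have "prod l (cols I) * (?x $ t * (\<Prod>j\<in>sym_diff (cols I) (cols t). z $ j)) = ?x $ t * prod l (cols t)"
          by (simp only: mult.left_commute)
        also have "\<dots> = weighted (\<lambda>k. l (of_nat k)) ?x $ t" by (simp add: weighted_def prod_cols)
        also have "\<dots> = plk w $ t" unfolding weighted_plk w_def[abs_def] ..
        finally show ?thesis using True by simp
      next
        case False
        then have "b \<notin> cols t" using mem_cols[OF a] unfolding ba by blast
        then have "b \<in> sym_diff (cols I) (cols t)" using one(1) by blast
        then have "(\<Prod>j\<in>sym_diff (cols I) (cols t). z $ j) = 0" using zb by (intro prod_zero) auto
        then show ?thesis using False by simp
      qed
      have "0 = prod l (cols I) * eval (chart_form I ?x (of_nat i)) z" unfolding zero by simp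
      also have "\<dots> = (\<Sum>t\<in>{t. i \<in> support t}. if a \<in> support t then plk w $ t else 0)"
        unfolding eval_chart_form sum_distrib_left mem_cols[OF i(1)] summand ..
      also have "\<dots> = link_sum (plk w) a i"
        unfolding link_sum_def by (rule sum.mono_neutral_cong_left) auto
      finally show ?thesis by simp
    qed
    then have li: "linked (w a) (map w ([Suc a..<7] @ [1..<a]))" by (rule linked_plk[OF a])
    have n: "2 \<le> card {i \<in> {1..6} - {a}. l (of_nat i) \<noteq> 0}"
    proof -
      have "card (support I) = card (cols I)"
        unfolding cols_def by (rule card_image[symmetric, OF inj_on_subset[OF inj_of_nat_6 support_bounds]])
      then have "card (support I - {a}) = 2" using card_cols[of I] aI by simp
      moreover have "support I - {a} \<subseteq> {i \<in> {1..6} - {a}. l (of_nat i) \<noteq> 0}"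
        using support_bounds[of I] l unfolding cols_def by auto
      from card_mono[OF _ this] have "card (support I - {a}) \<le> card {i \<in> {1..6} - {a}. l (of_nat i) \<noteq> 0}" by simp
      ultimately show ?thesis by simp
    qed
    show False
      by (rule sample_not_linked[OF w_def a(1) _ li _ _ n]) (use l[OF one(1)] a in \<open>auto simp: ba\<close>)
  qed
qed

theorem theorem2p4:
  "let
     V1 = variety (ideal.span (I_Gr36 \<union> {xvar 1 2 3 * xvar 4 5 6 - xvar 1 2 4 * xvar 3 5 6}));
     V2 = variety (ideal.span (I_Gr36 \<union> {xvar 1 2 6 * xvar 3 4 5 - xvar 1 3 6 * xvar 2 4 5}));
     Cs = irreducible_components (subtopology zariski (hypersimplex_discriminant \<inter> Gr36))
   in V1 \<in> Cs \<and> V2 \<in> Cs \<and> V1 \<noteq> V2 \<and>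
      proj_dim V1 = 8 \<and> proj_degree V1 = 84 \<and>
      proj_dim V2 = 8 \<and> proj_degree V2 = 84"
proof -
  have V: "variety (ideal.span (I_Gr36 \<union> {xvar 1 2 3 * xvar 4 5 6 - xvar 1 2 4 * xvar 3 5 6})) = Vty 0"
    "variety (ideal.span (I_Gr36 \<union> {xvar 1 2 6 * xvar 3 4 5 - xvar 1 3 6 * xvar 2 4 5})) = Vty 1"
    by (simp_all add: Vty_def defining_quadric_def)
  have "plk sample $ triple (1, 2, 3) \<noteq> 0"
    using sample_minors_sorted[of 1 2 3] by (simp add: plk_triple)
  then have "plk sample \<noteq> 0" by auto
  then have "plk sample \<in> cone Gr36" unfolding cone_Gr36 by blast
  moreover have "eval eliminant (plk sample) \<noteq> 0"
    using eliminant_sample[OF nondegenerate_sample] by simp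
  ultimately have "\<exists>v\<in>cone Gr36. eval eliminant v \<noteq> 0" by blast
  note component = component_Vty[OF _ eliminant_forms eliminant_vanishes this]
  show ?thesis unfolding Let_def V
    by (intro conjI component Vty_distinct proj_dim_Vty proj_degree_Vty) simp_all
qed

end
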